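(* Let $\{u\}_{\nu>0}=\{u^\nu\}_{\nu>0}$ be a sequence of stationary martingale solutions to the stochastically forced Navier–Stokes equations on $\mathbb{T}^3$ with viscosity $\nu$ and forcing $\partial_t W$ (with coefficients $\sigma_k$ independent of $\nu$), and suppose that weak anomalous dissipation holds: $$\lim_{\nu\to 0}\nu\,\mathbf{E}\|u\|_{L^2(\mathbb{T}^3)}^2=0 .$$ Let $$S_0(\ell)=\frac{1}{4\pi}\mathbf{E}\int_{\mathbb{S}^2}\int_{\mathbb{T}^3}|\delta_{\ell\hat n}u|^2\,\delta_{\ell\hat n}u\cdot\hat n\,dx\,dS(\hat n),\qquad S_{||}(\ell)=\frac{1}{4\pi}\mathbf{E}\int_{\mathbb{S}^2}\int_{\mathbb{T}^3}(\delta_{\ell\hat n}u\cdot\hat n)^3\,dx\,dS(\hat n).$$ Then the following hold. (i) (4/3 law) There exists $\ell_D=\ell_D(\nu)$ with $\lim_{\nu\to0}\ell_D=0$ such that $$\lim_{\ell_I\to0}\limsup_{\nu\to0}\sup_{\ell\in[\ell_D,\ell_I]}\left|\frac{S_0(\ell)}{\ell}+\frac43\varepsilon\right|=0 .$$ (ii) (4/5 law) There exists $\ell_D=\ell_D(\nu)$ with $\lim_{\nu\to0}\ell_D=0$ such that $$\lim_{\ell_I\to0}\limsup_{\nu\to0}\sup_{\ell\in[\ell_D,\ell_I]}\left|\frac{S_{||}(\ell)}{\ell}+\frac45\varepsilon\right|=0 .$$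
   Context: Equations. On the periodic box $\mathbb{T}^3$ consider $\partial_t u+u\cdot\nabla u+\nabla p-\nu\Delta u=\partial_t W$, $\mathrm{div}\,u=0$, with $\nu>0$ and $\partial_tW(t,x)=\sum_{k\ge1}\sigma_ke_k(x)\,d\beta_k(t)$, where $\{\beta_k\}$ are independent one-dimensional Brownian motions, $\{e_k\}$ are ($L^2$-)orthonormal eigenfunctions of the Stokes operator on $\mathbb{T}^3$, and $\{\sigma_k\}$ are fixed constants (independent of $\nu$) with $\varepsilon:=\frac12\sum_k|\sigma_k|^2<\infty$. $L^2_{\mathrm{div}}$ and $H^1_{\mathrm{div}}$ are the completions of $C^\infty_{\mathrm{div}}$ (smooth divergence-free zero-average vector fields on $\mathbb{T}^3$) in the $L^2$ and $H^1$ norms; $\dot H^\alpha_x$ are homogeneous Sobolev spaces. Stationary martingale solution on $[0,\infty)$: a stochastic basis $(\Omega,(\mathcal F_t)_{t\ge0},\mathbf P,\{\beta_k\})$ with complete right-continuous filtration and an $\mathcal F_t$-progressively measurable process $u:[0,\infty)\times\Omega\to L^2_{\mathrm{div}}$ such that: for each $T\ge0$ the restriction $u|_{[0,T]}$ has sample paths in $C_t(\dot H^\alpha_x)\cap L^\infty_tL^2_{\mathrm{div}}\cap L^2_tH^1_{\mathrm{div}}$ for some $\alpha<0$; the law of the path $u(\cdot+\tau)$ is the same as that of $u(\cdot)$ for each $\tau\ge0$; and for all $t\ge0$, $\varphi\in C^\infty_{\mathrm{div}}$, $\mathbf P$-almost surely $$\int u(t)\cdot\varphi\,dx+\nu\int_0^t\!\!\int\nabla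 u:\nabla\varphi\,dx\,ds+\int_0^t\!\!\int[(u\cdot\nabla)u]\cdot\varphi\,dx\,ds=\int u(0)\cdot\varphi\,dx+\sum_k\int_0^t\!\!\int\sigma_ke_k\cdot\varphi\,dx\,d\beta_k(s).$$ The stochastic basis may depend on $\nu$. Standing properties: stationary martingale solutions satisfy the energy inequality $\nu\,\mathbf E\|\nabla u\|_{L^2_x}^2\le\varepsilon$ and $\mathbf E\|u\|^r_{L^\infty(0,T;L^2_x)}<\infty$ for all $r\in[1,\infty)$, $T<\infty$. Notation: $\delta_hu(x)=u(x+h)-u(x)$ for $h\in\mathbb R^3$. Since $u$ is stationary, expectations of functionals of $u$ at a fixed time do not depend on the time, which is suppressed. $\mathbf{E}$ is the expectation on the basis carrying $u^\nu$. *)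

theory Defs
  imports "HOL-Probability.Probability"
begin

section \<open>Function spaces on the torus\<close>

text \<open>The torus is \<open>(\<real> / 2\<pi>\<int>)\<^sup>3\<close>. Functions on it are everywhere defined \<open>2\<pi>\<close>-periodic functions on
  \<^typ>\<open>real^3\<close>, so that the increment \<open>u (x + h) - u x\<close> makes sense, and \<open>dx\<close> is unnormalised Lebesgue
  measure on one period. Elements of \<open>L\<^sup>2\<close> are handled through representatives: every notion
  below is insensitive to changing a field on a null set.\<close>

definition torus_box :: "(real^3) set" where
  "torus_box = cbox 0 (vec (2 * pi))"

definition periodic :: "(real^3 \<Rightarrow> 'b) \<Rightarrow> bool" where
  "periodic f \<longleftrightarrow> (\<forall>x i. f (x + axis i (2 * pi)) = f x)"

definition L2_torus :: "(real^3 \<Rightarrow> 'b::euclidean_space) set" where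
  "L2_torus = {f. periodic f \<and> f \<in> borel_measurable borel \<and>
     set_integrable lborel torus_box (\<lambda>x. (norm (f x))\<^sup>2)}"

definition L2_inner :: "(real^3 \<Rightarrow> 'b::euclidean_space) \<Rightarrow> (real^3 \<Rightarrow> 'b) \<Rightarrow> real" where
  "L2_inner f g = (LINT x:torus_box|lborel. f x \<bullet> g x)"

definition L2_norm :: "(real^3 \<Rightarrow> 'b::euclidean_space) \<Rightarrow> real" where
  "L2_norm f = sqrt (LINT x:torus_box|lborel. (norm (f x))\<^sup>2)"

primrec C_k :: "nat \<Rightarrow> (real^3 \<Rightarrow> real^3) \<Rightarrow> bool" where
  "C_k 0 f \<longleftrightarrow> continuous_on UNIV f"
| "C_k (Suc n) f \<longleftrightarrow>
     (\<exists>f'. (\<forall>x. (f has_derivative f' x) (at x)) \<and> (\<forall>v. C_k n (\<lambda>x. f' x v)))"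

text \<open>The entry \<open>(i, j)\<close> of \<open>jacobian \<phi> (at x)\<close> is \<open>\<partial>\<^sub>j \<phi>\<^sub>i (x)\<close>; its trace is the divergence.\<close>

definition Cinf_div :: "(real^3 \<Rightarrow> real^3) set" where
  "Cinf_div = {\<phi>. periodic \<phi> \<and> (\<forall>n. C_k n \<phi>) \<and> (\<forall>x. trace (jacobian \<phi> (at x)) = 0) \<and>
     (LINT x:torus_box|lborel. \<phi> x) = 0}"

definition L2_div :: "(real^3 \<Rightarrow> real^3) set" where
  "L2_div = {u \<in> L2_torus. \<exists>\<phi>. (\<forall>n. \<phi> n \<in> Cinf_div) \<and>
     (\<lambda>n. L2_norm (\<lambda>x. u x - \<phi> n x)) \<longlonglongrightarrow> 0}"

text \<open>\<open>H\<^sup>1_div\<close> is the completion of the smooth fields for the \<open>H\<^sup>1\<close> norm: its elements are the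
  \<open>L\<^sup>2\<close>-limits \<open>u\<close> of smooth fields whose gradients also converge in \<open>L\<^sup>2\<close>, and the limit \<open>G\<close>
  of the gradients, unique up to null sets, is the gradient of \<open>u\<close>.\<close>

definition has_gradient :: "(real^3 \<Rightarrow> real^3) \<Rightarrow> (real^3 \<Rightarrow> real^3^3) \<Rightarrow> bool" where
  "has_gradient u G \<longleftrightarrow> u \<in> L2_torus \<and> G \<in> L2_torus \<and>
     (\<exists>\<phi>. (\<forall>n. \<phi> n \<in> Cinf_div) \<and>
       (\<lambda>n. L2_norm (\<lambda>x. u x - \<phi> n x)) \<longlonglongrightarrow> 0 \<and>
       (\<lambda>n. L2_norm (\<lambda>x. G x - jacobian (\<phi> n) (at x))) \<longlonglongrightarrow> 0)"

definition H1_div :: "(real^3 \<Rightarrow> real^3) set" where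
  "H1_div = {u. \<exists>G. has_gradient u G}"

definition grad :: "(real^3 \<Rightarrow> real^3) \<Rightarrow> real^3 \<Rightarrow> real^3^3" where
  "grad u = (if u \<in> H1_div then SOME G. has_gradient u G else (\<lambda>x. 0))"

definition grad_norm_sq :: "(real^3 \<Rightarrow> real^3) \<Rightarrow> ennreal" where
  "grad_norm_sq u = (if u \<in> H1_div then ennreal ((L2_norm (grad u))\<^sup>2) else \<infinity>)"

definition H1_norm_sq :: "(real^3 \<Rightarrow> real^3) \<Rightarrow> ennreal" where
  "H1_norm_sq u = ennreal ((L2_norm u)\<^sup>2) + grad_norm_sq u"

definition frequency :: "int^3 \<Rightarrow> real^3" where
  "frequency k = (\<chi> i. real_of_int (k $ i))"

definition fourier_coeff :: "(real^3 \<Rightarrow> real^3) \<Rightarrow> int^3 \<Rightarrow> complex^3" where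
  "fourier_coeff f k = (\<chi> i. (LINT x:torus_box|lborel.
     complex_of_real (f x $ i) * cis (- (frequency k \<bullet> x))) / (2 * pi) ^ 3)"

definition Hdot_norm_sq :: "real \<Rightarrow> (real^3 \<Rightarrow> real^3) \<Rightarrow> ennreal" where
  "Hdot_norm_sq \<alpha> f = (\<Sum>\<^sub>\<infinity>k\<in>- {0}.
     ennreal (norm (frequency k) powr (2 * \<alpha>) * (norm (fourier_coeff f k))\<^sup>2))"

text \<open>The Borel \<open>\<sigma>\<close>-algebra of the \<open>L\<^sup>2\<close> (semi)norm topology.\<close>

definition L2_div_borel :: "(real^3 \<Rightarrow> real^3) measure" where
  "L2_div_borel = sigma L2_div {U. U \<subseteq> L2_div \<and>
     (\<forall>f\<in>U. \<exists>r>0. \<forall>g\<in>L2_div. L2_norm (\<lambda>x. g x - f x) < r \<longrightarrow> g \<in> U)}"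

section \<open>Path norms\<close>

definition continuous_in_Hdot :: "real \<Rightarrow> real \<Rightarrow> (real \<Rightarrow> real^3 \<Rightarrow> real^3) \<Rightarrow> bool" where
  "continuous_in_Hdot \<alpha> T v \<longleftrightarrow>
     (\<forall>t\<in>{0..T}. Hdot_norm_sq \<alpha> (v t) < \<infinity> \<and>
        ((\<lambda>s. Hdot_norm_sq \<alpha> (\<lambda>x. v s x - v t x)) \<longlongrightarrow> 0) (at t within {0..T}))"

definition Linf_L2_norm :: "real \<Rightarrow> (real \<Rightarrow> real^3 \<Rightarrow> real^3) \<Rightarrow> ennreal" where
  "Linf_L2_norm T v = esssup (restrict_space lborel {0..T}) (\<lambda>t. ennreal (L2_norm (v t)))"

definition L2_H1_norm_sq :: "real \<Rightarrow> (real \<Rightarrow> real^3 \<Rightarrow> real^3) \<Rightarrow> ennreal" where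
  "L2_H1_norm_sq T v = (\<integral>\<^sup>+t\<in>{0..T}. H1_norm_sq (v t) \<partial>lborel)"

section \<open>The forcing\<close>

text \<open>The Stokes operator (minus the Leray projection of the Laplacian) as the operator of the
  Dirichlet form on divergence-free fields: \<open>stokes u f\<close> means that \<open>u\<close> is in its domain and is
  mapped to \<open>f\<close>.\<close>

definition stokes :: "(real^3 \<Rightarrow> real^3) \<Rightarrow> (real^3 \<Rightarrow> real^3) \<Rightarrow> bool" where
  "stokes u f \<longleftrightarrow> u \<in> H1_div \<and> f \<in> L2_div \<and>
     (\<forall>\<phi>\<in>Cinf_div. L2_inner (grad u) (\<lambda>x. jacobian \<phi> (at x)) = L2_inner f \<phi>)"

text \<open>The modes are numbered from \<open>0\<close>.\<close>

locale forcing =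
  fixes \<sigma> :: "nat \<Rightarrow> real" and e :: "nat \<Rightarrow> real^3 \<Rightarrow> real^3"
  assumes eigenfunctions: "\<And>k. \<exists>\<mu>. stokes (e k) (\<lambda>x. \<mu> *\<^sub>R e k x)"
    and orthonormal: "\<And>j k. L2_inner (e j) (e k) = (if j = k then 1 else 0)"
    and summable_coeffs: "summable (\<lambda>k. (\<sigma> k)\<^sup>2)"

definition energy_input :: "(nat \<Rightarrow> real) \<Rightarrow> real" where
  "energy_input \<sigma> = (\<Sum>k. (\<sigma> k)\<^sup>2) / 2"

section \<open>Stationary martingale solutions\<close>

locale brownian_motion = prob_space M
  for M :: "'w measure" and F :: "real \<Rightarrow> 'w measure" and B :: "real \<Rightarrow> 'w \<Rightarrow> real" +
  assumes adapted: "\<And>t. 0 \<le> t \<Longrightarrow> B t \<in> borel_measurable (F t)"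
    and starts_at_0: "AE \<omega> in M. B 0 \<omega> = 0"
    and continuous_paths: "AE \<omega> in M. continuous_on {0..} (\<lambda>t. B t \<omega>)"
    and gaussian_increments: "\<And>s t. 0 \<le> s \<Longrightarrow> s < t \<Longrightarrow>
      distributed M lborel (\<lambda>\<omega>. B t \<omega> - B s \<omega>) (normal_density 0 (sqrt (t - s)))"
    and independent_increments: "\<And>s t. 0 \<le> s \<Longrightarrow> s < t \<Longrightarrow>
      indep_set (sets (F s)) {(\<lambda>\<omega>. B t \<omega> - B s \<omega>) -` A \<inter> space M | A. A \<in> sets borel}"

text \<open>Only \<open>F t\<close> with \<open>t \<ge> 0\<close> matters. The library's filtrations are indexed by the whole type,
  whence \<open>max 0 t\<close>.\<close>

locale stochastic_basis = prob_space M + complete_measure M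
  for M :: "'w measure" +
  fixes F :: "real \<Rightarrow> 'w measure" and \<beta> :: "nat \<Rightarrow> real \<Rightarrow> 'w \<Rightarrow> real"
  assumes filtered: "filtration (space M) (\<lambda>t. F (max 0 t))"
    and subalgebras: "\<And>t. 0 \<le> t \<Longrightarrow> subalgebra M (F t)"
    and complete_filtration: "\<And>t. 0 \<le> t \<Longrightarrow> null_sets M \<subseteq> sets (F t)"
    and right_continuous: "\<And>t. 0 \<le> t \<Longrightarrow> sets (F t) = (\<Inter>s\<in>{t<..}. sets (F s))"
    and brownian: "\<And>k. brownian_motion M F (\<beta> k)"
    and independent: "indep_vars (\<lambda>_. \<Pi>\<^sub>M t\<in>{0..}. borel) (\<lambda>k \<omega>. \<lambda>t\<in>{0..}. \<beta> k t \<omega>) UNIV"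

text \<open>The Ito integral over \<open>[0, t]\<close> against \<open>B\<close> of an integrand that is constant in time and
  deterministic, which is the only kind of stochastic integral in the weak formulation.\<close>

definition ito_integral_const :: "real \<Rightarrow> (real \<Rightarrow> 'w \<Rightarrow> real) \<Rightarrow> real \<Rightarrow> 'w \<Rightarrow> real" where
  "ito_integral_const c B t \<omega> = c * (B t \<omega> - B 0 \<omega>)"

text \<open>In \<open>weak_formulation\<close>, \<open>sums\<close> (almost sure convergence of the noise series, whose terms are
  independent with summable variances) isolates the stochastic term. In \<open>stationary\<close>, the law of
  a path is taken on the \<open>\<sigma>\<close>-algebra generated by the evaluations at times \<open>t \<ge> 0\<close>.\<close>

locale stationary_martingale_solution = stochastic_basis M F \<beta> + forcing \<sigma> e
  for M :: "'w measure" and F \<beta> \<sigma> e +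
  fixes \<nu> :: real and u :: "real \<Rightarrow> 'w \<Rightarrow> real^3 \<Rightarrow> real^3"
  assumes viscosity_pos: "0 < \<nu>"
    and progressive: "\<And>T. 0 \<le> T \<Longrightarrow>
      (\<lambda>(t, \<omega>). u t \<omega>) \<in> restrict_space borel {0..T} \<Otimes>\<^sub>M F T \<rightarrow>\<^sub>M L2_div_borel"
    and path_regularity: "\<And>T. 0 \<le> T \<Longrightarrow> \<exists>\<alpha><0. AE \<omega> in M.
      continuous_in_Hdot \<alpha> T (\<lambda>t. u t \<omega>) \<and>
      Linf_L2_norm T (\<lambda>t. u t \<omega>) < \<infinity> \<and>
      L2_H1_norm_sq T (\<lambda>t. u t \<omega>) < \<infinity>"
    and stationary: "\<And>\<tau>. 0 \<le> \<tau> \<Longrightarrow>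
      distr M (\<Pi>\<^sub>M t\<in>{0..}. L2_div_borel) (\<lambda>\<omega>. \<lambda>t\<in>{0..}. u (t + \<tau>) \<omega>) =
      distr M (\<Pi>\<^sub>M t\<in>{0..}. L2_div_borel) (\<lambda>\<omega>. \<lambda>t\<in>{0..}. u t \<omega>)"
    and weak_formulation: "\<And>t \<phi>. 0 \<le> t \<Longrightarrow> \<phi> \<in> Cinf_div \<Longrightarrow> AE \<omega> in M.
      (\<lambda>k. ito_integral_const (L2_inner (\<lambda>x. \<sigma> k *\<^sub>R e k x) \<phi>) (\<beta> k) t \<omega>) sums
        (L2_inner (u t \<omega>) \<phi>
         + \<nu> * (LINT s:{0..t}|lborel. L2_inner (grad (u s \<omega>)) (\<lambda>x. jacobian \<phi> (at x)))
         + (LINT s:{0..t}|lborel. L2_inner (\<lambda>x. grad (u s \<omega>) x *v u s \<omega> x) \<phi>)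
         - L2_inner (u 0 \<omega>) \<phi>)"

section \<open>Structure functions\<close>

text \<open>Surface measure on the unit sphere: the area of \<open>A\<close> is three times the volume of the cone
  \<open>{x. 0 < norm x \<le> 1 \<and> x / norm x \<in> A}\<close>.\<close>

definition sphere_measure :: "(real^3) measure" where
  "sphere_measure = scale_measure 3 (distr (restrict_space lborel (cball 0 1 - {0})) borel sgn)"

definition increment :: "real^3 \<Rightarrow> (real^3 \<Rightarrow> real^3) \<Rightarrow> real^3 \<Rightarrow> real^3" where
  "increment h v x = v (x + h) - v x"

definition S_0 :: "'w measure \<Rightarrow> ('w \<Rightarrow> real^3 \<Rightarrow> real^3) \<Rightarrow> real \<Rightarrow> real" where
  "S_0 M v l = 1 / (4 * pi) * (LINT \<omega>|M. (LINT n|sphere_measure. (LINT x:torus_box|lborel.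
     (norm (increment (l *\<^sub>R n) (v \<omega>) x))\<^sup>2 * (increment (l *\<^sub>R n) (v \<omega>) x \<bullet> n))))"

definition S_par :: "'w measure \<Rightarrow> ('w \<Rightarrow> real^3 \<Rightarrow> real^3) \<Rightarrow> real \<Rightarrow> real" where
  "S_par M v l = 1 / (4 * pi) * (LINT \<omega>|M. (LINT n|sphere_measure. (LINT x:torus_box|lborel.
     (increment (l *\<^sub>R n) (v \<omega>) x \<bullet> n) ^ 3)))"

end

theory Submission
  imports Defs
begin

text \<open>For a divergence-free \<open>v\<close> with gradient \<open>G\<close> and an even weight \<open>\<kappa>\<close> on the ball of radius \<open>l\<close>, let \<open>T\<close>
  be the integral of \<open>\<kappa> h * (G x *v v x) \<bullet> v (x + h)\<close> over the torus and the ball. Integration by parts in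
  \<open>h\<close> and in \<open>x\<close> turns the spherical averages of the two cubic increments into \<open>- 4 T / l\<^sup>2\<close> for the weight
  \<open>1\<close> and \<open>- 6 T / l\<^sup>4\<close> for the weight \<open>l\<^sup>2 - |h|\<^sup>2\<close>; an \<open>L\<^sup>3\<close> bound by a Riesz potential extends this from smooth
  fields to \<open>H\<^sup>1\<close>. Testing the equation with the real Fourier modes, whose second moments are stationary,
  and summing over the modes with the Fourier coefficients of \<open>\<kappa>\<close> shows that \<open>E T\<close> plus \<open>\<nu>\<close> times the
  same quadratic form of the gradient is half the sum of \<open>\<sigma>\<^sub>j\<^sup>2\<close> times that form of \<open>e\<^sub>j\<close>. As \<open>l \<rightarrow> 0\<close> the
  right-hand side divided by the total weight tends to the energy input. One more integration by parts
  bounds the viscous term relative to the total weight by a multiple of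
  \<open>\<nu> E (|G| |v|) / l \<le> sqrt (\<nu> E |G|\<^sup>2) * sqrt (\<nu> E |v|\<^sup>2) / l\<close>, which is small for \<open>l\<close> at least the fourth root of
  \<open>\<nu> E |v|\<^sup>2 + \<nu>\<close>, up to a constant.\<close>

section \<open>Square integrable functions\<close>

text \<open>Balls take the place of spheres for two reasons. A weight vanishing on the sphere
  produces no boundary term, so \<open>R\<^sup>2 - |h|\<^sup>2\<close> exchanges a derivative for a
  factor \<open>h\<close>, and spherical averages are recovered by differentiating in
  \<open>R\<close>. Averaging over a ball also maps \<open>L\<^sup>2\<close> to bounded fields, and
  the product \<open>G x *v v x\<close>, which is merely integrable, needs a bounded partner. The
  obstacle is that the equation is known only when tested against fixed smooth divergence-free
  fields, whereas the energy argument wants to test it with the random field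
  \<open>u (x + h)\<close>. A single wave is admissible, and against it the advection term has a
  form without gradient, hence is a measurable functional on \<open>L2_div\<close>. For one
  coefficient the balance of second moments is a scalar problem: stationarity cancels the squares
  over a short time step, and what is left at first order is the drift and the variance of the
  noise. Summation over modes with the multipliers of the ball average reassembles the
  physical-space form. The constants are \<open>4 / (4 * pi)\<close> times the total weight
  \<open>4 * pi / 3\<close>, and \<open>6 / (4 * pi)\<close> times the total weight
  \<open>8 * pi / 15\<close>.\<close>

definition sqint :: "'a measure \<Rightarrow> ('a \<Rightarrow> 'b::euclidean_space) \<Rightarrow> bool" where
  "sqint M f \<longleftrightarrow> f \<in> borel_measurable M \<and> integrable M (\<lambda>x. (norm (f x))\<^sup>2)"

definition l2 :: "'a measure \<Rightarrow> ('a \<Rightarrow> 'b::euclidean_space) \<Rightarrow> real" where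
  "l2 M f = sqrt (LINT x|M. (norm (f x))\<^sup>2)"

lemma sqint_measurable [measurable_dest]: "sqint M f \<Longrightarrow> f \<in> borel_measurable M"
  by (simp add: sqint_def)

lemma l2_nonneg [simp]: "0 \<le> l2 M f"
  by (simp add: l2_def)

lemma l2_squared: "(l2 M f)\<^sup>2 = (LINT x|M. (norm (f x))\<^sup>2)"
  by (simp add: l2_def)

lemma nn_integral_eq_l2: "sqint M f \<Longrightarrow> (\<integral>\<^sup>+x. (ennreal (norm (f x)))\<^sup>2 \<partial>M) = ennreal ((l2 M f)\<^sup>2)"
  by (simp add: sqint_def l2_squared ennreal_power nn_integral_eq_integral)

text \<open>Square integrability is obtained from bounds on nonnegative integrals, where Fubini,
  Fatou and monotonicity apply before anything is known to be integrable.\<close>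

lemma sqintI_nn:
  assumes "f \<in> borel_measurable M" "(\<integral>\<^sup>+x. (ennreal (norm (f x)))\<^sup>2 \<partial>M) \<le> ennreal (c\<^sup>2)" "0 \<le> c"
  shows "sqint M f" and "l2 M f \<le> c"
proof -
  have *: "(\<integral>\<^sup>+x. ennreal ((norm (f x))\<^sup>2) \<partial>M) \<le> ennreal (c\<^sup>2)"
    using assms by (simp add: ennreal_power)
  have "(\<integral>\<^sup>+x. ennreal (norm ((norm (f x))\<^sup>2)) \<partial>M) < \<infinity>"
    using le_less_trans[OF *] by simp
  with assms(1) have "integrable M (\<lambda>x. (norm (f x))\<^sup>2)"
    by (intro integrableI_bounded) auto
  with assms show sq: "sqint M f" by (simp add: sqint_def)
  from assms(2) have "ennreal ((l2 M f)\<^sup>2) \<le> ennreal (c\<^sup>2)"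
    unfolding nn_integral_eq_l2[OF sq] .
  then have "(l2 M f)\<^sup>2 \<le> c\<^sup>2"
    using ennreal_le_iff[of "c\<^sup>2" "(l2 M f)\<^sup>2"] by (metis zero_le_power2)
  with assms(3) show "l2 M f \<le> c" using power2_le_imp_le by blast
qed

lemma sqint_norm: "sqint M f \<Longrightarrow> sqint M (\<lambda>x. norm (f x))"
  by (auto simp: sqint_def)

lemma l2_norm: "l2 M (\<lambda>x. norm (f x)) = l2 M f"
  by (simp add: l2_def)

lemma ennreal_power2_le_imp_le:
  assumes "a\<^sup>2 \<le> (ennreal c)\<^sup>2" "0 \<le> c"
  shows "a \<le> ennreal c"
proof (cases a)
  case (real r)
  with assms have "r\<^sup>2 \<le> c\<^sup>2" by (simp add: ennreal_power)
  with assms(2) real show ?thesis by (auto intro: ennreal_leI power2_le_imp_le)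
next
  case top
  with assms show ?thesis by (simp add: ennreal_power top_unique power2_eq_square ennreal_mult_eq_top_iff)
qed

lemma
  assumes f: "sqint M f" and g: "sqint M g"
  shows sqint_mult_norm: "integrable M (\<lambda>x. norm (f x) * norm (g x))"
    and integral_mult_norm_le: "(LINT x|M. norm (f x) * norm (g x)) \<le> l2 M f * l2 M g"
proof -
  note [measurable] = sqint_measurable[OF f] sqint_measurable[OF g]
  have "(\<integral>\<^sup>+x. ennreal (norm (f x)) * ennreal (norm (g x)) \<partial>M)\<^sup>2
      \<le> (\<integral>\<^sup>+x. (ennreal (norm (f x)))\<^sup>2 \<partial>M) * (\<integral>\<^sup>+x. (ennreal (norm (g x)))\<^sup>2 \<partial>M)"
    by (rule Cauchy_Schwarz_nn_integral) measurable
  also have "\<dots> = (ennreal (l2 M f * l2 M g))\<^sup>2"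
    unfolding nn_integral_eq_l2[OF f] nn_integral_eq_l2[OF g]
    by (simp add: power_mult_distrib ennreal_mult ennreal_power)
  finally have "(\<integral>\<^sup>+x. ennreal (norm (f x)) * ennreal (norm (g x)) \<partial>M) \<le> ennreal (l2 M f * l2 M g)"
    by (rule ennreal_power2_le_imp_le) simp
  then have *: "(\<integral>\<^sup>+x. ennreal (norm (f x) * norm (g x)) \<partial>M) \<le> ennreal (l2 M f * l2 M g)"
    by (simp add: ennreal_mult)
  show i: "integrable M (\<lambda>x. norm (f x) * norm (g x))"
    using le_less_trans[OF *] by (intro integrableI_bounded) auto
  have "ennreal (LINT x|M. norm (f x) * norm (g x)) \<le> ennreal (l2 M f * l2 M g)"
    using * nn_integral_eq_integral[OF i] by simp
  then show "(LINT x|M. norm (f x) * norm (g x)) \<le> l2 M f * l2 M g"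
    by simp
qed

lemma
  fixes f g :: "'a \<Rightarrow> 'b::euclidean_space"
  assumes f: "sqint M f" and g: "sqint M g"
  shows integrable_inner: "integrable M (\<lambda>x. f x \<bullet> g x)"
    and integral_inner_le: "\<bar>LINT x|M. f x \<bullet> g x\<bar> \<le> l2 M f * l2 M g"
proof -
  note [measurable] = sqint_measurable[OF f] sqint_measurable[OF g]
  show i: "integrable M (\<lambda>x. f x \<bullet> g x)"
    by (rule Bochner_Integration.integrable_bound[OF sqint_mult_norm[OF f g]])
      (auto simp: Cauchy_Schwarz_ineq2)
  have "\<bar>LINT x|M. f x \<bullet> g x\<bar> \<le> (LINT x|M. \<bar>f x \<bullet> g x\<bar>)"
    by (rule integral_abs_bound)
  also have "\<dots> \<le> (LINT x|M. norm (f x) * norm (g x))"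
    by (intro integral_mono integrable_abs i sqint_mult_norm f g Cauchy_Schwarz_ineq2)
  finally show "\<bar>LINT x|M. f x \<bullet> g x\<bar> \<le> l2 M f * l2 M g"
    using integral_mult_norm_le[OF f g] by simp
qed

lemma sqint_scaleR [intro]: "sqint M f \<Longrightarrow> sqint M (\<lambda>x. c *\<^sub>R f x)"
  by (auto simp: sqint_def power_mult_distrib)

lemma l2_scaleR: "l2 M (\<lambda>x. c *\<^sub>R f x) = \<bar>c\<bar> * l2 M f"
  by (simp add: l2_def power_mult_distrib real_sqrt_mult)

lemma sqint_minus: "sqint M f \<Longrightarrow> sqint M (\<lambda>x. - f x)"
  by (simp add: sqint_def)

lemma sqint_zero [simp]: "sqint M (\<lambda>x. 0)"
  by (simp add: sqint_def)

lemma l2_zero [simp]: "l2 M (\<lambda>x. 0) = 0"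
  by (simp add: l2_def)

lemma
  fixes f g :: "'a \<Rightarrow> 'b::euclidean_space"
  assumes f: "sqint M f" and g: "sqint M g"
  shows sqint_add: "sqint M (\<lambda>x. f x + g x)"
    and l2_add: "l2 M (\<lambda>x. f x + g x) \<le> l2 M f + l2 M g"
proof -
  note [measurable] = sqint_measurable[OF f] sqint_measurable[OF g]
  have eq: "(norm (f x + g x))\<^sup>2 = (norm (f x))\<^sup>2 + 2 * (f x \<bullet> g x) + (norm (g x))\<^sup>2" for x
    by (simp add: power2_norm_eq_inner inner_add inner_commute)
  have i: "integrable M (\<lambda>x. (norm (f x))\<^sup>2)" "integrable M (\<lambda>x. (norm (g x))\<^sup>2)"
    using f g by (auto simp: sqint_def)
  have "integrable M (\<lambda>x. (norm (f x + g x))\<^sup>2)"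
    unfolding eq using i integrable_inner[OF f g] by (intro Bochner_Integration.integrable_add) auto
  then show "sqint M (\<lambda>x. f x + g x)"
    using f g by (auto simp: sqint_def)
  have "(l2 M (\<lambda>x. f x + g x))\<^sup>2 = (l2 M f)\<^sup>2 + 2 * (LINT x|M. f x \<bullet> g x) + (l2 M g)\<^sup>2"
    using i integrable_inner[OF f g] by (simp add: l2_squared eq)
  also have "\<dots> \<le> (l2 M f + l2 M g)\<^sup>2"
    using integral_inner_le[OF f g] by (simp add: power2_sum)
  finally show "l2 M (\<lambda>x. f x + g x) \<le> l2 M f + l2 M g"
    by (rule power2_le_imp_le) simp
qed

lemma
  fixes f g :: "'a \<Rightarrow> 'b::euclidean_space"
  assumes f: "sqint M f" and g: "sqint M g"
  shows sqint_diff: "sqint M (\<lambda>x. f x - g x)"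
    and l2_diff: "l2 M (\<lambda>x. f x - g x) \<le> l2 M f + l2 M g"
    and l2_diff_abs: "\<bar>l2 M f - l2 M g\<bar> \<le> l2 M (\<lambda>x. f x - g x)"
proof -
  have m: "l2 M (\<lambda>x. - h x) = l2 M h" for h :: "'a \<Rightarrow> 'b" by (simp add: l2_def)
  show d: "sqint M (\<lambda>x. f x - g x)"
    using sqint_add[OF f sqint_minus[OF g]] by simp
  show "l2 M (\<lambda>x. f x - g x) \<le> l2 M f + l2 M g"
    using l2_add[OF f sqint_minus[OF g]] by (simp add: m)
  have "l2 M f \<le> l2 M (\<lambda>x. f x - g x) + l2 M g" using l2_add[OF d g] by simp
  moreover have "l2 M g \<le> l2 M (\<lambda>x. f x - g x) + l2 M f"
    using l2_add[OF sqint_minus[OF d] f] by (simp add: m[of "\<lambda>x. f x - g x", simplified])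
  ultimately show "\<bar>l2 M f - l2 M g\<bar> \<le> l2 M (\<lambda>x. f x - g x)" by simp
qed

lemma sqint_sum:
  "(\<And>i. i \<in> I \<Longrightarrow> sqint M (f i)) \<Longrightarrow> sqint M (\<lambda>x. \<Sum>i\<in>I. f i x)"
  by (induction I rule: infinite_finite_induct) (auto intro: sqint_add)

lemma
  assumes g: "sqint M g" and [measurable]: "f \<in> borel_measurable M"
    and le: "AE x in M. norm (f x) \<le> norm (g x)"
  shows sqint_bound: "sqint M f" and l2_mono: "l2 M f \<le> l2 M g"
proof -
  note [measurable] = sqint_measurable[OF g]
  have "(\<integral>\<^sup>+x. (ennreal (norm (f x)))\<^sup>2 \<partial>M) \<le> (\<integral>\<^sup>+x. (ennreal (norm (g x)))\<^sup>2 \<partial>M)"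
    using le by (intro nn_integral_mono_AE) (auto intro!: power_mono)
  then have *: "(\<integral>\<^sup>+x. (ennreal (norm (f x)))\<^sup>2 \<partial>M) \<le> ennreal ((l2 M g)\<^sup>2)"
    unfolding nn_integral_eq_l2[OF g] .
  show "sqint M f" "l2 M f \<le> l2 M g" using sqintI_nn[OF assms(2) *] by simp_all
qed

lemma (in finite_measure) sqint_const: "sqint M (\<lambda>x. c)"
  by (simp add: sqint_def)

lemma (in finite_measure) sqint_bounded:
  assumes "f \<in> borel_measurable M" "AE x in M. norm (f x) \<le> B"
  shows "sqint M f"
proof (rule sqint_bound[OF sqint_const[of B]])
  show "AE x in M. norm (f x) \<le> norm B" using assms(2) by eventually_elim auto
qed (use assms in auto)

lemma (in finite_measure)
  assumes f: "sqint M f"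
  shows sqint_integrable: "integrable M f"
    and l1_le_l2: "(LINT x|M. norm (f x)) \<le> sqrt (measure M (space M)) * l2 M f"
proof -
  note [measurable] = sqint_measurable[OF f]
  have "integrable M (\<lambda>x. norm (f x))"
    using sqint_mult_norm[OF f sqint_const[of "1::real"]] by simp
  then show "integrable M f" by (simp add: integrable_norm_iff)
  show "(LINT x|M. norm (f x)) \<le> sqrt (measure M (space M)) * l2 M f"
    using integral_mult_norm_le[OF f sqint_const[of "1::real"]]
    by (simp add: l2_def mult.commute)
qed

text \<open>Lower semicontinuity of the norm. Only almost everywhere convergence is asked of the
  sequence, so the lemma can recognise a limit not yet known to be square integrable.\<close>

lemma l2_fatou:
  fixes f :: "'a \<Rightarrow> 'b::euclidean_space"
  assumes s: "\<And>n. sqint M (s n)" and f [measurable]: "f \<in> borel_measurable M"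
    and lim: "AE x in M. (\<lambda>n. s n x) \<longlonglongrightarrow> f x"
    and le: "eventually (\<lambda>n. l2 M (s n) \<le> c) sequentially" and c: "0 \<le> c"
  shows "sqint M f" and "l2 M f \<le> c"
proof -
  note [measurable] = sqint_measurable[OF s]
  have "(\<integral>\<^sup>+x. (ennreal (norm (f x)))\<^sup>2 \<partial>M) = (\<integral>\<^sup>+x. liminf (\<lambda>n. (ennreal (norm (s n x)))\<^sup>2) \<partial>M)"
  proof (rule nn_integral_cong_AE, use lim in eventually_elim)
    case (elim x)
    have "(\<lambda>n. ennreal ((norm (s n x))\<^sup>2)) \<longlonglongrightarrow> ennreal ((norm (f x))\<^sup>2)"
      using elim by (intro tendsto_ennrealI tendsto_intros)
    then show ?case by (intro lim_imp_Liminf[symmetric]) (auto simp: ennreal_power)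
  qed
  also have "\<dots> \<le> liminf (\<lambda>n. \<integral>\<^sup>+x. (ennreal (norm (s n x)))\<^sup>2 \<partial>M)"
    by (rule nn_integral_liminf) measurable
  also have "\<dots> = liminf (\<lambda>n. ennreal ((l2 M (s n))\<^sup>2))"
    unfolding nn_integral_eq_l2[OF s] ..
  also have "\<dots> \<le> ennreal (c\<^sup>2)"
  proof -
    have "eventually (\<lambda>n. ennreal ((l2 M (s n))\<^sup>2) \<le> ennreal (c\<^sup>2)) sequentially"
      using le by eventually_elim (auto intro!: ennreal_leI power_mono)
    then have "liminf (\<lambda>n. ennreal ((l2 M (s n))\<^sup>2)) \<le> liminf (\<lambda>n::nat. ennreal (c\<^sup>2))"
      by (rule Liminf_mono)
    then show ?thesis by (simp add: Liminf_const)
  qed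
  finally show "sqint M f" "l2 M f \<le> c" using sqintI_nn[OF f _ c] by simp_all
qed

text \<open>On a finite measure space convergence in \<open>L\<^sup>2\<close> implies convergence in
  \<open>L\<^sup>1\<close>, for which a subsequence can be extracted.\<close>

lemma l2_tendsto_AE_subseq:
  fixes f :: "'a \<Rightarrow> 'b::euclidean_space"
  assumes fin: "finite_measure M" and s: "\<And>n. sqint M (s n)" and f: "sqint M f"
    and lim: "(\<lambda>n. l2 M (\<lambda>x. s n x - f x)) \<longlonglongrightarrow> 0"
  obtains r where "strict_mono r" "AE x in M. (\<lambda>n. s (r n) x) \<longlonglongrightarrow> f x"
proof -
  interpret finite_measure M by fact
  have d: "sqint M (\<lambda>x. s n x - f x)" for n by (intro sqint_diff s f)
  have "(\<lambda>n. LINT x|M. norm (s n x - f x)) \<longlonglongrightarrow> 0"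
  proof (rule tendsto_sandwich[OF _ _ tendsto_const])
    show "(\<lambda>n. sqrt (measure M (space M)) * l2 M (\<lambda>x. s n x - f x)) \<longlonglongrightarrow> 0"
      using tendsto_mult_right_zero[OF lim] .
    show "eventually (\<lambda>n. (LINT x|M. norm (s n x - f x)) \<le>
      sqrt (measure M (space M)) * l2 M (\<lambda>x. s n x - f x)) sequentially"
      using l1_le_l2[OF d] by auto
  qed auto
  then obtain r where "strict_mono r" "AE x in M. (\<lambda>n. s (r n) x - f x) \<longlonglongrightarrow> 0"
    using tendsto_L1_AE_subseq[of M "\<lambda>n x. s n x - f x"] sqint_integrable[OF d] by blast
  moreover from this(2) have "AE x in M. (\<lambda>n. s (r n) x) \<longlonglongrightarrow> f x"
    by eventually_elim (simp add: LIM_zero_iff)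
  ultimately show ?thesis using that by blast
qed

text \<open>Completeness without choosing the limit: any measurable function that is almost
  everywhere the limit of the subsequence will do. Both callers bring their own: the gradient in
  \<open>grad_norm_sq_eq\<close> has to be periodic, and the noise in \<open>noise_moments\<close>
  is prescribed.\<close>

lemma l2_complete:
  fixes s :: "nat \<Rightarrow> 'a \<Rightarrow> 'b::euclidean_space"
  assumes fin: "finite_measure M" and s: "\<And>n. sqint M (s n)"
    and cauchy: "\<And>e. 0 < e \<Longrightarrow> \<exists>N. \<forall>i\<ge>N. \<forall>j\<ge>N. l2 M (\<lambda>x. s i x - s j x) < e"
  obtains r where "strict_mono r" "AE x in M. convergent (\<lambda>n. s (r n) x)"
    "\<And>f. f \<in> borel_measurable M \<Longrightarrow> (AE x in M. (\<lambda>n. s (r n) x) \<longlonglongrightarrow> f x) \<Longrightarrow>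
      sqint M f \<and> (\<lambda>n. l2 M (\<lambda>x. f x - s n x)) \<longlonglongrightarrow> 0"
proof -
  interpret finite_measure M by fact
  have d: "sqint M (\<lambda>x. s i x - s j x)" for i j by (intro sqint_diff s)
  obtain r where r: "strict_mono r" "AE x in M. Cauchy (\<lambda>i. s (r i) x)"
  proof (rule cauchy_L1_AE_cauchy_subseq[of M s])
    show "integrable M (s n)" for n by (rule sqint_integrable[OF s])
    fix e :: real assume "0 < e"
    define c where "c = sqrt (measure M (space M)) + 1"
    have "0 < c" by (simp add: c_def add_nonneg_pos)
    with \<open>0 < e\<close> obtain N where N: "\<forall>i\<ge>N. \<forall>j\<ge>N. l2 M (\<lambda>x. s i x - s j x) < e / c"
      using cauchy[of "e / c"] by auto
    have "(LINT x|M. norm (s i x - s j x)) < e" if "i \<ge> N" "j \<ge> N" for i j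
    proof -
      have "(LINT x|M. norm (s i x - s j x)) \<le> c * l2 M (\<lambda>x. s i x - s j x)"
        by (rule order_trans[OF l1_le_l2[OF d]]) (simp add: c_def mult_right_mono)
      also have "\<dots> < e" using N that \<open>0 < c\<close> by (auto simp: field_simps)
      finally show ?thesis .
    qed
    then show "\<exists>N. \<forall>i\<ge>N. \<forall>j\<ge>N. (LINT x|M. norm (s i x - s j x)) < e" by blast
  qed auto
  show ?thesis
  proof (rule that[OF r(1)])
    show "AE x in M. convergent (\<lambda>n. s (r n) x)"
      using r(2) by eventually_elim (simp add: Cauchy_convergent)
    fix f :: "'a \<Rightarrow> 'b"
    assume [measurable]: "f \<in> borel_measurable M" and lim: "AE x in M. (\<lambda>n. s (r n) x) \<longlonglongrightarrow> f x"
    \<comment> \<open>Fatou's lemma in the second index turns the Cauchy bound into a bound on the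
      distance from the limit.\<close>
    have key: "\<exists>N. \<forall>n\<ge>N. sqint M (\<lambda>x. s n x - f x) \<and> l2 M (\<lambda>x. s n x - f x) \<le> e" if "0 < e" for e
    proof -
      obtain N where N: "\<forall>i\<ge>N. \<forall>j\<ge>N. l2 M (\<lambda>x. s i x - s j x) < e" using cauchy[OF \<open>0 < e\<close>] by auto
      have "sqint M (\<lambda>x. s n x - f x) \<and> l2 M (\<lambda>x. s n x - f x) \<le> e" if "n \<ge> N" for n
      proof -
        note [measurable] = sqint_measurable[OF s]
        have *: "eventually (\<lambda>i. l2 M (\<lambda>x. s n x - s (r i) x) \<le> e) sequentially"
          unfolding eventually_sequentially
          using N that seq_suble[OF r(1)] by (meson less_imp_le order_trans)
        have "AE x in M. (\<lambda>i. s n x - s (r i) x) \<longlonglongrightarrow> s n x - f x"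
          using lim by eventually_elim (intro tendsto_intros)
        from l2_fatou[OF d _ this *] \<open>0 < e\<close> show ?thesis by simp
      qed
      then show ?thesis by blast
    qed
    obtain n where "sqint M (\<lambda>x. s n x - f x)" using key[of 1] by auto
    from sqint_diff[OF s[of n] this] have 1: "sqint M f" by simp
    have eq: "l2 M (\<lambda>x. f x - s n x) = l2 M (\<lambda>x. s n x - f x)" for n
      by (simp add: l2_def norm_minus_commute)
    have "(\<lambda>n. l2 M (\<lambda>x. f x - s n x)) \<longlonglongrightarrow> 0"
    proof (rule LIMSEQ_I)
      fix e :: real assume "0 < e"
      then obtain N where "\<forall>n\<ge>N. l2 M (\<lambda>x. s n x - f x) \<le> e / 2" using key[of "e / 2"] by auto
      then show "\<exists>N. \<forall>n\<ge>N. norm (l2 M (\<lambda>x. f x - s n x) - 0) < e"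
        using \<open>0 < e\<close> by (auto simp: eq intro!: exI[of _ N] intro: le_less_trans)
    qed
    with 1 show "sqint M f \<and> (\<lambda>n. l2 M (\<lambda>x. f x - s n x)) \<longlonglongrightarrow> 0" by simp
  qed
qed

lemma inner_tendsto_l2:
  fixes f g :: "'a \<Rightarrow> 'b::euclidean_space"
  assumes "\<And>n. sqint M (s n)" "\<And>n. sqint M (t n)" "sqint M f" "sqint M g"
    and "(\<lambda>n. l2 M (\<lambda>x. f x - s n x)) \<longlonglongrightarrow> 0" "(\<lambda>n. l2 M (\<lambda>x. g x - t n x)) \<longlonglongrightarrow> 0"
  shows "(\<lambda>n. LINT x|M. s n x \<bullet> t n x) \<longlonglongrightarrow> (LINT x|M. f x \<bullet> g x)"
proof (rule LIM_zero_cancel, rule tendsto_rabs_zero_cancel, rule tendsto_sandwich[OF _ _ tendsto_const])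
  note i = assms(1-4)
  let ?a = "\<lambda>n. l2 M (\<lambda>x. f x - s n x)" and ?b = "\<lambda>n. l2 M (\<lambda>x. g x - t n x)"
  show "(\<lambda>n. ?a n * (?b n + l2 M g) + l2 M f * ?b n) \<longlonglongrightarrow> 0"
    using tendsto_add[OF tendsto_mult[OF assms(5) tendsto_add[OF assms(6) tendsto_const[of "l2 M g"]]]
      tendsto_mult[OF tendsto_const[of "l2 M f"] assms(6)]] by simp
  show "\<forall>\<^sub>F n in sequentially. \<bar>(LINT x|M. s n x \<bullet> t n x) - (LINT x|M. f x \<bullet> g x)\<bar>
      \<le> ?a n * (?b n + l2 M g) + l2 M f * ?b n"
  proof (rule always_eventually, rule allI)
    fix n
    have "(LINT x|M. s n x \<bullet> t n x) - (LINT x|M. f x \<bullet> g x)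
      = - (LINT x|M. (f x - s n x) \<bullet> t n x) - (LINT x|M. f x \<bullet> (g x - t n x))"
      using integrable_inner[OF i(1)[of n] i(2)[of n]] integrable_inner[OF i(3) i(4)]
        integrable_inner[OF i(3) i(2)[of n]]
      by (simp add: inner_diff_left inner_diff_right)
    also have "\<bar>\<dots>\<bar> \<le> ?a n * l2 M (t n) + l2 M f * ?b n"
      using integral_inner_le[OF sqint_diff[OF i(3) i(1)[of n]] i(2)[of n]]
        integral_inner_le[OF i(3) sqint_diff[OF i(4) i(2)[of n]]] by linarith
    also have "\<dots> \<le> ?a n * (?b n + l2 M g) + l2 M f * ?b n"
      using l2_diff_abs[OF i(4) i(2)[of n]] by (intro add_mono mult_left_mono) auto
    finally show "\<bar>(LINT x|M. s n x \<bullet> t n x) - (LINT x|M. f x \<bullet> g x)\<bar>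
      \<le> ?a n * (?b n + l2 M g) + l2 M f * ?b n" .
  qed
qed auto

lemma l2_tendsto_norm:
  fixes f :: "'a \<Rightarrow> 'b::euclidean_space"
  assumes "\<And>n. sqint M (s n)" "sqint M f" "(\<lambda>n. l2 M (\<lambda>x. f x - s n x)) \<longlonglongrightarrow> 0"
  shows "(\<lambda>n. l2 M (s n)) \<longlonglongrightarrow> l2 M f"
proof -
  have "(\<lambda>n. l2 M f - l2 M (s n)) \<longlonglongrightarrow> 0"
    by (rule tendsto_rabs_zero_cancel, rule tendsto_sandwich[OF _ _ tendsto_const assms(3)])
      (auto intro!: always_eventually l2_diff_abs assms)
  from tendsto_diff[OF tendsto_const[of "l2 M f"] this] show ?thesis by simp
qed

section \<open>Integration over the torus\<close>

text \<open>A density rather than a restricted space: the space stays \<open>UNIV\<close> and the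
  measurable sets stay Borel, so translations and periodic functions need no relativised
  measurability.\<close>

definition leb_on :: "'a::euclidean_space set \<Rightarrow> 'a measure" where
  "leb_on A = density lborel (indicator A)"

abbreviation torus :: "(real^3) measure" where
  "torus \<equiv> leb_on torus_box"

lemma sets_leb_on [simp, measurable_cong]: "sets (leb_on A) = sets borel"
  by (simp add: leb_on_def)

lemma space_leb_on [simp]: "space (leb_on A) = UNIV"
  by (simp add: leb_on_def)

lemma nn_integral_leb_on:
  "A \<in> sets borel \<Longrightarrow> f \<in> borel_measurable borel \<Longrightarrow>
    (\<integral>\<^sup>+x. f x \<partial>leb_on A) = (\<integral>\<^sup>+x. indicator A x * f x \<partial>lborel)"
  by (simp add: leb_on_def nn_integral_density)

lemma density_ennreal_indicator: "leb_on A = density lborel (\<lambda>x. ennreal (indicator A x))"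
  by (simp add: leb_on_def ennreal_indicator)

lemma integral_leb_on:
  fixes f :: "'a::euclidean_space \<Rightarrow> 'b::euclidean_space"
  assumes [measurable]: "A \<in> sets borel" "f \<in> borel_measurable borel"
  shows "(LINT x|leb_on A. f x) = (LINT x:A|lborel. f x)"
    and "integrable (leb_on A) f \<longleftrightarrow> set_integrable lborel A f"
  unfolding density_ennreal_indicator set_lebesgue_integral_def set_integrable_def
  by (subst integral_density; simp) (subst integrable_density; simp)

lemma finite_measure_leb_on: "bounded A \<Longrightarrow> A \<in> sets borel \<Longrightarrow> finite_measure (leb_on A)"
  using emeasure_bounded_finite[of A] by (intro finite_measureI) (simp add: leb_on_def emeasure_density)

lemma AE_leb_on:
  "A \<in> sets borel \<Longrightarrow> (AE x in leb_on A. P x) \<longleftrightarrow> (AE x in lborel. x \<in> A \<longrightarrow> P x)"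
  by (subst leb_on_def, subst AE_density) (auto simp: indicator_def)

lemma torus_box_sets [measurable, simp]: "torus_box \<in> sets borel"
  by (simp add: torus_box_def)

lemma bounded_torus_box: "bounded torus_box"
  by (simp add: torus_box_def bounded_cbox)

interpretation torus: finite_measure torus
  by (rule finite_measure_leb_on) (simp_all add: bounded_torus_box)

interpretation ball: finite_measure "leb_on (cball 0 R)"
  by (rule finite_measure_leb_on) auto

lemma L2_torus_iff: "f \<in> L2_torus \<longleftrightarrow> periodic f \<and> f \<in> borel_measurable borel \<and> sqint torus f"
proof -
  have "set_integrable lborel torus_box (\<lambda>x. (norm (f x))\<^sup>2) \<longleftrightarrow> integrable torus (\<lambda>x. (norm (f x))\<^sup>2)"
    if "f \<in> borel_measurable borel"
    using that by (subst integral_leb_on(2)) simp_all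
  then show ?thesis by (auto simp: L2_torus_def sqint_def)
qed

lemma L2_torusD:
  "f \<in> L2_torus \<Longrightarrow> periodic f"
  "f \<in> L2_torus \<Longrightarrow> f \<in> borel_measurable borel"
  "f \<in> L2_torus \<Longrightarrow> sqint torus f"
  by (auto simp: L2_torus_iff)

lemma L2_norm_eq: "f \<in> borel_measurable borel \<Longrightarrow> L2_norm f = l2 torus f"
  unfolding L2_norm_def l2_def by (subst integral_leb_on(1)) auto

lemma L2_inner_eq: "f \<in> borel_measurable borel \<Longrightarrow> g \<in> borel_measurable borel \<Longrightarrow>
    L2_inner f g = (LINT x|torus. f x \<bullet> g x)"
  unfolding L2_inner_def by (subst integral_leb_on(1)) auto

section \<open>Periodicity and translation invariance of the torus integral\<close>

lemma axis_add: "axis i a + axis i b = axis i (a + b :: real)"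
  by (simp add: vec_eq_iff axis_def)

lemma periodic_axis_int: "periodic f \<Longrightarrow> f (x + axis i (2 * pi * real_of_int m)) = f x"
proof (induction m arbitrary: x rule: int_induct[of _ 0])
  case (step1 m)
  have "f (x + axis i (2 * pi * real_of_int (m + 1))) = f (x + axis i (2 * pi * real_of_int m) + axis i (2 * pi))"
    by (simp add: add.assoc axis_add distrib_left)
  also have "\<dots> = f x" using step1 by (simp add: periodic_def)
  finally show ?case .
next
  case (step2 m)
  have "f (x + axis i (2 * pi * real_of_int (m - 1))) = f (x + axis i (2 * pi * real_of_int (m - 1)) + axis i (2 * pi))"
    using step2 by (simp add: periodic_def)
  also have "x + axis i (2 * pi * real_of_int (m - 1)) + axis i (2 * pi) = x + axis i (2 * pi * real_of_int m)"
    by (simp add: add.assoc axis_add algebra_simps)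
  finally show ?case using step2 by simp
qed (simp add: axis_def zero_vec_def[symmetric])

lemma periodic_lattice:
  assumes "periodic f"
  shows "f (x + (2 * pi) *\<^sub>R frequency k) = f x"
proof -
  have "x + (2 * pi) *\<^sub>R frequency k = x + axis 1 (2 * pi * real_of_int (k $ 1))
      + axis 2 (2 * pi * real_of_int (k $ 2)) + axis 3 (2 * pi * real_of_int (k $ 3))"
    using exhaust_3 by (auto simp: vec_eq_iff axis_def frequency_def)
  then show ?thesis by (simp only: periodic_axis_int[OF assms])
qed

text \<open>Half-open, so that its lattice translates tile the space exactly; the closed
  \<open>torus_box\<close> differs from it by a null set.\<close>

definition torus_cell :: "(real^3) set" where
  "torus_cell = {x. \<forall>i. 0 \<le> x $ i \<and> x $ i < 2 * pi}"

lemma torus_cell_sets [measurable, simp]: "torus_cell \<in> sets borel"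
  unfolding torus_cell_def by measurable

lemma AE_torus_cell: "AE x in lborel. x \<in> torus_box \<longleftrightarrow> x \<in> torus_cell"
proof -
  have "cbox 0 (vec (2 * pi)) - box 0 (vec (2 * pi)) \<in> null_sets (lborel :: (real^3) measure)"
    using negligible_frontier_interval[of 0 "vec (2 * pi) :: real^3"]
    by (simp add: negligible_iff_null_sets null_sets_completion_iff)
  from AE_not_in[OF this] show ?thesis
    by eventually_elim (auto simp: torus_box_def torus_cell_def mem_box_cart less_imp_le dest: less_imp_le)
qed

lemma ex1_cell: "\<exists>!k. x + (2 * pi) *\<^sub>R frequency k \<in> torus_cell"
proof
  let ?k = "\<chi> i. - \<lfloor>x $ i / (2 * pi)\<rfloor>"
  have "0 \<le> y - 2 * pi * real_of_int \<lfloor>y / (2 * pi)\<rfloor>" "y - 2 * pi * real_of_int \<lfloor>y / (2 * pi)\<rfloor> < 2 * pi" for y :: real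
  proof -
    have "real_of_int \<lfloor>y / (2 * pi)\<rfloor> \<le> y / (2 * pi)" "y / (2 * pi) < real_of_int \<lfloor>y / (2 * pi)\<rfloor> + 1"
      by linarith+
    then show "0 \<le> y - 2 * pi * real_of_int \<lfloor>y / (2 * pi)\<rfloor>" "y - 2 * pi * real_of_int \<lfloor>y / (2 * pi)\<rfloor> < 2 * pi"
      using mult_left_mono[of "real_of_int \<lfloor>y / (2 * pi)\<rfloor>" "y / (2 * pi)" "2 * pi"]
        mult_strict_left_mono[of "y / (2 * pi)" "real_of_int \<lfloor>y / (2 * pi)\<rfloor> + 1" "2 * pi"]
      by (simp_all add: distrib_left)
  qed
  then show "x + (2 * pi) *\<^sub>R frequency ?k \<in> torus_cell"
    by (simp add: torus_cell_def frequency_def)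
  fix k assume k: "x + (2 * pi) *\<^sub>R frequency k \<in> torus_cell"
  have "k $ i = - \<lfloor>x $ i / (2 * pi)\<rfloor>" for i
  proof -
    have "0 \<le> x $ i + 2 * pi * real_of_int (k $ i)" "x $ i + 2 * pi * real_of_int (k $ i) < 2 * pi"
      using k by (auto simp: torus_cell_def frequency_def)
    then have "\<lfloor>x $ i / (2 * pi)\<rfloor> = - (k $ i)"
      by (intro floor_unique) (auto simp: field_simps)
    then show ?thesis by simp
  qed
  then show "k = ?k" by (simp add: vec_eq_iff)
qed

lemma sum_cells: "(\<integral>\<^sup>+k. indicator torus_cell (x + (2 * pi) *\<^sub>R frequency k) \<partial>count_space UNIV) = (1::ennreal)"
proof -
  obtain k0 where k0: "\<And>k. x + (2 * pi) *\<^sub>R frequency k \<in> torus_cell \<longleftrightarrow> k = k0"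
    using ex1_cell[of x] by metis
  have "(\<integral>\<^sup>+k. indicator torus_cell (x + (2 * pi) *\<^sub>R frequency k) \<partial>count_space UNIV)
    = (\<integral>\<^sup>+k. indicator {k0} k \<partial>count_space UNIV)"
    by (intro nn_integral_cong) (simp add: indicator_def k0)
  then show ?thesis by simp
qed

lemma frequency_minus: "frequency (- k) = - frequency k"
  by (simp add: frequency_def vec_eq_iff)

lemma sum_cells': "(\<integral>\<^sup>+k. indicator torus_cell (x - (2 * pi) *\<^sub>R frequency k) \<partial>count_space UNIV) = (1::ennreal)"
proof -
  have "(\<integral>\<^sup>+k. indicator torus_cell (x + (2 * pi) *\<^sub>R frequency (- k)) \<partial>count_space UNIV)
    = (\<integral>\<^sup>+k. indicator torus_cell (x + (2 * pi) *\<^sub>R frequency k) \<partial>count_space (UNIV :: (int^3) set))"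
    by (rule nn_integral_bij_count_space) (auto intro!: bij_betw_byWitness[where f' = uminus])
  then show ?thesis by (simp add: sum_cells frequency_minus)
qed

lemma nn_integral_translate:
  fixes f :: "'a::euclidean_space \<Rightarrow> ennreal"
  assumes [measurable]: "f \<in> borel_measurable borel"
  shows "(\<integral>\<^sup>+x. f (x + c) \<partial>lborel) = (\<integral>\<^sup>+x. f x \<partial>lborel)"
proof -
  have "(\<integral>\<^sup>+x. f x \<partial>lborel) = (\<integral>\<^sup>+x. f x \<partial>distr lborel borel ((+) c))"
    by (simp add: lborel_distr_plus)
  also have "\<dots> = (\<integral>\<^sup>+x. f (c + x) \<partial>lborel)"
    by (rule nn_integral_distr) measurable
  finally show ?thesis by (simp add: add.commute)
qed

text \<open>Unfolding: the indicators of all lattice translates of the cell add up to one. Insert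
  this sum, move each summand by its lattice vector, and sum over the translates of the shifted
  cell; integration over one cell has been exchanged for integration over the other.\<close>

lemma nn_integral_torus_shift:
  fixes f :: "real^3 \<Rightarrow> ennreal"
  assumes per: "periodic f" and [measurable]: "f \<in> borel_measurable borel"
  shows "(\<integral>\<^sup>+x. f (x + h) \<partial>torus) = (\<integral>\<^sup>+x. f x \<partial>torus)"
proof -
  have cell: "(\<integral>\<^sup>+x. g x \<partial>torus) = (\<integral>\<^sup>+x. indicator torus_cell x * g x \<partial>lborel)"
    if [measurable]: "g \<in> borel_measurable borel" for g
  proof (subst nn_integral_leb_on)
    show "(\<integral>\<^sup>+x. indicator torus_box x * g x \<partial>lborel) = (\<integral>\<^sup>+x. indicator torus_cell x * g x \<partial>lborel)"
      by (rule nn_integral_cong_AE, use AE_torus_cell in eventually_elim) (simp add: indicator_def)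
  qed auto
  have per': "f (x + (2 * pi) *\<^sub>R frequency k) = f x" for x k by (rule periodic_lattice[OF per])
  let ?I = "indicator torus_cell :: real^3 \<Rightarrow> ennreal"
  have "(\<integral>\<^sup>+x. f (x + h) \<partial>torus) = (\<integral>\<^sup>+x. ?I x * f (x + h) \<partial>lborel)"
    by (rule cell) measurable
  also have "\<dots> = (\<integral>\<^sup>+x. ?I (x - h) * f x \<partial>lborel)"
    using nn_integral_translate[of "\<lambda>x. ?I (x - h) * f x" h] by simp
  also have "\<dots> = (\<integral>\<^sup>+x. (\<integral>\<^sup>+k. ?I (x - h) * f x * ?I (x - (2 * pi) *\<^sub>R frequency k) \<partial>count_space UNIV) \<partial>lborel)"
    by (simp add: nn_integral_cmult sum_cells')
  also have "\<dots> = (\<integral>\<^sup>+k. (\<integral>\<^sup>+x. ?I (x - h) * f x * ?I (x - (2 * pi) *\<^sub>R frequency k) \<partial>lborel) \<partial>count_space UNIV)"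
    by (rule nn_integral_count_space_nn_integral) auto
  also have "\<dots> = (\<integral>\<^sup>+k. (\<integral>\<^sup>+x. ?I (x - h + (2 * pi) *\<^sub>R frequency k) * f x * ?I x \<partial>lborel) \<partial>count_space UNIV)"
  proof (rule nn_integral_cong)
    fix k :: "int^3"
    have sh: "x + (2 * pi) *\<^sub>R frequency k - h = x - h + (2 * pi) *\<^sub>R frequency k" for x by simp
    show "(\<integral>\<^sup>+x. ?I (x - h) * f x * ?I (x - (2 * pi) *\<^sub>R frequency k) \<partial>lborel)
      = (\<integral>\<^sup>+x. ?I (x - h + (2 * pi) *\<^sub>R frequency k) * f x * ?I x \<partial>lborel)"
      using nn_integral_translate[of "\<lambda>x. ?I (x - h) * f x * ?I (x - (2 * pi) *\<^sub>R frequency k)" "(2 * pi) *\<^sub>R frequency k"]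
      by (simp add: per' sh del: mult.commute)
  qed
  also have "\<dots> = (\<integral>\<^sup>+x. (\<integral>\<^sup>+k. ?I (x - h + (2 * pi) *\<^sub>R frequency k) * f x * ?I x \<partial>count_space UNIV) \<partial>lborel)"
    by (rule nn_integral_count_space_nn_integral[symmetric]) auto
  also have "\<dots> = (\<integral>\<^sup>+x. ?I x * f x \<partial>lborel)"
    by (subst mult.assoc) (simp add: nn_integral_multc sum_cells mult.commute[of "f _"])
  also have "\<dots> = (\<integral>\<^sup>+x. f x \<partial>torus)"
    by (rule cell[symmetric]) measurable
  finally show ?thesis .
qed

text \<open>The representative modulo the lattice. Periodic functions factor through it, so
  translation invariance becomes an equality of image measures and carries over from nonnegative to
  vector-valued integrands.\<close>

definition torus_wrap :: "real^3 \<Rightarrow> real^3" where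
  "torus_wrap x = (\<chi> i. x $ i - 2 * pi * real_of_int \<lfloor>x $ i / (2 * pi)\<rfloor>)"

lemma torus_wrap_measurable [measurable]: "torus_wrap \<in> borel_measurable borel"
  by (subst borel_measurable_euclidean_space) (auto simp: torus_wrap_def Basis_vec_def inner_axis)

lemma periodic_wrap: "periodic f \<Longrightarrow> f (torus_wrap x) = f x"
proof -
  assume p: "periodic f"
  have "torus_wrap x = x + (2 * pi) *\<^sub>R frequency (\<chi> i. - \<lfloor>x $ i / (2 * pi)\<rfloor>)"
    by (simp add: torus_wrap_def frequency_def vec_eq_iff)
  then show ?thesis using periodic_lattice[OF p] by simp
qed

lemma periodic_torus_wrap: "periodic torus_wrap"
  by (auto simp: periodic_def torus_wrap_def vec_eq_iff axis_def add_divide_distrib algebra_simps)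

lemma distr_wrap_shift: "distr torus borel (\<lambda>x. torus_wrap (x + h)) = distr torus borel torus_wrap"
proof (rule measure_eqI)
  fix A :: "(real^3) set" assume "A \<in> sets (distr torus borel (\<lambda>x. torus_wrap (x + h)))"
  then have [measurable]: "A \<in> sets borel" by simp
  have "periodic (\<lambda>x. indicator A (torus_wrap x) :: ennreal)"
    using periodic_torus_wrap by (simp add: periodic_def)
  from nn_integral_torus_shift[OF this, of h]
  have "(\<integral>\<^sup>+x. indicator A (torus_wrap (x + h)) \<partial>torus) = (\<integral>\<^sup>+x. indicator A (torus_wrap x) \<partial>torus)"
    by simp
  then have "(\<integral>\<^sup>+x. indicator A x \<partial>distr torus borel (\<lambda>x. torus_wrap (x + h)))
    = (\<integral>\<^sup>+x. indicator A x \<partial>distr torus borel torus_wrap)"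
    by (simp add: nn_integral_distr del: nn_integral_indicator)
  then show "emeasure (distr torus borel (\<lambda>x. torus_wrap (x + h))) A = emeasure (distr torus borel torus_wrap) A"
    by (simp add: nn_integral_indicator)
qed simp

lemma
  fixes f :: "real^3 \<Rightarrow> 'b::euclidean_space"
  assumes per: "periodic f" and [measurable]: "f \<in> borel_measurable borel"
  shows integrable_torus_shift: "integrable torus (\<lambda>x. f (x + h)) \<longleftrightarrow> integrable torus f"
    and integral_torus_shift: "(LINT x|torus. f (x + h)) = (LINT x|torus. f x)"
proof -
  have eq: "f x = f (torus_wrap x)" for x by (simp add: periodic_wrap[OF per])
  have "integrable torus (\<lambda>x. f (torus_wrap (x + h))) \<longleftrightarrow> integrable torus (\<lambda>x. f (torus_wrap x))"
    using integrable_distr_eq[of "\<lambda>x. torus_wrap (x + h)" torus borel f]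
      integrable_distr_eq[of torus_wrap torus borel f] distr_wrap_shift[of h] by simp
  then show "integrable torus (\<lambda>x. f (x + h)) \<longleftrightarrow> integrable torus f" by (simp add: eq[symmetric])
  have "(LINT x|torus. f (torus_wrap (x + h))) = (LINT x|torus. f (torus_wrap x))"
    using integral_distr[of "\<lambda>x. torus_wrap (x + h)" torus borel f]
      integral_distr[of torus_wrap torus borel f] distr_wrap_shift[of h] by simp
  then show "(LINT x|torus. f (x + h)) = (LINT x|torus. f x)" by (simp add: eq[symmetric])
qed

lemma
  fixes f :: "real^3 \<Rightarrow> 'b::euclidean_space"
  assumes f: "f \<in> L2_torus"
  shows sqint_torus_shift: "sqint torus (\<lambda>x. f (x + h))"
    and l2_torus_shift: "l2 torus (\<lambda>x. f (x + h)) = l2 torus f"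
proof -
  note p = L2_torusD(1)[OF f] and [measurable] = L2_torusD(2)[OF f] and s = L2_torusD(3)[OF f]
  have p2: "periodic (\<lambda>x. (norm (f x))\<^sup>2)" using p by (simp add: periodic_def)
  show "sqint torus (\<lambda>x. f (x + h))"
    using s integrable_torus_shift[OF p2, of h] by (simp add: sqint_def)
  show "l2 torus (\<lambda>x. f (x + h)) = l2 torus f"
    using integral_torus_shift[OF p2, of h] by (simp add: l2_def)
qed

text \<open>This is where radii at most one come from: moved by the vector with all entries one,
  such a ball lies inside a single period because \<open>2 \<le> 2 * pi\<close>.\<close>

lemma nn_integral_ball_le_torus:
  fixes f :: "real^3 \<Rightarrow> ennreal"
  assumes per: "periodic f" and [measurable]: "f \<in> borel_measurable borel" and R: "R \<le> 1"
  shows "(\<integral>\<^sup>+h. f (x + h) \<partial>leb_on (cball 0 R)) \<le> (\<integral>\<^sup>+x. f x \<partial>torus)"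
proof -
  have sub: "h + vec 1 \<in> torus_box" if "h \<in> cball 0 R" for h :: "real^3"
  proof -
    have "\<bar>h $ i\<bar> \<le> 1" for i using that R component_le_norm_cart[of h i] by auto
    moreover have "2 \<le> 2 * pi" using pi_ge_two by simp
    ultimately have "- 1 \<le> h $ i \<and> h $ i + 1 \<le> 2 * pi" for i
      by (simp add: abs_le_iff) (smt (verit, best))
    then show ?thesis by (simp add: torus_box_def mem_box_cart add_nonneg_nonneg) (smt (verit, best))
  qed
  have "(\<integral>\<^sup>+h. f (x + h) \<partial>leb_on (cball 0 R)) = (\<integral>\<^sup>+h. indicator (cball 0 R) h * f (x + h) \<partial>lborel)"
    by (rule nn_integral_leb_on) auto
  also have "\<dots> \<le> (\<integral>\<^sup>+h. indicator torus_box (h + vec 1) * f (h + vec 1 + (x - vec 1)) \<partial>lborel)"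
    using sub by (intro nn_integral_mono) (auto simp: indicator_def algebra_simps)
  also have "\<dots> = (\<integral>\<^sup>+h. indicator torus_box h * f (h + (x - vec 1)) \<partial>lborel)"
    by (rule nn_integral_translate) measurable
  also have "\<dots> = (\<integral>\<^sup>+h. f (h + (x - vec 1)) \<partial>torus)"
    by (rule nn_integral_leb_on[symmetric]) auto
  also have "\<dots> = (\<integral>\<^sup>+h. f h \<partial>torus)"
    by (rule nn_integral_torus_shift[OF per]) auto
  finally show ?thesis .
qed

section \<open>Polar coordinates\<close>

lemma cball_sets [measurable]: "cball (x :: 'a::metric_space) r \<in> sets borel"
  by (rule borel_closed) simp

lemma sets_sphere_measure [simp, measurable_cong]: "sets sphere_measure = sets borel"
  by (simp add: sphere_measure_def)

lemma space_sphere_measure [simp]: "space sphere_measure = UNIV"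
  by (simp add: sphere_measure_def space_scale_measure)

lemma nn_integral_sphere:
  assumes [measurable]: "f \<in> borel_measurable borel"
  shows "(\<integral>\<^sup>+n. f n \<partial>sphere_measure)
    = 3 * (\<integral>\<^sup>+x. indicator (cball 0 1 - {0}) x * f (sgn x) \<partial>lborel)"
  by (simp add: sphere_measure_def nn_integral_scale_measure nn_integral_distr
      measurable_restrict_space1 nn_integral_restrict_space mult.commute)

lemma AE_sphere_norm: "AE n in sphere_measure. norm n = 1"
proof (rule AE_I')
  have "emeasure sphere_measure {n. norm n \<noteq> 1} = (\<integral>\<^sup>+n. indicator {n. norm n \<noteq> 1} n \<partial>sphere_measure)"
    by simp
  also have "\<dots> = 0"
    by (subst nn_integral_sphere) (auto simp: nn_integral_0_iff_AE norm_sgn indicator_def)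
  finally show "{n. norm n \<noteq> 1} \<in> null_sets sphere_measure" by (intro null_setsI) auto
qed auto

interpretation sphere: finite_measure sphere_measure
proof (rule finite_measureI)
  have "emeasure sphere_measure UNIV = (\<integral>\<^sup>+n. 1 \<partial>sphere_measure)" by simp
  also have "\<dots> = 3 * emeasure lborel (cball 0 1 - {0 :: real^3})"
    by (subst nn_integral_sphere) auto
  also have "\<dots> < \<infinity>"
    using emeasure_mono[of "cball 0 1 - {0}" "cball 0 1 :: (real^3) set" lborel]
      emeasure_bounded_finite[of "cball 0 1 :: (real^3) set"]
    by (auto simp: ennreal_mult_less_top less_top[symmetric] top_unique ennreal_mult_eq_top_iff)
  finally show "emeasure sphere_measure (space sphere_measure) \<noteq> \<infinity>" by simp
qed

lemma nn_integral_scale: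
  fixes f :: "real^3 \<Rightarrow> ennreal"
  assumes [measurable]: "f \<in> borel_measurable borel" and c: "0 < c"
  shows "(\<integral>\<^sup>+x. f x \<partial>lborel) = (\<integral>\<^sup>+x. ennreal (c ^ 3) * f (c *\<^sub>R x) \<partial>lborel)"
  using c by (subst lborel_affine[of c 0])
    (simp_all add: nn_integral_density nn_integral_distr abs_of_pos)

text \<open>Substituting first \<open>r = s |x|\<close> and then \<open>y = s x\<close> turns the cone description of the surface
  measure into \<open>f y\<close> times \<open>3 |y|\<^sup>3\<close> times the integral of \<open>s\<close> to the power \<open>- 4\<close> over \<open>s \<ge> |y|\<close>.\<close>

lemma nn_integral_polar:
  fixes f :: "real^3 \<Rightarrow> ennreal"
  assumes [measurable]: "f \<in> borel_measurable borel"
  shows "(\<integral>\<^sup>+x. f x \<partial>lborel) =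
    (\<integral>\<^sup>+r. indicator {0<..} r * ennreal (r\<^sup>2) * (\<integral>\<^sup>+n. f (r *\<^sub>R n) \<partial>sphere_measure) \<partial>lborel)"
proof -
  let ?B = "indicator (cball 0 1 - {0}) :: real^3 \<Rightarrow> ennreal"
  let ?H = "indicator {0<..} :: real \<Rightarrow> ennreal"
  have "(\<integral>\<^sup>+r. ?H r * ennreal (r\<^sup>2) * (\<integral>\<^sup>+n. f (r *\<^sub>R n) \<partial>sphere_measure) \<partial>lborel)
    = (\<integral>\<^sup>+r. (\<integral>\<^sup>+x. 3 * (?H r * ennreal (r\<^sup>2) * (?B x * f (r *\<^sub>R sgn x))) \<partial>lborel) \<partial>lborel)"
  proof (rule nn_integral_cong)
    fix r :: real
    let ?c = "?H r * ennreal (r\<^sup>2)"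
    have "?c * (\<integral>\<^sup>+n. f (r *\<^sub>R n) \<partial>sphere_measure) = 3 * (?c * (\<integral>\<^sup>+x. ?B x * f (r *\<^sub>R sgn x) \<partial>lborel))"
      by (subst nn_integral_sphere) (simp_all add: mult.left_commute)
    also have "?c * (\<integral>\<^sup>+x. ?B x * f (r *\<^sub>R sgn x) \<partial>lborel) = (\<integral>\<^sup>+x. ?c * (?B x * f (r *\<^sub>R sgn x)) \<partial>lborel)"
      by (rule nn_integral_cmult[symmetric]) measurable
    also have "3 * \<dots> = (\<integral>\<^sup>+x. 3 * (?c * (?B x * f (r *\<^sub>R sgn x))) \<partial>lborel)"
      by (rule nn_integral_cmult[symmetric]) measurable
    finally show "?c * (\<integral>\<^sup>+n. f (r *\<^sub>R n) \<partial>sphere_measure) = (\<integral>\<^sup>+x. 3 * (?c * (?B x * f (r *\<^sub>R sgn x))) \<partial>lborel)" .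
  qed
  also have "\<dots> = (\<integral>\<^sup>+x. (\<integral>\<^sup>+r. 3 * (?H r * ennreal (r\<^sup>2) * (?B x * f (r *\<^sub>R sgn x))) \<partial>lborel) \<partial>lborel)"
    by (rule lborel_pair.Fubini') measurable
  also have "\<dots> = (\<integral>\<^sup>+x. (\<integral>\<^sup>+s. 3 * (?H s * ennreal (norm x ^ 3 * s\<^sup>2) * (?B x * f (s *\<^sub>R x))) \<partial>lborel) \<partial>lborel)"
  proof (rule nn_integral_cong)
    fix x :: "real^3"
    show "(\<integral>\<^sup>+r. 3 * (?H r * ennreal (r\<^sup>2) * (?B x * f (r *\<^sub>R sgn x))) \<partial>lborel)
      = (\<integral>\<^sup>+s. 3 * (?H s * ennreal (norm x ^ 3 * s\<^sup>2) * (?B x * f (s *\<^sub>R x))) \<partial>lborel)"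
    proof (cases "x = 0")
      case False
      then have *: "(norm x * s) *\<^sub>R sgn x = s *\<^sub>R x" for s
        by (simp add: sgn_div_norm)
      have "(\<integral>\<^sup>+r. 3 * (?H r * ennreal (r\<^sup>2) * (?B x * f (r *\<^sub>R sgn x))) \<partial>lborel)
        = ennreal (norm x) * (\<integral>\<^sup>+s. 3 * (?H (norm x * s) * ennreal ((norm x * s)\<^sup>2) * (?B x * f ((norm x * s) *\<^sub>R sgn x))) \<partial>lborel)"
        using False by (subst nn_integral_real_affine[where c = "norm x" and t = 0]) auto
      also have "\<dots> = (\<integral>\<^sup>+s. ennreal (norm x) * (3 * (?H (norm x * s) * ennreal ((norm x * s)\<^sup>2) * (?B x * f (s *\<^sub>R x)))) \<partial>lborel)"
        unfolding * by (rule nn_integral_cmult[symmetric]) measurable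
      also have "\<dots> = (\<integral>\<^sup>+s. 3 * (?H s * ennreal (norm x ^ 3 * s\<^sup>2) * (?B x * f (s *\<^sub>R x))) \<partial>lborel)"
      proof (rule nn_integral_cong)
        fix s
        have "ennreal (norm x ^ 3 * s\<^sup>2) = ennreal (norm x) * ennreal ((norm x * s)\<^sup>2)"
          by (simp add: ennreal_mult[symmetric] power_mult_distrib power2_eq_square power3_eq_cube)
        then show "ennreal (norm x) * (3 * (?H (norm x * s) * ennreal ((norm x * s)\<^sup>2) * (?B x * f (s *\<^sub>R x))))
          = 3 * (?H s * ennreal (norm x ^ 3 * s\<^sup>2) * (?B x * f (s *\<^sub>R x)))"
          using False by (auto simp: indicator_def zero_less_mult_iff mult_ac)
      qed
      finally show ?thesis .
    qed simp
  qed
  also have "\<dots> = (\<integral>\<^sup>+s. (\<integral>\<^sup>+x. 3 * (?H s * ennreal (norm x ^ 3 * s\<^sup>2) * (?B x * f (s *\<^sub>R x))) \<partial>lborel) \<partial>lborel)"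
    by (rule lborel_pair.Fubini') measurable
  also have "\<dots> = (\<integral>\<^sup>+s. (\<integral>\<^sup>+y. f y * (3 * ?H s * ?B (y /\<^sub>R s) * ennreal (norm y ^ 3 / s ^ 4)) \<partial>lborel) \<partial>lborel)"
  proof (rule nn_integral_cong)
    fix s :: real
    show "(\<integral>\<^sup>+x. 3 * (?H s * ennreal (norm x ^ 3 * s\<^sup>2) * (?B x * f (s *\<^sub>R x))) \<partial>lborel)
      = (\<integral>\<^sup>+y. f y * (3 * ?H s * ?B (y /\<^sub>R s) * ennreal (norm y ^ 3 / s ^ 4)) \<partial>lborel)"
    proof (cases "0 < s")
      case True
      have "(\<integral>\<^sup>+x. 3 * (?H s * ennreal (norm x ^ 3 * s\<^sup>2) * (?B x * f (s *\<^sub>R x))) \<partial>lborel)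
        = (\<integral>\<^sup>+x. ennreal ((1 / s) ^ 3) * (3 * (?H s * ennreal (norm ((1 / s) *\<^sub>R x) ^ 3 * s\<^sup>2) *
            (?B ((1 / s) *\<^sub>R x) * f (s *\<^sub>R ((1 / s) *\<^sub>R x))))) \<partial>lborel)"
        by (rule nn_integral_scale) (measurable, use True in simp)
      also have "\<dots> = (\<integral>\<^sup>+y. f y * (3 * ?H s * ?B (y /\<^sub>R s) * ennreal (norm y ^ 3 / s ^ 4)) \<partial>lborel)"
      proof (rule nn_integral_cong)
        fix x :: "real^3"
        have "ennreal (norm x ^ 3 / s ^ 4) = ennreal ((1 / s) ^ 3) * ennreal (norm ((1 / s) *\<^sub>R x) ^ 3 * s\<^sup>2)"
          using True by (subst ennreal_mult[symmetric]) (simp_all add: field_simps power_mult_distrib eval_nat_numeral)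
        then show "ennreal ((1 / s) ^ 3) * (3 * (?H s * ennreal (norm ((1 / s) *\<^sub>R x) ^ 3 * s\<^sup>2) *
            (?B ((1 / s) *\<^sub>R x) * f (s *\<^sub>R ((1 / s) *\<^sub>R x)))))
          = f x * (3 * ?H s * ?B (x /\<^sub>R s) * ennreal (norm x ^ 3 / s ^ 4))"
          using True by (simp add: mult_ac divide_inverse)
      qed
      finally show ?thesis .
    qed simp
  qed
  also have "\<dots> = (\<integral>\<^sup>+y. (\<integral>\<^sup>+s. f y * (3 * ?H s * ?B (y /\<^sub>R s) * ennreal (norm y ^ 3 / s ^ 4)) \<partial>lborel) \<partial>lborel)"
    by (rule lborel_pair.Fubini') measurable
  also have "\<dots> = (\<integral>\<^sup>+y. f y * (\<integral>\<^sup>+s. 3 * ?H s * ?B (y /\<^sub>R s) * ennreal (norm y ^ 3 / s ^ 4) \<partial>lborel) \<partial>lborel)"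
    by (intro nn_integral_cong nn_integral_cmult) measurable
  also have "\<dots> = (\<integral>\<^sup>+y. f y \<partial>lborel)"
  proof (rule nn_integral_cong_AE)
    have "AE y in lborel. y \<noteq> (0 :: real^3)" by (rule AE_lborel_singleton)
    then show "AE y in lborel. f y * (\<integral>\<^sup>+s. 3 * ?H s * ?B (y /\<^sub>R s) * ennreal (norm y ^ 3 / s ^ 4) \<partial>lborel) = f y"
    proof eventually_elim
      case (elim y)
      then have y: "0 < norm y" by simp
      have "(\<integral>\<^sup>+s. 3 * ?H s * ?B (y /\<^sub>R s) * ennreal (norm y ^ 3 / s ^ 4) \<partial>lborel)
        = (\<integral>\<^sup>+s. ennreal (3 * norm y ^ 3 / s ^ 4) * indicator {norm y ..} s \<partial>lborel)"
      proof (rule nn_integral_cong)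
        fix s :: real
        have "?H s * ?B (y /\<^sub>R s) = indicator {norm y ..} s"
          using y order.strict_trans2[OF y, of s]
          by (cases "0 < s") (auto simp: indicator_def divide_simps mult.commute split: if_splits)
        moreover have "ennreal (3 * norm y ^ 3 / s ^ 4) = 3 * ennreal (norm y ^ 3 / s ^ 4)"
          using ennreal_mult[of 3 "norm y ^ 3 / s ^ 4"] by simp
        ultimately show "3 * ?H s * ?B (y /\<^sub>R s) * ennreal (norm y ^ 3 / s ^ 4)
          = ennreal (3 * norm y ^ 3 / s ^ 4) * indicator {norm y ..} s"
          by (simp add: mult_ac)
      qed
      also have "\<dots> = ennreal (0 - (- (norm y ^ 3 / norm y ^ 3)))"
      proof (rule nn_integral_FTC_atLeast[where F = "\<lambda>s. - (norm y ^ 3 / s ^ 3)"])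
        fix s assume "norm y \<le> s"
        from y this have "0 < s" by (rule order.strict_trans2)
        then show "((\<lambda>s. - (norm y ^ 3 / s ^ 3)) has_real_derivative 3 * norm y ^ 3 / s ^ 4) (at s)"
          by (auto intro!: derivative_eq_intros simp: field_simps eval_nat_numeral)
      next
        have "((\<lambda>s. norm y ^ 3 / s ^ 3) \<longlongrightarrow> 0) at_top"
          by (intro tendsto_divide_0[OF tendsto_const] filterlim_at_top_imp_at_infinity
              filterlim_pow_at_top filterlim_ident) simp
        from tendsto_minus[OF this] show "((\<lambda>s. - (norm y ^ 3 / s ^ 3)) \<longlongrightarrow> 0) at_top" by simp
      qed (auto simp: zero_le_even_power)
      also have "\<dots> = 1" using y by simp
      finally show ?case by simp
    qed
  qed
  finally show ?thesis by simp
qed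

definition radial_measure :: "real measure" where
  "radial_measure = density lborel (\<lambda>r. ennreal (indicator {0<..} r * r\<^sup>2))"

lemma sets_radial_measure [simp, measurable_cong]: "sets radial_measure = sets borel"
  by (simp add: radial_measure_def)

text \<open>Polar coordinates as an identity of measures, from which the version for signed
  integrands follows by Fubini.\<close>

lemma distr_polar: "distr (radial_measure \<Otimes>\<^sub>M sphere_measure) borel (\<lambda>(r, n). r *\<^sub>R n) = lborel"
proof (rule measure_eqI)
  fix A :: "(real^3) set" assume "A \<in> sets (distr (radial_measure \<Otimes>\<^sub>M sphere_measure) borel (\<lambda>(r, n). r *\<^sub>R n))"
  then have [measurable]: "A \<in> sets borel" by simp
  have "emeasure (distr (radial_measure \<Otimes>\<^sub>M sphere_measure) borel (\<lambda>(r, n). r *\<^sub>R n)) A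
    = (\<integral>\<^sup>+x. indicator A x \<partial>distr (radial_measure \<Otimes>\<^sub>M sphere_measure) borel (\<lambda>(r, n). r *\<^sub>R n))"
    by (subst nn_integral_indicator) auto
  also have "\<dots> = (\<integral>\<^sup>+p. indicator A (fst p *\<^sub>R snd p) \<partial>(radial_measure \<Otimes>\<^sub>M sphere_measure))"
    by (subst nn_integral_distr) (auto simp: case_prod_beta)
  also have "\<dots> = (\<integral>\<^sup>+r. (\<integral>\<^sup>+n. indicator A (r *\<^sub>R n) \<partial>sphere_measure) \<partial>radial_measure)"
    by (subst sphere.nn_integral_fst[symmetric]) auto
  also have "\<dots> = (\<integral>\<^sup>+x. indicator A x \<partial>lborel)"
    by (subst nn_integral_polar) (auto simp: radial_measure_def nn_integral_density ennreal_mult ennreal_indicator)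
  finally show "emeasure (distr (radial_measure \<Otimes>\<^sub>M sphere_measure) borel (\<lambda>(r, n). r *\<^sub>R n)) A = emeasure lborel A"
    by simp
qed simp

lemma integral_polar:
  fixes f :: "real^3 \<Rightarrow> real"
  assumes f: "integrable lborel f"
  shows "(LINT x|lborel. f x) =
    (LINT r|lborel. indicator {0<..} r * r\<^sup>2 * (LINT n|sphere_measure. f (r *\<^sub>R n)))"
    and "integrable lborel (\<lambda>r. indicator {0<..} r * r\<^sup>2 * (LINT n|sphere_measure. f (r *\<^sub>R n)))"
proof -
  have [measurable]: "f \<in> borel_measurable borel" using f by auto
  interpret radial: sigma_finite_measure radial_measure
    unfolding radial_measure_def
    by (subst sigma_finite_measure.sigma_finite_iff_density_finite[OF sigma_finite_lborel]) auto
  interpret pair_sigma_finite radial_measure sphere_measure ..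
  have i: "integrable (radial_measure \<Otimes>\<^sub>M sphere_measure) (\<lambda>(r, n). f (r *\<^sub>R n))"
    using f integrable_distr_eq[of "\<lambda>(r, n). r *\<^sub>R n" "radial_measure \<Otimes>\<^sub>M sphere_measure" borel f]
    by (simp add: distr_polar[unfolded case_prod_beta'] case_prod_beta')
  have "(LINT x|lborel. f x) = (LINT p|(radial_measure \<Otimes>\<^sub>M sphere_measure). (case p of (r, n) \<Rightarrow> f (r *\<^sub>R n)))"
    using integral_distr[of "\<lambda>(r, n). r *\<^sub>R n" "radial_measure \<Otimes>\<^sub>M sphere_measure" borel f]
    by (simp add: distr_polar[unfolded case_prod_beta'] case_prod_beta')
  also have "\<dots> = (LINT r|radial_measure. (LINT n|sphere_measure. f (r *\<^sub>R n)))"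
    using integral_fst'[OF i] by simp
  also have "\<dots> = (LINT r|lborel. indicator {0<..} r * r\<^sup>2 * (LINT n|sphere_measure. f (r *\<^sub>R n)))"
    unfolding radial_measure_def by (subst integral_density) (auto simp: indicator_def)
  finally show "(LINT x|lborel. f x) =
    (LINT r|lborel. indicator {0<..} r * r\<^sup>2 * (LINT n|sphere_measure. f (r *\<^sub>R n)))" .
  have "integrable radial_measure (\<lambda>r. LINT n|sphere_measure. f (r *\<^sub>R n))"
    using integrable_fst'[OF i] by simp
  then show "integrable lborel (\<lambda>r. indicator {0<..} r * r\<^sup>2 * (LINT n|sphere_measure. f (r *\<^sub>R n)))"
    unfolding radial_measure_def by (subst (asm) integrable_density) (auto simp: indicator_def)
qed

section \<open>Ball integrals as functions of the radius\<close>

lemma continuous_borel_measurable [measurable_dest]: "continuous_on UNIV f \<Longrightarrow> f \<in> borel_measurable borel"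
  by (rule borel_measurable_continuous_onI)

lemma continuous_bounded_ball:
  fixes f :: "'a::euclidean_space \<Rightarrow> 'b::real_normed_vector"
  assumes "continuous_on UNIV f"
  obtains C where "0 < C" "\<And>x. norm x \<le> K \<Longrightarrow> norm (f x) \<le> C"
proof -
  have "compact (f ` cball 0 K)"
    using assms continuous_on_subset by (intro compact_continuous_image) auto
  then obtain C where "0 < C" "\<forall>y\<in>f ` cball 0 K. norm y \<le> C"
    using compact_imp_bounded bounded_pos by blast
  then show ?thesis using that[of C] by auto
qed

lemma integrable_leb_on_continuous:
  fixes f :: "'a::euclidean_space \<Rightarrow> 'b::euclidean_space"
  assumes "compact A" "continuous_on UNIV f"
  shows "integrable (leb_on A) f"
proof -
  have [measurable]: "f \<in> borel_measurable borel" using assms(2) by (rule continuous_borel_measurable)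
  have "A \<in> sets borel" using assms(1) by (simp add: borel_closed compact_imp_closed)
  then show ?thesis
    using assms borel_integrable_compact[of A f] continuous_on_subset[OF assms(2)]
    by (subst integral_leb_on(2)) (auto simp: set_integrable_def)
qed

text \<open>Prepares the fundamental theorem of calculus in the radius. For a convergent sequence of
  radii the integrands are uniformly bounded on the unit sphere.\<close>

lemma continuous_sphere_average:
  fixes f :: "real^3 \<Rightarrow> real"
  assumes f: "continuous_on UNIV f"
  shows "continuous_on UNIV (\<lambda>r. LINT n|sphere_measure. f (r *\<^sub>R n))"
  unfolding continuous_on_eq_continuous_within continuous_within_sequentially
proof (intro ballI allI impI, unfold comp_def, elim conjE)
  fix r :: real and s :: "nat \<Rightarrow> real" assume s: "s \<longlonglongrightarrow> r"
  note [measurable] = continuous_borel_measurable[OF f]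
  obtain K where K: "\<And>n. \<bar>s n\<bar> \<le> K"
    using convergent_imp_Bseq[OF convergentI[OF s]] by (auto simp: Bseq_def)
  obtain C where C: "\<And>x. norm x \<le> K \<Longrightarrow> norm (f x) \<le> C"
    using continuous_bounded_ball[OF f, of K] by auto
  show "(\<lambda>i. LINT n|sphere_measure. f (s i *\<^sub>R n)) \<longlonglongrightarrow> (LINT n|sphere_measure. f (r *\<^sub>R n))"
  proof (rule integral_dominated_convergence[where w = "\<lambda>_. C"])
    show "AE n in sphere_measure. (\<lambda>i. f (s i *\<^sub>R n)) \<longlonglongrightarrow> f (r *\<^sub>R n)"
      using f s by (auto intro!: AE_I2 isCont_tendsto_compose[of _ f] tendsto_intros simp: continuous_on_eq_continuous_at)
    show "AE n in sphere_measure. norm (f (s i *\<^sub>R n)) \<le> C" for i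
      using AE_sphere_norm by eventually_elim (use C K in \<open>simp add: abs_le_iff\<close>)
  qed auto
qed

lemma ball_integral_eq:
  fixes f :: "real^3 \<Rightarrow> real"
  assumes f: "continuous_on UNIV f" and R: "0 \<le> R"
  shows "(LINT h|leb_on (cball 0 R). f h) = integral {0..R} (\<lambda>r. r\<^sup>2 * (LINT n|sphere_measure. f (r *\<^sub>R n)))"
proof -
  note [measurable] = continuous_borel_measurable[OF f]
  let ?F = "\<lambda>r. LINT n|sphere_measure. f (r *\<^sub>R n)"
  have i: "integrable lborel (\<lambda>h. indicator (cball 0 R) h *\<^sub>R f h)"
    using f continuous_on_subset by (intro borel_integrable_compact) auto
  have "(LINT h|leb_on (cball 0 R). f h) = (LINT h|lborel. indicator (cball 0 R) h *\<^sub>R f h)"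
    by (subst integral_leb_on) (auto simp: set_lebesgue_integral_def)
  also have "\<dots> = (LINT r|lborel. indicator {0<..} r * r\<^sup>2 *
      (LINT n|sphere_measure. indicator (cball 0 R) (r *\<^sub>R n) *\<^sub>R f (r *\<^sub>R n)))"
    by (rule integral_polar(1)[OF i])
  also have "\<dots> = (LINT r|lborel. indicator {0..R} r *\<^sub>R (r\<^sup>2 * ?F r))"
  proof (rule Bochner_Integration.integral_cong, rule refl)
    fix r :: real
    have "(LINT n|sphere_measure. indicator (cball 0 R) (r *\<^sub>R n) *\<^sub>R f (r *\<^sub>R n))
      = (LINT n|sphere_measure. indicator {..R} r * f (r *\<^sub>R n))" if "0 < r"
    proof (rule integral_cong_AE)
      show "AE n in sphere_measure. indicator (cball 0 R) (r *\<^sub>R n) *\<^sub>R f (r *\<^sub>R n) = indicator {..R} r * f (r *\<^sub>R n)"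
        using AE_sphere_norm by eventually_elim (use that in \<open>auto simp: indicator_def\<close>)
    qed measurable
    then show "indicator {0<..} r * r\<^sup>2 *
        (LINT n|sphere_measure. indicator (cball 0 R) (r *\<^sub>R n) *\<^sub>R f (r *\<^sub>R n))
      = indicator {0..R} r *\<^sub>R (r\<^sup>2 * ?F r)"
      by (cases "0 < r"; cases "r = 0") (auto simp: indicator_def)
  qed
  also have "\<dots> = integral {0..R} (\<lambda>r. r\<^sup>2 * ?F r)"
    unfolding set_lebesgue_integral_def[symmetric]
  proof (rule set_borel_integral_eq_integral)
    show "set_integrable lborel {0..R} (\<lambda>r. r\<^sup>2 * ?F r)"
      unfolding set_integrable_def
      by (rule borel_integrable_compact)
        (auto intro!: continuous_intros continuous_on_subset[OF continuous_sphere_average[OF f]])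
  qed
  finally show ?thesis .
qed

text \<open>The bridge from balls to spheres: identities between ball integrals that hold for all
  radii are differentiated with it to reach the spherical averages in \<open>S_0\<close> and
  \<open>S_par\<close>.\<close>

lemma ball_integral_deriv:
  fixes f :: "real^3 \<Rightarrow> real"
  assumes f: "continuous_on UNIV f" and R: "0 < R"
  shows "((\<lambda>R. LINT h|leb_on (cball 0 R). f h) has_real_derivative
    R\<^sup>2 * (LINT n|sphere_measure. f (R *\<^sub>R n))) (at R)"
proof -
  let ?g = "\<lambda>r. r\<^sup>2 * (LINT n|sphere_measure. f (r *\<^sub>R n))"
  have "((\<lambda>x. integral {0..x} ?g) has_real_derivative ?g R) (at R within {0..R + 1})"
    using R by (intro integral_has_real_derivative)
      (auto intro!: continuous_intros continuous_on_subset[OF continuous_sphere_average[OF f]])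
  then have "((\<lambda>x. integral {0..x} ?g) has_real_derivative ?g R) (at R)"
    using R by (subst (asm) at_within_interior[of R "{0..R + 1}"]) auto
  then show ?thesis
  proof (rule has_field_derivative_transform_within_open)
    show "open {0 :: real<..}" by (rule open_greaterThan)
    show "R \<in> {0<..}" using R by simp
  qed (auto simp: ball_integral_eq[OF f])
qed

text \<open>The weight vanishes on the sphere, so the two boundary contributions cancel and only the
  derivative of \<open>R\<^sup>2\<close> under the integral remains.\<close>

lemma ball_moment_deriv:
  fixes f :: "real^3 \<Rightarrow> real"
  assumes f: "continuous_on UNIV f" and R: "0 < R"
  shows "((\<lambda>R. LINT h|leb_on (cball 0 R). (R\<^sup>2 - (norm h)\<^sup>2) * f h) has_real_derivative
    2 * R * (LINT h|leb_on (cball 0 R). f h)) (at R)"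
proof -
  have f2: "continuous_on UNIV (\<lambda>h. (norm h)\<^sup>2 * f h)" by (intro continuous_intros f)
  have eq: "(LINT h|leb_on (cball 0 R). (R\<^sup>2 - (norm h)\<^sup>2) * f h) =
    R\<^sup>2 * (LINT h|leb_on (cball 0 R). f h) - (LINT h|leb_on (cball 0 R). (norm h)\<^sup>2 * f h)" for R
    using integrable_leb_on_continuous[OF compact_cball f, of 0 R]
      integrable_leb_on_continuous[OF compact_cball f2, of 0 R]
    by (simp add: left_diff_distrib)
  have "(LINT n|sphere_measure. (norm (R *\<^sub>R n))\<^sup>2 * f (R *\<^sub>R n)) = (LINT n|sphere_measure. R\<^sup>2 * f (R *\<^sub>R n))"
    by (rule integral_cong_AE, (use continuous_borel_measurable[OF f] in measurable)[2],
        use AE_sphere_norm in eventually_elim) (simp add: power_mult_distrib)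
  then have s: "(LINT n|sphere_measure. (norm (R *\<^sub>R n))\<^sup>2 * f (R *\<^sub>R n)) = R\<^sup>2 * (LINT n|sphere_measure. f (R *\<^sub>R n))"
    by simp
  show ?thesis
    unfolding eq
    by (rule derivative_eq_intros ball_integral_deriv[OF f R] ball_integral_deriv[OF f2 R] refl)+
      (simp only: s, simp add: algebra_simps)
qed


section \<open>Integration by parts on balls\<close>

lemma directional_quotient_tendsto:
  fixes f :: "'a::real_normed_vector \<Rightarrow> real"
  assumes "(f has_derivative f') (at x)" and t: "t \<longlonglongrightarrow> 0" "\<And>n. t n \<noteq> 0"
  shows "(\<lambda>n. (f (x + t n *\<^sub>R v) - f x) / t n) \<longlonglongrightarrow> f' v"
proof -
  interpret f': bounded_linear f' using assms(1) by (rule has_derivative_bounded_linear)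
  have "((\<lambda>s. f (x + s *\<^sub>R v)) has_derivative (\<lambda>s. f' (s *\<^sub>R v))) (at 0)"
    by (rule has_derivative_compose[where f = "\<lambda>s. x + s *\<^sub>R v", unfolded o_def])
      (auto intro!: derivative_eq_intros assms(1))
  then have "((\<lambda>s. f (x + s *\<^sub>R v)) has_real_derivative f' v) (at 0)"
    by (simp add: has_field_derivative_def f'.scaleR mult_commute_abs)
  then have "(\<lambda>h. (f (x + h *\<^sub>R v) - f x) / h) \<midarrow>0\<rightarrow> f' v"
    by (simp add: DERIV_def)
  moreover have "filterlim t (at 0) sequentially"
    using t by (auto simp: filterlim_at)
  ultimately show ?thesis by (rule filterlim_compose)
qed

lemma difference_le_derivative_bound:
  fixes g :: "'a::real_normed_vector \<Rightarrow> real"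
  assumes "\<And>x. (g has_derivative g' x) (at x)" and "\<And>s. 0 \<le> s \<Longrightarrow> s \<le> t \<Longrightarrow> \<bar>g' (h + s *\<^sub>R v) v\<bar> \<le> C"
    and t: "0 \<le> t"
  shows "\<bar>g (h + t *\<^sub>R v) - g h\<bar> \<le> C * t"
proof (cases "t = 0")
  case False
  with t have t: "0 < t" by simp
  have d: "((\<lambda>s. g (h + s *\<^sub>R v)) has_real_derivative g' (h + s *\<^sub>R v) v) (at s)" for s
  proof -
    interpret b: bounded_linear "g' (h + s *\<^sub>R v)" using assms(1) by (rule has_derivative_bounded_linear)
    have "((\<lambda>s. g (h + s *\<^sub>R v)) has_derivative (\<lambda>r. g' (h + s *\<^sub>R v) (r *\<^sub>R v))) (at s)"
      by (rule has_derivative_compose[where f = "\<lambda>s. h + s *\<^sub>R v", unfolded o_def])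
        (auto intro!: derivative_eq_intros assms(1))
    then show ?thesis by (simp add: has_field_derivative_def b.scaleR mult_commute_abs)
  qed
  obtain z where "0 < z" "z < t" and z: "g (h + t *\<^sub>R v) - g (h + 0 *\<^sub>R v) = (t - 0) * g' (h + z *\<^sub>R v) v"
    using MVT2[OF t, of "\<lambda>s. g (h + s *\<^sub>R v)" "\<lambda>s. g' (h + s *\<^sub>R v) v"] d by auto
  then show ?thesis using assms(2)[of z] t by (simp add: abs_mult)
qed simp

text \<open>The gradient of the weight is \<open>- 2 h\<close>, and there is no boundary term
  because the weight vanishes on the sphere. Extended by zero, the weight is Lipschitz on bounded
  sets. Difference quotients of its product with \<open>g\<close> integrate to zero over the whole
  space by translation invariance, and dominated convergence sends the step to zero.\<close>

lemma ball_integral_by_parts_scalar: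
  fixes g :: "real^3 \<Rightarrow> real"
  assumes g: "\<And>x. (g has_derivative g' x) (at x)" and g': "continuous_on UNIV (\<lambda>x. g' x v)"
    and R: "0 \<le> R"
  shows "(LINT h|leb_on (cball 0 R). (R\<^sup>2 - (norm h)\<^sup>2) * g' h v) = 2 * (LINT h|leb_on (cball 0 R). (h \<bullet> v) * g h)"
proof -
  have gc: "continuous_on UNIV g"
    using g by (meson has_derivative_continuous continuous_at_imp_continuous_on)
  note [measurable] = continuous_borel_measurable[OF gc] continuous_borel_measurable[OF g']
  define w where "w h = max 0 (R\<^sup>2 - (norm h)\<^sup>2)" for h :: "real^3"
  define F where "F h = w h * g h" for h
  define F' where "F' h = indicator (cball 0 R) h * (- 2 * (h \<bullet> v) * g h + (R\<^sup>2 - (norm h)\<^sup>2) * g' h v)" for h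
  have [measurable]: "F \<in> borel_measurable borel" "F' \<in> borel_measurable borel"
    unfolding F_def w_def F'_def by measurable
  define t where "t n = 1 / real (Suc n)" for n
  have t: "0 < t n" "t n \<le> 1" for n by (auto simp: t_def)
  have t0: "t \<longlonglongrightarrow> 0" unfolding t_def using LIMSEQ_inverse_real_of_nat by (simp add: inverse_eq_divide)
  have F0: "F h = 0" if "R \<le> norm h" for h
    using that R by (simp add: F_def w_def power_mono)
  \<comment> \<open>For steps at most one the quotient vanishes unless
    \<open>norm h \<le> R + norm v\<close>, and then the whole segment stays within distance
    \<open>K\<close> of the origin.\<close>
  define K where "K = R + 2 * norm v"
  obtain C1 where C1: "0 < C1" "\<And>x. norm x \<le> K \<Longrightarrow> \<bar>g x\<bar> \<le> C1"
    using continuous_bounded_ball[OF gc, of K] by auto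
  obtain C2 where C2: "0 < C2" "\<And>x. norm x \<le> K \<Longrightarrow> \<bar>g' x v\<bar> \<le> C2"
    using continuous_bounded_ball[OF g', of K] by auto
  define L where "L = 2 * K * norm v * C1 + R\<^sup>2 * C2"
  have K0: "0 \<le> K" "R \<le> K" using R by (auto simp: K_def)
  have lip: "\<bar>F (h + s *\<^sub>R v) - F h\<bar> \<le> L * s * indicator (cball 0 K) h" if s: "0 < s" "s \<le> 1" for h s
  proof (cases "norm h \<le> R + norm v")
    case True
    have in_K: "norm (h + r *\<^sub>R v) \<le> K" if "0 \<le> r" "r \<le> s" for r
    proof -
      have "norm (h + r *\<^sub>R v) \<le> norm h + r * norm v" using that norm_triangle_ineq[of h "r *\<^sub>R v"] by simp
      also have "\<dots> \<le> K" using True that s mult_right_mono[of r 1 "norm v"] by (simp add: K_def)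
      finally show ?thesis .
    qed
    have hK: "norm h \<le> K" and hsK: "norm (h + s *\<^sub>R v) \<le> K" using in_K[of 0] in_K[of s] s by auto
    have dn: "\<bar>norm h - norm (h + s *\<^sub>R v)\<bar> \<le> s * norm v"
      using norm_triangle_ineq3[of h "h + s *\<^sub>R v"] s by simp
    have dw: "\<bar>w (h + s *\<^sub>R v) - w h\<bar> \<le> 2 * K * (s * norm v)"
    proof -
      have "\<bar>w (h + s *\<^sub>R v) - w h\<bar> \<le> \<bar>(norm h)\<^sup>2 - (norm (h + s *\<^sub>R v))\<^sup>2\<bar>"
        unfolding w_def by auto
      also have "\<dots> = (norm h + norm (h + s *\<^sub>R v)) * \<bar>norm h - norm (h + s *\<^sub>R v)\<bar>"
        by (simp add: power2_eq_square square_diff_square_factored abs_mult)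
      also have "\<dots> \<le> (2 * K) * (s * norm v)"
        using hK hsK dn K0 by (intro mult_mono) auto
      finally show ?thesis .
    qed
    have dg: "\<bar>g (h + s *\<^sub>R v) - g h\<bar> \<le> C2 * s"
      by (rule difference_le_derivative_bound[OF g]) (use C2(2) in_K s in auto)
    have wR: "0 \<le> w h" "w h \<le> R\<^sup>2" by (auto simp: w_def)
    have "F (h + s *\<^sub>R v) - F h = (w (h + s *\<^sub>R v) - w h) * g (h + s *\<^sub>R v) + w h * (g (h + s *\<^sub>R v) - g h)"
      by (simp add: F_def algebra_simps)
    also have "\<bar>\<dots>\<bar> \<le> \<bar>w (h + s *\<^sub>R v) - w h\<bar> * \<bar>g (h + s *\<^sub>R v)\<bar> + w h * \<bar>g (h + s *\<^sub>R v) - g h\<bar>"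
      using wR by (intro order_trans[OF abs_triangle_ineq]) (simp add: abs_mult)
    also have "\<dots> \<le> 2 * K * (s * norm v) * C1 + R\<^sup>2 * (C2 * s)"
      using dw dg wR C1(2)[OF hsK] K0 s C1(1) by (intro add_mono mult_mono) auto
    also have "\<dots> = L * s * indicator (cball 0 K) h"
      using hK by (simp add: L_def algebra_simps)
    finally show ?thesis .
  next
    case False
    have "norm h \<le> norm (h + s *\<^sub>R v) + s * norm v"
      using norm_triangle_ineq4[of "h + s *\<^sub>R v" "s *\<^sub>R v"] s by simp
    moreover have "s * norm v \<le> norm v" using s mult_right_mono[of s 1 "norm v"] by simp
    ultimately have "R \<le> norm (h + s *\<^sub>R v)" using False by simp
    moreover have "R \<le> norm h" using False norm_ge_zero[of v] by linarith
    ultimately show ?thesis using K0 s C1 C2 by (simp add: F0 L_def)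
  qed
  have Fint: "integrable lborel F"
  proof -
    have "continuous_on (cball 0 R) (\<lambda>h. w h * g h)"
      unfolding w_def using gc by (intro continuous_intros) (auto intro: continuous_on_subset)
    from borel_integrable_compact[OF compact_cball this]
    have "integrable lborel (\<lambda>h. indicator (cball 0 R) h *\<^sub>R F h)" by (simp add: F_def)
    also have "(\<lambda>h. indicator (cball 0 R) h *\<^sub>R F h) = F"
      using F0 by (force simp: indicator_def)
    finally show ?thesis .
  qed
  have trans: "integrable lborel (\<lambda>h. F (h + c)) \<and> (LINT h|lborel. F (h + c)) = (LINT h|lborel. F h)" for c
    using integrable_distr_eq[of "(+) c" lborel borel F] integral_distr[of "(+) c" lborel borel F] Fint
    by (simp add: lborel_distr_plus add.commute)
  have zero: "(LINT h|lborel. (F (h + t n *\<^sub>R v) - F h) / t n) = 0" for n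
    using trans[of "t n *\<^sub>R v"] Fint by simp
  have "(\<lambda>n. LINT h|lborel. (F (h + t n *\<^sub>R v) - F h) / t n) \<longlonglongrightarrow> (LINT h|lborel. F' h)"
  proof (rule integral_dominated_convergence[where w = "\<lambda>h. L * indicator (cball 0 K) h"])
    show "integrable lborel (\<lambda>h :: real^3. L * indicator (cball 0 K) h)"
      using emeasure_bounded_finite[of "cball 0 K :: (real^3) set"]
      by (intro integrable_mult_right integrable_real_indicator) (auto simp: less_top[symmetric])
    show "AE h in lborel. norm ((F (h + t n *\<^sub>R v) - F h) / t n) \<le> L * indicator (cball 0 K) h" for n
      using lip[OF t] t[of n] by (intro AE_I2) (simp add: abs_divide divide_le_eq mult_ac abs_of_pos)
    \<comment> \<open>The extended product need not be differentiable on the sphere, but this is a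
      null set.\<close>
    have "sphere 0 R \<in> null_sets (lborel :: (real^3) measure)"
      using negligible_sphere[of 0 R] by (simp add: negligible_iff_null_sets null_sets_completion_iff)
    from AE_not_in[OF this]
    show "AE h in lborel. (\<lambda>n. (F (h + t n *\<^sub>R v) - F h) / t n) \<longlonglongrightarrow> F' h"
    proof eventually_elim
      case (elim h)
      then consider "norm h < R" | "R < norm h" by force
      then show ?case
      proof cases
        case 1
        have "((\<lambda>h. (R\<^sup>2 - h \<bullet> h) * g h) has_derivative
            (\<lambda>v. (R\<^sup>2 - h \<bullet> h) * g' h v + - (h \<bullet> v + v \<bullet> h) * g h)) (at h)"
          by (auto intro!: derivative_eq_intros g)
        then have "(F has_derivative (\<lambda>v. (R\<^sup>2 - h \<bullet> h) * g' h v + - (h \<bullet> v + v \<bullet> h) * g h)) (at h)"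
        proof (rule has_derivative_transform_within_open)
          show "open (ball 0 R :: (real^3) set)" "h \<in> ball 0 R" using 1 by auto
          show "(R\<^sup>2 - x \<bullet> x) * g x = F x" if "x \<in> ball 0 R" for x
            using that by (simp add: F_def w_def power2_norm_eq_inner[symmetric] max_def power_mono)
        qed
        from directional_quotient_tendsto[OF this t0, of v] t(1)
        have "(\<lambda>n. (F (h + t n *\<^sub>R v) - F h) / t n) \<longlonglongrightarrow>
          (R\<^sup>2 - h \<bullet> h) * g' h v + - (h \<bullet> v + v \<bullet> h) * g h" by (metis less_irrefl)
        moreover have "F' h = (R\<^sup>2 - h \<bullet> h) * g' h v + - (h \<bullet> v + v \<bullet> h) * g h"
          using 1 by (simp add: F'_def power2_norm_eq_inner inner_commute algebra_simps)
        ultimately show ?thesis by simp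
      next
        case 2
        have "((\<lambda>h. 0) has_derivative (\<lambda>v. 0)) (at h)" by simp
        then have "(F has_derivative (\<lambda>v. 0)) (at h)"
        proof (rule has_derivative_transform_within_open)
          show "open (- cball 0 R :: (real^3) set)" "h \<in> - cball 0 R" using 2 by auto
        qed (auto simp: F0)
        from directional_quotient_tendsto[OF this t0, of v] t(1)
        have "(\<lambda>n. (F (h + t n *\<^sub>R v) - F h) / t n) \<longlonglongrightarrow> 0" by (metis less_irrefl)
        then show ?thesis using 2 by (simp add: F'_def)
      qed
    qed
  qed measurable
  then have "(LINT h|lborel. F' h) = 0"
    unfolding zero by (simp add: LIMSEQ_const_iff)
  then have "(LINT h|leb_on (cball 0 R). - 2 * (h \<bullet> v) * g h + (R\<^sup>2 - (norm h)\<^sup>2) * g' h v) = 0"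
    by (subst integral_leb_on) (auto simp: set_lebesgue_integral_def F'_def)
  moreover have "integrable (leb_on (cball 0 R)) (\<lambda>h. (h \<bullet> v) * g h)"
    by (intro integrable_leb_on_continuous continuous_intros gc compact_cball)
  moreover have "integrable (leb_on (cball 0 R)) (\<lambda>h. (R\<^sup>2 - (norm h)\<^sup>2) * g' h v)"
    by (intro integrable_leb_on_continuous continuous_intros g' compact_cball)
  ultimately show ?thesis by (simp add: mult.assoc)
qed

text \<open>The scalar identity summed over the components: a divergence theorem for weighted
  fields.\<close>

lemma ball_integral_by_parts:
  fixes X :: "real^3 \<Rightarrow> real^3"
  assumes X: "\<And>x. (X has_derivative X' x) (at x)" and X': "\<And>v. continuous_on UNIV (\<lambda>x. X' x v)"
    and R: "0 \<le> R"
  shows "(LINT h|leb_on (cball 0 R). (R\<^sup>2 - (norm h)\<^sup>2) * (\<Sum>i\<in>UNIV. X' h (axis i 1) $ i))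
    = 2 * (LINT h|leb_on (cball 0 R). h \<bullet> X h)"
proof -
  have Xc: "continuous_on UNIV X"
    using X by (meson has_derivative_continuous continuous_at_imp_continuous_on)
  have c: "continuous_on UNIV (\<lambda>h. (h \<bullet> axis i 1) * X h $ i)"
    "continuous_on UNIV (\<lambda>h. (R\<^sup>2 - (norm h)\<^sup>2) * X' h (axis i 1) $ i)" for i
    by (intro continuous_intros Xc X')+
  note int = integrable_leb_on_continuous[OF compact_cball c(1), of 0 R]
    integrable_leb_on_continuous[OF compact_cball c(2), of 0 R]
  have *: "(LINT h|leb_on (cball 0 R). (R\<^sup>2 - (norm h)\<^sup>2) * X' h (axis i 1) $ i)
    = 2 * (LINT h|leb_on (cball 0 R). (h \<bullet> axis i 1) * X h $ i)" for i
  proof -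
    have "((\<lambda>x. X x $ i) has_derivative (\<lambda>v. X' x v $ i)) (at x)" for x
      using bounded_linear.has_derivative[OF bounded_linear_vec_nth X] .
    from ball_integral_by_parts_scalar[OF this _ R, of "axis i 1"] X'
    show ?thesis by (simp add: continuous_on_component)
  qed
  have "(LINT h|leb_on (cball 0 R). (R\<^sup>2 - (norm h)\<^sup>2) * (\<Sum>i\<in>UNIV. X' h (axis i 1) $ i))
    = (\<Sum>i\<in>UNIV. LINT h|leb_on (cball 0 R). (R\<^sup>2 - (norm h)\<^sup>2) * X' h (axis i 1) $ i)"
    by (subst Bochner_Integration.integral_sum[symmetric]) (auto intro: int simp: sum_distrib_left)
  also have "\<dots> = 2 * (\<Sum>i\<in>UNIV. LINT h|leb_on (cball 0 R). (h \<bullet> axis i 1) * X h $ i)"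
    by (simp add: * sum_distrib_left)
  also have "(\<Sum>i\<in>UNIV. LINT h|leb_on (cball 0 R). (h \<bullet> axis i 1) * X h $ i)
    = (LINT h|leb_on (cball 0 R). (\<Sum>i\<in>UNIV. (h \<bullet> axis i 1) * X h $ i))"
    using int by (subst Bochner_Integration.integral_sum) auto
  also have "\<dots> = (LINT h|leb_on (cball 0 R). h \<bullet> X h)"
    by (simp add: inner_axis) (simp add: inner_vec_def)
  finally show ?thesis .
qed

section \<open>Structure functions of smooth fields\<close>

lemma pair_leb_on:
  fixes A :: "'a::euclidean_space set" and B :: "'b::euclidean_space set"
  assumes [measurable]: "A \<in> sets borel" "B \<in> sets borel"
    and fin: "finite_measure (leb_on B)"
  shows "leb_on A \<Otimes>\<^sub>M leb_on B = leb_on (A \<times> B)"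
proof -
  have "leb_on A \<Otimes>\<^sub>M leb_on B = density (lborel \<Otimes>\<^sub>M lborel) (\<lambda>(x, y). indicator A x * indicator B y)"
    unfolding leb_on_def
    by (rule pair_measure_density) (use fin in \<open>auto simp: leb_on_def finite_measure_def intro: sigma_finite_lborel\<close>)
  also have "(\<lambda>(x, y). indicator A x * indicator B y :: ennreal) = indicator (A \<times> B)"
    by (auto simp: indicator_def fun_eq_iff)
  finally show ?thesis by (simp add: lborel_prod leb_on_def)
qed

lemma continuous_on_compose_pair:
  assumes "continuous_on UNIV (\<lambda>p. f (fst p) (snd p))" "continuous_on S a" "continuous_on S b"
  shows "continuous_on S (\<lambda>x. f (a x) (b x))"
  using continuous_on_compose2[OF assms(1) continuous_on_Pair[OF assms(2,3)]] by simp

text \<open>The ball is integrated first, because most cancellations below already hold at fixed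
  \<open>x\<close>.\<close>

definition double_int :: "real \<Rightarrow> (real^3 \<Rightarrow> real^3 \<Rightarrow> real) \<Rightarrow> real" where
  "double_int R f = (LINT x|torus. LINT h|leb_on (cball 0 R). f x h)"

lemma integrable_double:
  fixes f :: "real^3 \<Rightarrow> real^3 \<Rightarrow> real"
  assumes f: "continuous_on UNIV (\<lambda>p. f (fst p) (snd p))"
  shows "integrable (torus \<Otimes>\<^sub>M leb_on (cball 0 R)) (\<lambda>(x, h). f x h)"
proof -
  have "compact (torus_box \<times> cball 0 R :: ((real^3) \<times> (real^3)) set)"
    by (intro compact_Times) (auto simp: torus_box_def compact_cbox)
  moreover have "torus \<Otimes>\<^sub>M leb_on (cball 0 R :: (real^3) set) = leb_on (torus_box \<times> cball 0 R)"
    by (rule pair_leb_on) (auto intro: ball.finite_measure_axioms)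
  ultimately show ?thesis
    using integrable_leb_on_continuous[OF _ f] by (simp add: case_prod_beta')
qed

lemma continuous_section:
  assumes "continuous_on UNIV (\<lambda>p. f (fst p) (snd p))"
  shows "continuous_on UNIV (\<lambda>h. f x h)" "continuous_on UNIV (\<lambda>x. f x h)"
  by (rule continuous_on_compose_pair[OF assms]; intro continuous_intros)+

lemma
  fixes f :: "real^3 \<Rightarrow> real^3 \<Rightarrow> real"
  assumes f: "continuous_on UNIV (\<lambda>p. f (fst p) (snd p))"
  shows double_int_swap: "double_int R f = (LINT h|leb_on (cball 0 R). LINT x|torus. f x h)"
    and integrable_double_inner: "integrable torus (\<lambda>x. LINT h|leb_on (cball 0 R). f x h)"
proof -
  interpret pair_sigma_finite torus "leb_on (cball 0 R) :: (real^3) measure" ..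
  show "double_int R f = (LINT h|leb_on (cball 0 R). LINT x|torus. f x h)"
    unfolding double_int_def by (rule Fubini_integral[symmetric, OF integrable_double[OF f]])
  show "integrable torus (\<lambda>x. LINT h|leb_on (cball 0 R). f x h)"
    using integrable_fst'[OF integrable_double[OF f]] by simp
qed

lemma double_int_add:
  fixes f :: "real^3 \<Rightarrow> real^3 \<Rightarrow> real"
  assumes f: "continuous_on UNIV (\<lambda>p. f (fst p) (snd p))" and g: "continuous_on UNIV (\<lambda>p. g (fst p) (snd p))"
  shows "double_int R (\<lambda>x h. f x h + g x h) = double_int R f + double_int R g"
  unfolding double_int_def
  using integrable_leb_on_continuous[OF compact_cball continuous_section(1)[OF f], of 0 R]
    integrable_leb_on_continuous[OF compact_cball continuous_section(1)[OF g], of 0 R]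
    integrable_double_inner[OF f] integrable_double_inner[OF g]
  by simp

lemma double_int_cmult: "double_int R (\<lambda>x h. c * f x h) = c * double_int R f"
  by (simp add: double_int_def)

lemma double_int_eq_0:
  assumes "\<And>x. (LINT h|leb_on (cball 0 R). f x h) = 0"
  shows "double_int R f = 0"
  by (simp add: double_int_def assms)

lemma distr_ball_uminus:
  "distr (leb_on (cball 0 R :: 'a::euclidean_space set)) borel uminus = leb_on (cball 0 R)"
proof -
  have "distr lborel borel uminus = (lborel :: 'a measure)"
    by (subst lborel_affine[of "-1" 0]) (auto simp: density_1 distr_distr o_def)
  then have *: "distr lborel lborel uminus = (lborel :: 'a measure)" by (simp cong: distr_cong)
  have "leb_on (cball 0 R) = density (distr lborel lborel uminus) (indicator (cball 0 R :: 'a set))"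
    by (simp add: * leb_on_def)
  also have "\<dots> = distr (density lborel (\<lambda>x. indicator (cball 0 R) (- x))) lborel uminus"
    by (rule density_distr) auto
  also have "(\<lambda>x. indicator (cball 0 R) (- x)) = (indicator (cball 0 R) :: 'a \<Rightarrow> ennreal)"
    by (auto simp: indicator_def)
  also have "distr (density lborel (indicator (cball 0 R))) lborel uminus
      = distr (leb_on (cball 0 R :: 'a set)) borel uminus"
    unfolding leb_on_def by (rule distr_cong) simp_all
  finally show ?thesis ..
qed

lemma integral_ball_reflect:
  fixes f :: "'a::euclidean_space \<Rightarrow> 'b::euclidean_space"
  assumes [measurable]: "f \<in> borel_measurable borel"
  shows "(LINT h|leb_on (cball 0 R). f (- h)) = (LINT h|leb_on (cball 0 R). f h)"
  using integral_distr[of uminus "leb_on (cball 0 R)" borel f] by (simp add: distr_ball_uminus)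

text \<open>Replacing \<open>x\<close> by \<open>x + h\<close> and \<open>h\<close> by
  \<open>- h\<close> exchanges the two end points of the increment. Translation invariance on the
  torus and symmetry of the ball justify the two halves of the substitution.\<close>

lemma double_int_swap_points:
  fixes f :: "real^3 \<Rightarrow> real^3 \<Rightarrow> real"
  assumes f: "continuous_on UNIV (\<lambda>p. f (fst p) (snd p))" and per: "\<And>h. periodic (\<lambda>x. f x h)"
  shows "double_int R (\<lambda>x h. f (x + h) (- h)) = double_int R f"
proof -
  have c: "continuous_on UNIV (\<lambda>p. (\<lambda>x h. f (x + h) (- h)) (fst p) (snd p))"
    by (rule continuous_on_compose_pair[OF f]; intro continuous_intros)
  interpret pair_sigma_finite torus "leb_on (cball 0 R) :: (real^3) measure" ..
  have m: "(\<lambda>h. LINT x|torus. f x h) \<in> borel_measurable borel"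
    using integrable_snd[OF integrable_double[OF f, of R]] by auto
  have "double_int R (\<lambda>x h. f (x + h) (- h)) = (LINT h|leb_on (cball 0 R). LINT x|torus. f (x + h) (- h))"
    by (rule double_int_swap[OF c])
  also have "\<dots> = (LINT h|leb_on (cball 0 R). LINT x|torus. f x (- h))"
    by (intro Bochner_Integration.integral_cong refl integral_torus_shift per
        continuous_borel_measurable continuous_section(2)[OF f])
  also have "\<dots> = (LINT h|leb_on (cball 0 R). LINT x|torus. f x h)"
    by (rule integral_ball_reflect[OF m])
  finally show ?thesis by (simp add: double_int_swap[OF f])
qed

lemma continuous_torus_param:
  fixes f :: "real^3 \<Rightarrow> real^3 \<Rightarrow> real"
  assumes f: "continuous_on UNIV (\<lambda>p. f (fst p) (snd p))"
  shows "continuous_on UNIV (\<lambda>h. LINT x|torus. f x h)"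
proof -
  have "continuous_on (UNIV \<times> cbox 0 (vec (2 * pi))) (\<lambda>(h, x). f x h)"
    unfolding case_prod_beta' by (rule continuous_on_compose_pair[OF f]; intro continuous_intros)
  from integral_continuous_on_param[OF this]
  have "continuous_on UNIV (\<lambda>h. integral torus_box (\<lambda>x. f x h))" by (simp add: torus_box_def)
  moreover have "(LINT x|torus. f x h) = integral torus_box (\<lambda>x. f x h)" for h
  proof -
    have c: "continuous_on UNIV (\<lambda>x. f x h)" by (rule continuous_section(2)[OF f])
    note [measurable] = continuous_borel_measurable[OF c]
    have "integrable torus (\<lambda>x. f x h)"
      by (intro integrable_leb_on_continuous c) (simp add: torus_box_def compact_cbox)
    then have "set_integrable lborel torus_box (\<lambda>x. f x h)"
      by (subst (asm) integral_leb_on(2)) auto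
    then show ?thesis
      by (subst integral_leb_on(1)) (auto simp: set_borel_integral_eq_integral(2))
  qed
  ultimately show ?thesis by simp
qed

text \<open>Difference quotients of a periodic function have integral zero, and dominated
  convergence passes this to the derivative.\<close>

lemma torus_derivative_integral_0:
  fixes g :: "real^3 \<Rightarrow> real"
  assumes g: "\<And>x. (g has_derivative g' x) (at x)" and g': "continuous_on UNIV (\<lambda>x. g' x v)"
    and per: "periodic g"
  shows "(LINT x|torus. g' x v) = 0"
proof -
  have gc: "continuous_on UNIV g"
    using g by (meson has_derivative_continuous continuous_at_imp_continuous_on)
  note [measurable] = continuous_borel_measurable[OF gc] continuous_borel_measurable[OF g']
  have cb: "compact torus_box" by (simp add: torus_box_def compact_cbox)
  obtain K0 where K0: "\<And>x. x \<in> torus_box \<Longrightarrow> norm x \<le> K0"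
    using bounded_torus_box by (auto simp: bounded_iff)
  obtain C where C: "0 < C" "\<And>x. norm x \<le> K0 + norm v \<Longrightarrow> \<bar>g' x v\<bar> \<le> C"
    using continuous_bounded_ball[OF g', of "K0 + norm v"] by auto
  define t where "t n = 1 / real (Suc n)" for n
  have t: "0 < t n" "t n \<le> 1" for n by (auto simp: t_def)
  have t0: "t \<longlonglongrightarrow> 0" unfolding t_def using LIMSEQ_inverse_real_of_nat by (simp add: inverse_eq_divide)
  have int: "integrable torus g" by (rule integrable_leb_on_continuous[OF cb gc])
  have zero: "(LINT x|torus. (g (x + t n *\<^sub>R v) - g x) / t n) = 0" for n
    using int integrable_torus_shift[OF per, of "t n *\<^sub>R v"] integral_torus_shift[OF per, of "t n *\<^sub>R v"]
    by simp
  have "(\<lambda>n. LINT x|torus. (g (x + t n *\<^sub>R v) - g x) / t n) \<longlonglongrightarrow> (LINT x|torus. g' x v)"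
  proof (rule integral_dominated_convergence[where w = "\<lambda>_. C"])
    show "AE x in torus. (\<lambda>n. (g (x + t n *\<^sub>R v) - g x) / t n) \<longlonglongrightarrow> g' x v"
      by (intro AE_I2 directional_quotient_tendsto[OF g t0]) (simp add: t_def)
    show "AE x in torus. norm ((g (x + t n *\<^sub>R v) - g x) / t n) \<le> C" for n
    proof (subst AE_leb_on, simp, intro AE_I2 impI)
      fix x assume x: "x \<in> torus_box"
      have "\<bar>g (x + t n *\<^sub>R v) - g x\<bar> \<le> C * t n"
      proof (rule difference_le_derivative_bound[OF g])
        fix s assume s: "0 \<le> s" "s \<le> t n"
        have "norm (x + s *\<^sub>R v) \<le> norm x + s * norm v" using norm_triangle_ineq[of x "s *\<^sub>R v"] s by simp
        also have "\<dots> \<le> K0 + norm v" using K0[OF x] s t(2)[of n] mult_right_mono[of s 1 "norm v"] by simp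
        finally show "\<bar>g' (x + s *\<^sub>R v) v\<bar> \<le> C" by (rule C(2))
      qed (use t(1)[of n] in simp)
      then show "norm ((g (x + t n *\<^sub>R v) - g x) / t n) \<le> C"
        using t(1)[of n] by (simp add: abs_divide divide_le_eq)
    qed
  qed auto
  then show ?thesis unfolding zero by (simp add: LIMSEQ_const_iff)
qed

text \<open>The integrations by parts use one continuous derivative. Carrying it as an explicit
  matrix field keeps \<open>jacobian\<close> out of the calculations, and differences of
  approximants stay in the class by \<open>C1_div_diff\<close>.\<close>

definition C1_div :: "(real^3 \<Rightarrow> real^3) \<Rightarrow> (real^3 \<Rightarrow> real^3^3) \<Rightarrow> bool" where
  "C1_div \<phi> J \<longleftrightarrow> periodic \<phi> \<and> (\<forall>x. (\<phi> has_derivative (\<lambda>v. J x *v v)) (at x)) \<and>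
     continuous_on UNIV J \<and> (\<forall>x. trace (J x) = 0)"

lemma C1_divD:
  assumes "C1_div \<phi> J"
  shows "periodic \<phi>" "(\<phi> has_derivative (\<lambda>v. J x *v v)) (at x)" "continuous_on UNIV J"
    "trace (J x) = 0" "continuous_on UNIV \<phi>" "periodic J"
proof -
  have d: "(\<phi> has_derivative (\<lambda>v. J x *v v)) (at x)" for x using assms by (simp add: C1_div_def)
  then show "continuous_on UNIV \<phi>"
    by (meson has_derivative_continuous continuous_at_imp_continuous_on)
  show p: "periodic \<phi>" using assms by (simp add: C1_div_def)
  show "periodic J" unfolding periodic_def
  proof (intro allI)
    fix x i
    have "((\<lambda>y. \<phi> (y + axis i (2 * pi))) has_derivative (\<lambda>v. J (x + axis i (2 * pi)) *v v)) (at x)"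
      by (rule has_derivative_compose[where f = "\<lambda>y. y + axis i (2 * pi)", unfolded o_def])
        (auto intro!: derivative_eq_intros d)
    then have "(\<phi> has_derivative (\<lambda>v. J (x + axis i (2 * pi)) *v v)) (at x)"
      using p by (simp add: periodic_def)
    from has_derivative_unique[OF this d] show "J (x + axis i (2 * pi)) = J x"
      by (metis matrix_eq)
  qed
qed (use assms in \<open>auto simp: C1_div_def\<close>)

lemma Cinf_div_C1_div:
  assumes "\<phi> \<in> Cinf_div"
  shows "C1_div \<phi> (\<lambda>x. jacobian \<phi> (at x))"
proof -
  have "C_k (Suc (Suc 0)) \<phi>" using assms by (simp add: Cinf_div_def del: C_k.simps)
  then obtain f' where f': "\<And>x. (\<phi> has_derivative f' x) (at x)" "\<And>v. C_k (Suc 0) (\<lambda>x. f' x v)"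
    by auto
  have j: "(\<phi> has_derivative (\<lambda>v. jacobian \<phi> (at x) *v v)) (at x)" for x
    using f'(1)[of x] jacobian_works[of \<phi> "at x"] by (auto simp: differentiable_def)
  have eq: "f' x v = jacobian \<phi> (at x) *v v" for x v
    using has_derivative_unique[OF f'(1) j] by metis
  have c: "continuous_on UNIV (\<lambda>x. f' x v)" for v
  proof -
    obtain f'' where "\<And>x. ((\<lambda>x. f' x v) has_derivative f'' x) (at x)" using f'(2)[of v] by auto
    then show ?thesis by (meson has_derivative_continuous continuous_at_imp_continuous_on)
  qed
  have "continuous_on UNIV (\<lambda>x. \<chi> i j. f' x (axis j 1) $ i)"
    by (intro continuous_on_vec_lambda continuous_on_component c)
  moreover have "(\<chi> i j. f' x (axis j 1) $ i) = jacobian \<phi> (at x)" for x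
    by (simp add: eq matrix_vector_mult_basis column_def vec_eq_iff)
  ultimately show ?thesis using assms j by (simp add: C1_div_def Cinf_div_def)
qed

lemma trace_eq_sum_axis: "(\<Sum>i\<in>UNIV. (A *v axis i 1) $ i) = trace (A :: real^'n^'n)"
  by (simp add: matrix_vector_mult_basis column_def trace_def)

text \<open>The sum of the two integrands is the divergence of
  \<open>(\<phi> \<bullet> \<psi>) *\<^sub>R \<phi>\<close>, because \<open>\<phi>\<close> itself is
  divergence-free, and divergences of periodic fields integrate to zero.\<close>

lemma C1_div_advection_antisym:
  assumes \<phi>: "C1_div \<phi> J" and \<psi>: "\<And>x. (\<psi> has_derivative (\<lambda>v. K x *v v)) (at x)" "continuous_on UNIV K" "periodic \<psi>"
  shows "(LINT x|torus. \<phi> x \<bullet> (K x *v \<phi> x)) = - (LINT x|torus. (J x *v \<phi> x) \<bullet> \<psi> x)"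
proof -
  note d = C1_divD[OF \<phi>]
  have \<psi>c: "continuous_on UNIV \<psi>"
    using \<psi>(1) by (meson has_derivative_continuous continuous_at_imp_continuous_on)
  have cb: "compact torus_box" by (simp add: torus_box_def compact_cbox)
  have cm: "continuous_on UNIV (\<lambda>x. A x *v b x)"
    if "continuous_on UNIV A" "continuous_on UNIV b" for A :: "real^3 \<Rightarrow> real^3^3" and b :: "real^3 \<Rightarrow> real^3"
    unfolding matrix_vector_mult_def
    by (intro continuous_intros continuous_on_vec_lambda continuous_on_component that)
  have D: "((\<lambda>x. \<phi> x $ i * (\<phi> x \<bullet> \<psi> x)) has_derivative
     (\<lambda>v. \<phi> x $ i * (\<phi> x \<bullet> (K x *v v) + (J x *v v) \<bullet> \<psi> x) + (J x *v v) $ i * (\<phi> x \<bullet> \<psi> x))) (at x)" for i x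
    by (auto intro!: derivative_eq_intros d \<psi> bounded_linear.has_derivative[OF bounded_linear_vec_nth])
  have c: "continuous_on UNIV (\<lambda>x. \<phi> x $ i * (\<phi> x \<bullet> (K x *v v) + (J x *v v) \<bullet> \<psi> x) + (J x *v v) $ i * (\<phi> x \<bullet> \<psi> x))" for i v
    by (intro continuous_intros continuous_on_component cm d \<psi> \<psi>c)
  have "0 = (\<Sum>i\<in>UNIV. LINT x|torus. \<phi> x $ i * (\<phi> x \<bullet> (K x *v axis i 1) + (J x *v axis i 1) \<bullet> \<psi> x)
       + (J x *v axis i 1) $ i * (\<phi> x \<bullet> \<psi> x))"
  proof (rule sum.neutral[symmetric], rule ballI, rule torus_derivative_integral_0[OF D c])
    show "periodic (\<lambda>x. \<phi> x $ i * (\<phi> x \<bullet> \<psi> x))" for i using d(1) \<psi>(3) by (simp add: periodic_def)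
  qed
  also have "\<dots> = (LINT x|torus. (\<Sum>i\<in>UNIV. \<phi> x $ i * (\<phi> x \<bullet> (K x *v axis i 1) + (J x *v axis i 1) \<bullet> \<psi> x)
       + (J x *v axis i 1) $ i * (\<phi> x \<bullet> \<psi> x)))"
    by (rule Bochner_Integration.integral_sum[symmetric]) (intro integrable_leb_on_continuous cb c)
  also have "\<dots> = (LINT x|torus. \<phi> x \<bullet> (K x *v \<phi> x) + (J x *v \<phi> x) \<bullet> \<psi> x)"
  proof (rule Bochner_Integration.integral_cong[OF refl])
    fix x
    have lin: "(\<Sum>i\<in>UNIV. \<phi> x $ i *\<^sub>R (A *v axis i 1)) = A *v \<phi> x" for A :: "real^3^3"
      by (simp only: matrix_vector_mult_basis matrix_mult_sum[of A "\<phi> x"] scalar_mult_eq_scaleR)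
    have "(\<Sum>i\<in>UNIV. \<phi> x $ i * (\<phi> x \<bullet> (K x *v axis i 1) + (J x *v axis i 1) \<bullet> \<psi> x)
       + (J x *v axis i 1) $ i * (\<phi> x \<bullet> \<psi> x))
      = \<phi> x \<bullet> (\<Sum>i\<in>UNIV. \<phi> x $ i *\<^sub>R (K x *v axis i 1)) + (\<Sum>i\<in>UNIV. \<phi> x $ i *\<^sub>R (J x *v axis i 1)) \<bullet> \<psi> x
        + (\<Sum>i\<in>UNIV. (J x *v axis i 1) $ i) * (\<phi> x \<bullet> \<psi> x)"
      by (simp add: inner_sum_left inner_sum_right sum.distrib distrib_left sum_distrib_right)
    then show "(\<Sum>i\<in>UNIV. \<phi> x $ i * (\<phi> x \<bullet> (K x *v axis i 1) + (J x *v axis i 1) \<bullet> \<psi> x)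
       + (J x *v axis i 1) $ i * (\<phi> x \<bullet> \<psi> x)) = \<phi> x \<bullet> (K x *v \<phi> x) + (J x *v \<phi> x) \<bullet> \<psi> x"
      by (simp only: lin trace_eq_sum_axis d(4))
  qed
  also have "\<dots> = (LINT x|torus. \<phi> x \<bullet> (K x *v \<phi> x)) + (LINT x|torus. (J x *v \<phi> x) \<bullet> \<psi> x)"
    by (rule Bochner_Integration.integral_add)
      (intro integrable_leb_on_continuous cb continuous_intros cm d \<psi> \<psi>c)+
  finally show ?thesis by simp
qed

section \<open>Cubic and viscous identities for continuously differentiable fields\<close>

lemma continuous_on_matrix_vector_mult:
  fixes A :: "'a::topological_space \<Rightarrow> real^'n^'m"
  assumes "continuous_on S A" "continuous_on S b"
  shows "continuous_on S (\<lambda>x. A x *v b x)"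
  unfolding matrix_vector_mult_def
  by (intro continuous_intros continuous_on_vec_lambda continuous_on_component assms)

lemma integral_abs_le_AE:
  fixes f g :: "'a \<Rightarrow> real"
  assumes "integrable M g" "f \<in> borel_measurable M" "AE x in M. \<bar>f x\<bar> \<le> g x"
  shows "\<bar>LINT x|M. f x\<bar> \<le> (LINT x|M. g x)"
proof -
  have "integrable M f"
    using assms by (intro Bochner_Integration.integrable_bound[OF assms(1,2)]) auto
  then have "(LINT x|M. \<bar>f x\<bar>) \<le> (LINT x|M. g x)"
    using assms by (intro integral_mono_AE) auto
  then show ?thesis using integral_abs_bound[of M f] by linarith
qed

lemma norm_matrix_vector_le: "norm (A *v x) \<le> norm A * norm (x :: real^'n)"
proof -
  have "norm (A *v x) = L2_set (\<lambda>i. norm (A $ i \<bullet> x)) UNIV"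
    by (simp add: norm_vec_def matrix_vector_mul_component)
  also have "\<dots> \<le> L2_set (\<lambda>i. norm (A $ i) * norm x) UNIV"
    by (rule L2_set_mono) (auto simp: Cauchy_Schwarz_ineq2)
  also have "\<dots> = norm A * norm x"
    unfolding norm_vec_def[of A] by (rule L2_set_left_distrib[symmetric]) simp
  finally show ?thesis .
qed

locale C1_div_field =
  fixes \<phi> :: "real^3 \<Rightarrow> real^3" and J :: "real^3 \<Rightarrow> real^3^3"
  assumes C1: "C1_div \<phi> J"
begin

lemma continuous_\<phi>: "continuous_on S a \<Longrightarrow> continuous_on S (\<lambda>x. \<phi> (a x))"
  using continuous_on_compose2[OF C1_divD(5)[OF C1]] by auto

lemma continuous_J: "continuous_on S a \<Longrightarrow> continuous_on S (\<lambda>x. J (a x))"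
  using continuous_on_compose2[OF C1_divD(3)[OF C1]] by auto

lemmas cont = continuous_\<phi> continuous_J continuous_on_matrix_vector_mult continuous_intros

lemma shift_derivative: "((\<lambda>h. \<phi> (x + h)) has_derivative (\<lambda>v. J (x + h) *v v)) (at h)"
  by (rule has_derivative_compose[where f = "\<lambda>h. x + h", unfolded o_def])
    (auto intro!: derivative_eq_intros C1_divD(2)[OF C1])

text \<open>A template: whatever is built from the values at \<open>x\<close> and
  \<open>x + h\<close> is periodic in \<open>x\<close>. The particular \<open>F\<close> is supplied
  wherever the two points are exchanged.\<close>

lemma periodic_combination:
  "periodic (\<lambda>x. F (\<phi> x) (\<phi> (x + h)) (J x) (J (x + h)) h)"
proof -
  have "x + axis i (2 * pi) + h = x + h + axis i (2 * pi)" for x i by simp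
  then show ?thesis using C1_divD(1)[OF C1] C1_divD(6)[OF C1] by (simp only: periodic_def) simp
qed

text \<open>As a function of \<open>h\<close>, the field \<open>q h *\<^sub>R \<phi> (x + h)\<close>
  has divergence \<open>q' h (\<phi> (x + h))\<close>, since \<open>\<phi>\<close> is
  divergence-free. The identity holds for each \<open>x\<close> separately, so \<open>q\<close> may
  depend on \<open>\<phi> x\<close>.\<close>

lemma ball_weak_divergence:
  assumes q: "\<And>h. (q has_derivative q' h) (at h)" "\<And>v. continuous_on UNIV (\<lambda>h. q' h v)" and R: "0 \<le> R"
  shows "(LINT h|leb_on (cball 0 R). (R\<^sup>2 - (norm h)\<^sup>2) * q' h (\<phi> (x + h)))
    = 2 * (LINT h|leb_on (cball 0 R). q h * (h \<bullet> \<phi> (x + h)))"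
proof -
  have qc: "continuous_on UNIV q"
    using q(1) by (meson has_derivative_continuous continuous_at_imp_continuous_on)
  have D: "((\<lambda>h. q h *\<^sub>R \<phi> (x + h)) has_derivative
      (\<lambda>v. q h *\<^sub>R (J (x + h) *v v) + q' h v *\<^sub>R \<phi> (x + h))) (at h)" for h
    by (auto intro!: derivative_eq_intros q shift_derivative)
  have c: "continuous_on UNIV (\<lambda>h. q h *\<^sub>R (J (x + h) *v v) + q' h v *\<^sub>R \<phi> (x + h))" for v
    by (intro cont q qc)
  have "(\<Sum>i\<in>UNIV. (q h *\<^sub>R (J (x + h) *v axis i 1) + q' h (axis i 1) *\<^sub>R \<phi> (x + h)) $ i) = q' h (\<phi> (x + h))" for h
  proof -
    interpret b: bounded_linear "q' h" using q(1) by (rule has_derivative_bounded_linear)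
    have "(\<Sum>i\<in>UNIV. (q h *\<^sub>R (J (x + h) *v axis i 1) + q' h (axis i 1) *\<^sub>R \<phi> (x + h)) $ i)
      = q h * trace (J (x + h)) + (\<Sum>i\<in>UNIV. q' h (axis i 1) * \<phi> (x + h) $ i)"
      unfolding trace_eq_sum_axis[symmetric] by (simp add: sum.distrib sum_distrib_left)
    also have "(\<Sum>i\<in>UNIV. q' h (axis i 1) * \<phi> (x + h) $ i) = q' h (\<Sum>i\<in>UNIV. \<phi> (x + h) $ i *\<^sub>R axis i 1)"
      by (simp add: b.sum b.scaleR mult.commute)
    also have "(\<Sum>i\<in>UNIV. \<phi> (x + h) $ i *\<^sub>R axis i 1) = \<phi> (x + h)"
      using basis_expansion[of "\<phi> (x + h)"] by (simp add: scalar_mult_eq_scaleR)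
    finally show ?thesis using C1_divD(4)[OF C1] by simp
  qed
  then show ?thesis using ball_integral_by_parts[OF D c R] by simp
qed

lemma ball_odd:
  fixes f :: "real^3 \<Rightarrow> real"
  assumes "f \<in> borel_measurable borel" "\<And>h. f (- h) = - f h"
  shows "(LINT h|leb_on (cball 0 R). f h) = 0"
  using integral_ball_reflect[OF assms(1), of R] by (simp add: assms(2))

abbreviation "transfer R \<equiv> double_int R (\<lambda>x h. (R\<^sup>2 - (norm h)\<^sup>2) * ((J x *v \<phi> x) \<bullet> \<phi> (x + h)))"

lemma ball_constant_weight: "0 \<le> R \<Longrightarrow> (LINT h|leb_on (cball 0 R). c * (h \<bullet> \<phi> (x + h))) = 0"
  using ball_weak_divergence[of "\<lambda>h. c" "\<lambda>h v. 0" R x] by simp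

text \<open>Two integrations by parts: the one in \<open>h\<close> creates the weight and
  differentiates \<open>\<phi> (x + h)\<close>; the one in \<open>x\<close> moves this derivative to
  \<open>\<phi> x\<close> and changes the sign.\<close>

lemma advection_by_parts:
  assumes R: "0 \<le> R"
  shows "2 * double_int R (\<lambda>x h. (h \<bullet> \<phi> x) * (\<phi> x \<bullet> \<phi> (x + h))) = - transfer R"
proof -
  let ?p = "\<lambda>h :: real^3. R\<^sup>2 - (norm h)\<^sup>2"
  have "2 * (LINT h|leb_on (cball 0 R). (h \<bullet> \<phi> x) * (\<phi> x \<bullet> \<phi> (x + h)))
    = (LINT h|leb_on (cball 0 R). ?p h * (\<phi> x \<bullet> (J (x + h) *v \<phi> x)))" for x
  proof -
    have "((\<lambda>h. (\<phi> x \<bullet> \<phi> (x + h)) *\<^sub>R \<phi> x) has_derivative (\<lambda>v. (\<phi> x \<bullet> (J (x + h) *v v)) *\<^sub>R \<phi> x)) (at h)" for h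
      by (auto intro!: derivative_eq_intros shift_derivative)
    moreover have "continuous_on UNIV (\<lambda>h. (\<phi> x \<bullet> (J (x + h) *v v)) *\<^sub>R \<phi> x)" for v
      by (intro cont)
    moreover have "(\<Sum>i\<in>UNIV. ((\<phi> x \<bullet> (J (x + h) *v axis i 1)) *\<^sub>R \<phi> x) $ i) = \<phi> x \<bullet> (J (x + h) *v \<phi> x)" for h
    proof -
      have "(\<Sum>i\<in>UNIV. ((\<phi> x \<bullet> (J (x + h) *v axis i 1)) *\<^sub>R \<phi> x) $ i)
        = \<phi> x \<bullet> (\<Sum>i\<in>UNIV. \<phi> x $ i *\<^sub>R (J (x + h) *v axis i 1))"
        by (simp add: inner_sum_right mult.commute)
      then show ?thesis
        by (simp only: matrix_vector_mult_basis matrix_mult_sum[of "J (x + h)" "\<phi> x"] scalar_mult_eq_scaleR)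
    qed
    ultimately show ?thesis
      using ball_integral_by_parts[of "\<lambda>h. (\<phi> x \<bullet> \<phi> (x + h)) *\<^sub>R \<phi> x" "\<lambda>h v. (\<phi> x \<bullet> (J (x + h) *v v)) *\<^sub>R \<phi> x" R] R
      by (simp add: mult.commute)
  qed
  then have "2 * double_int R (\<lambda>x h. (h \<bullet> \<phi> x) * (\<phi> x \<bullet> \<phi> (x + h)))
    = double_int R (\<lambda>x h. ?p h * (\<phi> x \<bullet> (J (x + h) *v \<phi> x)))"
    unfolding double_int_def by (subst integral_mult_right_zero[symmetric]) simp
  also have "\<dots> = (LINT h|leb_on (cball 0 R). LINT x|torus. ?p h * (\<phi> x \<bullet> (J (x + h) *v \<phi> x)))"
    by (intro double_int_swap cont)
  also have "\<dots> = (LINT h|leb_on (cball 0 R). LINT x|torus. - (?p h * ((J x *v \<phi> x) \<bullet> \<phi> (x + h))))"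
  proof (rule Bochner_Integration.integral_cong[OF refl])
    fix h
    have "(LINT x|torus. \<phi> x \<bullet> (J (x + h) *v \<phi> x)) = - (LINT x|torus. (J x *v \<phi> x) \<bullet> \<phi> (x + h))"
    proof (rule C1_div_advection_antisym[OF C1])
      show "((\<lambda>x. \<phi> (x + h)) has_derivative (\<lambda>v. J (x + h) *v v)) (at x)" for x
        by (rule has_derivative_compose[where f = "\<lambda>x. x + h", unfolded o_def])
          (auto intro!: derivative_eq_intros C1_divD(2)[OF C1])
      show "continuous_on UNIV (\<lambda>x. J (x + h))" by (intro cont)
      show "periodic (\<lambda>x. \<phi> (x + h))" using periodic_combination[where F = "\<lambda>u u' K K' h. u'"] .
    qed
    then show "(LINT x|torus. ?p h * (\<phi> x \<bullet> (J (x + h) *v \<phi> x)))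
      = (LINT x|torus. - (?p h * ((J x *v \<phi> x) \<bullet> \<phi> (x + h))))" by simp
  qed
  also have "\<dots> = double_int R (\<lambda>x h. - (?p h * ((J x *v \<phi> x) \<bullet> \<phi> (x + h))))"
    by (intro double_int_swap[symmetric] cont)
  finally show ?thesis by (simp add: double_int_def)
qed

text \<open>Exchanging the two points maps each monomial in \<open>\<phi> x\<close> and \<open>\<phi> (x + h)\<close> to the negative of the
  monomial with the two values exchanged, so only half of the terms of the cubic expressions below
  have to be considered.\<close>

lemma energy_transfer:
  assumes R: "0 \<le> R"
  shows "double_int R (\<lambda>x h. (norm (\<phi> (x + h) - \<phi> x))\<^sup>2 * (h \<bullet> (\<phi> (x + h) - \<phi> x))) = - 2 * transfer R"
proof -
  let ?f = "\<lambda>x h. (h \<bullet> \<phi> (x + h)) * (\<phi> (x + h) \<bullet> \<phi> (x + h)) + - 2 * ((h \<bullet> \<phi> (x + h)) * (\<phi> x \<bullet> \<phi> (x + h)))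
    + (h \<bullet> \<phi> (x + h)) * (\<phi> x \<bullet> \<phi> x)"
  let ?a = "\<lambda>x h. (h \<bullet> \<phi> x) * (\<phi> x \<bullet> \<phi> x)"
  let ?b = "\<lambda>x h. (h \<bullet> \<phi> x) * (\<phi> x \<bullet> \<phi> (x + h))"
  let ?c = "\<lambda>x h. (\<phi> x \<bullet> \<phi> x) * (h \<bullet> \<phi> (x + h))"
  let ?d = "\<lambda>x h. (\<phi> (x + h) \<bullet> \<phi> (x + h)) * (h \<bullet> \<phi> x)"
  let ?g = "\<lambda>x h. 2 * ?b x h + (- 1) * ?d x h + (- 1) * ?a x h"
  \<comment> \<open>The integrand \<open>?a\<close> is odd in \<open>h\<close>; \<open>?c\<close>
    and its mirror image \<open>?d\<close> vanish because \<open>\<phi>\<close> is divergence-free.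
    Only \<open>?b\<close> survives.\<close>
  have a: "double_int R ?a = 0"
    by (intro double_int_eq_0 ball_odd continuous_borel_measurable cont) simp
  have c: "double_int R ?c = 0"
    by (intro double_int_eq_0 ball_constant_weight R)
  have "double_int R (\<lambda>x h. ?c (x + h) (- h)) = double_int R ?c"
    using periodic_combination[where F = "\<lambda>u u' K K' h. (u \<bullet> u) * (h \<bullet> u')"]
    by (intro double_int_swap_points cont) simp
  then have d: "double_int R ?d = 0"
    using c double_int_cmult[of R "- 1" ?d] by simp
  have lin: "double_int R ?g = 2 * double_int R ?b + (- 1) * double_int R ?d + (- 1) * double_int R ?a"
    unfolding double_int_cmult[symmetric]
    by (subst double_int_add[symmetric], intro cont, intro cont)+ simp
  have "double_int R (\<lambda>x h. (norm (\<phi> (x + h) - \<phi> x))\<^sup>2 * (h \<bullet> (\<phi> (x + h) - \<phi> x)))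
    = double_int R (\<lambda>x h. ?f x h + ?g x h)"
    by (intro arg_cong[where f = "double_int R"] ext)
      (simp add: power2_norm_eq_inner inner_diff_left inner_diff_right inner_commute algebra_simps)
  also have "\<dots> = double_int R ?f + double_int R ?g"
    by (rule double_int_add) (intro cont)+
  also have "double_int R ?f = double_int R (\<lambda>x h. ?f (x + h) (- h))"
    using periodic_combination[where F = "\<lambda>u u' K K' h. (h \<bullet> u') * (u' \<bullet> u') + - 2 * ((h \<bullet> u') * (u \<bullet> u')) + (h \<bullet> u') * (u \<bullet> u)"]
    by (intro double_int_swap_points[symmetric] cont) simp
  also have "\<dots> = double_int R ?g"
    by (intro arg_cong[where f = "double_int R"] ext) (simp add: inner_commute)
  finally have "double_int R (\<lambda>x h. (norm (\<phi> (x + h) - \<phi> x))\<^sup>2 * (h \<bullet> (\<phi> (x + h) - \<phi> x)))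
    = 2 * (2 * double_int R ?b)" unfolding lin a d by simp
  then show ?thesis unfolding advection_by_parts[OF R] by simp
qed

text \<open>The difference of the two sides expands into monomials. Those with at least two factors
  at \<open>x + h\<close> form \<open>?E1\<close>, whose mirror image under exchange of the points
  is \<open>?E2\<close>. In \<open>?E2\<close> the pure terms are odd in \<open>h\<close>, and the
  mixed ones cancel at each fixed \<open>x\<close> by the weak divergence identity with a suitable
  quadratic \<open>q\<close>.\<close>

lemma longitudinal_identity:
  assumes R: "0 \<le> R"
  shows "3 * double_int R (\<lambda>x h. (R\<^sup>2 - (norm h)\<^sup>2) * ((norm (\<phi> (x + h) - \<phi> x))\<^sup>2 * (h \<bullet> (\<phi> (x + h) - \<phi> x))))
    = 2 * double_int R (\<lambda>x h. (h \<bullet> (\<phi> (x + h) - \<phi> x)) ^ 3)"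
proof -
  let ?p = "\<lambda>h :: real^3. R\<^sup>2 - (norm h)\<^sup>2"
  let ?E1 = "\<lambda>x h. 3 * (?p h * ((\<phi> (x + h) \<bullet> \<phi> (x + h)) * (h \<bullet> \<phi> (x + h)))) + - 2 * (h \<bullet> \<phi> (x + h)) ^ 3
    + (- 3 * (?p h * ((\<phi> (x + h) \<bullet> \<phi> (x + h)) * (h \<bullet> \<phi> x) + 2 * ((\<phi> x \<bullet> \<phi> (x + h)) * (h \<bullet> \<phi> (x + h)))))
       + 6 * ((h \<bullet> \<phi> (x + h))\<^sup>2 * (h \<bullet> \<phi> x)))"
  let ?c = "\<lambda>x h. ?p h * ((\<phi> x \<bullet> \<phi> x) * (h \<bullet> \<phi> (x + h)) + 2 * ((\<phi> x \<bullet> \<phi> (x + h)) * (h \<bullet> \<phi> x)))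
       + - 2 * ((h \<bullet> \<phi> x)\<^sup>2 * (h \<bullet> \<phi> (x + h)))"
  let ?a = "\<lambda>x h. - 3 * (?p h * ((\<phi> x \<bullet> \<phi> x) * (h \<bullet> \<phi> x))) + 2 * (h \<bullet> \<phi> x) ^ 3"
  let ?E2 = "\<lambda>x h. ?a x h + 3 * ?c x h"
  have a: "double_int R ?a = 0"
    by (intro double_int_eq_0 ball_odd continuous_borel_measurable cont) (simp add: power3_eq_cube)
  have c: "double_int R ?c = 0"
  proof (rule double_int_eq_0)
    fix x
    \<comment> \<open>The factor \<open>1 / 4\<close> lets the derivative of \<open>?q\<close> and
      the term with \<open>2 * ?q\<close> each contribute one half of the monomial containing
      \<open>\<phi> x \<bullet> \<phi> x\<close>.\<close>
    let ?q = "\<lambda>h. - (1 / 4) * (\<phi> x \<bullet> \<phi> x) * (R\<^sup>2 - h \<bullet> h) + (h \<bullet> \<phi> x)\<^sup>2"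
    let ?q' = "\<lambda>h v. (1 / 2) * (\<phi> x \<bullet> \<phi> x) * (h \<bullet> v) + 2 * (h \<bullet> \<phi> x) * (v \<bullet> \<phi> x)"
    have q: "(?q has_derivative ?q' h) (at h)" for h
      by (auto intro!: derivative_eq_intros simp: inner_commute algebra_simps)
    have eq: "(LINT h|leb_on (cball 0 R). ?p h * ?q' h (\<phi> (x + h)))
      = 2 * (LINT h|leb_on (cball 0 R). ?q h * (h \<bullet> \<phi> (x + h)))"
      by (rule ball_weak_divergence[OF q _ R]) (intro cont)
    have i: "integrable (leb_on (cball 0 R)) (\<lambda>h. ?p h * ?q' h (\<phi> (x + h)))"
      "integrable (leb_on (cball 0 R)) (\<lambda>h. ?q h * (h \<bullet> \<phi> (x + h)))"
      by (intro integrable_leb_on_continuous cont compact_cball)+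
    have "(LINT h|leb_on (cball 0 R). ?c x h)
      = (LINT h|leb_on (cball 0 R). ?p h * ?q' h (\<phi> (x + h)) - 2 * (?q h * (h \<bullet> \<phi> (x + h))))"
    proof (rule Bochner_Integration.integral_cong[OF refl])
      fix h
      have *: "q * (B * A' + 2 * (C * A)) + - 2 * (A\<^sup>2 * A')
        = q * ((1 / 2) * B * A' + 2 * A * C) - 2 * ((- (1 / 4) * B * q + A\<^sup>2) * A')" for q A A' B C :: real
        by (simp add: field_simps)
      show "?c x h = ?p h * ?q' h (\<phi> (x + h)) - 2 * (?q h * (h \<bullet> \<phi> (x + h)))"
        unfolding * power2_norm_eq_inner[symmetric] by (simp add: inner_commute)
    qed
    also have "\<dots> = 0" using eq i by simp
    finally show "(LINT h|leb_on (cball 0 R). ?c x h) = 0" .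
  qed
  have E2: "double_int R ?E2 = 0"
  proof -
    have "double_int R ?E2 = double_int R ?a + double_int R (\<lambda>x h. 3 * ?c x h)"
      by (rule double_int_add) (intro cont)+
    then show ?thesis unfolding double_int_cmult a c by simp
  qed
  have E1: "double_int R ?E1 = 0"
  proof -
    have "double_int R ?E1 = double_int R (\<lambda>x h. ?E1 (x + h) (- h))"
      using periodic_combination[where F = "\<lambda>u u' K K' h. 3 * (?p h * ((u' \<bullet> u') * (h \<bullet> u'))) + - 2 * (h \<bullet> u') ^ 3
        + (- 3 * (?p h * ((u' \<bullet> u') * (h \<bullet> u) + 2 * ((u \<bullet> u') * (h \<bullet> u')))) + 6 * ((h \<bullet> u')\<^sup>2 * (h \<bullet> u)))"]
      by (intro double_int_swap_points[symmetric] cont) simp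
    also have "\<dots> = double_int R ?E2"
      by (intro arg_cong[where f = "double_int R"] ext)
        (simp add: inner_commute algebra_simps power3_eq_cube power2_eq_square)
    finally show ?thesis using E2 by simp
  qed
  have "0 = double_int R (\<lambda>x h. ?E1 x h + ?E2 x h)"
    by (subst double_int_add) (simp_all only: E1 E2, (intro cont)+)
  also have "\<dots> = double_int R (\<lambda>x h. 3 * (?p h * ((norm (\<phi> (x + h) - \<phi> x))\<^sup>2 * (h \<bullet> (\<phi> (x + h) - \<phi> x))))
      + - 2 * (h \<bullet> (\<phi> (x + h) - \<phi> x)) ^ 3)"
  proof (intro arg_cong[where f = "double_int R"] ext)
    fix x h
    have *: "3 * (q * (B' * A')) + - 2 * A' ^ 3 + (- 3 * (q * (B' * A + 2 * (C * A'))) + 6 * (A'\<^sup>2 * A))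
      + (- 3 * (q * (B * A)) + 2 * A ^ 3 + 3 * (q * (B * A' + 2 * (C * A)) + - 2 * (A\<^sup>2 * A')))
      = 3 * (q * ((B' - 2 * C + B) * (A' - A))) + - 2 * (A' - A) ^ 3" for q A A' B B' C :: real
      by (simp add: power3_eq_cube power2_eq_square algebra_simps)
    have n: "(norm (\<phi> (x + h) - \<phi> x))\<^sup>2 = \<phi> (x + h) \<bullet> \<phi> (x + h) - 2 * (\<phi> x \<bullet> \<phi> (x + h)) + \<phi> x \<bullet> \<phi> x"
      by (simp add: power2_norm_eq_inner inner_diff_left inner_diff_right inner_commute)
    show "?E1 x h + ?E2 x h = 3 * (?p h * ((norm (\<phi> (x + h) - \<phi> x))\<^sup>2 * (h \<bullet> (\<phi> (x + h) - \<phi> x))))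
      + - 2 * (h \<bullet> (\<phi> (x + h) - \<phi> x)) ^ 3"
      unfolding * n inner_diff_right[of h] ..
  qed
  also have "\<dots> = double_int R (\<lambda>x h. 3 * (?p h * ((norm (\<phi> (x + h) - \<phi> x))\<^sup>2 * (h \<bullet> (\<phi> (x + h) - \<phi> x)))))
      + double_int R (\<lambda>x h. - 2 * (h \<bullet> (\<phi> (x + h) - \<phi> x)) ^ 3)"
    by (rule double_int_add) (intro cont)+
  finally show ?thesis unfolding double_int_cmult by simp
qed

text \<open>Integration by parts for the transpose of \<open>J x\<close> applied to
  \<open>\<phi> (x + h)\<close>, whose divergence in \<open>h\<close> is
  \<open>J x \<bullet> J (x + h)\<close>. One of the two gradients is exchanged for a factor
  \<open>h\<close>.\<close>

lemma viscous_identity: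
  assumes R: "0 \<le> R"
  shows "double_int R (\<lambda>x h. (R\<^sup>2 - (norm h)\<^sup>2) * (J x \<bullet> J (x + h)))
    = 2 * double_int R (\<lambda>x h. (J x *v h) \<bullet> \<phi> (x + h))"
proof -
  have "(LINT h|leb_on (cball 0 R). (R\<^sup>2 - (norm h)\<^sup>2) * (J x \<bullet> J (x + h)))
    = 2 * (LINT h|leb_on (cball 0 R). (J x *v h) \<bullet> \<phi> (x + h))" for x
  proof -
    let ?T = "transpose (J x)"
    have "((\<lambda>h. ?T *v \<phi> (x + h)) has_derivative (\<lambda>v. ?T *v (J (x + h) *v v))) (at h)" for h
      by (rule bounded_linear.has_derivative[OF matrix_vector_mul_bounded_linear shift_derivative])
    moreover have "continuous_on UNIV (\<lambda>h. ?T *v (J (x + h) *v v))" for v by (intro cont)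
    moreover have "(\<Sum>i\<in>UNIV. (?T *v (J (x + h) *v axis i 1)) $ i) = J x \<bullet> J (x + h)" for h
    proof -
      have "(\<Sum>i\<in>UNIV. (?T *v (J (x + h) *v axis i 1)) $ i) = (\<Sum>i\<in>UNIV. \<Sum>j\<in>UNIV. J x $ j $ i * J (x + h) $ j $ i)"
        unfolding matrix_vector_mult_basis by (simp add: matrix_vector_mult_def column_def transpose_def)
      also have "\<dots> = (\<Sum>j\<in>UNIV. \<Sum>i\<in>UNIV. J x $ j $ i * J (x + h) $ j $ i)" by (rule sum.swap)
      finally show ?thesis by (simp add: inner_vec_def)
    qed
    moreover have "h \<bullet> (?T *v y) = (J x *v h) \<bullet> y" for h y
      by (metis dot_lmul_matrix inner_commute transpose_matrix_vector)
    ultimately show ?thesis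
      using ball_integral_by_parts[of "\<lambda>h. ?T *v \<phi> (x + h)" "\<lambda>h v. ?T *v (J (x + h) *v v)" R] R
      by simp
  qed
  then show ?thesis unfolding double_int_def by simp
qed

lemma double_int_weight:
  assumes "continuous_on UNIV (\<lambda>p. f (fst p) (snd p))"
  shows "double_int R (\<lambda>x h. (R\<^sup>2 - (norm h)\<^sup>2) * f x h)
    = (LINT h|leb_on (cball 0 R). (R\<^sup>2 - (norm h)\<^sup>2) * (LINT x|torus. f x h))"
  by (subst double_int_swap) (auto intro!: continuous_intros assms)

text \<open>The derivative of \<open>energy_transfer\<close> in \<open>R\<close>: on the left the
  ball becomes a sphere, on the right the weight disappears. The factor \<open>R\<close> from
  \<open>h = R *\<^sub>R n\<close> cancels the one from differentiating the weight.\<close>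

lemma sphere_energy_transfer:
  assumes R: "0 < R"
  shows "R\<^sup>2 * (LINT n|sphere_measure. LINT x|torus.
      (norm (\<phi> (x + R *\<^sub>R n) - \<phi> x))\<^sup>2 * ((\<phi> (x + R *\<^sub>R n) - \<phi> x) \<bullet> n))
    = - 4 * double_int R (\<lambda>x h. (J x *v \<phi> x) \<bullet> \<phi> (x + h))"
proof -
  let ?f = "\<lambda>x h. (norm (\<phi> (x + h) - \<phi> x))\<^sup>2 * (h \<bullet> (\<phi> (x + h) - \<phi> x))"
  let ?D = "\<lambda>h. LINT x|torus. ?f x h"
  let ?T = "\<lambda>h. LINT x|torus. (J x *v \<phi> x) \<bullet> \<phi> (x + h)"
  have cf: "continuous_on UNIV (\<lambda>p. ?f (fst p) (snd p))" by (intro cont)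
  have cT: "continuous_on UNIV (\<lambda>p. (\<lambda>x h. (J x *v \<phi> x) \<bullet> \<phi> (x + h)) (fst p) (snd p))" by (intro cont)
  note dD = ball_integral_deriv[OF continuous_torus_param[OF cf] R]
  note dT = ball_moment_deriv[OF continuous_torus_param[OF cT] R]
  have eq: "(LINT h|leb_on (cball 0 R). ?D h) = - 2 * (LINT h|leb_on (cball 0 R). (R\<^sup>2 - (norm h)\<^sup>2) * ?T h)"
    if "0 \<le> R" for R
    using energy_transfer[OF that] by (simp only: double_int_swap[OF cf] double_int_weight[OF cT])
  have "((\<lambda>R. LINT h|leb_on (cball 0 R). ?D h) has_real_derivative
      - 2 * (2 * R * (LINT h|leb_on (cball 0 R). ?T h))) (at R)"
  proof (rule has_field_derivative_transform_within_open)
    show "((\<lambda>R. - 2 * (LINT h|leb_on (cball 0 R). (R\<^sup>2 - (norm h)\<^sup>2) * ?T h)) has_real_derivative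
      - 2 * (2 * R * (LINT h|leb_on (cball 0 R). ?T h))) (at R)"
      by (rule DERIV_cmult[OF dT])
    show "open {0 :: real<..}" "R \<in> {0<..}" using R by auto
  qed (use eq in simp)
  from DERIV_unique[OF dD this]
  have "R\<^sup>2 * (LINT n|sphere_measure. ?D (R *\<^sub>R n)) = R * (- 4 * double_int R (\<lambda>x h. (J x *v \<phi> x) \<bullet> \<phi> (x + h)))"
    by (simp add: double_int_swap[OF cT])
  moreover have "(LINT n|sphere_measure. ?D (R *\<^sub>R n)) = R * (LINT n|sphere_measure. LINT x|torus.
      (norm (\<phi> (x + R *\<^sub>R n) - \<phi> x))\<^sup>2 * ((\<phi> (x + R *\<^sub>R n) - \<phi> x) \<bullet> n))"
    by (subst integral_mult_right_zero[symmetric])+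
      (auto intro!: Bochner_Integration.integral_cong simp: inner_commute mult.left_commute)
  ultimately have "R * (R\<^sup>2 * (LINT n|sphere_measure. LINT x|torus.
      (norm (\<phi> (x + R *\<^sub>R n) - \<phi> x))\<^sup>2 * ((\<phi> (x + R *\<^sub>R n) - \<phi> x) \<bullet> n)))
    = R * (- 4 * double_int R (\<lambda>x h. (J x *v \<phi> x) \<bullet> \<phi> (x + h)))" by (simp only: mult.left_commute)
  then show ?thesis using R by (subst (asm) mult_cancel_left) simp
qed

text \<open>The derivative of \<open>longitudinal_identity\<close> in \<open>R\<close>. The weighted
  side loses its weight and becomes the integral evaluated by \<open>energy_transfer\<close>, which
  brings the weighted transfer back.\<close>

lemma sphere_longitudinal_transfer:
  assumes R: "0 < R"
  shows "R ^ 4 * (LINT n|sphere_measure. LINT x|torus. ((\<phi> (x + R *\<^sub>R n) - \<phi> x) \<bullet> n) ^ 3) = - 6 * transfer R"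
proof -
  let ?f = "\<lambda>x h. (norm (\<phi> (x + h) - \<phi> x))\<^sup>2 * (h \<bullet> (\<phi> (x + h) - \<phi> x))"
  let ?D = "\<lambda>h. LINT x|torus. ?f x h"
  let ?g = "\<lambda>x h. (h \<bullet> (\<phi> (x + h) - \<phi> x)) ^ 3"
  let ?P = "\<lambda>h. LINT x|torus. ?g x h"
  have cf: "continuous_on UNIV (\<lambda>p. ?f (fst p) (snd p))" by (intro cont)
  have cg: "continuous_on UNIV (\<lambda>p. ?g (fst p) (snd p))" by (intro cont)
  note dP = DERIV_cmult[OF ball_integral_deriv[OF continuous_torus_param[OF cg] R], of 2]
  note dD = ball_moment_deriv[OF continuous_torus_param[OF cf] R]
  have eq: "3 * (LINT h|leb_on (cball 0 R). (R\<^sup>2 - (norm h)\<^sup>2) * ?D h) = 2 * (LINT h|leb_on (cball 0 R). ?P h)"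
    if "0 \<le> R" for R
    using longitudinal_identity[OF that] by (simp only: double_int_swap[OF cg] double_int_weight[OF cf])
  have "((\<lambda>R. 2 * (LINT h|leb_on (cball 0 R). ?P h)) has_real_derivative
      3 * (2 * R * (LINT h|leb_on (cball 0 R). ?D h))) (at R)"
  proof (rule has_field_derivative_transform_within_open)
    show "((\<lambda>R. 3 * (LINT h|leb_on (cball 0 R). (R\<^sup>2 - (norm h)\<^sup>2) * ?D h)) has_real_derivative
      3 * (2 * R * (LINT h|leb_on (cball 0 R). ?D h))) (at R)"
      by (rule DERIV_cmult[OF dD])
    show "open {0 :: real<..}" "R \<in> {0<..}" using R by auto
  qed (use eq in simp)
  from DERIV_unique[OF dP this]
  have "2 * (R\<^sup>2 * (LINT n|sphere_measure. ?P (R *\<^sub>R n))) = 3 * (2 * R * double_int R ?f)"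
    by (simp only: double_int_swap[OF cf])
  moreover have "(LINT n|sphere_measure. ?P (R *\<^sub>R n)) = R ^ 3 * (LINT n|sphere_measure. LINT x|torus.
      ((\<phi> (x + R *\<^sub>R n) - \<phi> x) \<bullet> n) ^ 3)"
    by (subst integral_mult_right_zero[symmetric])+
      (auto intro!: Bochner_Integration.integral_cong simp: inner_commute power_mult_distrib)
  moreover have "double_int R ?f = - 2 * transfer R"
    by (rule energy_transfer) (use R in simp)
  moreover have "R * (R ^ 4 * S) = R * (- 6 * T)"
    if "2 * (R\<^sup>2 * P) = 3 * (2 * R * D)" "P = R ^ 3 * S" "D = - 2 * T" for P S D T :: real
  proof -
    have "2 * (R * (R ^ 4 * S)) = 2 * (R\<^sup>2 * P)" by (simp add: that(2) power2_eq_square eval_nat_numeral)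
    then show ?thesis using that(1,3) by (simp add: ac_simps)
  qed
  ultimately have "R * (R ^ 4 * (LINT n|sphere_measure. LINT x|torus. ((\<phi> (x + R *\<^sub>R n) - \<phi> x) \<bullet> n) ^ 3))
      = R * (- 6 * transfer R)"
    by blast
  then show ?thesis using R by (subst (asm) mult_cancel_left) simp
qed

lemma sqint_fields: "sqint torus \<phi>" "sqint torus J" "sqint torus (\<lambda>x. \<phi> (x + h))" "l2 torus (\<lambda>x. \<phi> (x + h)) = l2 torus \<phi>"
proof -
  have cb: "compact torus_box" by (simp add: torus_box_def compact_cbox)
  show s: "sqint torus \<phi>" "sqint torus J"
    unfolding sqint_def using C1_divD[OF C1] cb
    by (auto intro!: continuous_borel_measurable integrable_leb_on_continuous continuous_intros)
  have "\<phi> \<in> L2_torus"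
    using s C1_divD[OF C1] by (simp add: L2_torus_iff continuous_borel_measurable)
  then show "sqint torus (\<lambda>x. \<phi> (x + h))" "l2 torus (\<lambda>x. \<phi> (x + h)) = l2 torus \<phi>"
    by (simp_all add: sqint_torus_shift l2_torus_shift)
qed

lemma viscous_pointwise_bound:
  "\<bar>LINT x|torus. (J x *v h) \<bullet> \<phi> (x + h)\<bar> \<le> norm h * (l2 torus J * l2 torus \<phi>)"
proof -
  have m: "(\<lambda>x. J x *v h) \<in> borel_measurable torus"
    unfolding measurable_cong_sets[OF sets_leb_on refl] by (intro continuous_borel_measurable cont)
  have le: "AE x in torus. norm (J x *v h) \<le> norm (norm h *\<^sub>R J x)"
    using norm_matrix_vector_le[of "J _" h] by (simp add: mult.commute)
  note b = sqint_bound[OF sqint_scaleR[OF sqint_fields(2)] m le] l2_mono[OF sqint_scaleR[OF sqint_fields(2)] m le]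
  have "\<bar>LINT x|torus. (J x *v h) \<bullet> \<phi> (x + h)\<bar> \<le> l2 torus (\<lambda>x. J x *v h) * l2 torus (\<lambda>x. \<phi> (x + h))"
    by (rule integral_inner_le[OF b(1) sqint_fields(3)])
  also have "\<dots> \<le> (norm h * l2 torus J) * l2 torus \<phi>"
    unfolding sqint_fields(4) using b(2) by (intro mult_right_mono) (simp_all add: l2_scaleR)
  finally show ?thesis by (simp add: mult.assoc)
qed

text \<open>The weighted bound integrates the pointwise one over the ball. The form without weight
  is, up to a factor, the derivative in \<open>R\<close> of the weighted one, hence an integral over
  the sphere, which explains the surface measure in its constant.\<close>

lemma viscous_bounds:
  assumes R: "0 < R"
  shows "\<bar>double_int R (\<lambda>x h. J x \<bullet> J (x + h))\<bar>
      \<le> measure sphere_measure UNIV * R\<^sup>2 * (l2 torus J * l2 torus \<phi>)"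
    and "\<bar>double_int R (\<lambda>x h. (R\<^sup>2 - (norm h)\<^sup>2) * (J x \<bullet> J (x + h)))\<bar>
      \<le> 2 * measure lborel (cball 0 R :: (real^3) set) * R * (l2 torus J * l2 torus \<phi>)"
proof -
  let ?K = "l2 torus J * l2 torus \<phi>"
  let ?f = "\<lambda>x h. (J x *v h) \<bullet> \<phi> (x + h)"
  let ?Y = "\<lambda>h. LINT x|torus. ?f x h"
  let ?V = "\<lambda>h. LINT x|torus. J x \<bullet> J (x + h)"
  have cf: "continuous_on UNIV (\<lambda>p. ?f (fst p) (snd p))" by (intro cont)
  have cV: "continuous_on UNIV (\<lambda>p. (\<lambda>x h. J x \<bullet> J (x + h)) (fst p) (snd p))" by (intro cont)
  note cY = continuous_torus_param[OF cf]
  note [measurable] = continuous_borel_measurable[OF cY]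
  note dY = DERIV_cmult[OF ball_integral_deriv[OF cY R], of 2]
  note dV = ball_moment_deriv[OF continuous_torus_param[OF cV] R]
  have eq: "(LINT h|leb_on (cball 0 R). (R\<^sup>2 - (norm h)\<^sup>2) * ?V h) = 2 * (LINT h|leb_on (cball 0 R). ?Y h)"
    if "0 \<le> R" for R
    using viscous_identity[OF that] by (simp only: double_int_swap[OF cf] double_int_weight[OF cV])
  have "((\<lambda>R. 2 * (LINT h|leb_on (cball 0 R). ?Y h)) has_real_derivative
      2 * R * (LINT h|leb_on (cball 0 R). ?V h)) (at R)"
  proof (rule has_field_derivative_transform_within_open[OF dV])
    show "open {0 :: real<..}" "R \<in> {0<..}" using R by auto
  qed (use eq in simp)
  from DERIV_unique[OF dY this]
  have "R * double_int R (\<lambda>x h. J x \<bullet> J (x + h)) = R * (R * (LINT n|sphere_measure. ?Y (R *\<^sub>R n)))"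
    by (simp only: double_int_swap[OF cV]) (auto simp: power2_eq_square)
  then have 1: "double_int R (\<lambda>x h. J x \<bullet> J (x + h)) = R * (LINT n|sphere_measure. ?Y (R *\<^sub>R n))"
    using R by simp
  have "\<bar>LINT n|sphere_measure. ?Y (R *\<^sub>R n)\<bar> \<le> (LINT n|sphere_measure. R * ?K)"
  proof (rule integral_abs_le_AE)
    show "AE n in sphere_measure. \<bar>?Y (R *\<^sub>R n)\<bar> \<le> R * ?K"
      using AE_sphere_norm
    proof eventually_elim
      case (elim n)
      then show ?case using viscous_pointwise_bound[of "R *\<^sub>R n"] R by simp
    qed
    have "?Y \<in> borel_measurable borel" by (rule continuous_borel_measurable[OF cY])
    from measurable_compose[OF _ this, of "\<lambda>n. R *\<^sub>R n" sphere_measure]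
    show "(\<lambda>n. ?Y (R *\<^sub>R n)) \<in> borel_measurable sphere_measure" by simp
  qed simp
  then show "\<bar>double_int R (\<lambda>x h. J x \<bullet> J (x + h))\<bar> \<le> measure sphere_measure UNIV * R\<^sup>2 * ?K"
    unfolding 1 using R by (simp add: abs_mult power2_eq_square mult_left_mono mult_ac)
  have "\<bar>LINT h|leb_on (cball 0 R). ?Y h\<bar> \<le> (LINT h|leb_on (cball 0 R :: (real^3) set). R * ?K)"
  proof (rule integral_abs_le_AE)
    show "AE h in leb_on (cball 0 R). \<bar>?Y h\<bar> \<le> R * ?K"
    proof (subst AE_leb_on, simp add: borel_closed, intro AE_I2 impI)
      fix h :: "real^3" assume "h \<in> cball 0 R"
      then show "\<bar>?Y h\<bar> \<le> R * ?K"
        using viscous_pointwise_bound[of h] mult_right_mono[of "norm h" R ?K] by simp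
    qed
  qed (use continuous_borel_measurable[OF cY] in simp_all)
  also have "\<dots> = measure lborel (cball 0 R :: (real^3) set) * (R * ?K)"
    by (simp add: measure_def leb_on_def emeasure_density)
  finally show "\<bar>double_int R (\<lambda>x h. (R\<^sup>2 - (norm h)\<^sup>2) * (J x \<bullet> J (x + h)))\<bar>
      \<le> 2 * measure lborel (cball 0 R :: (real^3) set) * R * ?K"
    using viscous_identity[of R] R by (simp add: double_int_swap[OF cf] abs_mult)
qed

end

section \<open>Sobolev embedding into \<open>L\<^sup>3\<close>\<close>

lemma sphere_measure_pos: "0 < measure sphere_measure UNIV"
proof -
  have "emeasure sphere_measure UNIV = (\<integral>\<^sup>+n. 1 \<partial>sphere_measure)" by simp
  also have "\<dots> = 3 * emeasure lborel (cball 0 1 - {0 :: real^3})"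
    by (subst nn_integral_sphere) auto
  also have "emeasure lborel (cball 0 1 - {0 :: real^3}) = emeasure lborel (cball 0 1 :: (real^3) set)"
    by (subst emeasure_Diff) auto
  also have "\<dots> = ennreal (measure lborel (cball 0 1 :: (real^3) set))"
    using emeasure_bounded_finite[of "cball 0 1 :: (real^3) set"]
    by (intro emeasure_eq_ennreal_measure) auto
  finally have "emeasure sphere_measure UNIV = ennreal (3 * measure lborel (cball 0 1 :: (real^3) set))"
    by (simp add: ennreal_mult)
  then have "measure sphere_measure UNIV = 3 * measure lborel (cball 0 1 :: (real^3) set)"
    by (simp add: measure_def)
  then show ?thesis using content_cball_pos[of 1 "0 :: real^3"] by simp
qed

text \<open>The cube is \<open>norm h\<close> to the power \<open>- 2\<close>, which cancels the
  Jacobian of polar coordinates; the fourth power is still integrable at the origin in three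
  dimensions. The exponent thus lets Cauchy-Schwarz split the kernel of the potential into one
  factor and two.\<close>

definition riesz :: "real^3 \<Rightarrow> ennreal" where
  "riesz h = ennreal (norm h powr (- 2 / 3))"

lemma riesz_measurable [measurable]: "riesz \<in> borel_measurable borel"
  unfolding riesz_def by measurable

lemma riesz_integral_finite: "(\<integral>\<^sup>+h. (riesz h) ^ 4 \<partial>leb_on (cball 0 1)) < \<infinity>"
proof -
  let ?H = "indicator {0<..} :: real \<Rightarrow> ennreal"
  have "(\<integral>\<^sup>+h. (riesz h) ^ 4 \<partial>leb_on (cball 0 1)) = (\<integral>\<^sup>+h. indicator (cball 0 1) h * (riesz h) ^ 4 \<partial>lborel)"
    by (rule nn_integral_leb_on) auto
  also have "\<dots> = (\<integral>\<^sup>+r. ?H r * ennreal (r\<^sup>2) *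
      (\<integral>\<^sup>+n. indicator (cball 0 1) (r *\<^sub>R n) * (riesz (r *\<^sub>R n)) ^ 4 \<partial>sphere_measure) \<partial>lborel)"
    by (rule nn_integral_polar) measurable
  also have "\<dots> = (\<integral>\<^sup>+r. emeasure sphere_measure UNIV * (ennreal (r powr (- 2 / 3)) * indicator {0..1} r) \<partial>lborel)"
  proof (rule nn_integral_cong)
    fix r :: real
    show "?H r * ennreal (r\<^sup>2) * (\<integral>\<^sup>+n. indicator (cball 0 1) (r *\<^sub>R n) * (riesz (r *\<^sub>R n)) ^ 4 \<partial>sphere_measure)
      = emeasure sphere_measure UNIV * (ennreal (r powr (- 2 / 3)) * indicator {0..1} r)"
    proof (cases "0 < r")
      case True
      have p: "r\<^sup>2 * (r powr (- 2 / 3)) ^ 4 = r powr (- 2 / 3)"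
        using True by (simp add: powr_numeral[symmetric] powr_powr powr_add[symmetric] del: powr_numeral)
      have "(\<integral>\<^sup>+n. indicator (cball 0 1) (r *\<^sub>R n) * (riesz (r *\<^sub>R n)) ^ 4 \<partial>sphere_measure)
        = (\<integral>\<^sup>+n. indicator {0..1} r * ennreal ((r powr (- 2 / 3)) ^ 4) \<partial>sphere_measure)"
      proof (rule nn_integral_cong_AE)
        show "AE n in sphere_measure. indicator (cball 0 1) (r *\<^sub>R n) * (riesz (r *\<^sub>R n)) ^ 4
          = indicator {0..1} r * ennreal ((r powr (- 2 / 3)) ^ 4)"
          using AE_sphere_norm by eventually_elim (use True in \<open>simp add: riesz_def indicator_def ennreal_power\<close>)
      qed
      also have "\<dots> = indicator {0..1} r * ennreal ((r powr (- 2 / 3)) ^ 4) * emeasure sphere_measure UNIV"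
        by simp
      finally have eq: "(\<integral>\<^sup>+n. indicator (cball 0 1) (r *\<^sub>R n) * (riesz (r *\<^sub>R n)) ^ 4 \<partial>sphere_measure)
        = indicator {0..1} r * ennreal ((r powr (- 2 / 3)) ^ 4) * emeasure sphere_measure UNIV" .
      have p': "ennreal (r powr (- 2 / 3)) = ennreal (r\<^sup>2) * ennreal ((r powr (- 2 / 3)) ^ 4)"
        by (subst ennreal_mult[symmetric]) (simp_all only: p, simp_all)
      show ?thesis
        unfolding eq p' using True by (simp only: mult_ac) simp
    qed (auto simp: indicator_def not_less order.order_iff_strict)
  qed
  also have "\<dots> = emeasure sphere_measure UNIV * (\<integral>\<^sup>+r. ennreal (r powr (- 2 / 3)) * indicator {0..1} r \<partial>lborel)"
    by (rule nn_integral_cmult) measurable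
  also have "(\<integral>\<^sup>+r. ennreal (r powr (- 2 / 3)) * indicator {0..1} r \<partial>lborel) = ennreal 3"
  proof -
    have "((\<lambda>x::real. x powr (- 2 / 3)) has_integral 3) {0..1}"
      using has_integral_powr_from_0[of "- 2 / 3" 1] by simp
    then have "((\<lambda>x::real. x powr (- 2 / 3) * indicator {0..1} x) has_integral 3) UNIV"
      using has_integral_restrict_UNIV[of "{0..1}" "\<lambda>x::real. x powr (- 2 / 3)" 3]
      by (simp add: indicator_def of_bool_def if_distrib[where f = "\<lambda>c. _ * c"] cong: if_cong)
    then have "(\<integral>\<^sup>+x. ennreal (x powr (- 2 / 3) * indicator {0..1} x) \<partial>lborel) = ennreal 3"
      by (intro nn_integral_has_integral_lborel) auto
    then show ?thesis by (simp add: ennreal_mult' ennreal_indicator)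
  qed
  finally show ?thesis using sphere.emeasure_finite by (simp add: ennreal_mult_less_top less_top[symmetric] ennreal_mult_eq_top_iff)
qed

context C1_div_field
begin

abbreviation "h1_size x \<equiv> norm (J x) + norm (\<phi> x)"

text \<open>Integrate the derivative of \<open>(1 - r) \<phi> (x + r n)\<close> over \<open>0 \<le> r \<le> 1\<close> and average over directions.\<close>

lemma pointwise_le_riesz_potential:
  "emeasure sphere_measure UNIV * ennreal (norm (\<phi> x))
    \<le> (\<integral>\<^sup>+h. ennreal (h1_size (x + h)) * (riesz h) ^ 3 \<partial>leb_on (cball 0 1))"
proof -
  have cs: "continuous_on UNIV (\<lambda>h. h1_size (x + h))" by (intro cont)
  note [measurable] = continuous_borel_measurable[OF cs]
  have radial: "ennreal (norm (\<phi> x)) \<le> (\<integral>\<^sup>+r. indicator {0<..1} r * ennreal (h1_size (x + r *\<^sub>R n)) \<partial>lborel)"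
    if n: "norm n = 1" for n
  proof -
    let ?g = "\<lambda>r. (1 - r) *\<^sub>R \<phi> (x + r *\<^sub>R n)"
    let ?g' = "\<lambda>r. (1 - r) *\<^sub>R (J (x + r *\<^sub>R n) *v n) - \<phi> (x + r *\<^sub>R n)"
    have d: "(?g has_vector_derivative ?g' r) (at r within {0..1})" for r
    proof -
      have "((\<lambda>r. \<phi> (x + r *\<^sub>R n)) has_derivative (\<lambda>s. J (x + r *\<^sub>R n) *v (s *\<^sub>R n))) (at r within {0..1})"
        by (rule has_derivative_compose[where f = "\<lambda>r. x + r *\<^sub>R n", unfolded o_def])
          (auto intro!: derivative_eq_intros C1_divD(2)[OF C1])
      then have "((\<lambda>r. \<phi> (x + r *\<^sub>R n)) has_vector_derivative J (x + r *\<^sub>R n) *v n) (at r within {0..1})"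
        by (simp add: has_vector_derivative_def matrix_vector_mult_scaleR)
      then show ?thesis
        by (auto intro!: derivative_eq_intros simp: has_vector_derivative_def[symmetric])
    qed
    have "(?g' has_integral (?g 1 - ?g 0)) {0..1}"
      by (rule fundamental_theorem_of_calculus) (use d in auto)
    then have int: "(?g' has_integral (- \<phi> x)) {0..1}" by simp
    have "continuous_on UNIV (\<lambda>r. h1_size (x + r *\<^sub>R n))" by (intro cont)
    then have cs': "continuous_on {0..1} (\<lambda>r. h1_size (x + r *\<^sub>R n))" by (rule continuous_on_subset) simp
    have i2: "(\<lambda>r. h1_size (x + r *\<^sub>R n)) integrable_on {0..1}"
      by (rule integrable_continuous_real[OF cs'])
    have "norm (\<phi> x) \<le> integral {0..1} (\<lambda>r. h1_size (x + r *\<^sub>R n))"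
    proof -
      have "norm (integral {0..1} ?g') \<le> integral {0..1} (\<lambda>r. h1_size (x + r *\<^sub>R n))"
      proof (rule integral_norm_bound_integral)
        show "?g' integrable_on {0..1}" using int by auto
        fix r :: real assume r: "r \<in> {0..1}"
        have "norm (?g' r) \<le> norm ((1 - r) *\<^sub>R (J (x + r *\<^sub>R n) *v n)) + norm (\<phi> (x + r *\<^sub>R n))"
          by (rule norm_triangle_ineq4)
        also have "norm ((1 - r) *\<^sub>R (J (x + r *\<^sub>R n) *v n)) \<le> norm (J (x + r *\<^sub>R n) *v n)"
          using r by (simp add: mult_left_le_one_le)
        also have "\<dots> \<le> norm (J (x + r *\<^sub>R n))"
          using norm_matrix_vector_le[of "J (x + r *\<^sub>R n)" n] n by simp
        finally show "norm (?g' r) \<le> h1_size (x + r *\<^sub>R n)" by simp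
      qed (rule i2)
      then show ?thesis using int by (simp add: integral_unique)
    qed
    also have "ennreal (integral {0..1} (\<lambda>r. h1_size (x + r *\<^sub>R n)))
      = (\<integral>\<^sup>+r. ennreal (h1_size (x + r *\<^sub>R n) * indicator {0..1} r) \<partial>lborel)"
    proof (rule nn_integral_has_integral_lborel[symmetric])
      show "((\<lambda>r. h1_size (x + r *\<^sub>R n) * indicator {0..1} r) has_integral
          integral {0..1} (\<lambda>r. h1_size (x + r *\<^sub>R n))) UNIV"
        using integrable_integral[OF i2]
        by (subst (asm) has_integral_restrict_UNIV[symmetric]) (simp add: indicator_def of_bool_def if_distrib[where f = "\<lambda>c. _ * c"] cong: if_cong)
    qed auto
    also have "\<dots> = (\<integral>\<^sup>+r. indicator {0<..1} r * ennreal (h1_size (x + r *\<^sub>R n)) \<partial>lborel)"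
    proof (rule nn_integral_cong_AE)
      show "AE r in lborel. ennreal (h1_size (x + r *\<^sub>R n) * indicator {0..1} r)
        = indicator {0<..1} r * ennreal (h1_size (x + r *\<^sub>R n))"
        using AE_lborel_singleton[of "0 :: real"] by eventually_elim (auto simp: indicator_def)
    qed
    finally show ?thesis by (simp add: ennreal_leI)
  qed
  have "emeasure sphere_measure UNIV * ennreal (norm (\<phi> x)) = (\<integral>\<^sup>+n. ennreal (norm (\<phi> x)) \<partial>sphere_measure)"
    by (simp add: mult.commute)
  also have "\<dots> \<le> (\<integral>\<^sup>+n. (\<integral>\<^sup>+r. indicator {0<..1} r * ennreal (h1_size (x + r *\<^sub>R n)) \<partial>lborel) \<partial>sphere_measure)"
    by (rule nn_integral_mono_AE) (use AE_sphere_norm in eventually_elim, rule radial)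
  also have "\<dots> = (\<integral>\<^sup>+r. (\<integral>\<^sup>+n. indicator {0<..1} r * ennreal (h1_size (x + r *\<^sub>R n)) \<partial>sphere_measure) \<partial>lborel)"
  proof -
    interpret pair_sigma_finite sphere_measure "lborel :: real measure" ..
    show ?thesis by (rule Fubini'[symmetric]) measurable
  qed
  also have "\<dots> = (\<integral>\<^sup>+r. indicator {0<..} r * ennreal (r\<^sup>2) *
      (\<integral>\<^sup>+n. indicator (cball 0 1) (r *\<^sub>R n) * (ennreal (h1_size (x + r *\<^sub>R n)) * (riesz (r *\<^sub>R n)) ^ 3) \<partial>sphere_measure) \<partial>lborel)"
  proof (rule nn_integral_cong)
    fix r :: real
    show "(\<integral>\<^sup>+n. indicator {0<..1} r * ennreal (h1_size (x + r *\<^sub>R n)) \<partial>sphere_measure)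
      = indicator {0<..} r * ennreal (r\<^sup>2) * (\<integral>\<^sup>+n. indicator (cball 0 1) (r *\<^sub>R n) *
          (ennreal (h1_size (x + r *\<^sub>R n)) * (riesz (r *\<^sub>R n)) ^ 3) \<partial>sphere_measure)"
    proof (cases "0 < r")
      case True
      have p: "r\<^sup>2 * (r powr (- 2 / 3)) ^ 3 = 1"
        using True by (simp add: powr_numeral[symmetric] powr_powr powr_add[symmetric] del: powr_numeral)
      have "(\<integral>\<^sup>+n. indicator {0<..1} r * ennreal (h1_size (x + r *\<^sub>R n)) \<partial>sphere_measure)
        = (\<integral>\<^sup>+n. ennreal (r\<^sup>2) * (indicator (cball 0 1) (r *\<^sub>R n) *
            (ennreal (h1_size (x + r *\<^sub>R n)) * (riesz (r *\<^sub>R n)) ^ 3)) \<partial>sphere_measure)"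
      proof (rule nn_integral_cong_AE)
        show "AE n in sphere_measure. indicator {0<..1} r * ennreal (h1_size (x + r *\<^sub>R n))
          = ennreal (r\<^sup>2) * (indicator (cball 0 1) (r *\<^sub>R n) * (ennreal (h1_size (x + r *\<^sub>R n)) * (riesz (r *\<^sub>R n)) ^ 3))"
          using AE_sphere_norm
        proof eventually_elim
          case (elim n)
          have "ennreal (r\<^sup>2) * (riesz (r *\<^sub>R n)) ^ 3 = ennreal (r\<^sup>2 * (r powr (- 2 / 3)) ^ 3)"
            using True elim by (simp add: riesz_def ennreal_power ennreal_mult)
          then have one: "ennreal (r\<^sup>2) * (riesz (r *\<^sub>R n)) ^ 3 = 1" by (simp only: p) simp
          have "ennreal (r\<^sup>2) * (indicator (cball 0 1) (r *\<^sub>R n) * (ennreal (h1_size (x + r *\<^sub>R n)) * (riesz (r *\<^sub>R n)) ^ 3))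
            = (ennreal (r\<^sup>2) * (riesz (r *\<^sub>R n)) ^ 3) * (indicator (cball 0 1) (r *\<^sub>R n) * ennreal (h1_size (x + r *\<^sub>R n)))"
            by (simp only: mult_ac)
          then show ?case using True elim by (simp add: one indicator_def)
        qed
      qed
      also have "\<dots> = ennreal (r\<^sup>2) * (\<integral>\<^sup>+n. indicator (cball 0 1) (r *\<^sub>R n) *
            (ennreal (h1_size (x + r *\<^sub>R n)) * (riesz (r *\<^sub>R n)) ^ 3) \<partial>sphere_measure)"
        by (rule nn_integral_cmult) measurable
      finally show ?thesis using True by simp
    qed simp
  qed
  also have "\<dots> = (\<integral>\<^sup>+h. indicator (cball 0 1) h * (ennreal (h1_size (x + h)) * (riesz h) ^ 3) \<partial>lborel)"
    by (rule nn_integral_polar[symmetric]) measurable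
  also have "\<dots> = (\<integral>\<^sup>+h. ennreal (h1_size (x + h)) * (riesz h) ^ 3 \<partial>leb_on (cball 0 1))"
    by (rule nn_integral_leb_on[symmetric]) (simp, measurable)
  finally show ?thesis .
qed

text \<open>Cauchy-Schwarz on the potential, with the kernel split as \<open>riesz\<close> times its
  square, bounds the square of the field. Multiplying by the field, exchanging the integrals and
  shifting \<open>x\<close> leaves a ball average of the field against the squared
  \<open>riesz\<close>, which a second Cauchy-Schwarz bounds. The result is quadratic in the
  \<open>H\<^sup>1\<close> size and linear in the \<open>L\<^sup>2\<close> norm.\<close>

lemma L3_bound:
  "(measure sphere_measure UNIV)\<^sup>2 * (LINT x|torus. norm (\<phi> x) ^ 3)
    \<le> enn2real (\<integral>\<^sup>+h. (riesz h) ^ 4 \<partial>leb_on (cball 0 1))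
      * sqrt (enn2real (\<integral>\<^sup>+h. (riesz h) ^ 4 \<partial>leb_on (cball 0 1))) * (l2 torus h1_size)\<^sup>2 * l2 torus \<phi>"
proof -
  define A where "A = enn2real (\<integral>\<^sup>+h. (riesz h) ^ 4 \<partial>leb_on (cball 0 1))"
  have A: "(\<integral>\<^sup>+h. (riesz h) ^ 4 \<partial>leb_on (cball 0 1)) = ennreal A" "0 \<le> A"
    using riesz_integral_finite by (simp_all add: A_def)
  define S where "S = measure sphere_measure UNIV"
  have S: "emeasure sphere_measure UNIV = ennreal S" "0 \<le> S"
    using sphere.emeasure_eq_measure by (simp_all add: S_def)
  let ?B = "leb_on (cball 0 1 :: (real^3) set)"
  let ?F = "\<lambda>x. ennreal (h1_size x)" and ?P = "\<lambda>x. ennreal (norm (\<phi> x))"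
  have cs: "continuous_on UNIV h1_size" "continuous_on UNIV \<phi>" by (intro cont)+
  note [measurable] = continuous_borel_measurable[OF cs(1)] continuous_borel_measurable[OF cs(2)]
  have per: "periodic ?F" "periodic (\<lambda>x. (?P x)\<^sup>2)" "periodic (\<lambda>x. ?P x * (?F (x + h))\<^sup>2)" for h
    using periodic_combination[where F = "\<lambda>u u' K K' h. ennreal (norm K + norm u)"]
      periodic_combination[where F = "\<lambda>u u' K K' h. (ennreal (norm u))\<^sup>2"]
      periodic_combination[where F = "\<lambda>u u' K K' h. ennreal (norm u) * (ennreal (norm K' + norm u'))\<^sup>2" and h = h]
    by simp_all
  have sq1: "sqint torus h1_size"
    using sqint_fields by (intro sqint_add sqint_norm)
  have eF: "(\<integral>\<^sup>+x. (?F x)\<^sup>2 \<partial>torus) = ennreal ((l2 torus h1_size)\<^sup>2)"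
    using nn_integral_eq_l2[OF sq1] by (simp add: add_nonneg_nonneg)
  have eP: "(\<integral>\<^sup>+x. (?P x)\<^sup>2 \<partial>torus) = ennreal ((l2 torus \<phi>)\<^sup>2)"
    by (rule nn_integral_eq_l2[OF sqint_fields(1)])
  have pw: "(ennreal S)\<^sup>2 * (?P x)\<^sup>2 \<le> ennreal A * (\<integral>\<^sup>+h. (?F (x + h))\<^sup>2 * (riesz h)\<^sup>2 \<partial>?B)" for x
  proof -
    have "(ennreal S)\<^sup>2 * (?P x)\<^sup>2 = (ennreal S * ?P x)\<^sup>2" by (simp add: power_mult_distrib)
    also have "\<dots> \<le> (\<integral>\<^sup>+h. (?F (x + h) * riesz h) * (riesz h)\<^sup>2 \<partial>?B)\<^sup>2"
      using pointwise_le_riesz_potential[of x]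
      by (intro power_mono) (simp_all add: S mult.assoc power3_eq_cube power2_eq_square)
    also have "\<dots> \<le> (\<integral>\<^sup>+h. (?F (x + h) * riesz h)\<^sup>2 \<partial>?B) * (\<integral>\<^sup>+h. ((riesz h)\<^sup>2)\<^sup>2 \<partial>?B)"
      by (rule Cauchy_Schwarz_nn_integral) measurable
    also have "(\<integral>\<^sup>+h. ((riesz h)\<^sup>2)\<^sup>2 \<partial>?B) = ennreal A"
      by (simp add: A(1)[symmetric] power_mult[symmetric])
    finally show ?thesis by (simp add: power_mult_distrib mult.commute)
  qed
  have inner: "(\<integral>\<^sup>+h. (riesz h)\<^sup>2 * ?P (x + - h) \<partial>?B) \<le> ennreal (sqrt A * l2 torus \<phi>)" for x
  proof (rule ennreal_power2_le_imp_le)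
    have "(\<integral>\<^sup>+h. (riesz h)\<^sup>2 * ?P (x + - h) \<partial>?B)\<^sup>2
      \<le> (\<integral>\<^sup>+h. ((riesz h)\<^sup>2)\<^sup>2 \<partial>?B) * (\<integral>\<^sup>+h. (?P (x + - h))\<^sup>2 \<partial>?B)"
      by (rule Cauchy_Schwarz_nn_integral) measurable
    also have "(\<integral>\<^sup>+h. ((riesz h)\<^sup>2)\<^sup>2 \<partial>?B) = ennreal A"
      by (simp add: A(1)[symmetric] power_mult[symmetric])
    also have "(\<integral>\<^sup>+h. (?P (x + - h))\<^sup>2 \<partial>?B) = (\<integral>\<^sup>+h. (?P (x + h))\<^sup>2 \<partial>distr ?B borel uminus)"
      by (subst nn_integral_distr) auto
    also have "\<dots> \<le> ennreal ((l2 torus \<phi>)\<^sup>2)"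
      unfolding distr_ball_uminus eP[symmetric] by (rule nn_integral_ball_le_torus[OF per(2)]) auto
    finally show "(\<integral>\<^sup>+h. (riesz h)\<^sup>2 * ?P (x + - h) \<partial>?B)\<^sup>2 \<le> (ennreal (sqrt A * l2 torus \<phi>))\<^sup>2"
      using A(2) by (simp add: ennreal_power power_mult_distrib ennreal_mult mult_left_mono)
  qed (use A(2) in simp)
  have "(ennreal S)\<^sup>2 * (\<integral>\<^sup>+x. (?P x) ^ 3 \<partial>torus) = (\<integral>\<^sup>+x. ?P x * ((ennreal S)\<^sup>2 * (?P x)\<^sup>2) \<partial>torus)"
    by (subst nn_integral_cmult[symmetric]) (auto simp: power3_eq_cube power2_eq_square mult_ac)
  also have "\<dots> \<le> (\<integral>\<^sup>+x. ?P x * (ennreal A * (\<integral>\<^sup>+h. (?F (x + h))\<^sup>2 * (riesz h)\<^sup>2 \<partial>?B)) \<partial>torus)"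
    by (intro nn_integral_mono mult_left_mono pw) simp
  also have "\<dots> = ennreal A * (\<integral>\<^sup>+x. (\<integral>\<^sup>+h. (riesz h)\<^sup>2 * (?P x * (?F (x + h))\<^sup>2) \<partial>?B) \<partial>torus)"
  proof (subst nn_integral_cmult[symmetric], measurable, rule nn_integral_cong)
    fix x
    show "?P x * (ennreal A * (\<integral>\<^sup>+h. (?F (x + h))\<^sup>2 * (riesz h)\<^sup>2 \<partial>?B))
      = ennreal A * (\<integral>\<^sup>+h. (riesz h)\<^sup>2 * (?P x * (?F (x + h))\<^sup>2) \<partial>?B)"
      by (subst mult.left_commute, subst (2) mult.left_commute, subst nn_integral_cmult, measurable, simp only: mult_ac)
  qed
  also have "(\<integral>\<^sup>+x. (\<integral>\<^sup>+h. (riesz h)\<^sup>2 * (?P x * (?F (x + h))\<^sup>2) \<partial>?B) \<partial>torus)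
    = (\<integral>\<^sup>+h. (\<integral>\<^sup>+x. (riesz h)\<^sup>2 * (?P x * (?F (x + h))\<^sup>2) \<partial>torus) \<partial>?B)"
  proof -
    interpret pair_sigma_finite torus ?B ..
    show ?thesis by (rule Fubini'[symmetric]) measurable
  qed
  also have "\<dots> = (\<integral>\<^sup>+h. (\<integral>\<^sup>+x. (riesz h)\<^sup>2 * (?P (x + - h) * (?F x)\<^sup>2) \<partial>torus) \<partial>?B)"
  proof (rule nn_integral_cong)
    fix h
    have "(\<integral>\<^sup>+x. (riesz h)\<^sup>2 * (?P x * (?F (x + h))\<^sup>2) \<partial>torus) = (riesz h)\<^sup>2 * (\<integral>\<^sup>+x. ?P x * (?F (x + h))\<^sup>2 \<partial>torus)"
      by (rule nn_integral_cmult) measurable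
    also have "(\<integral>\<^sup>+x. ?P x * (?F (x + h))\<^sup>2 \<partial>torus) = (\<integral>\<^sup>+x. ?P (x + - h) * (?F (x + - h + h))\<^sup>2 \<partial>torus)"
      by (rule nn_integral_torus_shift[OF per(3), symmetric]) measurable
    also have "(\<lambda>x. ?P (x + - h) * (?F (x + - h + h))\<^sup>2) = (\<lambda>x. ?P (x + - h) * (?F x)\<^sup>2)" by simp
    also have "(riesz h)\<^sup>2 * (\<integral>\<^sup>+x. ?P (x + - h) * (?F x)\<^sup>2 \<partial>torus)
      = (\<integral>\<^sup>+x. (riesz h)\<^sup>2 * (?P (x + - h) * (?F x)\<^sup>2) \<partial>torus)"
      by (rule nn_integral_cmult[symmetric]) measurable
    finally show "(\<integral>\<^sup>+x. (riesz h)\<^sup>2 * (?P x * (?F (x + h))\<^sup>2) \<partial>torus)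
      = (\<integral>\<^sup>+x. (riesz h)\<^sup>2 * (?P (x + - h) * (?F x)\<^sup>2) \<partial>torus)" .
  qed
  also have "\<dots> = (\<integral>\<^sup>+x. (\<integral>\<^sup>+h. (riesz h)\<^sup>2 * (?P (x + - h) * (?F x)\<^sup>2) \<partial>?B) \<partial>torus)"
  proof -
    interpret pair_sigma_finite torus ?B ..
    show ?thesis by (rule Fubini') measurable
  qed
  also have "\<dots> = (\<integral>\<^sup>+x. (?F x)\<^sup>2 * (\<integral>\<^sup>+h. (riesz h)\<^sup>2 * ?P (x + - h) \<partial>?B) \<partial>torus)"
    by (intro nn_integral_cong, subst nn_integral_cmult[symmetric]) (auto simp: mult_ac)
  also have "\<dots> \<le> (\<integral>\<^sup>+x. (?F x)\<^sup>2 * ennreal (sqrt A * l2 torus \<phi>) \<partial>torus)"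
    by (intro nn_integral_mono mult_left_mono inner) simp
  also have "\<dots> = ennreal ((l2 torus h1_size)\<^sup>2) * ennreal (sqrt A * l2 torus \<phi>)"
    by (subst nn_integral_multc, measurable, simp only: eF)
  finally have le: "(ennreal S)\<^sup>2 * (\<integral>\<^sup>+x. (?P x) ^ 3 \<partial>torus)
    \<le> ennreal A * (ennreal ((l2 torus h1_size)\<^sup>2) * ennreal (sqrt A * l2 torus \<phi>))"
    by (simp add: mult_left_mono)
  have "continuous_on UNIV (\<lambda>x. norm (\<phi> x) ^ 3)" by (intro cont)
  then have "integrable torus (\<lambda>x. norm (\<phi> x) ^ 3)"
    by (intro integrable_leb_on_continuous) (simp_all add: torus_box_def compact_cbox)
  then have "(\<integral>\<^sup>+x. (?P x) ^ 3 \<partial>torus) = ennreal (LINT x|torus. norm (\<phi> x) ^ 3)"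
    by (subst nn_integral_eq_integral[symmetric]) (auto simp: ennreal_power)
  with le have "ennreal (S\<^sup>2 * (LINT x|torus. norm (\<phi> x) ^ 3)) \<le> ennreal (A * ((l2 torus h1_size)\<^sup>2 * (sqrt A * l2 torus \<phi>)))"
    using S(2) A(2) by (simp add: ennreal_power ennreal_mult)
  then have "S\<^sup>2 * (LINT x|torus. norm (\<phi> x) ^ 3) \<le> A * ((l2 torus h1_size)\<^sup>2 * (sqrt A * l2 torus \<phi>))"
    using A(2) by (subst (asm) ennreal_le_iff) auto
  then show ?thesis by (simp add: S_def[symmetric] A_def[symmetric] mult_ac)
qed

end

section \<open>Cubic integrals along approximating sequences\<close>

lemma cube_sum_le: "(a + b) ^ 3 \<le> 4 * (a ^ 3 + b ^ 3)" if "0 \<le> a" "0 \<le> b" for a b :: real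
proof -
  have "0 \<le> 3 * (a + b) * (a - b)\<^sup>2" using that by simp
  also have "3 * (a + b) * (a - b)\<^sup>2 = 4 * (a ^ 3 + b ^ 3) - (a + b) ^ 3"
    by (simp add: power2_eq_square power3_eq_cube algebra_simps)
  finally show ?thesis by simp
qed

lemma norm_diff_cube_le: "norm (a - b) ^ 3 \<le> 4 * (norm a ^ 3 + norm b ^ 3)"
  by (rule order_trans[OF power_mono[OF norm_triangle_ineq4] cube_sum_le]) auto

text \<open>Either \<open>x \<le> \<mu> * y\<close> or \<open>y \<le> x / \<mu>\<close>; each case
  yields one of the two terms.\<close>

lemma young_cube:
  fixes x y :: real
  assumes "0 \<le> x" "0 \<le> y" "0 < \<mu>"
  shows "x * y\<^sup>2 \<le> x ^ 3 / \<mu>\<^sup>2 + \<mu> * y ^ 3"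
proof (cases "x \<le> \<mu> * y")
  case True
  then have "x * y\<^sup>2 \<le> (\<mu> * y) * y\<^sup>2" by (rule mult_right_mono) simp
  then show ?thesis using assms by (simp add: power2_eq_square power3_eq_cube add_increasing mult.assoc)
next
  case False
  then have "y \<le> x / \<mu>" using assms by (simp add: field_simps)
  then have "y\<^sup>2 \<le> (x / \<mu>)\<^sup>2" using assms by (intro power_mono) auto
  then have "x * y\<^sup>2 \<le> x * (x / \<mu>)\<^sup>2" using assms by (intro mult_left_mono) auto
  also have "\<dots> = x ^ 3 / \<mu>\<^sup>2" by (simp add: power2_eq_square power3_eq_cube)
  finally show ?thesis using assms by (simp add: add_increasing2)
qed

lemma integrable_cube_diff:
  fixes f g :: "'a \<Rightarrow> 'b::euclidean_space"
  assumes [measurable]: "f \<in> borel_measurable M" "g \<in> borel_measurable M"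
    and i: "integrable M (\<lambda>x. norm (f x) ^ 3)" "integrable M (\<lambda>x. norm (g x) ^ 3)"
  shows "integrable M (\<lambda>x. norm (f x - g x) ^ 3)"
    and "(LINT x|M. norm (f x - g x) ^ 3) \<le> 4 * ((LINT x|M. norm (f x) ^ 3) + (LINT x|M. norm (g x) ^ 3))"
proof -
  have b: "integrable M (\<lambda>x. 4 * (norm (f x) ^ 3 + norm (g x) ^ 3))" using i by simp
  show d: "integrable M (\<lambda>x. norm (f x - g x) ^ 3)"
    by (rule Bochner_Integration.integrable_bound[OF b]) (use norm_diff_cube_le in \<open>auto intro!: AE_I2\<close>)
  have "(LINT x|M. norm (f x - g x) ^ 3) \<le> (LINT x|M. 4 * (norm (f x) ^ 3 + norm (g x) ^ 3))"
    by (intro integral_mono d b norm_diff_cube_le)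
  then show "(LINT x|M. norm (f x - g x) ^ 3) \<le> 4 * ((LINT x|M. norm (f x) ^ 3) + (LINT x|M. norm (g x) ^ 3))"
    using i by simp
qed

text \<open>\<open>young_cube\<close> bounds the difference by a large multiple of the cubic
  distance plus a small multiple of the cubic norm of the limit. The parameter \<open>\<mu>\<close>
  is fixed first, the index afterwards.\<close>

lemma cubic_integral_tendsto:
  fixes a :: "'a \<Rightarrow> 'b::euclidean_space" and Q :: "'b \<Rightarrow> real"
  assumes m [measurable]: "\<And>n. s n \<in> borel_measurable M" "a \<in> borel_measurable M" "Q \<in> borel_measurable borel"
    and i: "\<And>n. integrable M (\<lambda>x. norm (s n x) ^ 3)" "integrable M (\<lambda>x. norm (a x) ^ 3)"
    and lim: "(\<lambda>n. LINT x|M. norm (s n x - a x) ^ 3) \<longlonglongrightarrow> 0"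
    and Q: "\<And>p q. \<bar>Q p - Q q\<bar> \<le> 3 * norm (p - q) * ((norm p)\<^sup>2 + (norm q)\<^sup>2)" "Q 0 = 0"
  shows "(\<lambda>n. LINT x|M. Q (s n x)) \<longlonglongrightarrow> (LINT x|M. Q (a x))"
proof -
  have Q3: "\<bar>Q p\<bar> \<le> 3 * norm p ^ 3" for p using Q(1)[of p 0] Q(2) by (simp add: power2_eq_square power3_eq_cube)
  have iQ: "integrable M (\<lambda>x. Q (f x))"
    if [measurable]: "f \<in> borel_measurable M" and "integrable M (\<lambda>x. norm (f x) ^ 3)" for f
  proof (rule Bochner_Integration.integrable_bound)
    show "integrable M (\<lambda>x. 3 * norm (f x) ^ 3)" using that by simp
  qed (use Q3 in \<open>auto intro!: AE_I2\<close>)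
  define e where "e n = (LINT x|M. norm (s n x - a x) ^ 3)" for n
  define L where "L = (LINT x|M. norm (a x) ^ 3)"
  have L0: "0 \<le> L" by (simp add: L_def)
  have bound: "\<bar>(LINT x|M. Q (s n x)) - (LINT x|M. Q (a x))\<bar> \<le> (9 / \<mu>\<^sup>2 + 6) * e n + 9 * \<mu> * L" if "0 < \<mu>" for n \<mu>
  proof -
    have pt: "\<bar>Q p - Q q\<bar> \<le> (9 / \<mu>\<^sup>2 + 6) * norm (p - q) ^ 3 + 9 * \<mu> * norm q ^ 3" for p q :: 'b
    proof -
      have "norm p \<le> norm q + norm (p - q)" using norm_triangle_ineq[of q "p - q"] by simp
      then have "(norm p)\<^sup>2 \<le> (norm q + norm (p - q))\<^sup>2" by (rule power_mono) simp
      also have "\<dots> \<le> 2 * (norm q)\<^sup>2 + 2 * (norm (p - q))\<^sup>2"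
        using sum_squares_bound[of "norm q" "norm (p - q)"] by (simp add: power2_sum)
      finally have "3 * norm (p - q) * ((norm p)\<^sup>2 + (norm q)\<^sup>2)
        \<le> 3 * norm (p - q) * ((2 * (norm q)\<^sup>2 + 2 * (norm (p - q))\<^sup>2) + (norm q)\<^sup>2)"
        by (intro mult_left_mono) auto
      also have "\<dots> = 9 * (norm (p - q) * (norm q)\<^sup>2) + 6 * norm (p - q) ^ 3"
        by (simp add: power2_eq_square power3_eq_cube algebra_simps)
      also have "\<dots> \<le> 9 * (norm (p - q) ^ 3 / \<mu>\<^sup>2 + \<mu> * norm q ^ 3) + 6 * norm (p - q) ^ 3"
        using young_cube[of "norm (p - q)" "norm q" \<mu>] that by simp
      finally show ?thesis using Q(1)[of p q] by (simp add: algebra_simps)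
    qed
    have d: "integrable M (\<lambda>x. norm (s n x - a x) ^ 3)" by (rule integrable_cube_diff(1)) (auto intro: i)
    have ib: "integrable M (\<lambda>x. (9 / \<mu>\<^sup>2 + 6) * norm (s n x - a x) ^ 3 + 9 * \<mu> * norm (a x) ^ 3)"
      using d i by auto
    have "\<bar>LINT x|M. Q (s n x) - Q (a x)\<bar> \<le> (LINT x|M. (9 / \<mu>\<^sup>2 + 6) * norm (s n x - a x) ^ 3 + 9 * \<mu> * norm (a x) ^ 3)"
      by (rule integral_abs_le_AE[OF ib]) (use pt in \<open>auto intro!: AE_I2\<close>)
    then show ?thesis using iQ i d by (simp add: e_def L_def)
  qed
  show ?thesis
  proof (rule LIM_zero_cancel, rule LIMSEQ_I)
    fix r :: real assume r: "0 < r"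
    \<comment> \<open>This makes \<open>9 * \<mu> * L\<close> at most \<open>r / 2\<close>; adding
      one to \<open>L\<close> covers the case \<open>L = 0\<close>.\<close>
    define \<mu> where "\<mu> = r / (18 * (L + 1))"
    have l: "0 < \<mu>" and l2: "9 * \<mu> * L \<le> r / 2"
      using r L0 by (auto simp: \<mu>_def field_simps add_nonneg_pos)
    define c where "c = 9 / \<mu>\<^sup>2 + 6"
    have c: "0 < c" by (simp add: c_def add_nonneg_pos)
    have "e \<longlonglongrightarrow> 0" using lim by (simp add: e_def[abs_def])
    from LIMSEQ_D[OF this, of "r / (2 * c)"] r c
    obtain N where N: "\<And>n. n \<ge> N \<Longrightarrow> \<bar>e n\<bar> < r / (2 * c)" by (auto simp: field_simps)
    have "\<bar>(LINT x|M. Q (s n x)) - (LINT x|M. Q (a x))\<bar> < r" if "n \<ge> N" for n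
    proof -
      have "c * e n < r / 2" using N[OF that] c by (simp add: field_simps abs_less_iff)
      moreover have "\<bar>(LINT x|M. Q (s n x)) - (LINT x|M. Q (a x))\<bar> \<le> c * e n + 9 * \<mu> * L"
        using bound[OF l, of n] by (simp add: c_def)
      ultimately show ?thesis using l2 by linarith
    qed
    then show "\<exists>no. \<forall>n\<ge>no. norm ((LINT x|M. Q (s n x)) - (LINT x|M. Q (a x)) - 0) < r" by auto
  qed
qed

lemma C1_div_diff:
  assumes "C1_div \<phi> J" "C1_div \<psi> K"
  shows "C1_div (\<lambda>x. \<phi> x - \<psi> x) (\<lambda>x. J x - K x)"
  using assms unfolding C1_div_def periodic_def
  by (auto intro!: derivative_eq_intros continuous_intros
      simp: matrix_vector_mult_diff_rdistrib trace_sub)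

definition L3_const :: real where
  "L3_const = enn2real (\<integral>\<^sup>+h. (riesz h) ^ 4 \<partial>leb_on (cball 0 1))
      * sqrt (enn2real (\<integral>\<^sup>+h. (riesz h) ^ 4 \<partial>leb_on (cball 0 1))) / (measure sphere_measure UNIV)\<^sup>2"

lemma L3_const_nonneg: "0 \<le> L3_const"
  by (simp add: L3_const_def)

lemma C1_div_L3_bound:
  assumes "C1_div \<phi> J"
  shows "(LINT x|torus. norm (\<phi> x) ^ 3) \<le> L3_const * ((l2 torus J + l2 torus \<phi>)\<^sup>2 * l2 torus \<phi>)"
    and "integrable torus (\<lambda>x. norm (\<phi> x) ^ 3)"
proof -
  interpret C1_div_field \<phi> J by unfold_locales fact
  have "l2 torus (\<lambda>x. norm (J x) + norm (\<phi> x)) \<le> l2 torus J + l2 torus \<phi>"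
    using l2_add[OF sqint_norm[OF sqint_fields(2)] sqint_norm[OF sqint_fields(1)]] by (simp add: l2_norm)
  then have "(l2 torus h1_size)\<^sup>2 * l2 torus \<phi> \<le> (l2 torus J + l2 torus \<phi>)\<^sup>2 * l2 torus \<phi>"
    by (intro mult_right_mono power_mono) auto
  then have "L3_const * ((l2 torus h1_size)\<^sup>2 * l2 torus \<phi>) \<le> L3_const * ((l2 torus J + l2 torus \<phi>)\<^sup>2 * l2 torus \<phi>)"
    by (rule mult_left_mono[OF _ L3_const_nonneg])
  moreover have "(LINT x|torus. norm (\<phi> x) ^ 3) \<le> L3_const * ((l2 torus h1_size)\<^sup>2 * l2 torus \<phi>)"
    using L3_bound sphere_measure_pos by (simp add: L3_const_def field_simps)
  ultimately show "(LINT x|torus. norm (\<phi> x) ^ 3) \<le> L3_const * ((l2 torus J + l2 torus \<phi>)\<^sup>2 * l2 torus \<phi>)"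
    by linarith
  have "continuous_on UNIV (\<lambda>x. norm (\<phi> x) ^ 3)" by (intro cont)
  then show "integrable torus (\<lambda>x. norm (\<phi> x) ^ 3)"
    by (intro integrable_leb_on_continuous) (simp_all add: torus_box_def compact_cbox)
qed

text \<open>Fixes one approximating sequence, so that each identity for smooth fields can be
  extended to \<open>v\<close> and \<open>G\<close> by a limit in this context.\<close>

locale H1_approx =
  fixes v :: "real^3 \<Rightarrow> real^3" and G :: "real^3 \<Rightarrow> real^3^3"
    and \<phi> :: "nat \<Rightarrow> real^3 \<Rightarrow> real^3" and J :: "nat \<Rightarrow> real^3 \<Rightarrow> real^3^3"
  assumes v: "v \<in> L2_torus" and G: "G \<in> L2_torus" and C1: "\<And>n. C1_div (\<phi> n) (J n)"
    and lim_v: "(\<lambda>n. l2 torus (\<lambda>x. v x - \<phi> n x)) \<longlonglongrightarrow> 0"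
    and lim_G: "(\<lambda>n. l2 torus (\<lambda>x. G x - J n x)) \<longlonglongrightarrow> 0"

lemma C1_div_L2_torus:
  assumes "C1_div \<phi> J"
  shows "\<phi> \<in> L2_torus" "J \<in> L2_torus"
proof -
  interpret C1_div_field \<phi> J by unfold_locales fact
  show "\<phi> \<in> L2_torus" "J \<in> L2_torus"
    using sqint_fields C1_divD[OF C1] by (simp_all add: L2_torus_iff continuous_borel_measurable)
qed

lemma has_gradient_imp_H1_approx:
  assumes "has_gradient v G"
  obtains \<phi> where "\<And>n. \<phi> n \<in> Cinf_div" "H1_approx v G \<phi> (\<lambda>n x. jacobian (\<phi> n) (at x))"
proof -
  obtain \<phi> where \<phi>: "\<And>n. \<phi> n \<in> Cinf_div" and v: "v \<in> L2_torus" "G \<in> L2_torus"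
    and lim: "(\<lambda>n. L2_norm (\<lambda>x. v x - \<phi> n x)) \<longlonglongrightarrow> 0"
      "(\<lambda>n. L2_norm (\<lambda>x. G x - jacobian (\<phi> n) (at x))) \<longlonglongrightarrow> 0"
    using assms unfolding has_gradient_def by blast
  have [measurable]: "v \<in> borel_measurable borel" "G \<in> borel_measurable borel"
    "\<phi> n \<in> borel_measurable borel" "(\<lambda>x. jacobian (\<phi> n) (at x)) \<in> borel_measurable borel" for n
    using v C1_div_L2_torus[OF Cinf_div_C1_div[OF \<phi>]] by (auto simp: L2_torus_iff)
  have "H1_approx v G \<phi> (\<lambda>n x. jacobian (\<phi> n) (at x))"
    by unfold_locales (use v lim in \<open>auto simp: L2_norm_eq intro: Cinf_div_C1_div \<phi>\<close>)
  then show ?thesis using that \<phi> by blast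
qed

lemma l2_diff_commute: "l2 M (\<lambda>x. f x - g x) = l2 M (\<lambda>x. g x - f x)"
  by (simp add: l2_def norm_minus_commute)

context H1_approx
begin

lemma sq: "sqint torus v" "sqint torus G" "sqint torus (\<phi> n)" "sqint torus (J n)"
  using v G C1_div_L2_torus[OF C1] by (auto simp: L2_torus_iff)

lemma meas [measurable]: "v \<in> borel_measurable borel" "G \<in> borel_measurable borel"
  "\<phi> n \<in> borel_measurable borel" "J n \<in> borel_measurable borel"
  using v G C1_div_L2_torus[OF C1] by (auto simp: L2_torus_iff)

text \<open>The cubic bound is available for differences of two approximants. Fatou's lemma along a
  subsequence transfers it to \<open>\<phi> n - v\<close>, where it tends to zero; subtraction from
  one approximant then gives integrability of the cube of \<open>v\<close>.\<close>

lemma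
  shows L3_integrable: "integrable torus (\<lambda>x. norm (v x) ^ 3)"
    and L3_tendsto: "(\<lambda>n. LINT x|torus. norm (\<phi> n x - v x) ^ 3) \<longlonglongrightarrow> 0"
proof -
  let ?b = "\<lambda>n. L3_const * ((l2 torus (\<lambda>x. J n x - G x) + l2 torus (\<lambda>x. \<phi> n x - v x))\<^sup>2 * l2 torus (\<lambda>x. \<phi> n x - v x))"
  have "(\<lambda>n. l2 torus (\<lambda>x. \<phi> n x - v x)) \<longlonglongrightarrow> 0"
    using lim_v by (simp add: l2_diff_commute[of _ v])
  from l2_tendsto_AE_subseq[OF torus.finite_measure_axioms sq(3) sq(1) this]
  obtain r where r: "strict_mono r" "AE x in torus. (\<lambda>n. \<phi> (r n) x) \<longlonglongrightarrow> v x" .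
  have "(\<integral>\<^sup>+x. ennreal (norm (\<phi> n x - v x) ^ 3) \<partial>torus) \<le> ennreal (?b n)" for n
  proof -
    let ?c = "\<lambda>m. L3_const * ((l2 torus (\<lambda>x. J n x - J (r m) x) + l2 torus (\<lambda>x. \<phi> n x - \<phi> (r m) x))\<^sup>2
        * l2 torus (\<lambda>x. \<phi> n x - \<phi> (r m) x))"
    have "(\<integral>\<^sup>+x. ennreal (norm (\<phi> n x - v x) ^ 3) \<partial>torus)
      = (\<integral>\<^sup>+x. liminf (\<lambda>m. ennreal (norm (\<phi> n x - \<phi> (r m) x) ^ 3)) \<partial>torus)"
    proof (rule nn_integral_cong_AE, use r(2) in eventually_elim)
      case (elim x)
      have "(\<lambda>m. ennreal (norm (\<phi> n x - \<phi> (r m) x) ^ 3)) \<longlonglongrightarrow> ennreal (norm (\<phi> n x - v x) ^ 3)"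
        by (intro tendsto_ennrealI tendsto_intros elim)
      then show ?case by (intro lim_imp_Liminf[symmetric]) auto
    qed
    also have "\<dots> \<le> liminf (\<lambda>m. \<integral>\<^sup>+x. ennreal (norm (\<phi> n x - \<phi> (r m) x) ^ 3) \<partial>torus)"
      by (rule nn_integral_liminf) measurable
    also have "\<dots> \<le> liminf (\<lambda>m. ennreal (?c m))"
    proof (rule Liminf_mono, rule always_eventually, rule allI)
      fix m
      note b = C1_div_L3_bound[OF C1_div_diff[OF C1[of n] C1[of "r m"]]]
      show "(\<integral>\<^sup>+x. ennreal (norm (\<phi> n x - \<phi> (r m) x) ^ 3) \<partial>torus) \<le> ennreal (?c m)"
        using b by (subst nn_integral_eq_integral) (auto intro: ennreal_leI)
    qed
    also have "liminf (\<lambda>m. ennreal (?c m)) = ennreal (?b n)"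
    proof -
      have sub: "(\<lambda>m. l2 torus (\<lambda>x. v x - \<phi> (r m) x)) \<longlonglongrightarrow> 0" "(\<lambda>m. l2 torus (\<lambda>x. G x - J (r m) x)) \<longlonglongrightarrow> 0"
        using LIMSEQ_subseq_LIMSEQ[OF lim_v r(1)] LIMSEQ_subseq_LIMSEQ[OF lim_G r(1)] by (auto simp: o_def)
      have "(\<lambda>m. l2 torus (\<lambda>x. \<phi> n x - \<phi> (r m) x)) \<longlonglongrightarrow> l2 torus (\<lambda>x. \<phi> n x - v x)"
        by (rule l2_tendsto_norm) (auto intro!: sqint_diff sq simp: sub l2_diff_commute[of _ _ v])
      moreover have "(\<lambda>m. l2 torus (\<lambda>x. J n x - J (r m) x)) \<longlonglongrightarrow> l2 torus (\<lambda>x. J n x - G x)"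
        by (rule l2_tendsto_norm) (auto intro!: sqint_diff sq simp: sub l2_diff_commute[of _ _ G])
      ultimately have "(\<lambda>m. ennreal (?c m)) \<longlonglongrightarrow> ennreal (?b n)"
        by (intro tendsto_ennrealI tendsto_intros)
      then show ?thesis by (intro lim_imp_Liminf) auto
    qed
    finally show ?thesis .
  qed
  then have fin: "(\<integral>\<^sup>+x. ennreal (norm (\<phi> n x - v x) ^ 3) \<partial>torus) \<le> ennreal (?b n)" for n .
  have int: "integrable torus (\<lambda>x. norm (\<phi> n x - v x) ^ 3)" for n
    by (rule integrableI_bounded) (use le_less_trans[OF fin[of n]] in auto)
  have le: "(LINT x|torus. norm (\<phi> n x - v x) ^ 3) \<le> ?b n" for n
    using fin[of n] L3_const_nonneg by (subst (asm) nn_integral_eq_integral[OF int]) auto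
  have "?b \<longlonglongrightarrow> L3_const * ((0 + 0)\<^sup>2 * 0)"
    using lim_v lim_G by (intro tendsto_intros) (auto simp: l2_diff_commute[of _ _ v] l2_diff_commute[of _ _ G])
  then have b0: "?b \<longlonglongrightarrow> 0" by simp
  show "(\<lambda>n. LINT x|torus. norm (\<phi> n x - v x) ^ 3) \<longlonglongrightarrow> 0"
    by (rule tendsto_sandwich[OF _ _ tendsto_const b0]) (auto intro!: always_eventually le)
  have "integrable torus (\<lambda>x. norm (\<phi> 0 x - (\<phi> 0 x - v x)) ^ 3)"
    by (rule integrable_cube_diff(1)) (auto intro!: int C1_div_L3_bound[OF C1])
  then show "integrable torus (\<lambda>x. norm (v x) ^ 3)" by simp
qed

end

lemma increment_cube:
  assumes "f \<in> L2_torus" and i: "integrable torus (\<lambda>x. norm (f x) ^ 3)"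
  shows "integrable torus (\<lambda>x. norm (increment h f x) ^ 3)"
    and "(LINT x|torus. norm (increment h f x) ^ 3) \<le> 8 * (LINT x|torus. norm (f x) ^ 3)"
proof -
  have per: "periodic (\<lambda>x. norm (f x) ^ 3)" and [measurable]: "f \<in> borel_measurable borel"
    using assms(1) by (auto simp: L2_torus_iff periodic_def)
  have sh: "integrable torus (\<lambda>x. norm (f (x + h)) ^ 3)"
    "(LINT x|torus. norm (f (x + h)) ^ 3) = (LINT x|torus. norm (f x) ^ 3)"
    using integrable_torus_shift[OF per, of h] integral_torus_shift[OF per, of h] i by auto
  show "integrable torus (\<lambda>x. norm (increment h f x) ^ 3)"
    unfolding increment_def by (rule integrable_cube_diff(1)) (auto intro: sh i)
  show "(LINT x|torus. norm (increment h f x) ^ 3) \<le> 8 * (LINT x|torus. norm (f x) ^ 3)"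
    unfolding increment_def
    using integrable_cube_diff(2)[of "\<lambda>x. f (x + h)" torus f] sh i by simp
qed

context H1_approx
begin

text \<open>The Lipschitz hypothesis is shared by both structure functions, so the limit is taken
  once for an abstract cubic \<open>Q n\<close>. On the sphere the convergence is dominated because
  the cubic norms of the approximants are bounded.\<close>

lemma structure_function_tendsto:
  fixes Q :: "real^3 \<Rightarrow> real^3 \<Rightarrow> real"
  assumes mQ: "(\<lambda>(n, a). Q n a) \<in> borel_measurable (borel \<Otimes>\<^sub>M borel)"
    and Q: "\<And>n p q. norm n = 1 \<Longrightarrow> \<bar>Q n p - Q n q\<bar> \<le> 3 * norm (p - q) * ((norm p)\<^sup>2 + (norm q)\<^sup>2)" "\<And>n. Q n 0 = 0"
  shows "(\<lambda>m. LINT n|sphere_measure. LINT x|torus. Q n (increment (R *\<^sub>R n) (\<phi> m) x))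
    \<longlonglongrightarrow> (LINT n|sphere_measure. LINT x|torus. Q n (increment (R *\<^sub>R n) v x))"
proof -
  have mQn: "Q n \<in> borel_measurable borel" for n
    using measurable_compose[OF measurable_Pair1' mQ, of n] by simp
  have vL: "v \<in> L2_torus" "integrable torus (\<lambda>x. norm (v x) ^ 3)" by (rule v) (rule L3_integrable)
  have fL: "\<phi> m \<in> L2_torus" "integrable torus (\<lambda>x. norm (\<phi> m x) ^ 3)" for m
    using C1_div_L2_torus[OF C1] C1_div_L3_bound(2)[OF C1] by auto
  have dL: "(\<lambda>x. \<phi> m x - v x) \<in> L2_torus" "integrable torus (\<lambda>x. norm (\<phi> m x - v x) ^ 3)" for m
    using vL fL integrable_cube_diff(1)[of "\<phi> m" torus v] sqint_diff[OF sq(3) sq(1)]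
    by (auto simp: L2_torus_iff periodic_def)
  have meas_F: "(\<lambda>n. LINT x|torus. Q n (increment (R *\<^sub>R n) f x)) \<in> borel_measurable sphere_measure"
    if [measurable]: "f \<in> borel_measurable borel" for f
  proof -
    have "(\<lambda>p. (fst p, increment (R *\<^sub>R fst p) f (snd p))) \<in> borel \<Otimes>\<^sub>M borel \<rightarrow>\<^sub>M borel \<Otimes>\<^sub>M borel"
      unfolding increment_def by measurable
    from measurable_compose[OF this mQ]
    have "(\<lambda>(n, x). Q n (increment (R *\<^sub>R n) f x)) \<in> borel_measurable (sphere_measure \<Otimes>\<^sub>M torus)"
      by (simp add: case_prod_beta' cong: measurable_cong_sets sets_pair_measure_cong)
    then show ?thesis by (rule torus.borel_measurable_lebesgue_integral)
  qed
  have conv: "(\<lambda>m. LINT x|torus. Q n (increment h (\<phi> m) x)) \<longlonglongrightarrow> (LINT x|torus. Q n (increment h v x))"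
    if n: "norm n = 1" for n h
  proof (rule cubic_integral_tendsto[where Q = "Q n" and s = "\<lambda>m. increment h (\<phi> m)" and a = "increment h v"])
    have eq: "increment h (\<phi> m) x - increment h v x = increment h (\<lambda>x. \<phi> m x - v x) x" for m x
      by (simp add: increment_def)
    show "(\<lambda>m. LINT x|torus. norm (increment h (\<phi> m) x - increment h v x) ^ 3) \<longlonglongrightarrow> 0"
    proof (rule tendsto_sandwich[OF _ _ tendsto_const])
      show "(\<lambda>m. 8 * (LINT x|torus. norm (\<phi> m x - v x) ^ 3)) \<longlonglongrightarrow> 0"
        using tendsto_mult_right_zero[OF L3_tendsto] .
    qed (auto intro!: always_eventually simp: eq increment_cube(2)[OF dL])
  qed (auto simp: increment_def[abs_def] mQn Q n intro: increment_cube(1)[OF vL, unfolded increment_def]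
      increment_cube(1)[OF fL, unfolded increment_def])
  obtain E where E: "\<And>m. \<bar>LINT x|torus. norm (\<phi> m x - v x) ^ 3\<bar> \<le> E"
    using convergent_imp_Bseq[OF convergentI[OF L3_tendsto]] by (auto simp: Bseq_def)
  \<comment> \<open>Three from the growth of \<open>Q\<close> times eight from
    \<open>increment_cube\<close> gives \<open>24\<close>; the \<open>4\<close> compares the cube of
    \<open>\<phi> m\<close> with the cubes of \<open>\<phi> m - v\<close> and
    \<open>v\<close>.\<close>
  let ?C = "24 * (4 * (E + (LINT x|torus. norm (v x) ^ 3)))"
  have bound: "\<bar>LINT x|torus. Q n (increment h (\<phi> m) x)\<bar> \<le> ?C" if n: "norm n = 1" for n h m
  proof -
    have "norm (\<phi> m x) ^ 3 \<le> 4 * (norm (\<phi> m x - v x) ^ 3 + norm (v x) ^ 3)" for x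
      using norm_diff_cube_le[of "\<phi> m x - v x" "- v x"] by simp
    then have "(LINT x|torus. norm (\<phi> m x) ^ 3) \<le> (LINT x|torus. 4 * (norm (\<phi> m x - v x) ^ 3 + norm (v x) ^ 3))"
      by (intro integral_mono fL) (auto intro!: dL vL)
    also have "\<dots> \<le> 4 * (E + (LINT x|torus. norm (v x) ^ 3))"
      using dL vL E[of m] by simp
    finally have le: "(LINT x|torus. norm (\<phi> m x) ^ 3) \<le> 4 * (E + (LINT x|torus. norm (v x) ^ 3))" .
    have "\<bar>LINT x|torus. Q n (increment h (\<phi> m) x)\<bar> \<le> (LINT x|torus. 3 * norm (increment h (\<phi> m) x) ^ 3)"
    proof (rule integral_abs_le_AE)
      have "(\<lambda>x. increment h (\<phi> m) x) \<in> borel_measurable torus" unfolding increment_def by measurable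
      from measurable_compose[OF this mQn] show "(\<lambda>x. Q n (increment h (\<phi> m) x)) \<in> borel_measurable torus" .
      show "AE x in torus. \<bar>Q n (increment h (\<phi> m) x)\<bar> \<le> 3 * norm (increment h (\<phi> m) x) ^ 3"
        using Q(1)[OF n, of _ 0] Q(2) by (intro AE_I2) (simp add: power2_eq_square power3_eq_cube mult.assoc)
    qed (use increment_cube(1)[OF fL] in simp)
    also have "\<dots> \<le> ?C" using increment_cube(2)[OF fL, of h m] le by simp
    finally show ?thesis .
  qed
  show ?thesis
  proof (rule integral_dominated_convergence[where w = "\<lambda>_. ?C"])
    show "AE n in sphere_measure. (\<lambda>m. LINT x|torus. Q n (increment (R *\<^sub>R n) (\<phi> m) x))
      \<longlonglongrightarrow> (LINT x|torus. Q n (increment (R *\<^sub>R n) v x))"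
      using AE_sphere_norm by eventually_elim (rule conv)
    show "AE n in sphere_measure. norm (LINT x|torus. Q n (increment (R *\<^sub>R n) (\<phi> m) x)) \<le> ?C" for m
      using AE_sphere_norm
    proof eventually_elim
      case (elim n)
      show ?case using bound[OF elim, of "R *\<^sub>R n" m] by (simp only: real_norm_def)
    qed
  qed (auto intro: meas_F)
qed

end

section \<open>Averages over balls\<close>

definition ball_conv :: "real \<Rightarrow> (real^3 \<Rightarrow> real) \<Rightarrow> (real^3 \<Rightarrow> 'b::euclidean_space) \<Rightarrow> real^3 \<Rightarrow> 'b" where
  "ball_conv R \<kappa> w x = (LINT h|leb_on (cball 0 R). \<kappa> h *\<^sub>R w (x + h))"

text \<open>Three separate arguments make the form trilinear, so gradient, advecting field and
  shifted field can be approximated independently of each other.\<close>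

definition transfer_form :: "real \<Rightarrow> (real^3 \<Rightarrow> real) \<Rightarrow> (real^3 \<Rightarrow> real^3^3) \<Rightarrow> (real^3 \<Rightarrow> real^3) \<Rightarrow> (real^3 \<Rightarrow> real^3) \<Rightarrow> real" where
  "transfer_form R \<kappa> G v w = (LINT x|torus. (G x *v v x) \<bullet> ball_conv R \<kappa> w x)"

definition ball_form :: "real \<Rightarrow> (real^3 \<Rightarrow> real) \<Rightarrow> (real^3 \<Rightarrow> 'b::euclidean_space) \<Rightarrow> (real^3 \<Rightarrow> 'b) \<Rightarrow> real" where
  "ball_form R \<kappa> f g = (LINT x|torus. f x \<bullet> ball_conv R \<kappa> g x)"

lemma
  fixes A :: "real^3 \<Rightarrow> real^3^3"
  assumes A: "sqint torus A" and v: "sqint torus v"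
    and c: "c \<in> borel_measurable borel" "\<And>x. norm (c x) \<le> C"
  shows trilinear_integrable: "integrable torus (\<lambda>x. (A x *v v x) \<bullet> c x)"
    and trilinear_bound: "\<bar>LINT x|torus. (A x *v v x) \<bullet> c x\<bar> \<le> C * (l2 torus A * l2 torus v)"
proof -
  note [measurable] = c(1)
  have [measurable]: "A \<in> borel_measurable borel" "v \<in> borel_measurable borel"
    using sqint_measurable[OF A] sqint_measurable[OF v] by simp_all
  have C0: "0 \<le> C" using c(2)[of 0] norm_ge_zero order_trans by blast
  have m: "(\<lambda>x. (A x *v v x) \<bullet> c x) \<in> borel_measurable torus"
  proof -
    have "(\<lambda>x. \<Sum>i\<in>UNIV. (\<Sum>j\<in>UNIV. A x $ i $ j * v x $ j) * c x $ i) \<in> borel_measurable borel"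
    proof (intro borel_measurable_sum borel_measurable_times)
      have nth: "(\<lambda>y. y $ i) \<in> borel_measurable borel" for i :: 3 and y :: "'z::euclidean_space^3"
        by (intro borel_measurable_continuous_onI continuous_intros)
      show "(\<lambda>x. A x $ i $ j) \<in> borel_measurable borel" for i j
        using measurable_compose[OF measurable_compose[OF \<open>A \<in> borel_measurable borel\<close>]]
        by (intro borel_measurable_continuous_on[of "\<lambda>B. B $ i $ j"] continuous_intros) simp
      show "(\<lambda>x. v x $ j) \<in> borel_measurable borel" "(\<lambda>x. c x $ j) \<in> borel_measurable borel" for j
        by (intro borel_measurable_continuous_on[of "\<lambda>b. b $ j"] continuous_intros; simp)+
    qed
    then show ?thesis by (simp add: inner_vec_def matrix_vector_mult_def)
  qed
  have b: "integrable torus (\<lambda>x. C * (norm (A x) * norm (v x)))"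
    by (intro integrable_mult_right sqint_mult_norm A v)
  have pt: "\<bar>(A x *v v x) \<bullet> c x\<bar> \<le> C * (norm (A x) * norm (v x))" for x
  proof -
    have "\<bar>(A x *v v x) \<bullet> c x\<bar> \<le> norm (A x *v v x) * norm (c x)" by (rule Cauchy_Schwarz_ineq2)
    also have "\<dots> \<le> (norm (A x) * norm (v x)) * C"
      by (intro mult_mono norm_matrix_vector_le c) auto
    finally show ?thesis by (simp add: mult.commute)
  qed
  show "integrable torus (\<lambda>x. (A x *v v x) \<bullet> c x)"
    by (rule Bochner_Integration.integrable_bound[OF b m]) (use pt C0 in \<open>auto intro!: AE_I2 simp: abs_mult\<close>)
  have "\<bar>LINT x|torus. (A x *v v x) \<bullet> c x\<bar> \<le> (LINT x|torus. C * (norm (A x) * norm (v x)))"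
    by (rule integral_abs_le_AE[OF b m]) (simp add: pt)
  also have "\<dots> \<le> C * (l2 torus A * l2 torus v)"
    using integral_mult_norm_le[OF A v] C0 by (simp add: mult_left_mono)
  finally show "\<bar>LINT x|torus. (A x *v v x) \<bullet> c x\<bar> \<le> C * (l2 torus A * l2 torus v)" .
qed

lemma L2_torus_diff:
  fixes w :: "real^3 \<Rightarrow> 'b::euclidean_space"
  assumes "w \<in> L2_torus" "z \<in> L2_torus"
  shows "(\<lambda>x. w x - z x) \<in> L2_torus"
  using assms by (auto simp: L2_torus_iff periodic_def intro!: sqint_diff)

text \<open>Radii at most one keep the ball inside one period, and evenness makes
  \<open>ball_conv\<close> multiply each wave by a real number. The instances are the constant
  weight and \<open>R\<^sup>2 - |h|\<^sup>2\<close>.\<close>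

locale ball_weight =
  fixes R :: real and \<kappa> :: "real^3 \<Rightarrow> real" and K :: real
  assumes R: "0 < R" "R \<le> 1" and \<kappa>: "continuous_on UNIV \<kappa>"
    and bound: "\<And>h. norm h \<le> R \<Longrightarrow> \<bar>\<kappa> h\<bar> \<le> K" and even: "\<And>h. \<kappa> (- h) = \<kappa> h"
begin

definition C :: real where
  "C = K * sqrt (measure (leb_on (cball 0 R) :: (real^3) measure) UNIV)"

lemma K_nonneg: "0 \<le> K"
  using bound[of 0] R by simp

lemma C_nonneg: "0 \<le> C"
  using K_nonneg by (simp add: C_def)

lemma \<kappa>_measurable [measurable]: "\<kappa> \<in> borel_measurable borel"
  by (rule continuous_borel_measurable[OF \<kappa>])

lemma
  fixes w :: "real^3 \<Rightarrow> 'b::euclidean_space"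
  assumes w: "w \<in> L2_torus"
  shows sqint_ball: "sqint (leb_on (cball 0 R)) (\<lambda>h. w (x + h))"
    and l2_ball: "l2 (leb_on (cball 0 R)) (\<lambda>h. w (x + h)) \<le> l2 torus w"
proof -
  note [measurable] = L2_torusD(2)[OF w]
  have "periodic (\<lambda>x. (ennreal (norm (w x)))\<^sup>2)" using L2_torusD(1)[OF w] by (simp add: periodic_def)
  from nn_integral_ball_le_torus[OF this _ R(2), of x]
  have "(\<integral>\<^sup>+h. (ennreal (norm (w (x + h))))\<^sup>2 \<partial>leb_on (cball 0 R)) \<le> ennreal ((l2 torus w)\<^sup>2)"
    unfolding nn_integral_eq_l2[OF L2_torusD(3)[OF w], symmetric] by simp
  from sqintI_nn[OF _ this]
  show "sqint (leb_on (cball 0 R)) (\<lambda>h. w (x + h))" "l2 (leb_on (cball 0 R)) (\<lambda>h. w (x + h)) \<le> l2 torus w"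
    by simp_all
qed

text \<open>Cauchy-Schwarz on the ball: averaging maps \<open>L\<^sup>2\<close> to bounded
  functions. The product of a gradient and a field is only integrable, so this is what makes
  \<open>transfer_form\<close> finite and continuous in \<open>L\<^sup>2\<close>.\<close>

lemma
  fixes w :: "real^3 \<Rightarrow> 'b::euclidean_space"
  assumes w: "w \<in> L2_torus"
  shows ball_conv_integrable: "integrable (leb_on (cball 0 R)) (\<lambda>h. \<kappa> h *\<^sub>R w (x + h))"
    and ball_conv_bound: "norm (ball_conv R \<kappa> w x) \<le> C * l2 torus w"
proof -
  note [measurable] = L2_torusD(2)[OF w]
  have i: "integrable (leb_on (cball 0 R)) (\<lambda>h. K * norm (w (x + h)))"
    using ball.sqint_integrable[OF sqint_ball[OF w, of x]] by (intro integrable_mult_right integrable_norm)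
  have le: "AE h in leb_on (cball 0 R). norm (\<kappa> h *\<^sub>R w (x + h)) \<le> K * norm (w (x + h))"
    by (subst AE_leb_on) (auto intro!: AE_I2 mult_right_mono bound simp: borel_closed)
  show c: "integrable (leb_on (cball 0 R)) (\<lambda>h. \<kappa> h *\<^sub>R w (x + h))"
    by (rule Bochner_Integration.integrable_bound[OF i]) (use le K_nonneg in auto)
  have "norm (ball_conv R \<kappa> w x) \<le> (LINT h|leb_on (cball 0 R). norm (\<kappa> h *\<^sub>R w (x + h)))"
    unfolding ball_conv_def by (rule integral_norm_bound)
  also have "\<dots> \<le> (LINT h|leb_on (cball 0 R). K * norm (w (x + h)))"
    by (rule integral_mono_AE[OF integrable_norm[OF c] i le])
  also have "\<dots> \<le> K * (sqrt (measure (leb_on (cball 0 R) :: (real^3) measure) UNIV) * l2 (leb_on (cball 0 R)) (\<lambda>h. w (x + h)))"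
    using ball.l1_le_l2[OF sqint_ball[OF w, of x]] K_nonneg by (simp add: mult_left_mono)
  also have "\<dots> \<le> C * l2 torus w"
    unfolding C_def mult.assoc using l2_ball[OF w, of x] K_nonneg by (intro mult_left_mono) auto
  finally show "norm (ball_conv R \<kappa> w x) \<le> C * l2 torus w" .
qed

lemma ball_conv_measurable [measurable]:
  fixes w :: "real^3 \<Rightarrow> 'b::euclidean_space"
  assumes [measurable]: "w \<in> borel_measurable borel"
  shows "ball_conv R \<kappa> w \<in> borel_measurable borel"
  unfolding ball_conv_def by (rule ball.borel_measurable_lebesgue_integral) measurable

lemma
  fixes w :: "real^3 \<Rightarrow> 'b::euclidean_space"
  assumes w: "w \<in> L2_torus"
  shows ball_conv_L2: "ball_conv R \<kappa> w \<in> L2_torus"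
    and l2_ball_conv: "l2 torus (ball_conv R \<kappa> w) \<le> sqrt (measure torus UNIV) * C * l2 torus w"
proof -
  note m = ball_conv_measurable[OF L2_torusD(2)[OF w]]
  have "periodic (ball_conv R \<kappa> w)"
    unfolding periodic_def ball_conv_def
  proof (intro allI)
    fix x i
    have "x + axis i (2 * pi) + h = x + h + axis i (2 * pi)" for h :: "real^3" by simp
    then show "(LINT h|leb_on (cball 0 R). \<kappa> h *\<^sub>R w (x + axis i (2 * pi) + h)) = (LINT h|leb_on (cball 0 R). \<kappa> h *\<^sub>R w (x + h))"
      using L2_torusD(1)[OF w] by (simp only: periodic_def)
  qed
  moreover have s: "sqint torus (ball_conv R \<kappa> w)"
    by (rule torus.sqint_bounded[where B = "C * l2 torus w"]) (use m ball_conv_bound[OF w] in auto)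
  ultimately show "ball_conv R \<kappa> w \<in> L2_torus" using m by (simp add: L2_torus_iff)
  have "l2 torus (ball_conv R \<kappa> w) \<le> l2 torus (\<lambda>x. C * l2 torus w)"
    by (rule l2_mono[OF torus.sqint_const]) (use m ball_conv_bound[OF w] C_nonneg in \<open>auto simp: abs_mult\<close>)
  also have "\<dots> = sqrt (measure torus UNIV) * C * l2 torus w"
    using C_nonneg by (simp add: l2_def real_sqrt_mult abs_mult)
  finally show "l2 torus (ball_conv R \<kappa> w) \<le> sqrt (measure torus UNIV) * C * l2 torus w" .
qed

lemma ball_conv_diff:
  fixes w :: "real^3 \<Rightarrow> 'b::euclidean_space"
  assumes "w \<in> L2_torus" "z \<in> L2_torus"
  shows "ball_conv R \<kappa> (\<lambda>x. w x - z x) x = ball_conv R \<kappa> w x - ball_conv R \<kappa> z x"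
  unfolding ball_conv_def using ball_conv_integrable[OF assms(1)] ball_conv_integrable[OF assms(2)]
  by (simp add: scaleR_diff_right)

lemma integral_inner_ball_conv:
  assumes w: "w \<in> L2_torus"
  shows "(LINT x|torus. a x \<bullet> ball_conv R \<kappa> w x)
    = (LINT x|torus. LINT h|leb_on (cball 0 R). \<kappa> h * (a x \<bullet> w (x + h)))"
  unfolding ball_conv_def
  by (subst integral_inner_right[symmetric]) (use ball_conv_integrable[OF w] in auto)

lemma transfer_form_bound:
  assumes G: "G \<in> L2_torus" and v: "v \<in> L2_torus" and w: "w \<in> L2_torus"
  shows "\<bar>transfer_form R \<kappa> G v w\<bar> \<le> C * l2 torus w * (l2 torus G * l2 torus v)"
  unfolding transfer_form_def
  by (rule trilinear_bound) (use assms ball_conv_bound[OF w] in \<open>auto simp: L2_torus_iff\<close>)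

lemma transfer_form_diff_bound:
  assumes "G \<in> L2_torus" "v \<in> L2_torus" "w \<in> L2_torus" "G' \<in> L2_torus" "v' \<in> L2_torus" "w' \<in> L2_torus"
  shows "\<bar>transfer_form R \<kappa> G v w - transfer_form R \<kappa> G' v' w'\<bar> \<le> C * (l2 torus w * (l2 torus (\<lambda>x. G x - G' x) * l2 torus v)
     + l2 torus w * (l2 torus G' * l2 torus (\<lambda>x. v x - v' x)) + l2 torus (\<lambda>x. w x - w' x) * (l2 torus G' * l2 torus v'))"
proof -
  note d = L2_torus_diff[OF assms(1) assms(4)] L2_torus_diff[OF assms(2) assms(5)] L2_torus_diff[OF assms(3) assms(6)]
  have t: "integrable torus (\<lambda>x. (A x *v b x) \<bullet> ball_conv R \<kappa> z x)"
    if "A \<in> L2_torus" "b \<in> L2_torus" "z \<in> L2_torus"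
    for A :: "real^3 \<Rightarrow> real^3^3" and b z :: "real^3 \<Rightarrow> real^3"
    by (rule trilinear_integrable[where C = "C * l2 torus z"])
      (use that ball_conv_bound[OF that(3)] in \<open>auto simp: L2_torus_iff\<close>)
  have "transfer_form R \<kappa> G v w - transfer_form R \<kappa> G' v' w'
    = transfer_form R \<kappa> (\<lambda>x. G x - G' x) v w + transfer_form R \<kappa> G' (\<lambda>x. v x - v' x) w
      + transfer_form R \<kappa> G' v' (\<lambda>x. w x - w' x)"
  proof -
    have "transfer_form R \<kappa> (\<lambda>x. G x - G' x) v w = transfer_form R \<kappa> G v w - transfer_form R \<kappa> G' v w"
      unfolding transfer_form_def using t[OF assms(1,2,3)] t[OF assms(4,2,3)]
      by (simp add: matrix_vector_mult_diff_rdistrib inner_diff_left)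
    moreover have "transfer_form R \<kappa> G' (\<lambda>x. v x - v' x) w = transfer_form R \<kappa> G' v w - transfer_form R \<kappa> G' v' w"
      unfolding transfer_form_def using t[OF assms(4,2,3)] t[OF assms(4,5,3)]
      by (simp add: matrix_vector_mult_diff_distrib inner_diff_left)
    moreover have "transfer_form R \<kappa> G' v' (\<lambda>x. w x - w' x) = transfer_form R \<kappa> G' v' w - transfer_form R \<kappa> G' v' w'"
      unfolding transfer_form_def using t[OF assms(4,5,3)] t[OF assms(4,5,6)]
      by (simp add: ball_conv_diff assms inner_diff_right)
    ultimately show ?thesis by simp
  qed
  then show ?thesis
    using transfer_form_bound[OF d(1) assms(2) assms(3)] transfer_form_bound[OF assms(4) d(2) assms(3)]
      transfer_form_bound[OF assms(4,5) d(3)] by (simp add: algebra_simps)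
qed

end

context H1_approx
begin

lemma transfer_form_tendsto:
  assumes "ball_weight R \<kappa> K"
  shows "(\<lambda>n. transfer_form R \<kappa> (J n) (\<phi> n) (\<phi> n)) \<longlonglongrightarrow> transfer_form R \<kappa> G v v"
proof -
  interpret ball_weight R \<kappa> K by fact
  have L2: "\<phi> n \<in> L2_torus" "J n \<in> L2_torus" for n by (auto intro: C1_div_L2_torus[OF C1])
  let ?b = "\<lambda>n. C * (l2 torus (\<phi> n) * (l2 torus (\<lambda>x. J n x - G x) * l2 torus (\<phi> n))
     + l2 torus (\<phi> n) * (l2 torus G * l2 torus (\<lambda>x. \<phi> n x - v x)) + l2 torus (\<lambda>x. \<phi> n x - v x) * (l2 torus G * l2 torus v))"
  have lim: "(\<lambda>n. l2 torus (\<lambda>x. \<phi> n x - v x)) \<longlonglongrightarrow> 0" "(\<lambda>n. l2 torus (\<lambda>x. J n x - G x)) \<longlonglongrightarrow> 0"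
    "(\<lambda>n. l2 torus (\<phi> n)) \<longlonglongrightarrow> l2 torus v"
    using lim_v lim_G l2_tendsto_norm[OF sq(3) sq(1) lim_v]
    by (simp_all add: l2_diff_commute[of _ _ v] l2_diff_commute[of _ _ G])
  have "?b \<longlonglongrightarrow> C * (l2 torus v * (0 * l2 torus v) + l2 torus v * (l2 torus G * 0) + 0 * (l2 torus G * l2 torus v))"
    by (intro tendsto_intros lim)
  then have b: "?b \<longlonglongrightarrow> 0" by simp
  show ?thesis
    by (rule LIM_zero_cancel, rule tendsto_rabs_zero_cancel, rule tendsto_sandwich[OF _ _ tendsto_const b])
      (auto intro!: always_eventually transfer_form_diff_bound L2 v G)
qed

lemma ball_form_tendsto:
  assumes "ball_weight R \<kappa> K"
  shows "(\<lambda>n. ball_form R \<kappa> (J n) (J n)) \<longlonglongrightarrow> ball_form R \<kappa> G G"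
proof -
  interpret ball_weight R \<kappa> K by fact
  have L2: "J n \<in> L2_torus" for n by (rule C1_div_L2_torus[OF C1])
  show ?thesis
    unfolding ball_form_def
  proof (rule inner_tendsto_l2)
    show "sqint torus (ball_conv R \<kappa> (J n))" for n using ball_conv_L2[OF L2] by (simp add: L2_torus_iff)
    show "sqint torus (ball_conv R \<kappa> G)" using ball_conv_L2[OF G] by (simp add: L2_torus_iff)
    show "(\<lambda>n. l2 torus (\<lambda>x. ball_conv R \<kappa> G x - ball_conv R \<kappa> (J n) x)) \<longlonglongrightarrow> 0"
    proof (rule tendsto_sandwich[OF _ _ tendsto_const])
      show "(\<lambda>n. sqrt (measure torus UNIV) * C * l2 torus (\<lambda>x. G x - J n x)) \<longlonglongrightarrow> 0"
        using tendsto_mult_right_zero[OF lim_G] .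
      show "\<forall>\<^sub>F n in sequentially. l2 torus (\<lambda>x. ball_conv R \<kappa> G x - ball_conv R \<kappa> (J n) x)
          \<le> sqrt (measure torus UNIV) * C * l2 torus (\<lambda>x. G x - J n x)"
        using l2_ball_conv[OF L2_torus_diff[OF G L2]]
        by (intro always_eventually allI) (simp add: ball_conv_diff[OF G L2, abs_def])
    qed auto
  qed (use sq lim_G in auto)
qed

end

section \<open>Third-order identities and viscous bounds for \<open>H\<^sup>1\<close> fields\<close>

lemma mixed_square_le: "a\<^sup>2 + a * b + b\<^sup>2 \<le> 3 * (a\<^sup>2 + b\<^sup>2)" for a b :: real
proof -
  have "3 * (a\<^sup>2 + b\<^sup>2) - (a\<^sup>2 + a * b + b\<^sup>2) = (3 / 2) * (a\<^sup>2 + b\<^sup>2) + (1 / 2) * (a - b)\<^sup>2"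
    by (simp add: power2_eq_square field_simps)
  moreover have "0 \<le> (3 / 2) * (a\<^sup>2 + b\<^sup>2) + (1 / 2) * (a - b)\<^sup>2" by simp
  ultimately show ?thesis by linarith
qed

lemma mixed_square_abs_le:
  fixes a b p q :: real
  assumes "a\<^sup>2 \<le> p" "b\<^sup>2 \<le> q"
  shows "\<bar>a\<^sup>2 + a * b + b\<^sup>2\<bar> \<le> 3 * (p + q)"
proof -
  have "4 * (a\<^sup>2 + a * b + b\<^sup>2) = (2 * a + b)\<^sup>2 + 3 * b\<^sup>2"
    by (simp add: power2_eq_square algebra_simps)
  moreover have "0 \<le> (2 * a + b)\<^sup>2 + 3 * b\<^sup>2" by simp
  ultimately have "0 \<le> 4 * (a\<^sup>2 + a * b + b\<^sup>2)" by (simp only:)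
  then have "\<bar>a\<^sup>2 + a * b + b\<^sup>2\<bar> = a\<^sup>2 + a * b + b\<^sup>2"
    by (intro abs_of_nonneg) (simp only: zero_le_mult_iff, simp)
  also have "\<dots> \<le> 3 * (a\<^sup>2 + b\<^sup>2)" by (rule mixed_square_le)
  also have "\<dots> \<le> 3 * (p + q)" using assms by (intro mult_left_mono add_mono) simp_all
  finally show ?thesis .
qed

lemma ball_weight_one: "0 < R \<Longrightarrow> R \<le> 1 \<Longrightarrow> ball_weight R (\<lambda>h. 1) 1"
  by unfold_locales auto

lemma ball_weight_moment: "0 < R \<Longrightarrow> R \<le> 1 \<Longrightarrow> ball_weight R (\<lambda>h. R\<^sup>2 - (norm h)\<^sup>2) (R\<^sup>2)"
  by unfold_locales (auto intro!: continuous_intros simp: abs_le_iff power_mono add_increasing)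

context H1_approx
begin

text \<open>Limits of the identities for the approximants: the structure functions converge by the
  cubic bound, the transfer forms by their trilinear bound.\<close>

lemma H1_third_order_identities:
  assumes R: "0 < R" "R \<le> 1"
  shows "R\<^sup>2 * (LINT n|sphere_measure. LINT x|torus. (norm (increment (R *\<^sub>R n) v x))\<^sup>2 * (increment (R *\<^sub>R n) v x \<bullet> n))
      = - 4 * transfer_form R (\<lambda>h. 1) G v v"
    and "R ^ 4 * (LINT n|sphere_measure. LINT x|torus. (increment (R *\<^sub>R n) v x \<bullet> n) ^ 3)
      = - 6 * transfer_form R (\<lambda>h. R\<^sup>2 - (norm h)\<^sup>2) G v v"
proof -
  have f: "C1_div_field (\<phi> n) (J n)" for n by unfold_locales (rule C1)
  have L2: "\<phi> n \<in> L2_torus" for n by (rule C1_div_L2_torus[OF C1])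
  have tf: "transfer_form R \<kappa> (J n) (\<phi> n) (\<phi> n) = double_int R (\<lambda>x h. \<kappa> h * ((J n x *v \<phi> n x) \<bullet> \<phi> n (x + h)))"
    if "ball_weight R \<kappa> K" for \<kappa> K n
  proof -
    interpret ball_weight R \<kappa> K by fact
    show ?thesis unfolding transfer_form_def double_int_def by (rule integral_inner_ball_conv[OF L2])
  qed
  have "(\<lambda>m. R\<^sup>2 * (LINT n|sphere_measure. LINT x|torus. (norm (increment (R *\<^sub>R n) (\<phi> m) x))\<^sup>2 * (increment (R *\<^sub>R n) (\<phi> m) x \<bullet> n)))
    \<longlonglongrightarrow> R\<^sup>2 * (LINT n|sphere_measure. LINT x|torus. (norm (increment (R *\<^sub>R n) v x))\<^sup>2 * (increment (R *\<^sub>R n) v x \<bullet> n))"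
  proof (intro tendsto_mult_left structure_function_tendsto[where Q = "\<lambda>n a. (norm a)\<^sup>2 * (a \<bullet> n)"])
    fix n p q :: "real^3" assume n: "norm n = 1"
    let ?d = "norm (p - q)" and ?p = "norm p" and ?q = "norm q"
    have "(norm p)\<^sup>2 * (p \<bullet> n) - (norm q)\<^sup>2 * (q \<bullet> n) = (norm p)\<^sup>2 * ((p - q) \<bullet> n) + (?p - ?q) * (?p + ?q) * (q \<bullet> n)"
      by (simp add: inner_diff_left power2_eq_square algebra_simps)
    also have "\<bar>\<dots>\<bar> \<le> ?p\<^sup>2 * ?d + ?d * (?p + ?q) * ?q"
    proof (rule order_trans[OF abs_triangle_ineq], rule add_mono)
      show "\<bar>?p\<^sup>2 * ((p - q) \<bullet> n)\<bar> \<le> ?p\<^sup>2 * ?d"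
        using Cauchy_Schwarz_ineq2[of "p - q" n] n by (simp add: abs_mult mult_left_mono)
      have "\<bar>?p - ?q\<bar> * \<bar>?p + ?q\<bar> * \<bar>q \<bullet> n\<bar> \<le> ?d * (?p + ?q) * ?q"
        using Cauchy_Schwarz_ineq2[of q n] n norm_triangle_ineq3[of p q] by (intro mult_mono) auto
      then show "\<bar>(?p - ?q) * (?p + ?q) * (q \<bullet> n)\<bar> \<le> ?d * (?p + ?q) * ?q" by (simp add: abs_mult)
    qed
    also have "\<dots> = ?d * (?p\<^sup>2 + ?p * ?q + ?q\<^sup>2)"
      by (simp add: power2_eq_square algebra_simps)
    also have "\<dots> \<le> ?d * (3 * (?p\<^sup>2 + ?q\<^sup>2))"
      by (rule mult_left_mono[OF mixed_square_le]) simp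
    also have "\<dots> = 3 * ?d * (?p\<^sup>2 + ?q\<^sup>2)" by simp
    finally show "\<bar>?p\<^sup>2 * (p \<bullet> n) - ?q\<^sup>2 * (q \<bullet> n)\<bar> \<le> 3 * ?d * (?p\<^sup>2 + ?q\<^sup>2)" .
  qed (auto simp: case_prod_beta')
  moreover have "R\<^sup>2 * (LINT n|sphere_measure. LINT x|torus. (norm (increment (R *\<^sub>R n) (\<phi> m) x))\<^sup>2 * (increment (R *\<^sub>R n) (\<phi> m) x \<bullet> n))
    = - 4 * transfer_form R (\<lambda>h. 1) (J m) (\<phi> m) (\<phi> m)" for m
    using C1_div_field.sphere_energy_transfer[OF f R(1)] by (simp add: increment_def tf[OF ball_weight_one[OF R]])
  ultimately have "(\<lambda>m. - 4 * transfer_form R (\<lambda>h. 1) (J m) (\<phi> m) (\<phi> m))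
    \<longlonglongrightarrow> R\<^sup>2 * (LINT n|sphere_measure. LINT x|torus. (norm (increment (R *\<^sub>R n) v x))\<^sup>2 * (increment (R *\<^sub>R n) v x \<bullet> n))"
    by (simp only:)
  from LIMSEQ_unique[OF this tendsto_mult_left[OF transfer_form_tendsto[OF ball_weight_one[OF R]]]]
  show "R\<^sup>2 * (LINT n|sphere_measure. LINT x|torus. (norm (increment (R *\<^sub>R n) v x))\<^sup>2 * (increment (R *\<^sub>R n) v x \<bullet> n))
      = - 4 * transfer_form R (\<lambda>h. 1) G v v" .
  have "(\<lambda>m. R ^ 4 * (LINT n|sphere_measure. LINT x|torus. (increment (R *\<^sub>R n) (\<phi> m) x \<bullet> n) ^ 3))
    \<longlonglongrightarrow> R ^ 4 * (LINT n|sphere_measure. LINT x|torus. (increment (R *\<^sub>R n) v x \<bullet> n) ^ 3)"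
  proof (intro tendsto_mult_left structure_function_tendsto[where Q = "\<lambda>n a. (a \<bullet> n) ^ 3"])
    fix n p q :: "real^3" assume n: "norm n = 1"
    let ?a = "p \<bullet> n" and ?b = "q \<bullet> n"
    have a: "\<bar>?a\<bar> \<le> norm p" "\<bar>?b\<bar> \<le> norm q" "\<bar>?a - ?b\<bar> \<le> norm (p - q)"
      using Cauchy_Schwarz_ineq2[of p n] Cauchy_Schwarz_ineq2[of q n] Cauchy_Schwarz_ineq2[of "p - q" n] n
      by (auto simp: inner_diff_left)
    have sq: "?a\<^sup>2 \<le> (norm p)\<^sup>2" "?b\<^sup>2 \<le> (norm q)\<^sup>2" using a by (auto simp: abs_le_square_iff[symmetric])
    have "?a ^ 3 - ?b ^ 3 = (?a - ?b) * (?a\<^sup>2 + ?a * ?b + ?b\<^sup>2)"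
      by (simp add: power2_eq_square power3_eq_cube algebra_simps)
    also have "\<bar>\<dots>\<bar> \<le> norm (p - q) * (3 * ((norm p)\<^sup>2 + (norm q)\<^sup>2))"
      unfolding abs_mult
    proof (rule mult_mono)
      show "\<bar>?a\<^sup>2 + ?a * ?b + ?b\<^sup>2\<bar> \<le> 3 * ((norm p)\<^sup>2 + (norm q)\<^sup>2)"
        by (rule mixed_square_abs_le[OF sq])
    qed (use a in auto)
    finally show "\<bar>?a ^ 3 - ?b ^ 3\<bar> \<le> 3 * norm (p - q) * ((norm p)\<^sup>2 + (norm q)\<^sup>2)"
      by (simp only: mult.left_commute mult.assoc)
  qed (auto simp: case_prod_beta')
  moreover have "R ^ 4 * (LINT n|sphere_measure. LINT x|torus. (increment (R *\<^sub>R n) (\<phi> m) x \<bullet> n) ^ 3)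
    = - 6 * transfer_form R (\<lambda>h. R\<^sup>2 - (norm h)\<^sup>2) (J m) (\<phi> m) (\<phi> m)" for m
    using C1_div_field.sphere_longitudinal_transfer[OF f R(1)]
    by (simp add: increment_def tf[OF ball_weight_moment[OF R]])
  ultimately have "(\<lambda>m. - 6 * transfer_form R (\<lambda>h. R\<^sup>2 - (norm h)\<^sup>2) (J m) (\<phi> m) (\<phi> m))
    \<longlonglongrightarrow> R ^ 4 * (LINT n|sphere_measure. LINT x|torus. (increment (R *\<^sub>R n) v x \<bullet> n) ^ 3)"
    by (simp only:)
  from LIMSEQ_unique[OF this tendsto_mult_left[OF transfer_form_tendsto[OF ball_weight_moment[OF R]]]]
  show "R ^ 4 * (LINT n|sphere_measure. LINT x|torus. (increment (R *\<^sub>R n) v x \<bullet> n) ^ 3)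
      = - 6 * transfer_form R (\<lambda>h. R\<^sup>2 - (norm h)\<^sup>2) G v v" .
qed

lemma H1_viscous_bounds:
  assumes R: "0 < R" "R \<le> 1"
  shows "\<bar>ball_form R (\<lambda>h. 1) G G\<bar> \<le> measure sphere_measure UNIV * R\<^sup>2 * (l2 torus G * l2 torus v)"
    and "\<bar>ball_form R (\<lambda>h. R\<^sup>2 - (norm h)\<^sup>2) G G\<bar>
      \<le> 2 * measure lborel (cball 0 R :: (real^3) set) * R * (l2 torus G * l2 torus v)"
proof -
  have f: "C1_div_field (\<phi> n) (J n)" for n by unfold_locales (rule C1)
  have L2: "J n \<in> L2_torus" for n by (rule C1_div_L2_torus[OF C1])
  have tf: "ball_form R \<kappa> (J n) (J n) = double_int R (\<lambda>x h. \<kappa> h * (J n x \<bullet> J n (x + h)))"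
    if "ball_weight R \<kappa> K" for \<kappa> K n
  proof -
    interpret ball_weight R \<kappa> K by fact
    show ?thesis unfolding ball_form_def double_int_def by (rule integral_inner_ball_conv[OF L2])
  qed
  have n: "(\<lambda>n. l2 torus (J n) * l2 torus (\<phi> n)) \<longlonglongrightarrow> l2 torus G * l2 torus v"
    by (intro tendsto_mult l2_tendsto_norm sq lim_v lim_G)
  show "\<bar>ball_form R (\<lambda>h. 1) G G\<bar> \<le> measure sphere_measure UNIV * R\<^sup>2 * (l2 torus G * l2 torus v)"
  proof (rule LIMSEQ_le[OF tendsto_rabs[OF ball_form_tendsto[OF ball_weight_one[OF R]]] tendsto_mult_left[OF n]])
    show "\<exists>N. \<forall>n\<ge>N. \<bar>ball_form R (\<lambda>h. 1) (J n) (J n)\<bar> \<le> measure sphere_measure UNIV * R\<^sup>2 * (l2 torus (J n) * l2 torus (\<phi> n))"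
      using C1_div_field.viscous_bounds(1)[OF f R(1)] by (simp add: tf[OF ball_weight_one[OF R]])
  qed
  show "\<bar>ball_form R (\<lambda>h. R\<^sup>2 - (norm h)\<^sup>2) G G\<bar>
      \<le> 2 * measure lborel (cball 0 R :: (real^3) set) * R * (l2 torus G * l2 torus v)"
  proof (rule LIMSEQ_le[OF tendsto_rabs[OF ball_form_tendsto[OF ball_weight_moment[OF R]]] tendsto_mult_left[OF n]])
    show "\<exists>N. \<forall>n\<ge>N. \<bar>ball_form R (\<lambda>h. R\<^sup>2 - (norm h)\<^sup>2) (J n) (J n)\<bar>
      \<le> 2 * measure lborel (cball 0 R :: (real^3) set) * R * (l2 torus (J n) * l2 torus (\<phi> n))"
      using C1_div_field.viscous_bounds(2)[OF f R(1)] by (simp add: tf[OF ball_weight_moment[OF R]])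
  qed
qed

end

section \<open>Trigonometric polynomials on the torus\<close>

text \<open>Real waves with a phase, because test fields are real. The phases \<open>0\<close> and
  \<open>pi / 2\<close> give cosine and sine, differentiation lowers the phase by
  \<open>pi / 2\<close>, and a translation changes nothing but the phase.\<close>

definition trig_wave :: "'b::euclidean_space \<Rightarrow> int^3 \<Rightarrow> real \<Rightarrow> real^3 \<Rightarrow> 'b" where
  "trig_wave a k \<theta> x = cos (frequency k \<bullet> x - \<theta>) *\<^sub>R a"

definition modes :: "nat \<Rightarrow> (int^3) set" where
  "modes n = {k. \<forall>i. \<bar>k $ i\<bar> \<le> int n}"

text \<open>The degree bound belongs to the predicate because the truncation
  \<open>trig_proj n\<close> reproduces such functions for the same \<open>n\<close>.\<close>

inductive trig_poly :: "nat \<Rightarrow> (real^3 \<Rightarrow> 'b::euclidean_space) \<Rightarrow> bool" for n where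
  trig_poly_wave: "k \<in> modes n \<Longrightarrow> trig_poly n (trig_wave a k \<theta>)"
| trig_poly_add: "trig_poly n f \<Longrightarrow> trig_poly n g \<Longrightarrow> trig_poly n (\<lambda>x. f x + g x)"

lemma compact_torus_box: "compact torus_box"
  by (simp add: torus_box_def compact_cbox)

lemma finite_modes [simp]: "finite (modes n)"
proof -
  have "inj_on (\<lambda>k :: int^3. (k $ 1, k $ 2, k $ 3)) (modes n)"
    by (auto simp: inj_on_def vec_eq_iff forall_3)
  moreover have "(\<lambda>k. (k $ 1, k $ 2, k $ 3)) ` modes n \<subseteq> {- int n..int n} \<times> {- int n..int n} \<times> {- int n..int n}"
    by (auto simp: modes_def abs_le_iff) (metis minus_le_iff)+
  ultimately show ?thesis by (meson finite_SigmaI finite_atLeastAtMost_int finite_imageD finite_subset)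
qed

lemma modes_uminus [simp]: "- k \<in> modes n \<longleftrightarrow> k \<in> modes n"
  by (simp add: modes_def)

lemma modes_mono: "m \<le> n \<Longrightarrow> modes m \<subseteq> modes n"
  by (auto simp: modes_def intro: order_trans)

lemma modes_add: "k \<in> modes m \<Longrightarrow> l \<in> modes n \<Longrightarrow> k + l \<in> modes (m + n)"
  unfolding modes_def by (auto intro: order_trans[OF abs_triangle_ineq] add_mono)

lemma zero_modes [simp]: "0 \<in> modes n"
  by (simp add: modes_def)

lemma frequency_add: "frequency (k + l) = frequency k + frequency l"
  by (simp add: frequency_def vec_eq_iff)

lemma frequency_0 [simp]: "frequency 0 = 0"
  by (simp add: frequency_def vec_eq_iff)

lemma frequency_eq_0_iff: "frequency k = 0 \<longleftrightarrow> k = 0"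
  by (simp add: frequency_def vec_eq_iff)

lemma cos_periodic_freq: "cos (frequency k \<bullet> (x + axis i (2 * pi)) - \<theta>) = cos (frequency k \<bullet> x - \<theta>)"
proof -
  have "frequency k \<bullet> (x + axis i (2 * pi)) - \<theta> = (frequency k \<bullet> x - \<theta>) + 2 * pi * real_of_int (k $ i)"
    by (simp add: inner_add_right inner_axis frequency_def)
  then show ?thesis by (metis cos_int_2pin sin_int_2pin cos_add mult_1_right mult_zero_right diff_zero mult.commute)
qed

lemma sin_eq_cos_shift: "sin x = cos (x - pi / 2)"
  by (simp add: cos_diff)

lemma trig_wave_continuous: "continuous_on UNIV (trig_wave a k \<theta>)"
  unfolding trig_wave_def by (intro continuous_intros)

lemma periodic_trig_wave: "periodic (trig_wave a k \<theta>)"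
  unfolding periodic_def trig_wave_def by (simp add: cos_periodic_freq)

lemma trig_wave_measurable [measurable]: "trig_wave a k \<theta> \<in> borel_measurable borel"
  by (rule continuous_borel_measurable[OF trig_wave_continuous])

lemma norm_trig_wave_le: "norm (trig_wave a k \<theta> x) \<le> norm a"
  by (simp add: trig_wave_def mult_left_le_one_le)

lemma L2_torus_continuous:
  assumes "continuous_on UNIV f" "periodic f"
  shows "f \<in> L2_torus"
  using assms continuous_borel_measurable[OF assms(1)]
  by (auto simp: L2_torus_iff sqint_def intro!: integrable_leb_on_continuous compact_torus_box continuous_intros)

lemma trig_wave_L2: "trig_wave a k \<theta> \<in> L2_torus"
  by (rule L2_torus_continuous[OF trig_wave_continuous periodic_trig_wave])

lemma L2_torus_add: "f \<in> L2_torus \<Longrightarrow> g \<in> L2_torus \<Longrightarrow> (\<lambda>x. f x + g x) \<in> L2_torus"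
  by (auto simp: L2_torus_iff periodic_def intro!: sqint_add)

lemma L2_torus_zero: "(\<lambda>x. 0) \<in> L2_torus"
  by (auto simp: L2_torus_iff periodic_def)

lemma L2_torus_sum: "(\<And>i. i \<in> I \<Longrightarrow> f i \<in> L2_torus) \<Longrightarrow> (\<lambda>x. \<Sum>i\<in>I. f i x) \<in> L2_torus"
  by (induction I rule: infinite_finite_induct) (auto intro: L2_torus_add L2_torus_zero)

lemma trig_poly_L2: "trig_poly n f \<Longrightarrow> f \<in> L2_torus"
  by (induction rule: trig_poly.induct) (auto intro: trig_wave_L2 L2_torus_add)

lemma trig_poly_mono: "trig_poly m f \<Longrightarrow> m \<le> n \<Longrightarrow> trig_poly n f"
  by (induction rule: trig_poly.induct) (use modes_mono in \<open>auto intro: trig_poly.intros\<close>)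

lemma trig_poly_zero: "trig_poly n (\<lambda>x. 0)"
  using trig_poly_wave[OF zero_modes, of n 0 0] by (simp add: trig_wave_def[abs_def])

lemma trig_poly_scaleR: "trig_poly n f \<Longrightarrow> trig_poly n (\<lambda>x. c *\<^sub>R f x)"
proof (induction rule: trig_poly.induct)
  case (trig_poly_wave k a \<theta>)
  then show ?case using trig_poly.trig_poly_wave[of k n "c *\<^sub>R a" \<theta>]
    by (simp add: trig_wave_def[abs_def] mult.commute)
qed (simp add: scaleR_add_right trig_poly_add)

lemma trig_poly_sum: "(\<And>i. i \<in> I \<Longrightarrow> trig_poly n (f i)) \<Longrightarrow> trig_poly n (\<lambda>x. \<Sum>i\<in>I. f i x)"
  by (induction I rule: infinite_finite_induct) (auto intro: trig_poly_add trig_poly_zero)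

lemma trig_poly_times_wave:
  fixes g :: "real^3 \<Rightarrow> real"
  shows "trig_poly n g \<Longrightarrow> k \<in> modes m \<Longrightarrow> trig_poly (m + n) (\<lambda>x. trig_wave a k \<theta> x * g x)"
proof (induction rule: trig_poly.induct)
  case (trig_poly_wave l b \<psi>)
  have "trig_wave a k \<theta> x * trig_wave b l \<psi> x
    = trig_wave (a * b / 2) (k + - l) (\<theta> - \<psi>) x + trig_wave (a * b / 2) (k + l) (\<theta> + \<psi>) x" for x
  proof -
    have e: "frequency (k + - l) \<bullet> x - (\<theta> - \<psi>) = (frequency k \<bullet> x - \<theta>) - (frequency l \<bullet> x - \<psi>)"
      "frequency (k + l) \<bullet> x - (\<theta> + \<psi>) = (frequency k \<bullet> x - \<theta>) + (frequency l \<bullet> x - \<psi>)"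
      unfolding frequency_add frequency_minus by (simp_all add: inner_add_left inner_diff_left)
    have gen: "(p * a) * (q * b) = r * (a * b / 2) + s * (a * b / 2)" if "p * q = (r + s) / 2" for p q r s :: real
    proof -
      have "(p * a) * (q * b) = (p * q) * (a * b)" by simp
      then show ?thesis by (simp add: that field_simps)
    qed
    show ?thesis
      unfolding trig_wave_def e real_scaleR_def by (rule gen[OF cos_times_cos])
  qed
  moreover have "k + - l \<in> modes (m + n)" "k + l \<in> modes (m + n)"
    using modes_add[of k m "- l" n] modes_add[of k m l n] trig_poly_wave by auto
  ultimately show ?case by (simp add: trig_poly.intros)
qed (simp add: distrib_left trig_poly_add)

lemma trig_poly_times:
  fixes f g :: "real^3 \<Rightarrow> real"
  shows "trig_poly m f \<Longrightarrow> trig_poly n g \<Longrightarrow> trig_poly (m + n) (\<lambda>x. f x * g x)"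
  by (induction rule: trig_poly.induct) (auto simp: trig_poly_times_wave distrib_right intro: trig_poly_add)

lemma trig_poly_scaleR_const:
  fixes f :: "real^3 \<Rightarrow> real"
  shows "trig_poly n f \<Longrightarrow> trig_poly n (\<lambda>x. f x *\<^sub>R b)"
proof (induction rule: trig_poly.induct)
  case (trig_poly_wave k a \<theta>)
  then show ?case using trig_poly.trig_poly_wave[of k n "a *\<^sub>R b" \<theta>] by (simp add: trig_wave_def[abs_def])
qed (simp add: scaleR_add_left trig_poly_add)

text \<open>Embeds the torus into a Euclidean space, where the Stone-Weierstrass theorem for
  polynomials applies; polynomials in the coordinates become trigonometric polynomials.\<close>

definition circle_map :: "real^3 \<Rightarrow> complex^3" where
  "circle_map x = (\<chi> i. cis (x $ i))"

lemma continuous_circle_map: "continuous_on A circle_map"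
  unfolding circle_map_def by (intro continuous_intros)

lemma axis_1_modes: "axis i 1 \<in> modes 1"
  by (simp add: modes_def axis_def)

lemma frequency_axis: "frequency (axis i 1) \<bullet> x = x $ i"
proof -
  have "frequency (axis i 1) = axis i 1" by (simp add: frequency_def vec_eq_iff axis_def)
  then show ?thesis by (simp add: inner_axis')
qed

lemma polynomial_circle_map:
  "real_polynomial_function g \<Longrightarrow> \<exists>n. trig_poly n (\<lambda>x. g (circle_map x))"
proof (induction rule: real_polynomial_function.induct)
  case (linear h)
  then interpret h: bounded_linear h .
  have comp: "\<exists>n. trig_poly n (\<lambda>x. (circle_map x \<bullet> b) * h b)" if bB: "b \<in> Basis" for b
  proof -
    obtain i z where b: "b = axis i z" "z \<in> {1, \<i>}"
      using bB unfolding Basis_vec_def Basis_complex_def by blast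
    have "trig_poly 1 (trig_wave (h b) (axis i 1) 0)" "trig_poly 1 (trig_wave (h b) (axis i 1) (pi / 2))"
      by (rule trig_poly_wave[OF axis_1_modes])+
    moreover have "(circle_map x \<bullet> b) * h b = (if z = 1 then trig_wave (h b) (axis i 1) 0 x else trig_wave (h b) (axis i 1) (pi / 2) x)" for x
      using b by (auto simp: circle_map_def inner_axis trig_wave_def frequency_axis inner_complex_def sin_eq_cos_shift)
    ultimately show ?thesis by (cases "z = 1") (auto intro!: exI[of _ 1])
  qed
  then obtain N where N: "\<And>b. b \<in> Basis \<Longrightarrow> trig_poly (N b) (\<lambda>x. (circle_map x \<bullet> b) * h b)" by metis
  have "trig_poly (Max (N ` Basis)) (\<lambda>x. \<Sum>b\<in>Basis. (circle_map x \<bullet> b) * h b)"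
    by (rule trig_poly_sum) (auto intro!: trig_poly_mono[OF N])
  moreover have "(\<Sum>b\<in>Basis. (circle_map x \<bullet> b) * h b) = h (circle_map x)" for x
  proof -
    have "h (circle_map x) = h (\<Sum>b\<in>Basis. (circle_map x \<bullet> b) *\<^sub>R b)" by (simp add: euclidean_representation)
    then show ?thesis by (simp only: h.sum h.scaleR real_scaleR_def)
  qed
  ultimately show ?case by auto
next
  case (const c)
  have "trig_poly 0 (trig_wave c 0 0)" by (rule trig_poly_wave[OF zero_modes])
  then show ?case by (auto simp: trig_wave_def[abs_def] intro!: exI[of _ 0])
next
  case (add f g)
  then obtain m n where "trig_poly m (\<lambda>x. f (circle_map x))" "trig_poly n (\<lambda>x. g (circle_map x))" by auto
  then have "trig_poly (max m n) (\<lambda>x. f (circle_map x) + g (circle_map x))"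
    by (intro trig_poly_add) (auto elim: trig_poly_mono)
  then show ?case by blast
next
  case (mult f g)
  then show ?case using trig_poly_times by blast
qed

text \<open>A continuous periodic function factors through \<open>circle_map\<close>, and the factor
  is continuous on the image because the compact period box has closed images of closed
  subsets.\<close>

lemma trig_poly_dense_real:
  fixes f :: "real^3 \<Rightarrow> real"
  assumes f: "continuous_on UNIV f" and per: "periodic f" and e: "0 < e"
  obtains n t where "trig_poly n t" "\<And>x. \<bar>f x - t x\<bar> < e"
proof -
  define S where "S = circle_map ` torus_box"
  define F where "F z = f (SOME x. x \<in> torus_box \<and> circle_map x = z)" for z
  have wd: "f x = f y" if "circle_map x = circle_map y" for x y
  proof -
    have "\<exists>m :: int. y $ i = x $ i + 2 * pi * real_of_int m" for i
    proof -
      have "cis (x $ i) = cis (y $ i)" using that by (simp add: circle_map_def vec_eq_iff)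
      then have "sin (y $ i) = sin (x $ i) \<and> cos (y $ i) = cos (x $ i)" by (simp add: cis.ctr)
      then obtain m :: int where "y $ i = x $ i + 2 * real_of_int m * pi" using sin_cos_eq_iff by auto
      then show ?thesis by (auto simp: mult_ac)
    qed
    then obtain m where m: "\<And>i. y $ i = x $ i + 2 * pi * real_of_int (m i)" by metis
    have "y = x + (2 * pi) *\<^sub>R frequency (\<chi> i. m i)" by (simp add: vec_eq_iff m frequency_def)
    then show ?thesis using periodic_lattice[OF per] by simp
  qed
  have FE: "F (circle_map x) = f x" if "x \<in> torus_box" for x
    unfolding F_def by (rule wd) (use someI[of "\<lambda>y. y \<in> torus_box \<and> circle_map y = circle_map x" x] that in auto)
  have S: "compact S" unfolding S_def by (intro compact_continuous_image continuous_circle_map compact_torus_box)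
  have "continuous_on S F"
    unfolding continuous_on_closed_invariant
  proof (intro allI impI)
    fix C :: "real set" assume C: "closed C"
    let ?A = "circle_map ` (torus_box \<inter> f -` C)"
    have "closed (f -` C)" using continuous_closed_preimage[OF f closed_UNIV C] by simp
    then have "compact ?A"
      by (intro compact_continuous_image continuous_circle_map compact_Int_closed compact_torus_box)
    then have "closed ?A" by (rule compact_imp_closed)
    moreover have "?A \<inter> S = F -` C \<inter> S" by (auto simp: S_def FE) (metis wd)
    ultimately show "\<exists>A. closed A \<and> A \<inter> S = F -` C \<inter> S" by blast
  qed
  from Stone_Weierstrass_real_polynomial_function[OF S this e]
  obtain g where g: "real_polynomial_function g" "\<And>z. z \<in> S \<Longrightarrow> \<bar>F z - g z\<bar> < e" by blast
  obtain n where n: "trig_poly n (\<lambda>x. g (circle_map x))" using polynomial_circle_map[OF g(1)] by blast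
  have "\<bar>f x - g (circle_map x)\<bar> < e" for x
  proof -
    obtain k where k: "x + (2 * pi) *\<^sub>R frequency k \<in> torus_cell" using ex1_cell[of x] by blast
    let ?y = "x + (2 * pi) *\<^sub>R frequency k"
    have y: "?y \<in> torus_box" using k by (auto simp: torus_cell_def torus_box_def mem_box_cart less_imp_le)
    have "circle_map ?y = circle_map x"
    proof -
      have "cis (x $ i + 2 * pi * real_of_int (k $ i)) = cis (x $ i)" for i
        by (simp add: cis_mult[symmetric] cis_multiple_2pi)
      then show ?thesis by (simp add: circle_map_def vec_eq_iff frequency_def)
    qed
    moreover have "f ?y = f x" by (rule periodic_lattice[OF per])
    ultimately show ?thesis using g(2)[of "circle_map ?y"] FE[OF y] imageI[OF y, of circle_map] by (simp add: S_def)
  qed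
  with n show ?thesis using that by blast
qed

lemma trig_poly_dense:
  fixes f :: "real^3 \<Rightarrow> 'b::euclidean_space"
  assumes f: "continuous_on UNIV f" and per: "periodic f" and e: "0 < e"
  obtains n t where "trig_poly n t" "\<And>x. norm (f x - t x) < e"
proof -
  let ?e = "e / real (DIM('b))"
  have "\<exists>n t. trig_poly n t \<and> (\<forall>x. \<bar>f x \<bullet> b - t x\<bar> < ?e)" for b
  proof -
    have "continuous_on UNIV (\<lambda>x. f x \<bullet> b)" by (intro continuous_intros f)
    moreover have "periodic (\<lambda>x. f x \<bullet> b)" using per by (simp add: periodic_def)
    moreover have "0 < ?e" using e by simp
    ultimately obtain n t where "trig_poly n t" "\<And>x. \<bar>f x \<bullet> b - t x\<bar> < ?e"
      by (rule trig_poly_dense_real) blast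
    then show ?thesis by blast
  qed
  then obtain N T where T: "\<And>b. trig_poly (N b) (T b)" "\<And>b x. \<bar>f x \<bullet> b - T b x\<bar> < ?e" by metis
  have "trig_poly (Max (N ` Basis)) (\<lambda>x. \<Sum>b\<in>Basis. T b x *\<^sub>R b)"
    by (rule trig_poly_sum) (auto intro!: trig_poly_scaleR_const trig_poly_mono[OF T(1)])
  moreover have "norm (f x - (\<Sum>b\<in>Basis. T b x *\<^sub>R b)) < e" for x
  proof -
    have "f x - (\<Sum>b\<in>Basis. T b x *\<^sub>R b) = (\<Sum>b\<in>Basis. (f x \<bullet> b - T b x) *\<^sub>R b)"
      by (subst (1) euclidean_representation[of "f x", symmetric]) (simp add: sum_subtractf scaleR_diff_left)
    also have "norm \<dots> \<le> (\<Sum>b\<in>(Basis :: 'b set). \<bar>f x \<bullet> b - T b x\<bar>)"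
      by (rule order_trans[OF norm_sum]) simp
    also have "\<dots> < (\<Sum>b\<in>(Basis :: 'b set). ?e)"
      by (rule sum_strict_mono) (use T in auto)
    finally show ?thesis by simp
  qed
  ultimately show ?thesis using that by blast
qed

section \<open>Fourier coefficients with a phase and the truncation to finitely many modes\<close>

lemma measure_torus: "measure torus UNIV = (2 * pi) ^ 3"
proof -
  have "emeasure torus UNIV = emeasure lborel torus_box"
    by (simp add: leb_on_def emeasure_density)
  also have "\<dots> = ennreal ((2 * pi) ^ 3)"
    unfolding torus_box_def
    by (subst emeasure_lborel_cbox) (auto simp: Basis_vec_def inner_axis prod.UNION_disjoint axis_eq_axis UNION_singleton_eq_range prod.reindex inj_on_def)
  finally show ?thesis by (simp add: measure_def)
qed

lemma integral_cos:
  "(LINT x|torus. cos (frequency k \<bullet> x - \<theta>)) = (if k = 0 then (2 * pi) ^ 3 * cos \<theta> else 0)"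
proof (cases "k = 0")
  case True
  then show ?thesis by (simp add: measure_torus)
next
  case False
  let ?k = "frequency k"
  have "((\<lambda>x. sin (?k \<bullet> x - \<theta>)) has_derivative (\<lambda>v. cos (?k \<bullet> x - \<theta>) * (?k \<bullet> v))) (at x)" for x
    by (auto intro!: derivative_eq_intros)
  moreover have "continuous_on UNIV (\<lambda>x. cos (?k \<bullet> x - \<theta>) * (?k \<bullet> ?k))" by (intro continuous_intros)
  moreover have "periodic (\<lambda>x. sin (?k \<bullet> x - \<theta>))"
    using cos_periodic_freq[of k _ _ "\<theta> + pi / 2"] by (simp add: periodic_def sin_eq_cos_shift diff_diff_eq)
  ultimately have "(LINT x|torus. cos (?k \<bullet> x - \<theta>) * (?k \<bullet> ?k)) = 0"
    by (rule torus_derivative_integral_0)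
  then show ?thesis using False frequency_eq_0_iff[of k] by simp
qed

text \<open>The frequencies \<open>k\<close> and \<open>- k\<close> carry the same real waves, hence
  two alternatives. For \<open>k = l = 0\<close> both apply, and their sum is the correct
  value.\<close>

lemma integral_cos_cos:
  "(LINT x|torus. cos (frequency k \<bullet> x - \<alpha>) * cos (frequency l \<bullet> x - \<theta>))
    = (2 * pi) ^ 3 / 2 * ((if k = l then cos (\<alpha> - \<theta>) else 0) + (if k = - l then cos (\<alpha> + \<theta>) else 0))"
proof -
  have i: "integrable torus (\<lambda>x. cos (frequency m \<bullet> x - \<beta>))" for m \<beta>
    by (intro integrable_leb_on_continuous compact_torus_box continuous_intros)
  have "cos (frequency k \<bullet> x - \<alpha>) * cos (frequency l \<bullet> x - \<theta>)
    = (1 / 2) * (cos (frequency (k + - l) \<bullet> x - (\<alpha> - \<theta>)) + cos (frequency (k + l) \<bullet> x - (\<alpha> + \<theta>)))" for x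
  proof -
    have e: "frequency (k + - l) \<bullet> x - (\<alpha> - \<theta>) = (frequency k \<bullet> x - \<alpha>) - (frequency l \<bullet> x - \<theta>)"
      "frequency (k + l) \<bullet> x - (\<alpha> + \<theta>) = (frequency k \<bullet> x - \<alpha>) + (frequency l \<bullet> x - \<theta>)"
      unfolding frequency_add frequency_minus by (simp_all add: inner_add_left inner_diff_left)
    show ?thesis unfolding e cos_times_cos by simp
  qed
  moreover have "k + - l = 0 \<longleftrightarrow> k = l" "k + l = 0 \<longleftrightarrow> k = - l"
    by (simp_all add: eq_neg_iff_add_eq_0)
  ultimately show ?thesis using i by (simp only: integral_mult_right_zero Bochner_Integration.integral_add[OF i i] integral_cos) (simp add: distrib_left)
qed

definition phase_coeff :: "(real^3 \<Rightarrow> 'b::euclidean_space) \<Rightarrow> int^3 \<Rightarrow> real \<Rightarrow> 'b" where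
  "phase_coeff f k \<theta> = (LINT y|torus. cos (frequency k \<bullet> y - \<theta>) *\<^sub>R f y)"

lemma torus_scale_integrable:
  fixes f :: "real^3 \<Rightarrow> 'b::euclidean_space"
  assumes f: "f \<in> L2_torus" and g: "g \<in> borel_measurable borel" "\<And>x. \<bar>g x\<bar> \<le> B"
  shows "integrable torus (\<lambda>x. g x *\<^sub>R f x)"
proof (rule Bochner_Integration.integrable_bound)
  show "integrable torus (\<lambda>x. B * norm (f x))"
    using torus.sqint_integrable[OF L2_torusD(3)[OF f]] by (intro integrable_mult_right integrable_norm)
  show "AE x in torus. norm (g x *\<^sub>R f x) \<le> norm (B * norm (f x))"
    using g(2) order_trans[OF abs_ge_zero g(2)] by (intro AE_I2) (auto simp: abs_mult intro: mult_right_mono)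
qed (use f g in \<open>auto simp: L2_torus_iff\<close>)

lemma phase_coeff_integrable:
  "f \<in> L2_torus \<Longrightarrow> integrable torus (\<lambda>y. cos (frequency k \<bullet> y - \<theta>) *\<^sub>R f y)"
  by (rule torus_scale_integrable[where B = 1]) auto

lemma phase_coeff_inner: "f \<in> L2_torus \<Longrightarrow> phase_coeff f k \<theta> \<bullet> a = (LINT y|torus. f y \<bullet> trig_wave a k \<theta> y)"
  unfolding phase_coeff_def
  by (subst integral_inner_left[symmetric]) (auto simp: phase_coeff_integrable trig_wave_def)

lemma phase_coeff_diff: "f \<in> L2_torus \<Longrightarrow> g \<in> L2_torus \<Longrightarrow> phase_coeff (\<lambda>x. f x - g x) k \<theta> = phase_coeff f k \<theta> - phase_coeff g k \<theta>"
  unfolding phase_coeff_def using phase_coeff_integrable[of f] phase_coeff_integrable[of g]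
  by (simp add: scaleR_diff_right)

lemma phase_coeff_shift:
  assumes "f \<in> L2_torus"
  shows "phase_coeff f k \<theta> = cos \<theta> *\<^sub>R phase_coeff f k 0 + sin \<theta> *\<^sub>R phase_coeff f k (pi / 2)"
proof -
  have "phase_coeff f k \<theta> = (LINT y|torus. cos \<theta> *\<^sub>R (cos (frequency k \<bullet> y - 0) *\<^sub>R f y)
      + sin \<theta> *\<^sub>R (cos (frequency k \<bullet> y - pi / 2) *\<^sub>R f y))"
    unfolding phase_coeff_def
    by (intro Bochner_Integration.integral_cong refl) (simp add: cos_diff scaleR_add_left[symmetric] mult.commute)
  also have "\<dots> = cos \<theta> *\<^sub>R phase_coeff f k 0 + sin \<theta> *\<^sub>R phase_coeff f k (pi / 2)"
    unfolding phase_coeff_def integral_scaleR_right[symmetric]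
    by (intro Bochner_Integration.integral_add integrable_scaleR_right phase_coeff_integrable assms)
  finally show ?thesis .
qed

lemma phase_coeff_bound:
  assumes "f \<in> L2_torus"
  shows "norm (phase_coeff f k \<theta>) \<le> sqrt ((2 * pi) ^ 3) * l2 torus f"
proof -
  have "norm (phase_coeff f k \<theta>) \<le> (LINT y|torus. norm (cos (frequency k \<bullet> y - \<theta>) *\<^sub>R f y))"
    unfolding phase_coeff_def by (rule integral_norm_bound)
  also have "\<dots> \<le> (LINT y|torus. norm (f y))"
    using phase_coeff_integrable[OF assms] torus.sqint_integrable[OF L2_torusD(3)[OF assms]]
    by (intro integral_mono integrable_norm) (auto intro: mult_left_le_one_le)
  also have "\<dots> \<le> sqrt ((2 * pi) ^ 3) * l2 torus f"
    using torus.l1_le_l2[OF L2_torusD(3)[OF assms]] by (simp add: measure_torus)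
  finally show ?thesis .
qed

text \<open>The orthogonal projection to the modes up to \<open>n\<close>. Each wave with nonzero
  frequency occurs under \<open>k\<close> and under \<open>- k\<close>, which is why the factor is
  \<open>1 / (2 * pi) ^ 3\<close> and not twice that.\<close>

definition trig_proj :: "nat \<Rightarrow> (real^3 \<Rightarrow> 'b::euclidean_space) \<Rightarrow> real^3 \<Rightarrow> 'b" where
  "trig_proj n f x = (1 / (2 * pi) ^ 3) *\<^sub>R (\<Sum>k\<in>modes n. trig_wave (phase_coeff f k 0) k 0 x
     + trig_wave (phase_coeff f k (pi / 2)) k (pi / 2) x)"

lemma trig_poly_trig_proj: "trig_poly n (trig_proj n f)"
  unfolding trig_proj_def by (intro trig_poly_scaleR trig_poly_sum trig_poly_add trig_poly_wave)

lemma trig_proj_L2: "trig_proj n f \<in> L2_torus"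
  by (rule trig_poly_L2[OF trig_poly_trig_proj])

lemma phase_coeff_trig_wave:
  "phase_coeff (trig_wave a l \<theta>) k \<alpha>
    = ((2 * pi) ^ 3 / 2 * ((if k = l then cos (\<alpha> - \<theta>) else 0) + (if k = - l then cos (\<alpha> + \<theta>) else 0))) *\<^sub>R a"
proof -
  have "phase_coeff (trig_wave a l \<theta>) k \<alpha> = (LINT x|torus. (cos (frequency k \<bullet> x - \<alpha>) * cos (frequency l \<bullet> x - \<theta>)) *\<^sub>R a)"
    by (simp add: phase_coeff_def trig_wave_def)
  also have "\<dots> = (LINT x|torus. cos (frequency k \<bullet> x - \<alpha>) * cos (frequency l \<bullet> x - \<theta>)) *\<^sub>R a"
  proof (rule integral_scaleR_left)
    show "integrable torus (\<lambda>x. cos (frequency k \<bullet> x - \<alpha>) * cos (frequency l \<bullet> x - \<theta>))"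
      by (intro integrable_leb_on_continuous compact_torus_box continuous_intros)
  qed
  finally show ?thesis by (simp only: integral_cos_cos)
qed

text \<open>The summands \<open>k = l\<close> and \<open>k = - l\<close> reproduce half of the wave
  each; for \<open>l = 0\<close> the two halves sit in one summand.\<close>

lemma trig_proj_wave:
  "trig_proj n (trig_wave a l \<theta>) x = (if l \<in> modes n then trig_wave a l \<theta> x else 0)"
proof -
  let ?c = "(2 * pi) ^ 3 :: real"
  let ?L = "frequency l \<bullet> x"
  let ?F = "\<lambda>k. (if k = l then cos (?L - \<theta>) / 2 else 0) + (if k = - l then cos (?L - \<theta>) / 2 else 0) :: real"
  have c: "?c \<noteq> 0" by simp
  have t: "trig_wave (phase_coeff (trig_wave a l \<theta>) k 0) k 0 x + trig_wave (phase_coeff (trig_wave a l \<theta>) k (pi / 2)) k (pi / 2) x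
    = (?c * ?F k) *\<^sub>R a" for k
  proof -
    let ?K = "frequency k \<bullet> x"
    have "cos (- \<theta>) * cos ?K + cos (pi / 2 - \<theta>) * cos (?K - pi / 2) = cos (?K - \<theta>)"
      "cos \<theta> * cos ?K + cos (pi / 2 + \<theta>) * cos (?K - pi / 2) = cos (- ?K - \<theta>)"
      by (simp_all add: cos_diff cos_add sin_diff)
    moreover have "?c / 2 * ((if P then cm else 0) + (if Q then ct else 0)) * cK + ?c / 2 * ((if P then cp else 0) + (if Q then cs else 0)) * sK
      = ?c * ((if P then c1 / 2 else 0) + (if Q then c2 / 2 else 0))"
      if "cm * cK + cp * sK = c1" "ct * cK + cs * sK = c2" for P Q and cm ct cp cs cK sK c1 c2 :: real
      unfolding that[symmetric] by (simp add: field_simps)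
    ultimately have "?c / 2 * ((if k = l then cos (- \<theta>) else 0) + (if k = - l then cos \<theta> else 0)) * cos ?K
      + ?c / 2 * ((if k = l then cos (pi / 2 - \<theta>) else 0) + (if k = - l then cos (pi / 2 + \<theta>) else 0)) * cos (?K - pi / 2)
      = ?c * ((if k = l then cos (?K - \<theta>) / 2 else 0) + (if k = - l then cos (- ?K - \<theta>) / 2 else 0))"
      by blast
    moreover have "(if k = l then cos (?K - \<theta>) / 2 else 0) + (if k = - l then cos (- ?K - \<theta>) / 2 else 0) = ?F k"
      by (rule arg_cong2[where f = "(+)"]) (auto simp: frequency_minus)
    ultimately have "?c / 2 * ((if k = l then cos (0 - \<theta>) else 0) + (if k = - l then cos (0 + \<theta>) else 0)) * cos (?K - 0)
      + ?c / 2 * ((if k = l then cos (pi / 2 - \<theta>) else 0) + (if k = - l then cos (pi / 2 + \<theta>) else 0)) * cos (?K - pi / 2)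
      = ?c * ?F k"
      by (simp only: diff_0 add_0 diff_zero)
    then show ?thesis
      unfolding phase_coeff_trig_wave unfolding trig_wave_def scaleR_scaleR scaleR_add_left[symmetric]
      by (simp add: mult.commute)
  qed
  have "trig_proj n (trig_wave a l \<theta>) x = (1 / ?c) *\<^sub>R ((?c * (\<Sum>k\<in>modes n. ?F k)) *\<^sub>R a)"
    unfolding trig_proj_def t by (simp add: scaleR_sum_left[symmetric] sum_distrib_left)
  also have "\<dots> = (\<Sum>k\<in>modes n. ?F k) *\<^sub>R a" using c by simp
  also have "(\<Sum>k\<in>modes n. ?F k) = (if l \<in> modes n then cos (?L - \<theta>) else 0)"
    using modes_uminus[of l n] by (simp add: sum.distrib sum.delta del: modes_uminus)
  finally show ?thesis by (cases "l \<in> modes n") (simp_all add: trig_wave_def[of a l \<theta> x])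
qed

lemma phase_coeff_add: "f \<in> L2_torus \<Longrightarrow> g \<in> L2_torus \<Longrightarrow> phase_coeff (\<lambda>x. f x + g x) k \<theta> = phase_coeff f k \<theta> + phase_coeff g k \<theta>"
  unfolding phase_coeff_def using phase_coeff_integrable[of f] phase_coeff_integrable[of g]
  by (simp add: scaleR_add_right)

lemma trig_proj_add: "f \<in> L2_torus \<Longrightarrow> g \<in> L2_torus \<Longrightarrow> trig_proj n (\<lambda>x. f x + g x) x = trig_proj n f x + trig_proj n g x"
  by (simp add: trig_proj_def phase_coeff_add trig_wave_def scaleR_add_right sum.distrib)

lemma trig_proj_trig_poly: "trig_poly n f \<Longrightarrow> trig_proj n f x = f x"
proof (induction rule: trig_poly.induct)
  case (trig_poly_add f g)
  then show ?case by (simp add: trig_proj_add trig_poly_L2)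
qed (simp add: trig_proj_wave)

lemma inner_trig_proj:
  assumes f: "f \<in> L2_torus" and g: "g \<in> L2_torus"
  shows "(LINT x|torus. trig_proj n f x \<bullet> g x) = (1 / (2 * pi) ^ 3) * (\<Sum>k\<in>modes n.
    phase_coeff f k 0 \<bullet> phase_coeff g k 0 + phase_coeff f k (pi / 2) \<bullet> phase_coeff g k (pi / 2))"
proof -
  have i: "integrable torus (\<lambda>x. trig_wave a k \<theta> x \<bullet> g x)" for a k \<theta>
    using trig_wave_L2 g by (intro integrable_inner) (auto simp: L2_torus_iff)
  have w: "(LINT x|torus. trig_wave a k \<theta> x \<bullet> g x) = a \<bullet> phase_coeff g k \<theta>" for a k \<theta>
    using phase_coeff_inner[OF g, of k \<theta> a] by (simp add: inner_commute)
  have "(LINT x|torus. trig_proj n f x \<bullet> g x) = (LINT x|torus. (1 / (2 * pi) ^ 3) * (\<Sum>k\<in>modes n.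
      trig_wave (phase_coeff f k 0) k 0 x \<bullet> g x + trig_wave (phase_coeff f k (pi / 2)) k (pi / 2) x \<bullet> g x))"
    unfolding trig_proj_def by (simp add: inner_sum_left inner_add_left)
  also have "\<dots> = (1 / (2 * pi) ^ 3) * (\<Sum>k\<in>modes n.
    phase_coeff f k 0 \<bullet> phase_coeff g k 0 + phase_coeff f k (pi / 2) \<bullet> phase_coeff g k (pi / 2))"
    by (subst integral_mult_right_zero, subst Bochner_Integration.integral_sum)
      (auto simp: i w intro!: Bochner_Integration.integrable_add)
  finally show ?thesis .
qed

lemma trig_proj_self_adjoint:
  assumes "f \<in> L2_torus" "g \<in> L2_torus"
  shows "(LINT x|torus. trig_proj n f x \<bullet> g x) = (LINT x|torus. f x \<bullet> trig_proj n g x)"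
proof -
  have "(LINT x|torus. f x \<bullet> trig_proj n g x) = (LINT x|torus. trig_proj n g x \<bullet> f x)" by (simp add: inner_commute)
  then show ?thesis
    by (simp only: inner_trig_proj[OF assms] inner_trig_proj[OF assms(2,1)] inner_commute[of "phase_coeff g _ _"])
qed

text \<open>Pythagoras, from idempotence and self-adjointness of the projection.\<close>

lemma l2_diff_trig_proj:
  assumes f: "f \<in> L2_torus"
  shows "(l2 torus (\<lambda>x. f x - trig_proj n f x))\<^sup>2 = (l2 torus f)\<^sup>2 - (l2 torus (trig_proj n f))\<^sup>2"
proof -
  note sf = L2_torusD(3)[OF f] and sp = L2_torusD(3)[OF trig_proj_L2[of n f]]
  have "(LINT x|torus. f x \<bullet> trig_proj n f x) = (LINT x|torus. f x \<bullet> trig_proj n (trig_proj n f) x)"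
    by (simp add: trig_proj_trig_poly[OF trig_poly_trig_proj])
  also have "\<dots> = (LINT x|torus. trig_proj n f x \<bullet> trig_proj n f x)"
    by (rule trig_proj_self_adjoint[symmetric, OF f trig_proj_L2])
  finally have eq: "(LINT x|torus. f x \<bullet> trig_proj n f x) = (LINT x|torus. trig_proj n f x \<bullet> trig_proj n f x)" .
  have "(l2 torus (\<lambda>x. f x - trig_proj n f x))\<^sup>2
    = (LINT x|torus. f x \<bullet> f x - 2 * (f x \<bullet> trig_proj n f x) + trig_proj n f x \<bullet> trig_proj n f x)"
    unfolding l2_squared power2_norm_eq_inner
    by (intro Bochner_Integration.integral_cong refl) (simp add: inner_diff_left inner_diff_right inner_commute)
  also have "\<dots> = (LINT x|torus. f x \<bullet> f x) - 2 * (LINT x|torus. f x \<bullet> trig_proj n f x) + (LINT x|torus. trig_proj n f x \<bullet> trig_proj n f x)"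
    using integrable_inner[OF sf sf] integrable_inner[OF sf sp] integrable_inner[OF sp sp] by simp
  finally show ?thesis unfolding eq by (simp add: l2_squared power2_norm_eq_inner)
qed

lemma l2_trig_proj_le: "f \<in> L2_torus \<Longrightarrow> l2 torus (trig_proj n f) \<le> l2 torus f"
  using l2_diff_trig_proj[of f n] zero_le_power2[of "l2 torus (\<lambda>x. f x - trig_proj n f x)"]
  by (intro power2_le_imp_le[OF _ l2_nonneg]) simp

lemma trig_proj_diff: "f \<in> L2_torus \<Longrightarrow> g \<in> L2_torus \<Longrightarrow> trig_proj n (\<lambda>x. f x - g x) x = trig_proj n f x - trig_proj n g x"
  by (simp add: trig_proj_def phase_coeff_diff trig_wave_def scaleR_diff_right sum.distrib sum_subtractf scaleR_add_right)

lemma l2_diff_trig_proj_le: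
  assumes f: "f \<in> L2_torus" and t: "trig_poly m t" and m: "m \<le> n"
  shows "l2 torus (\<lambda>x. f x - trig_proj n f x) \<le> l2 torus (\<lambda>x. f x - t x)"
proof -
  have t': "trig_poly n t" by (rule trig_poly_mono[OF t m])
  have d: "(\<lambda>x. f x - t x) \<in> L2_torus" by (rule L2_torus_diff[OF f trig_poly_L2[OF t]])
  have "f x - trig_proj n f x = (f x - t x) - trig_proj n (\<lambda>x. f x - t x) x" for x
    by (simp add: trig_proj_diff[OF f trig_poly_L2[OF t]] trig_proj_trig_poly[OF t'])
  then have "(l2 torus (\<lambda>x. f x - trig_proj n f x))\<^sup>2 = (l2 torus (\<lambda>x. (f x - t x) - trig_proj n (\<lambda>x. f x - t x) x))\<^sup>2"
    by (simp only:)
  then have "(l2 torus (\<lambda>x. f x - trig_proj n f x))\<^sup>2 \<le> (l2 torus (\<lambda>x. f x - t x))\<^sup>2"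
    using l2_diff_trig_proj[OF d, of n] zero_le_power2[of "l2 torus (trig_proj n (\<lambda>x. f x - t x))"] by linarith
  then show ?thesis by (rule power2_le_imp_le) simp
qed

text \<open>Fields in \<open>L2_div\<close> and gradients come with continuous periodic approximants
  by definition. Best approximation reduces the claim to these, and uniform density of trigonometric
  polynomials settles them.\<close>

lemma trig_proj_tendsto_of_approx:
  fixes f :: "real^3 \<Rightarrow> 'b::euclidean_space"
  assumes f: "f \<in> L2_torus" and s: "\<And>j. continuous_on UNIV (s j)" "\<And>j. periodic (s j)"
    and lim: "(\<lambda>j. l2 torus (\<lambda>x. f x - s j x)) \<longlonglongrightarrow> 0"
  shows "(\<lambda>n. l2 torus (\<lambda>x. f x - trig_proj n f x)) \<longlonglongrightarrow> 0"
proof (rule LIMSEQ_I)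
  fix e :: real assume e: "0 < e"
  obtain j where j: "l2 torus (\<lambda>x. f x - s j x) < e / 2"
    using LIMSEQ_D[OF lim, of "e / 2"] e by force
  \<comment> \<open>\<open>M\<close> is the norm of the constant one and converts a uniform bound
    into an \<open>L\<^sup>2\<close> bound.\<close>
  define M where "M = sqrt ((2 * pi) ^ 3)"
  have M: "0 < M" by (simp add: M_def)
  obtain m t where t: "trig_poly m t" "\<And>x. norm (s j x - t x) < e / (2 * M)"
    using trig_poly_dense[OF s(1)[of j] s(2)[of j], of "e / (2 * M)"] e M by auto
  note sf = L2_torusD(3)[OF f] and ss = L2_torusD(3)[OF L2_torus_continuous[OF s(1)[of j] s(2)[of j]]]
    and st = L2_torusD(3)[OF trig_poly_L2[OF t(1)]]
  have "l2 torus (\<lambda>x. s j x - t x) \<le> l2 torus (\<lambda>x. e / (2 * M))"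
    by (rule l2_mono[OF torus.sqint_const]) (use t(2) e M sqint_diff[OF ss st] in \<open>auto simp: less_imp_le sqint_def\<close>)
  also have "\<dots> = e / 2"
    using e M by (simp add: l2_def measure_torus real_sqrt_mult M_def)
  finally have 2: "l2 torus (\<lambda>x. s j x - t x) \<le> e / 2" .
  have "l2 torus (\<lambda>x. f x - t x) \<le> l2 torus (\<lambda>x. f x - s j x) + l2 torus (\<lambda>x. s j x - t x)"
    using l2_add[OF sqint_diff[OF sf ss] sqint_diff[OF ss st]] by simp
  then have "l2 torus (\<lambda>x. f x - t x) < e" using j 2 by simp
  then have "l2 torus (\<lambda>x. f x - trig_proj n f x) < e" if "m \<le> n" for n
    using l2_diff_trig_proj_le[OF f t(1) that] by simp
  then show "\<exists>N. \<forall>n\<ge>N. norm (l2 torus (\<lambda>x. f x - trig_proj n f x) - 0) < e" by auto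
qed

section \<open>Divergence-free modes and the gradient\<close>

text \<open>The matrix amplitude of the gradient of a wave with amplitude \<open>a\<close> and
  frequency vector \<open>b\<close>.\<close>

definition outer :: "real^3 \<Rightarrow> real^3 \<Rightarrow> real^3^3" where
  "outer a b = (\<chi> i j. a $ i * b $ j)"

lemma outer_mult: "outer a b *v v = (b \<bullet> v) *\<^sub>R a"
  by (simp add: outer_def matrix_vector_mult_def vec_eq_iff inner_vec_def sum_distrib_left sum_distrib_right mult_ac)

lemma inner_outer: "outer a b \<bullet> outer c d = (a \<bullet> c) * (b \<bullet> d)"
  by (simp add: outer_def inner_vec_def sum_product mult_ac)

lemma trace_outer: "trace (outer a b) = a \<bullet> b"
  by (simp add: outer_def trace_def inner_vec_def)

lemma trig_wave_has_derivative:
  "(trig_wave a k \<theta> has_derivative (\<lambda>v. (frequency k \<bullet> v) *\<^sub>R trig_wave a k (\<theta> - pi / 2) x)) (at x)"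
proof -
  have "cos (frequency k \<bullet> x - (\<theta> - pi / 2)) = - sin (frequency k \<bullet> x - \<theta>)"
    using cos_add[of "frequency k \<bullet> x - \<theta>" "pi / 2"] by (simp add: algebra_simps)
  then show ?thesis
    unfolding trig_wave_def[abs_def] by (auto intro!: derivative_eq_intros simp: mult.commute)
qed

lemma C_k_trig_wave: "C_k n (trig_wave a k \<theta>)" for a :: "real^3"
proof (induction n arbitrary: a \<theta>)
  case 0
  show ?case by (simp add: trig_wave_continuous)
next
  case (Suc n)
  have "(\<lambda>x. (frequency k \<bullet> v) *\<^sub>R trig_wave a k (\<theta> - pi / 2) x) = trig_wave ((frequency k \<bullet> v) *\<^sub>R a) k (\<theta> - pi / 2)" for v
    by (simp add: trig_wave_def fun_eq_iff mult.commute)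
  then show ?case
    using Suc trig_wave_has_derivative[of a k \<theta>]
    by (auto intro!: exI[of _ "\<lambda>x v. (frequency k \<bullet> v) *\<^sub>R trig_wave a k (\<theta> - pi / 2) x"])
qed

lemma jacobian_eqI:
  fixes f :: "real^3 \<Rightarrow> real^3"
  assumes "(f has_derivative (\<lambda>v. A *v v)) (at x)"
  shows "jacobian f (at x) = A"
  by (simp add: jacobian_def frechet_derivative_at[OF assms, symmetric] matrix_of_matrix_vector_mul)

lemma trig_wave_has_derivative_outer:
  "(trig_wave a k \<theta> has_derivative (\<lambda>v. trig_wave (outer a (frequency k)) k (\<theta> - pi / 2) x *v v)) (at x)"
proof -
  have "trig_wave (outer a (frequency k)) k (\<theta> - pi / 2) x *v v = (frequency k \<bullet> v) *\<^sub>R trig_wave a k (\<theta> - pi / 2) x" for v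
    by (simp add: trig_wave_def scaleR_matrix_vector_assoc[symmetric] outer_mult mult.commute)
  then show ?thesis using trig_wave_has_derivative[of a k \<theta> x] by simp
qed

lemmas jacobian_trig_wave = jacobian_eqI[OF trig_wave_has_derivative_outer]

lemma trace_trig_wave: "trace (trig_wave A k \<theta> x) = cos (frequency k \<bullet> x - \<theta>) * trace A"
  by (simp add: trig_wave_def trace_def sum_distrib_left)

lemma trig_wave_Cinf_div:
  assumes "a \<bullet> frequency k = 0" "k \<noteq> 0"
  shows "trig_wave a k \<theta> \<in> Cinf_div"
proof -
  have "(LINT x:torus_box|lborel. trig_wave a k \<theta> x) = (LINT x|torus. trig_wave a k \<theta> x)"
    by (subst integral_leb_on(1)) auto
  also have "\<dots> = (LINT x|torus. cos (frequency k \<bullet> x - \<theta>)) *\<^sub>R a"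
    unfolding trig_wave_def
    by (rule integral_scaleR_left) (intro integrable_leb_on_continuous compact_torus_box continuous_intros)
  also have "\<dots> = 0" using assms(2) by (simp add: integral_cos)
  finally show ?thesis
    using assms
    by (simp add: Cinf_div_def periodic_trig_wave C_k_trig_wave jacobian_trig_wave trace_trig_wave trace_outer)
qed

lemma C_k_add: "C_k n f \<Longrightarrow> C_k n g \<Longrightarrow> C_k n (\<lambda>x. f x + g x)"
proof (induction n arbitrary: f g)
  case 0
  then show ?case by (auto intro: continuous_on_add)
next
  case (Suc n)
  obtain f' g' where "\<And>x. (f has_derivative f' x) (at x)" "\<And>v. C_k n (\<lambda>x. f' x v)"
    "\<And>x. (g has_derivative g' x) (at x)" "\<And>v. C_k n (\<lambda>x. g' x v)"
    using Suc.prems by auto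
  then show ?case
    using Suc.IH by (auto intro!: exI[of _ "\<lambda>x v. f' x v + g' x v"] has_derivative_add)
qed

lemma Cinf_div_zero: "(\<lambda>x. 0) \<in> Cinf_div"
proof -
  have "C_k n (\<lambda>x. 0)" for n
    using C_k_trig_wave[of n 0 0 0] by (simp add: trig_wave_def[abs_def])
  moreover have "jacobian (\<lambda>x. 0 :: real^3) (at x) = 0" for x :: "real^3"
    by (rule jacobian_eqI) simp
  ultimately show ?thesis by (simp add: Cinf_div_def periodic_def trace_def)
qed

lemma Cinf_div_has_derivative:
  "\<phi> \<in> Cinf_div \<Longrightarrow> (\<phi> has_derivative (\<lambda>v. jacobian \<phi> (at x) *v v)) (at x)"
  using C1_divD(2)[OF Cinf_div_C1_div] by blast

lemma integral_Cinf_div: "\<phi> \<in> Cinf_div \<Longrightarrow> (LINT x|torus. \<phi> x) = 0"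
  using C1_div_L2_torus(1)[OF Cinf_div_C1_div]
  by (subst integral_leb_on(1)) (auto simp: Cinf_div_def L2_torus_iff)

lemma Cinf_div_add:
  assumes f: "f \<in> Cinf_div" and g: "g \<in> Cinf_div"
  shows "(\<lambda>x. f x + g x) \<in> Cinf_div"
proof -
  note L = C1_div_L2_torus(1)[OF Cinf_div_C1_div[OF f]] C1_div_L2_torus(1)[OF Cinf_div_C1_div[OF g]]
  have J: "jacobian (\<lambda>x. f x + g x) (at x) = jacobian f (at x) + jacobian g (at x)" for x
    using has_derivative_add[OF Cinf_div_has_derivative[OF f] Cinf_div_has_derivative[OF g]]
    by (intro jacobian_eqI) (simp add: matrix_vector_mult_add_rdistrib)
  have "(LINT x:torus_box|lborel. f x + g x) = (LINT x|torus. f x + g x)"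
    using L by (subst integral_leb_on(1)) (auto simp: L2_torus_iff)
  also have "\<dots> = 0"
    using torus.sqint_integrable[OF L2_torusD(3)[OF L(1)]] torus.sqint_integrable[OF L2_torusD(3)[OF L(2)]]
    by (simp add: integral_Cinf_div f g)
  finally show ?thesis using f g by (auto simp: Cinf_div_def periodic_def J trace_add C_k_add)
qed

lemma Cinf_div_sum: "(\<And>i. i \<in> I \<Longrightarrow> f i \<in> Cinf_div) \<Longrightarrow> (\<lambda>x. \<Sum>i\<in>I. f i x) \<in> Cinf_div"
  by (induction I rule: infinite_finite_induct) (auto intro: Cinf_div_add Cinf_div_zero)

lemma L2_div_L2_torus: "v \<in> L2_div \<Longrightarrow> v \<in> L2_torus"
  by (simp add: L2_div_def)

lemma L2_div_approx:
  assumes v: "v \<in> L2_div"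
  obtains \<phi> where "\<And>n. \<phi> n \<in> Cinf_div" "(\<lambda>n. l2 torus (\<lambda>x. v x - \<phi> n x)) \<longlonglongrightarrow> 0"
proof -
  obtain \<phi> where \<phi>: "\<And>n. \<phi> n \<in> Cinf_div" "(\<lambda>n. L2_norm (\<lambda>x. v x - \<phi> n x)) \<longlonglongrightarrow> 0"
    using v by (auto simp: L2_div_def)
  have "v \<in> borel_measurable borel" "\<phi> n \<in> borel_measurable borel" for n
    using L2_div_L2_torus[OF v] C1_div_L2_torus(1)[OF Cinf_div_C1_div[OF \<phi>(1)]] by (auto simp: L2_torus_iff)
  then have "L2_norm (\<lambda>x. v x - \<phi> n x) = l2 torus (\<lambda>x. v x - \<phi> n x)" for n by (intro L2_norm_eq) auto
  with \<phi> show ?thesis by (intro that[of \<phi>]) simp_all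
qed

lemma phase_coeff_tendsto:
  fixes f :: "real^3 \<Rightarrow> 'b::euclidean_space"
  assumes "f \<in> L2_torus" "\<And>n. s n \<in> L2_torus" "(\<lambda>n. l2 torus (\<lambda>x. f x - s n x)) \<longlonglongrightarrow> 0"
  shows "(\<lambda>n. phase_coeff (s n) k \<theta>) \<longlonglongrightarrow> phase_coeff f k \<theta>"
proof -
  have "(\<lambda>n. phase_coeff f k \<theta> - phase_coeff (s n) k \<theta>) \<longlonglongrightarrow> 0"
  proof (rule tendsto_norm_zero_cancel, rule tendsto_sandwich[OF _ _ tendsto_const tendsto_mult_right_zero[OF assms(3)]])
    show "\<forall>\<^sub>F n in sequentially. norm (phase_coeff f k \<theta> - phase_coeff (s n) k \<theta>)
        \<le> sqrt ((2 * pi) ^ 3) * l2 torus (\<lambda>x. f x - s n x)"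
      using phase_coeff_bound[OF L2_torus_diff[OF assms(1,2)]]
      by (intro always_eventually allI) (simp add: phase_coeff_diff[OF assms(1,2)])
  qed simp
  from tendsto_diff[OF tendsto_const[of "phase_coeff f k \<theta>"] this] show ?thesis by simp
qed

text \<open>The divergence of
  \<open>sin (frequency k \<bullet> x - \<theta>) *\<^sub>R \<phi> x\<close> reduces to the
  integrand of the first claim, since \<open>\<phi>\<close> is divergence-free. The second claim is
  the zero mean.\<close>

lemma Cinf_div_phase_coeff:
  assumes "\<phi> \<in> Cinf_div"
  shows "phase_coeff \<phi> k \<theta> \<bullet> frequency k = 0" and "phase_coeff \<phi> 0 \<theta> = 0"
proof -
  let ?k = "frequency k" and ?J = "\<lambda>x. jacobian \<phi> (at x)"
  note C1 = Cinf_div_C1_div[OF assms]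
  interpret C1_div_field \<phi> ?J by unfold_locales (rule C1)
  have "((\<lambda>x. sin (?k \<bullet> x - \<theta>) * \<phi> x $ i) has_derivative
    (\<lambda>v. sin (?k \<bullet> x - \<theta>) * (?J x *v v) $ i + (cos (?k \<bullet> x - \<theta>) * (?k \<bullet> v)) * \<phi> x $ i)) (at x)" for x i
    by (auto intro!: derivative_eq_intros C1_divD(2)[OF C1] bounded_linear.has_derivative[OF bounded_linear_vec_nth])
  moreover have c: "continuous_on UNIV (\<lambda>x. sin (?k \<bullet> x - \<theta>) * (?J x *v v) $ i + (cos (?k \<bullet> x - \<theta>) * (?k \<bullet> v)) * \<phi> x $ i)" for i v
    by (intro cont continuous_on_component)
  moreover have "periodic (\<lambda>x. sin (?k \<bullet> x - \<theta>) * \<phi> x $ i)" for i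
    using C1_divD(1)[OF C1] cos_periodic_freq[of k _ _ "\<theta> + pi / 2"]
    by (simp add: periodic_def sin_eq_cos_shift diff_diff_eq)
  ultimately have z: "(LINT x|torus. sin (?k \<bullet> x - \<theta>) * (?J x *v axis i 1) $ i + (cos (?k \<bullet> x - \<theta>) * (?k \<bullet> axis i 1)) * \<phi> x $ i) = 0" for i
    by (rule torus_derivative_integral_0)
  have "phase_coeff \<phi> k \<theta> \<bullet> ?k = (LINT x|torus. \<phi> x \<bullet> trig_wave ?k k \<theta> x)"
    by (rule phase_coeff_inner[OF C1_div_L2_torus(1)[OF C1]])
  also have "\<dots> = (LINT x|torus. (\<Sum>i\<in>UNIV. sin (?k \<bullet> x - \<theta>) * (?J x *v axis i 1) $ i + (cos (?k \<bullet> x - \<theta>) * (?k \<bullet> axis i 1)) * \<phi> x $ i))"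
  proof (rule Bochner_Integration.integral_cong[OF refl])
    fix x
    have "(\<Sum>i\<in>UNIV. sin (?k \<bullet> x - \<theta>) * (?J x *v axis i 1) $ i + (cos (?k \<bullet> x - \<theta>) * (?k \<bullet> axis i 1)) * \<phi> x $ i)
      = sin (?k \<bullet> x - \<theta>) * trace (?J x) + cos (?k \<bullet> x - \<theta>) * (\<Sum>i\<in>UNIV. ?k $ i * \<phi> x $ i)"
      unfolding trace_eq_sum_axis[symmetric] by (simp add: sum.distrib sum_distrib_left inner_axis mult.assoc)
    also have "\<dots> = \<phi> x \<bullet> trig_wave ?k k \<theta> x"
    proof -
      have "(\<Sum>i\<in>UNIV. ?k $ i * \<phi> x $ i) = \<phi> x \<bullet> ?k" by (simp add: inner_vec_def mult.commute)
      then show ?thesis using C1_divD(4)[OF C1, of x] by (simp add: trig_wave_def)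
    qed
    finally show "\<phi> x \<bullet> trig_wave ?k k \<theta> x = (\<Sum>i\<in>UNIV. sin (?k \<bullet> x - \<theta>) * (?J x *v axis i 1) $ i + (cos (?k \<bullet> x - \<theta>) * (?k \<bullet> axis i 1)) * \<phi> x $ i)" by simp
  qed
  also have "\<dots> = 0"
    by (subst Bochner_Integration.integral_sum) (auto simp only: z intro!: integrable_leb_on_continuous compact_torus_box c, simp)
  finally show "phase_coeff \<phi> k \<theta> \<bullet> ?k = 0" .
  show "phase_coeff \<phi> 0 \<theta> = 0" by (simp add: phase_coeff_def integral_Cinf_div assms)
qed

lemma L2_div_phase_coeff:
  assumes "v \<in> L2_div"
  shows "phase_coeff v k \<theta> \<bullet> frequency k = 0" and "phase_coeff v 0 \<theta> = 0"
proof -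
  obtain \<phi> where \<phi>: "\<And>n. \<phi> n \<in> Cinf_div" "(\<lambda>n. l2 torus (\<lambda>x. v x - \<phi> n x)) \<longlonglongrightarrow> 0"
    using L2_div_approx[OF assms] by blast
  have lim: "(\<lambda>n. phase_coeff (\<phi> n) k \<theta>) \<longlonglongrightarrow> phase_coeff v k \<theta>" for k
    by (rule phase_coeff_tendsto[OF L2_div_L2_torus[OF assms] C1_div_L2_torus(1)[OF Cinf_div_C1_div[OF \<phi>(1)]] \<phi>(2)])
  have "(\<lambda>n. phase_coeff (\<phi> n) k \<theta> \<bullet> frequency k) \<longlonglongrightarrow> phase_coeff v k \<theta> \<bullet> frequency k"
    by (intro tendsto_intros lim)
  then show "phase_coeff v k \<theta> \<bullet> frequency k = 0"
    by (simp add: Cinf_div_phase_coeff \<phi> LIMSEQ_const_iff)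
  show "phase_coeff v 0 \<theta> = 0"
    using lim[of 0] by (simp add: Cinf_div_phase_coeff \<phi> LIMSEQ_const_iff)
qed

lemma trig_wave_scale: "c *\<^sub>R trig_wave a k \<theta> x = trig_wave (c *\<^sub>R a) k \<theta> x"
  by (simp add: trig_wave_def mult.commute)

text \<open>Truncation stays in the smooth test class: amplitudes are orthogonal to their
  frequencies, and the amplitude at frequency zero vanishes.\<close>

lemma trig_proj_Cinf_div:
  assumes v: "v \<in> L2_div"
  shows "trig_proj n v \<in> Cinf_div"
proof -
  have w: "trig_wave (c *\<^sub>R phase_coeff v k \<theta>) k \<theta> \<in> Cinf_div" for c k \<theta>
  proof (cases "k = 0")
    case True
    then show ?thesis using Cinf_div_zero by (simp add: L2_div_phase_coeff[OF v] trig_wave_def[abs_def])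
  next
    case False
    then show ?thesis by (intro trig_wave_Cinf_div) (simp_all add: L2_div_phase_coeff[OF v])
  qed
  show ?thesis
    unfolding trig_proj_def scaleR_sum_right scaleR_add_right trig_wave_scale
    by (intro Cinf_div_sum Cinf_div_add w)
qed

lemma trig_proj_tendsto:
  assumes v: "v \<in> L2_div"
  shows "(\<lambda>n. l2 torus (\<lambda>x. v x - trig_proj n v x)) \<longlonglongrightarrow> 0"
proof -
  obtain \<phi> where \<phi>: "\<And>n. \<phi> n \<in> Cinf_div" "(\<lambda>n. l2 torus (\<lambda>x. v x - \<phi> n x)) \<longlonglongrightarrow> 0"
    using L2_div_approx[OF v] by blast
  show ?thesis
    by (rule trig_proj_tendsto_of_approx[OF L2_div_L2_torus[OF v] _ _ \<phi>(2)])
      (use C1_divD[OF Cinf_div_C1_div[OF \<phi>(1)]] in auto)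
qed

text \<open>The gradient of \<open>trig_proj n v\<close>, written out so that it can be studied for
  fields not yet known to have a gradient. The unevaluated phases match
  \<open>trig_wave_has_derivative_outer\<close>.\<close>

definition grad_proj :: "nat \<Rightarrow> (real^3 \<Rightarrow> real^3) \<Rightarrow> real^3 \<Rightarrow> real^3^3" where
  "grad_proj n v x = (1 / (2 * pi) ^ 3) *\<^sub>R (\<Sum>k\<in>modes n.
     trig_wave (outer (phase_coeff v k 0) (frequency k)) k (0 - pi / 2) x
     + trig_wave (outer (phase_coeff v k (pi / 2)) (frequency k)) k (pi / 2 - pi / 2) x)"

lemma trig_poly_grad_proj: "trig_poly n (grad_proj n v)"
  unfolding grad_proj_def by (intro trig_poly_scaleR trig_poly_sum trig_poly_add trig_poly_wave)

lemma jacobian_trig_proj: "jacobian (trig_proj n v) (at x) = grad_proj n v x"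
proof (rule jacobian_eqI)
  have d: "(trig_proj n v has_derivative (\<lambda>w. (1 / (2 * pi) ^ 3) *\<^sub>R (\<Sum>k\<in>modes n.
     trig_wave (outer (phase_coeff v k 0) (frequency k)) k (0 - pi / 2) x *v w
     + trig_wave (outer (phase_coeff v k (pi / 2)) (frequency k)) k (pi / 2 - pi / 2) x *v w))) (at x)"
    unfolding trig_proj_def[abs_def]
    by (intro has_derivative_scaleR_right has_derivative_sum has_derivative_add trig_wave_has_derivative_outer)
  have "(\<Sum>k\<in>A. M k) *v w = (\<Sum>k\<in>A. M k *v w)" for M :: "int^3 \<Rightarrow> real^3^3" and w A
    by (induction A rule: infinite_finite_induct) (auto simp: matrix_vector_mult_add_rdistrib)
  then have e: "grad_proj n v x *v w = (1 / (2 * pi) ^ 3) *\<^sub>R (\<Sum>k\<in>modes n.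
     trig_wave (outer (phase_coeff v k 0) (frequency k)) k (0 - pi / 2) x *v w
     + trig_wave (outer (phase_coeff v k (pi / 2)) (frequency k)) k (pi / 2 - pi / 2) x *v w)" for w
    by (simp only: grad_proj_def scaleR_matrix_vector_assoc[symmetric] matrix_vector_mult_add_rdistrib)
  show "(trig_proj n v has_derivative (*v) (grad_proj n v x)) (at x)"
    by (rule has_derivative_eq_rhs[OF d], rule ext) (rule e[symmetric])
qed

lemma trig_proj_sum:
  "(\<And>i. i \<in> I \<Longrightarrow> f i \<in> L2_torus) \<Longrightarrow> trig_proj n (\<lambda>x. \<Sum>i\<in>I. f i x) x = (\<Sum>i\<in>I. trig_proj n (f i) x)"
proof (induction I rule: infinite_finite_induct)
  case (insert i I)
  then show ?case by (simp add: trig_proj_add L2_torus_sum)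
qed (simp_all add: trig_proj_def phase_coeff_def trig_wave_def)

lemma trig_proj_scaleR: "trig_proj n (\<lambda>x. c *\<^sub>R f x) x = c *\<^sub>R trig_proj n f x"
proof -
  have "phase_coeff (\<lambda>x. c *\<^sub>R f x) k \<theta> = c *\<^sub>R phase_coeff f k \<theta>" for k \<theta>
    unfolding phase_coeff_def integral_scaleR_right[symmetric] by (simp add: mult.commute)
  then show ?thesis
    by (simp add: trig_proj_def trig_wave_scale[symmetric] scaleR_add_right[symmetric] scaleR_sum_right[symmetric])
qed

text \<open>Truncations are nested; by Pythagoras the squared norms of the truncated gradients
  therefore increase with the degree.\<close>

lemma trig_proj_grad_proj:
  assumes "n \<le> m"
  shows "trig_proj n (grad_proj m v) x = grad_proj n v x"
proof -
  let ?w = "\<lambda>k. trig_wave (outer (phase_coeff v k 0) (frequency k)) k (0 - pi / 2)"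
  let ?z = "\<lambda>k. trig_wave (outer (phase_coeff v k (pi / 2)) (frequency k)) k (pi / 2 - pi / 2)"
  have "trig_proj n (grad_proj m v) x = (1 / (2 * pi) ^ 3) *\<^sub>R (\<Sum>k\<in>modes m. trig_proj n (\<lambda>x. ?w k x + ?z k x) x)"
    unfolding grad_proj_def[abs_def] trig_proj_scaleR by (subst trig_proj_sum) (auto intro: L2_torus_add trig_wave_L2)
  also have "(\<Sum>k\<in>modes m. trig_proj n (\<lambda>x. ?w k x + ?z k x) x) = (\<Sum>k\<in>modes m. if k \<in> modes n then ?w k x + ?z k x else 0)"
    by (intro sum.cong refl) (simp add: trig_proj_add[OF trig_wave_L2 trig_wave_L2] trig_proj_wave)
  also have "\<dots> = (\<Sum>k\<in>modes n. ?w k x + ?z k x)"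
    using modes_mono[OF assms] by (simp add: sum.inter_restrict[symmetric] Int_absorb1)
  finally show ?thesis by (simp only: grad_proj_def[of n v x])
qed

context H1_approx
begin

lemma v_L2_div:
  assumes "\<And>n. \<phi> n \<in> Cinf_div"
  shows "v \<in> L2_div"
  using v assms lim_v by (auto simp: L2_div_def L2_norm_eq intro!: exI[of _ \<phi>])

text \<open>On the Fourier side a gradient is multiplication by the frequency and a quarter turn of
  the phase. Integration by parts shows this for the approximants, and coefficients are continuous
  in \<open>L\<^sup>2\<close>.\<close>

lemma phase_coeff_gradient: "phase_coeff G k \<theta> = outer (phase_coeff v k (\<theta> + pi / 2)) (frequency k)"
proof -
  have "phase_coeff (J n) k \<theta> = outer (phase_coeff (\<phi> n) k (\<theta> + pi / 2)) (frequency k)" for n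
  proof -
    let ?k = "frequency k"
    note c1 = C1[of n]
    interpret C1_div_field "\<phi> n" "J n" by unfold_locales (rule c1)
    note L = C1_div_L2_torus[OF c1]
    have sc: "sin (?k \<bullet> x - \<theta>) = cos (?k \<bullet> x - (\<theta> + pi / 2))" for x by (simp add: sin_eq_cos_shift diff_diff_eq)
    have "phase_coeff (J n) k \<theta> $ i $ j = phase_coeff (\<phi> n) k (\<theta> + pi / 2) $ i * ?k $ j" for i j
    proof -
      have D: "((\<lambda>x. cos (?k \<bullet> x - \<theta>) * \<phi> n x $ i) has_derivative
        (\<lambda>v. cos (?k \<bullet> x - \<theta>) * (J n x *v v) $ i + (- sin (?k \<bullet> x - \<theta>) * (?k \<bullet> v)) * \<phi> n x $ i)) (at x)" for x
        by (auto intro!: derivative_eq_intros C1_divD(2)[OF C1] bounded_linear.has_derivative[OF bounded_linear_vec_nth])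
      have c: "continuous_on UNIV (\<lambda>x. cos (?k \<bullet> x - \<theta>) * (J n x *v w) $ i)"
        "continuous_on UNIV (\<lambda>x. (- sin (?k \<bullet> x - \<theta>) * (?k \<bullet> w)) * \<phi> n x $ i)" for w
        by (intro cont continuous_on_component)+
      have p: "periodic (\<lambda>x. cos (?k \<bullet> x - \<theta>) * \<phi> n x $ i)"
        using C1_divD(1)[OF C1] by (simp add: periodic_def cos_periodic_freq)
      have "(LINT x|torus. cos (?k \<bullet> x - \<theta>) * (J n x *v axis j 1) $ i + (- sin (?k \<bullet> x - \<theta>) * (?k \<bullet> axis j 1)) * \<phi> n x $ i) = 0"
        by (rule torus_derivative_integral_0[OF D continuous_on_add[OF c] p])
      then have eq: "(LINT x|torus. cos (?k \<bullet> x - \<theta>) * (J n x *v axis j 1) $ i) = - (LINT x|torus. (- sin (?k \<bullet> x - \<theta>) * (?k \<bullet> axis j 1)) * \<phi> n x $ i)"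
        using integrable_leb_on_continuous[OF compact_torus_box c(1)] integrable_leb_on_continuous[OF compact_torus_box c(2)] by simp
      have "phase_coeff (J n) k \<theta> $ i $ j = (LINT x|torus. cos (?k \<bullet> x - \<theta>) * (J n x *v axis j 1) $ i)"
      proof -
        have "phase_coeff (J n) k \<theta> $ i $ j = phase_coeff (J n) k \<theta> \<bullet> axis i (axis j 1)" by (simp add: inner_axis)
        also have "\<dots> = (LINT x|torus. J n x \<bullet> trig_wave (axis i (axis j 1)) k \<theta> x)" by (rule phase_coeff_inner[OF L(2)])
        finally show ?thesis by (simp add: trig_wave_def inner_axis matrix_vector_mult_basis column_def)
      qed
      also have "\<dots> = (LINT x|torus. (cos (?k \<bullet> x - (\<theta> + pi / 2)) * \<phi> n x $ i) * ?k $ j)"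
        unfolding eq sc by (subst Bochner_Integration.integral_minus[symmetric],
            rule Bochner_Integration.integral_cong[OF refl]) (simp add: inner_axis)
      also have "\<dots> = phase_coeff (\<phi> n) k (\<theta> + pi / 2) $ i * ?k $ j"
      proof -
        have "phase_coeff (\<phi> n) k (\<theta> + pi / 2) $ i = phase_coeff (\<phi> n) k (\<theta> + pi / 2) \<bullet> axis i 1" by (simp add: inner_axis)
        also have "\<dots> = (LINT x|torus. \<phi> n x \<bullet> trig_wave (axis i 1) k (\<theta> + pi / 2) x)" by (rule phase_coeff_inner[OF L(1)])
        finally have "phase_coeff (\<phi> n) k (\<theta> + pi / 2) $ i = (LINT x|torus. cos (?k \<bullet> x - (\<theta> + pi / 2)) * \<phi> n x $ i)"
          by (simp add: trig_wave_def inner_axis)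
        then show ?thesis by (simp only: integral_mult_left_zero)
      qed
      finally show ?thesis .
    qed
    then show ?thesis by (simp add: outer_def vec_eq_iff)
  qed
  then have "(\<lambda>n. phase_coeff (J n) k \<theta>) = (\<lambda>n. outer (phase_coeff (\<phi> n) k (\<theta> + pi / 2)) (frequency k))" by simp
  moreover have "(\<lambda>n. phase_coeff (J n) k \<theta>) \<longlonglongrightarrow> phase_coeff G k \<theta>"
    by (rule phase_coeff_tendsto[OF G C1_div_L2_torus(2)[OF C1] lim_G])
  moreover have "(\<lambda>n. outer (phase_coeff (\<phi> n) k (\<theta> + pi / 2)) (frequency k)) \<longlonglongrightarrow> outer (phase_coeff v k (\<theta> + pi / 2)) (frequency k)"
    unfolding outer_def
    by (intro tendsto_intros tendsto_vec_lambda phase_coeff_tendsto[OF v C1_div_L2_torus(1)[OF C1] lim_v])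
  ultimately show ?thesis using LIMSEQ_unique by metis
qed

lemma trig_proj_gradient: "trig_proj n G x = grad_proj n v x"
proof -
  have p: "phase_coeff v k (pi / 2 + pi / 2) = - phase_coeff v k 0" for k
    using phase_coeff_shift[OF v, of k pi] by simp
  have w: "trig_wave (outer (- a) b) k (pi / 2) x = trig_wave (outer a b) k (0 - pi / 2) x" for a b k
  proof -
    have "outer (- a) b = - outer a b" by (simp add: outer_def vec_eq_iff)
    moreover have "cos (y - (0 - pi / 2)) = - cos (y - pi / 2)" for y by (simp add: cos_add cos_diff)
    ultimately show ?thesis by (simp only: trig_wave_def) simp
  qed
  show ?thesis
    unfolding trig_proj_def grad_proj_def phase_coeff_gradient p w by (simp add: add.commute)
qed

lemma trig_proj_G_tendsto: "(\<lambda>n. l2 torus (\<lambda>x. G x - trig_proj n G x)) \<longlonglongrightarrow> 0"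
  by (rule trig_proj_tendsto_of_approx[OF G _ _ lim_G]) (use C1_divD[OF C1] in auto)

end

text \<open>Serves measurability: \<open>grad_norm_sq\<close> is defined through a choice of
  gradient, whereas the right side is a supremum of functionals that are continuous in
  \<open>L\<^sup>2\<close>. If the supremum is finite, the truncated gradients are Cauchy by
  Pythagoras, and their limit is a gradient of \<open>v\<close>.\<close>

lemma grad_norm_sq_eq:
  assumes v: "v \<in> L2_div"
  shows "grad_norm_sq v = (SUP n. ennreal ((l2 torus (grad_proj n v))\<^sup>2))"
proof (cases "v \<in> H1_div")
  case True
  define G where "G = grad v"
  have hg: "has_gradient v G"
    using True unfolding G_def grad_def H1_div_def by (simp add: someI_ex)
  obtain \<phi> where \<phi>: "\<And>n. \<phi> n \<in> Cinf_div" "H1_approx v G \<phi> (\<lambda>n x. jacobian (\<phi> n) (at x))"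
    using has_gradient_imp_H1_approx[OF hg] by blast
  interpret H1_approx v G \<phi> "\<lambda>n x. jacobian (\<phi> n) (at x)" by fact
  have eq: "grad_proj n v = trig_proj n G" for n using trig_proj_gradient by auto
  have "(SUP n. ennreal ((l2 torus (grad_proj n v))\<^sup>2)) = ennreal ((l2 torus G)\<^sup>2)"
  proof (rule antisym)
    show "(SUP n. ennreal ((l2 torus (grad_proj n v))\<^sup>2)) \<le> ennreal ((l2 torus G)\<^sup>2)"
      unfolding eq by (intro SUP_least ennreal_leI power_mono l2_trig_proj_le G) simp
    have "(\<lambda>n. ennreal ((l2 torus (trig_proj n G))\<^sup>2)) \<longlonglongrightarrow> ennreal ((l2 torus G)\<^sup>2)"
      by (intro tendsto_ennrealI tendsto_power l2_tendsto_norm L2_torusD(3) trig_proj_L2 G trig_proj_G_tendsto)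
    then show "ennreal ((l2 torus G)\<^sup>2) \<le> (SUP n. ennreal ((l2 torus (grad_proj n v))\<^sup>2))"
      unfolding eq by (rule LIMSEQ_le_const2) (intro exI allI impI SUP_upper UNIV_I)
  qed
  moreover have "L2_norm G = l2 torus G" using G by (intro L2_norm_eq) (simp add: L2_torus_iff)
  ultimately show ?thesis using True by (simp add: grad_norm_sq_def G_def[symmetric])
next
  case False
  have "(SUP n. ennreal ((l2 torus (grad_proj n v))\<^sup>2)) = \<infinity>"
  proof (rule ccontr)
    assume fin: "(SUP n. ennreal ((l2 torus (grad_proj n v))\<^sup>2)) \<noteq> \<infinity>"
    define q where "q n = (l2 torus (grad_proj n v))\<^sup>2" for n
    have L2: "grad_proj n v \<in> L2_torus" for n by (rule trig_poly_L2[OF trig_poly_grad_proj])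
    have diff: "(l2 torus (\<lambda>x. grad_proj m v x - grad_proj n v x))\<^sup>2 = q m - q n" if "n \<le> m" for n m
      using l2_diff_trig_proj[OF L2[of m], of n] by (simp add: q_def trig_proj_grad_proj[OF that, abs_def])
    have mono: "incseq q"
    proof (rule incseq_SucI)
      fix n
      have "q (Suc n) - q n = (l2 torus (\<lambda>x. grad_proj (Suc n) v x - grad_proj n v x))\<^sup>2"
        by (rule diff[symmetric]) simp
      also have "\<dots> \<ge> 0" by (rule zero_le_power2)
      finally show "q n \<le> q (Suc n)" by simp
    qed
    obtain B where B: "\<And>n. q n \<le> B"
    proof -
      obtain b where b: "(SUP n. ennreal (q n)) = ennreal b" "0 \<le> b"
        using fin by (cases "SUP n. ennreal (q n)") (auto simp: q_def)
      have "q n \<le> b" for n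
        using SUP_upper[of n UNIV "\<lambda>n. ennreal (q n)"] b by (simp add: ennreal_le_iff)
      then show ?thesis using that by blast
    qed
    have "Bseq q"
      by (rule BseqI'[of _ B]) (use B in \<open>simp add: q_def\<close>)
    then have "Cauchy q" using mono Bseq_mono_convergent[of q] by (auto simp: incseq_def convergent_Cauchy)
    have cauchy: "\<exists>N. \<forall>i\<ge>N. \<forall>j\<ge>N. l2 torus (\<lambda>x. grad_proj i v x - grad_proj j v x) < e" if "0 < e" for e
    proof -
      obtain N where N: "\<And>i j. i \<ge> N \<Longrightarrow> j \<ge> N \<Longrightarrow> \<bar>q i - q j\<bar> < e\<^sup>2"
        using CauchyD[OF \<open>Cauchy q\<close>, of "e\<^sup>2"] \<open>0 < e\<close> by auto
      have "l2 torus (\<lambda>x. grad_proj i v x - grad_proj j v x) < e" if "i \<ge> N" "j \<ge> N" for i j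
      proof -
        have "(l2 torus (\<lambda>x. grad_proj i v x - grad_proj j v x))\<^sup>2 = \<bar>q i - q j\<bar>"
        proof (cases "j \<le> i")
          case True
          then show ?thesis using diff[OF True] monoD[OF mono True] by simp
        next
          case False
          then have "i \<le> j" by simp
          then show ?thesis using diff[OF \<open>i \<le> j\<close>] monoD[OF mono \<open>i \<le> j\<close>]
            by (subst l2_diff_commute) simp
        qed
        also have "\<dots> < e\<^sup>2" by (rule N[OF that])
        finally show ?thesis using \<open>0 < e\<close> by (simp add: power2_less_imp_less)
      qed
      then show ?thesis by blast
    qed
    obtain r where r: "strict_mono r" "AE x in torus. convergent (\<lambda>n. grad_proj (r n) v x)"
      and lim: "\<And>f. f \<in> borel_measurable torus \<Longrightarrow> (AE x in torus. (\<lambda>n. grad_proj (r n) v x) \<longlonglongrightarrow> f x) \<Longrightarrow>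
        sqint torus f \<and> (\<lambda>n. l2 torus (\<lambda>x. f x - grad_proj n v x)) \<longlonglongrightarrow> 0"
      using l2_complete[OF torus.finite_measure_axioms L2_torusD(3)[OF L2] cauchy] by blast
    \<comment> \<open>Built from pointwise limits, so that measurability and exact periodicity are
      inherited from the truncations.\<close>
    define G where "G x = (if convergent (\<lambda>n. grad_proj (r n) v x) then lim (\<lambda>n. grad_proj (r n) v x) else 0)" for x
    have [measurable]: "grad_proj n v \<in> borel_measurable borel" for n using L2 by (simp add: L2_torus_iff)
    have [measurable]: "G \<in> borel_measurable borel" unfolding G_def Cauchy_convergent_iff[symmetric] by measurable
    have "AE x in torus. (\<lambda>n. grad_proj (r n) v x) \<longlonglongrightarrow> G x"
      using r(2) by eventually_elim (simp add: G_def convergent_LIMSEQ_iff)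
    from lim[OF _ this] have G: "sqint torus G" "(\<lambda>n. l2 torus (\<lambda>x. G x - grad_proj n v x)) \<longlonglongrightarrow> 0" by auto
    have "grad_proj n v (x + axis i (2 * pi)) = grad_proj n v x" for n x i
      using L2 by (simp add: L2_torus_iff periodic_def)
    then have "periodic G" by (simp add: periodic_def G_def)
    then have "G \<in> L2_torus" using G by (simp add: L2_torus_iff)
    have [measurable]: "v \<in> borel_measurable borel" "trig_proj n v \<in> borel_measurable borel" for n
      using L2_div_L2_torus[OF v] trig_proj_L2[of n v] by (auto simp: L2_torus_iff)
    have "has_gradient v G"
      unfolding has_gradient_def
    proof (intro conjI exI[of _ "\<lambda>n. trig_proj n v"] allI trig_proj_Cinf_div v)
      show "(\<lambda>n. L2_norm (\<lambda>x. v x - trig_proj n v x)) \<longlonglongrightarrow> 0"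
        using trig_proj_tendsto[OF v] by (simp add: L2_norm_eq)
      show "(\<lambda>n. L2_norm (\<lambda>x. G x - jacobian (trig_proj n v) (at x))) \<longlonglongrightarrow> 0"
        using G(2) by (simp add: jacobian_trig_proj L2_norm_eq)
    qed (use \<open>G \<in> L2_torus\<close> L2_div_L2_torus[OF v] in auto)
    with False show False by (auto simp: H1_div_def)
  qed
  then show ?thesis by (simp only: grad_norm_sq_def False if_False)
qed

section \<open>The viscous and advective terms tested with single waves\<close>

lemma borel_measurable_matrix_vector_mult [measurable]:
  fixes A :: "'a \<Rightarrow> real^3^3"
  assumes "A \<in> borel_measurable M" "v \<in> borel_measurable M"
  shows "(\<lambda>x. A x *v v x) \<in> borel_measurable M"
  by (rule borel_measurable_continuous_Pair[OF assms])
    (intro continuous_on_matrix_vector_mult continuous_intros)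

text \<open>The advection term tested with a wave, after the derivative has been moved to the wave;
  see \<open>advection_mode\<close>. Without a gradient of \<open>v\<close> the expression is
  continuous in \<open>L\<^sup>2\<close>.\<close>

definition mode_flux :: "real^3 \<Rightarrow> int^3 \<Rightarrow> real \<Rightarrow> (real^3 \<Rightarrow> real^3) \<Rightarrow> real" where
  "mode_flux a k \<theta> v = (LINT x|torus. sin (frequency k \<bullet> x - \<theta>) * ((a \<bullet> v x) * (frequency k \<bullet> v x)))"

lemma
  assumes "v \<in> L2_torus" "w \<in> L2_torus"
  shows mode_flux_integrable: "integrable torus (\<lambda>x. sin (frequency k \<bullet> x - \<theta>) * ((a \<bullet> v x) * (b \<bullet> w x)))"
    and mode_flux_bilinear_bound: "\<bar>LINT x|torus. sin (frequency k \<bullet> x - \<theta>) * ((a \<bullet> v x) * (b \<bullet> w x))\<bar>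
      \<le> norm a * norm b * (l2 torus v * l2 torus w)"
proof -
  note [measurable] = L2_torusD(2)[OF assms(1)] L2_torusD(2)[OF assms(2)]
  let ?f = "\<lambda>x. sin (frequency k \<bullet> x - \<theta>) * ((a \<bullet> v x) * (b \<bullet> w x))" and ?g = "\<lambda>x. norm a * norm b * (norm (v x) * norm (w x))"
  have i: "integrable torus ?g"
    by (intro integrable_mult_right sqint_mult_norm L2_torusD(3) assms)
  have m: "?f \<in> borel_measurable torus" by measurable
  have le: "\<bar>?f x\<bar> \<le> ?g x" for x
  proof -
    have "\<bar>sin (frequency k \<bullet> x - \<theta>)\<bar> * (\<bar>a \<bullet> v x\<bar> * \<bar>b \<bullet> w x\<bar>) \<le> 1 * ((norm a * norm (v x)) * (norm b * norm (w x)))"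
      by (intro mult_mono Cauchy_Schwarz_ineq2) auto
    then show ?thesis by (simp add: abs_mult mult_ac)
  qed
  show "integrable torus ?f"
    by (rule Bochner_Integration.integrable_bound[OF i m]) (use le in \<open>auto intro!: AE_I2 order_trans[OF _ abs_ge_self]\<close>)
  have "\<bar>LINT x|torus. ?f x\<bar> \<le> (LINT x|torus. ?g x)"
    by (rule integral_abs_le_AE[OF i m AE_I2[OF le]])
  also have "\<dots> \<le> norm a * norm b * (l2 torus v * l2 torus w)"
    using integral_mult_norm_le[OF L2_torusD(3)[OF assms(1)] L2_torusD(3)[OF assms(2)]]
    by (simp add: mult_left_mono)
  finally show "\<bar>LINT x|torus. ?f x\<bar> \<le> norm a * norm b * (l2 torus v * l2 torus w)" .
qed

lemma mode_flux_bound: "v \<in> L2_torus \<Longrightarrow> \<bar>mode_flux a k \<theta> v\<bar> \<le> norm a * norm (frequency k) * (l2 torus v)\<^sup>2"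
  using mode_flux_bilinear_bound[of v v] by (simp add: mode_flux_def power2_eq_square)

lemma mode_flux_diff_bound:
  assumes v: "v \<in> L2_torus" and w: "w \<in> L2_torus"
  shows "\<bar>mode_flux a k \<theta> v - mode_flux a k \<theta> w\<bar>
    \<le> norm a * norm (frequency k) * (l2 torus (\<lambda>x. v x - w x) * (l2 torus v + l2 torus w))"
proof -
  let ?s = "\<lambda>x. sin (frequency k \<bullet> x - \<theta>)" and ?k = "frequency k"
  note d = L2_torus_diff[OF v w]
  have "mode_flux a k \<theta> v - mode_flux a k \<theta> w
    = (LINT x|torus. ?s x * ((a \<bullet> (v x - w x)) * (?k \<bullet> v x)) + ?s x * ((a \<bullet> w x) * (?k \<bullet> (v x - w x))))"
    unfolding mode_flux_def
    by (subst Bochner_Integration.integral_diff[symmetric, OF mode_flux_integrable[OF v v] mode_flux_integrable[OF w w]],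
        rule Bochner_Integration.integral_cong[OF refl]) (simp add: inner_diff_right algebra_simps)
  also have "\<dots> = (LINT x|torus. ?s x * ((a \<bullet> (v x - w x)) * (?k \<bullet> v x))) + (LINT x|torus. ?s x * ((a \<bullet> w x) * (?k \<bullet> (v x - w x))))"
    by (rule Bochner_Integration.integral_add[OF mode_flux_integrable[OF d v] mode_flux_integrable[OF w d]])
  finally show ?thesis
    using mode_flux_bilinear_bound[OF d v, of k \<theta> a ?k] mode_flux_bilinear_bound[OF w d, of k \<theta> a ?k]
    by (simp add: algebra_simps)
qed

context H1_approx
begin

lemma viscous_mode:
  "(LINT x|torus. G x \<bullet> trig_wave (outer a (frequency k)) k (\<theta> - pi / 2) x)
    = (norm (frequency k))\<^sup>2 * (phase_coeff v k \<theta> \<bullet> a)"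
  using phase_coeff_inner[OF G, of k "\<theta> - pi / 2" "outer a (frequency k)"]
  by (simp add: phase_coeff_gradient inner_outer power2_norm_eq_inner mult.commute)

text \<open>For the approximants this is the antisymmetry of advection with the wave as second
  field. Both sides pass to the limit, the left by the trilinear bound and the right by
  \<open>mode_flux_diff_bound\<close>.\<close>

lemma advection_mode: "(LINT x|torus. (G x *v v x) \<bullet> trig_wave a k \<theta> x) = mode_flux a k \<theta> v"
proof -
  have smooth: "(LINT x|torus. (J n x *v \<phi> n x) \<bullet> trig_wave a k \<theta> x) = mode_flux a k \<theta> (\<phi> n)" for n
  proof -
    have "(LINT x|torus. \<phi> n x \<bullet> (trig_wave (outer a (frequency k)) k (\<theta> - pi / 2) x *v \<phi> n x))
      = - (LINT x|torus. (J n x *v \<phi> n x) \<bullet> trig_wave a k \<theta> x)"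
      by (rule C1_div_advection_antisym[OF C1 trig_wave_has_derivative_outer trig_wave_continuous periodic_trig_wave])
    moreover have "(LINT x|torus. \<phi> n x \<bullet> (trig_wave (outer a (frequency k)) k (\<theta> - pi / 2) x *v \<phi> n x))
      = (LINT x|torus. - (sin (frequency k \<bullet> x - \<theta>) * ((a \<bullet> \<phi> n x) * (frequency k \<bullet> \<phi> n x))))"
    proof (rule Bochner_Integration.integral_cong[OF refl])
      fix x
      have "cos (frequency k \<bullet> x - (\<theta> - pi / 2)) = - sin (frequency k \<bullet> x - \<theta>)"
        using cos_add[of "frequency k \<bullet> x - \<theta>" "pi / 2"] by (simp add: algebra_simps)
      then show "\<phi> n x \<bullet> (trig_wave (outer a (frequency k)) k (\<theta> - pi / 2) x *v \<phi> n x)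
        = - (sin (frequency k \<bullet> x - \<theta>) * ((a \<bullet> \<phi> n x) * (frequency k \<bullet> \<phi> n x)))"
        by (simp only: trig_wave_def scaleR_matrix_vector_assoc[symmetric] outer_mult inner_scaleR_right)
          (simp add: inner_commute mult_ac)
    qed
    ultimately show ?thesis by (simp add: mode_flux_def)
  qed
  have L2: "\<phi> n \<in> L2_torus" "J n \<in> L2_torus" for n by (auto intro: C1_div_L2_torus[OF C1])
  have lim: "(\<lambda>n. l2 torus (\<phi> n)) \<longlonglongrightarrow> l2 torus v" by (intro l2_tendsto_norm sq lim_v)
  have "(\<lambda>n. mode_flux a k \<theta> (\<phi> n)) \<longlonglongrightarrow> mode_flux a k \<theta> v"
  proof -
    let ?b = "\<lambda>n. norm a * norm (frequency k) * (l2 torus (\<lambda>x. v x - \<phi> n x) * (l2 torus v + l2 torus (\<phi> n)))"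
    have "?b \<longlonglongrightarrow> norm a * norm (frequency k) * (0 * (l2 torus v + l2 torus v))"
      by (intro tendsto_intros lim lim_v)
    then have b: "?b \<longlonglongrightarrow> 0" by simp
    have "(\<lambda>n. mode_flux a k \<theta> v - mode_flux a k \<theta> (\<phi> n)) \<longlonglongrightarrow> 0"
      by (rule tendsto_rabs_zero_cancel, rule tendsto_sandwich[OF _ _ tendsto_const b])
        (auto intro!: always_eventually mode_flux_diff_bound v L2)
    from tendsto_diff[OF tendsto_const[of "mode_flux a k \<theta> v"] this] show ?thesis by simp
  qed
  moreover have "(\<lambda>n. LINT x|torus. (J n x *v \<phi> n x) \<bullet> trig_wave a k \<theta> x) \<longlonglongrightarrow> (LINT x|torus. (G x *v v x) \<bullet> trig_wave a k \<theta> x)"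
  proof -
    let ?I = "\<lambda>A b. LINT x|torus. (A x *v b x) \<bullet> trig_wave a k \<theta> x"
    let ?b = "\<lambda>n. norm a * (l2 torus (\<lambda>x. G x - J n x) * l2 torus (\<phi> n)) + norm a * (l2 torus G * l2 torus (\<lambda>x. v x - \<phi> n x))"
    note ti = trilinear_integrable[OF _ _ trig_wave_measurable norm_trig_wave_le[of a k \<theta>]]
    note tb = trilinear_bound[OF _ _ trig_wave_measurable norm_trig_wave_le[of a k \<theta>]]
    have le: "\<bar>?I G v - ?I (J n) (\<phi> n)\<bar> \<le> ?b n" for n
    proof -
      have "?I G v - ?I (J n) (\<phi> n) = ?I (\<lambda>x. G x - J n x) (\<phi> n) + ?I G (\<lambda>x. v x - \<phi> n x)"
        using ti[OF sq(2) sq(1)] ti[OF sq(4) sq(3)] ti[OF sq(2) sq(3), of n]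
        by (simp add: matrix_vector_mult_diff_rdistrib matrix_vector_mult_diff_distrib inner_diff_left)
      then show ?thesis
        using tb[OF sqint_diff[OF sq(2) sq(4)[of n]] sq(3)[of n]] tb[OF sq(2) sqint_diff[OF sq(1) sq(3)[of n]]]
        by linarith
    qed
    have "?b \<longlonglongrightarrow> norm a * (0 * l2 torus v) + norm a * (l2 torus G * 0)"
      by (intro tendsto_intros lim lim_v lim_G)
    then have b: "?b \<longlonglongrightarrow> 0" by simp
    have "(\<lambda>n. ?I G v - ?I (J n) (\<phi> n)) \<longlonglongrightarrow> 0"
      by (rule tendsto_rabs_zero_cancel, rule tendsto_sandwich[OF _ _ tendsto_const b])
        (auto intro!: always_eventually le)
    from tendsto_diff[OF tendsto_const[of "?I G v"] this] show ?thesis by simp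
  qed
  ultimately show ?thesis unfolding smooth using LIMSEQ_unique by blast
qed

end

text \<open>For \<open>k \<noteq> 0\<close> the amplitudes \<open>mode_amp k i\<close> are the projections of the unit vectors to the
  orthogonal complement of the frequency, so that the modes are admissible test fields.\<close>

definition mode_amp :: "int^3 \<Rightarrow> 3 \<Rightarrow> real^3" where
  "mode_amp k i = axis i 1 - (frequency k $ i / (frequency k \<bullet> frequency k)) *\<^sub>R frequency k"

lemma mode_amp_orthogonal: "k \<noteq> 0 \<Longrightarrow> mode_amp k i \<bullet> frequency k = 0"
  using frequency_eq_0_iff[of k] by (simp add: mode_amp_def inner_diff_left inner_axis')

lemma inner_mode_amp: "c \<bullet> frequency k = 0 \<Longrightarrow> c \<bullet> mode_amp k i = c $ i"
  by (simp add: mode_amp_def inner_diff_right inner_axis)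

text \<open>Three vectors in a plane are no basis, but projections of an orthonormal basis form a
  Parseval frame. The usual formulas for inner products and expansions hold without choosing a basis
  of the orthogonal complement.\<close>

lemma sum_mode_amp_inner:
  "c \<bullet> frequency k = 0 \<Longrightarrow> d \<bullet> frequency k = 0 \<Longrightarrow> (\<Sum>i\<in>UNIV. (c \<bullet> mode_amp k i) * (d \<bullet> mode_amp k i)) = c \<bullet> d"
  by (simp only: inner_mode_amp) (simp add: inner_vec_def)

lemma sum_mode_amp: "c \<bullet> frequency k = 0 \<Longrightarrow> (\<Sum>i\<in>UNIV. (c \<bullet> mode_amp k i) *\<^sub>R mode_amp k i) = c"
proof -
  assume c: "c \<bullet> frequency k = 0"
  have "(\<Sum>i\<in>UNIV. c $ i *\<^sub>R mode_amp k i)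
    = (\<Sum>i\<in>UNIV. c $ i *\<^sub>R axis i 1) - ((\<Sum>i\<in>UNIV. c $ i * frequency k $ i) / (frequency k \<bullet> frequency k)) *\<^sub>R frequency k"
    by (simp add: mode_amp_def scaleR_diff_right sum_subtractf scaleR_sum_left[symmetric] sum_divide_distrib[symmetric])
  also have "(\<Sum>i\<in>UNIV. c $ i * frequency k $ i) = 0" using c by (simp add: inner_vec_def)
  also have "(\<Sum>i\<in>UNIV. c $ i *\<^sub>R axis i 1) = c"
    using basis_expansion[of c] by (simp add: scalar_mult_eq_scaleR)
  finally show ?thesis using c by (simp add: inner_mode_amp)
qed

definition phases :: "real set" where
  "phases = {0, pi / 2}"

lemma sum_phases: "(\<Sum>\<theta>\<in>phases. f \<theta>) = f 0 + f (pi / 2)"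
  by (simp add: phases_def)

section \<open>Ball averages as Fourier multipliers\<close>

context ball_weight
begin

definition weight_coeff :: "int^3 \<Rightarrow> real" where
  "weight_coeff k = (LINT h|leb_on (cball 0 R). \<kappa> h * cos (frequency k \<bullet> h))"

text \<open>Evenness of the weight removes the sine part of the addition formula, so every wave is
  an eigenfunction; the eigenvalue is the cosine transform of the weight.\<close>

lemma ball_conv_trig_wave: "ball_conv R \<kappa> (trig_wave a k \<theta>) x = weight_coeff k *\<^sub>R trig_wave a k \<theta> x"
proof -
  let ?k = "frequency k" and ?B = "leb_on (cball 0 R) :: (real^3) measure"
  have c: "continuous_on UNIV (\<lambda>h. \<kappa> h * cos (?k \<bullet> h))" "continuous_on UNIV (\<lambda>h. \<kappa> h * sin (?k \<bullet> h))"
    by (intro continuous_intros \<kappa>)+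
  note i = integrable_leb_on_continuous[OF compact_cball c(1), of 0 R] integrable_leb_on_continuous[OF compact_cball c(2), of 0 R]
  have odd: "(LINT h|?B. \<kappa> h * sin (?k \<bullet> h)) = 0"
    using integral_ball_reflect[OF continuous_borel_measurable[OF c(2)], of R] by (simp add: even)
  have "ball_conv R \<kappa> (trig_wave a k \<theta>) x
    = (LINT h|?B. (cos (?k \<bullet> x - \<theta>) * (\<kappa> h * cos (?k \<bullet> h)) - sin (?k \<bullet> x - \<theta>) * (\<kappa> h * sin (?k \<bullet> h))) *\<^sub>R a)"
    unfolding ball_conv_def
  proof (rule Bochner_Integration.integral_cong[OF refl])
    fix h
    have "?k \<bullet> (x + h) - \<theta> = (?k \<bullet> x - \<theta>) + ?k \<bullet> h" by (simp add: inner_add_right)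
    then have "cos (?k \<bullet> (x + h) - \<theta>) = cos (?k \<bullet> x - \<theta>) * cos (?k \<bullet> h) - sin (?k \<bullet> x - \<theta>) * sin (?k \<bullet> h)"
      by (simp only: cos_add)
    then show "\<kappa> h *\<^sub>R trig_wave a k \<theta> (x + h)
      = (cos (?k \<bullet> x - \<theta>) * (\<kappa> h * cos (?k \<bullet> h)) - sin (?k \<bullet> x - \<theta>) * (\<kappa> h * sin (?k \<bullet> h))) *\<^sub>R a"
      by (simp add: trig_wave_def right_diff_distrib mult_ac)
  qed
  also have "\<dots> = (LINT h|?B. cos (?k \<bullet> x - \<theta>) * (\<kappa> h * cos (?k \<bullet> h)) - sin (?k \<bullet> x - \<theta>) * (\<kappa> h * sin (?k \<bullet> h))) *\<^sub>R a"
    by (rule integral_scaleR_left) (use i in auto)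
  also have "\<dots> = (cos (?k \<bullet> x - \<theta>) * weight_coeff k) *\<^sub>R a"
    using i odd by (simp add: weight_coeff_def)
  finally show ?thesis by (simp add: trig_wave_def mult.commute)
qed

lemma ball_conv_add:
  fixes w :: "real^3 \<Rightarrow> 'b::euclidean_space"
  assumes "w \<in> L2_torus" "z \<in> L2_torus"
  shows "ball_conv R \<kappa> (\<lambda>x. w x + z x) x = ball_conv R \<kappa> w x + ball_conv R \<kappa> z x"
  unfolding ball_conv_def using ball_conv_integrable[OF assms(1)] ball_conv_integrable[OF assms(2)]
  by (simp add: scaleR_add_right)

lemma ball_conv_sum:
  fixes f :: "'i \<Rightarrow> real^3 \<Rightarrow> 'b::euclidean_space"
  shows "(\<And>i. i \<in> I \<Longrightarrow> f i \<in> L2_torus) \<Longrightarrow> ball_conv R \<kappa> (\<lambda>x. \<Sum>i\<in>I. f i x) x = (\<Sum>i\<in>I. ball_conv R \<kappa> (f i) x)"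
proof (induction I rule: infinite_finite_induct)
  case (insert i I)
  then show ?case by (simp add: ball_conv_add L2_torus_sum)
qed (simp_all add: ball_conv_def)

lemma ball_conv_trig_proj:
  "ball_conv R \<kappa> (trig_proj n g) x = (\<Sum>k\<in>modes n. \<Sum>\<theta>\<in>phases.
    trig_wave ((weight_coeff k / (2 * pi) ^ 3) *\<^sub>R phase_coeff g k \<theta>) k \<theta> x)"
proof -
  have "trig_proj n g = (\<lambda>x. \<Sum>k\<in>modes n. \<Sum>\<theta>\<in>phases. trig_wave ((1 / (2 * pi) ^ 3) *\<^sub>R phase_coeff g k \<theta>) k \<theta> x)"
    by (simp add: trig_proj_def[abs_def] sum_phases scaleR_sum_right scaleR_add_right trig_wave_scale)
  then show ?thesis
    by (simp add: ball_conv_sum ball_conv_trig_wave L2_torus_sum trig_wave_L2 trig_wave_scale)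
qed

lemma ball_form_trig_proj:
  fixes f :: "real^3 \<Rightarrow> 'b::euclidean_space"
  assumes f: "f \<in> L2_torus"
  shows "ball_form R \<kappa> f (trig_proj n g) = (\<Sum>k\<in>modes n. \<Sum>\<theta>\<in>phases.
    weight_coeff k / (2 * pi) ^ 3 * (phase_coeff f k \<theta> \<bullet> phase_coeff g k \<theta>))"
proof -
  have i: "integrable torus (\<lambda>x. f x \<bullet> trig_wave a k \<theta> x)" for a k \<theta>
    by (intro integrable_inner L2_torusD(3) f trig_wave_L2)
  show ?thesis
    unfolding ball_form_def ball_conv_trig_proj inner_sum_right
    by (subst Bochner_Integration.integral_sum, (intro Bochner_Integration.integrable_sum i)+,
        subst Bochner_Integration.integral_sum, (intro i)+)
      (simp only: phase_coeff_inner[OF f, symmetric] inner_scaleR_right)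
qed

lemma transfer_form_trig_proj:
  assumes G: "G \<in> L2_torus" and v: "v \<in> L2_torus"
  shows "transfer_form R \<kappa> G v (trig_proj n g) = (\<Sum>k\<in>modes n. \<Sum>\<theta>\<in>phases.
    weight_coeff k / (2 * pi) ^ 3 * (LINT x|torus. (G x *v v x) \<bullet> trig_wave (phase_coeff g k \<theta>) k \<theta> x))"
proof -
  have i: "integrable torus (\<lambda>x. (G x *v v x) \<bullet> trig_wave a k \<theta> x)" for a k \<theta>
    by (rule trilinear_integrable[OF L2_torusD(3)[OF G] L2_torusD(3)[OF v] trig_wave_measurable norm_trig_wave_le])
  have sc: "(LINT x|torus. (G x *v v x) \<bullet> trig_wave (c *\<^sub>R a) k \<theta> x) = c * (LINT x|torus. (G x *v v x) \<bullet> trig_wave a k \<theta> x)" for c a k \<theta>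
    by (simp add: trig_wave_scale[symmetric])
  show ?thesis
    unfolding transfer_form_def ball_conv_trig_proj inner_sum_right
    by (subst Bochner_Integration.integral_sum, (intro Bochner_Integration.integrable_sum i)+,
        subst Bochner_Integration.integral_sum, (intro i)+) (simp only: sc)
qed

lemma ball_form_trig_proj_self:
  assumes v: "v \<in> L2_div"
  shows "ball_form R \<kappa> v (trig_proj n v) = (\<Sum>k\<in>modes n. \<Sum>\<theta>\<in>phases. \<Sum>i\<in>UNIV.
    weight_coeff k / (2 * pi) ^ 3 * (phase_coeff v k \<theta> \<bullet> mode_amp k i)\<^sup>2)"
proof -
  have "phase_coeff v k \<theta> \<bullet> phase_coeff v k \<theta> = (\<Sum>i\<in>UNIV. (phase_coeff v k \<theta> \<bullet> mode_amp k i)\<^sup>2)" for k \<theta>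
    unfolding power2_eq_square by (rule sum_mode_amp_inner[symmetric]) (rule L2_div_phase_coeff(1)[OF v])+
  then show ?thesis by (simp only: ball_form_trig_proj[OF L2_div_L2_torus[OF v]] sum_distrib_left)
qed

lemma ball_form_tendsto_proj:
  fixes f :: "real^3 \<Rightarrow> 'b::euclidean_space"
  assumes f: "f \<in> L2_torus" and lim: "(\<lambda>n. l2 torus (\<lambda>x. f x - trig_proj n f x)) \<longlonglongrightarrow> 0"
  shows "(\<lambda>n. ball_form R \<kappa> f (trig_proj n f)) \<longlonglongrightarrow> ball_form R \<kappa> f f"
  unfolding ball_form_def
proof (rule inner_tendsto_l2)
  show "(\<lambda>n. l2 torus (\<lambda>x. ball_conv R \<kappa> f x - ball_conv R \<kappa> (trig_proj n f) x)) \<longlonglongrightarrow> 0"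
  proof (rule tendsto_sandwich[OF _ _ tendsto_const tendsto_mult_right_zero[OF lim]])
    show "\<forall>\<^sub>F n in sequentially. l2 torus (\<lambda>x. ball_conv R \<kappa> f x - ball_conv R \<kappa> (trig_proj n f) x)
        \<le> sqrt (measure torus UNIV) * C * l2 torus (\<lambda>x. f x - trig_proj n f x)"
      using l2_ball_conv[OF L2_torus_diff[OF f trig_proj_L2]]
      by (intro always_eventually allI) (simp add: ball_conv_diff[OF f trig_proj_L2, abs_def])
  qed simp
  show "sqint torus (ball_conv R \<kappa> f)" by (rule L2_torusD(3)[OF ball_conv_L2[OF f]])
  show "sqint torus (ball_conv R \<kappa> (trig_proj n f))" for n by (rule L2_torusD(3)[OF ball_conv_L2[OF trig_proj_L2]])
qed (use L2_torusD(3)[OF f] in auto)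

lemma ball_form_bound:
  fixes f :: "real^3 \<Rightarrow> 'b::euclidean_space"
  assumes f: "f \<in> L2_torus"
  shows "\<bar>ball_form R \<kappa> f (trig_proj n f)\<bar> \<le> sqrt (measure torus UNIV) * C * (l2 torus f)\<^sup>2"
proof -
  have "\<bar>ball_form R \<kappa> f (trig_proj n f)\<bar> \<le> l2 torus f * l2 torus (ball_conv R \<kappa> (trig_proj n f))"
    unfolding ball_form_def
    by (rule integral_inner_le[OF L2_torusD(3)[OF f] L2_torusD(3)[OF ball_conv_L2[OF trig_proj_L2]]])
  also have "\<dots> \<le> l2 torus f * (sqrt (measure torus UNIV) * C * l2 torus f)"
    using order_trans[OF l2_ball_conv[OF trig_proj_L2] mult_left_mono[OF l2_trig_proj_le[OF f]]] C_nonneg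
    by (intro mult_left_mono) auto
  finally show ?thesis by (simp add: power2_eq_square mult_ac)
qed

end

context H1_approx
begin

text \<open>With the third argument truncated, the form becomes a finite sum of products of a
  coefficient and its flux, the products that occur in the balance of single modes.\<close>

lemma transfer_form_modes:
  assumes "ball_weight R \<kappa> K" and v': "v \<in> L2_div"
  shows "transfer_form R \<kappa> G v (trig_proj n v) = (\<Sum>k\<in>modes n. \<Sum>\<theta>\<in>phases. \<Sum>i\<in>UNIV.
    ball_weight.weight_coeff R \<kappa> k / (2 * pi) ^ 3 * ((phase_coeff v k \<theta> \<bullet> mode_amp k i) * mode_flux (mode_amp k i) k \<theta> v))"
proof -
  interpret ball_weight R \<kappa> K by fact
  have "(LINT x|torus. (G x *v v x) \<bullet> trig_wave (phase_coeff v k \<theta>) k \<theta> x)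
    = (\<Sum>i\<in>UNIV. (phase_coeff v k \<theta> \<bullet> mode_amp k i) * mode_flux (mode_amp k i) k \<theta> v)" for k \<theta>
  proof -
    have i: "integrable torus (\<lambda>x. (G x *v v x) \<bullet> trig_wave a k \<theta> x)" for a
      by (rule trilinear_integrable[OF sq(2) sq(1) trig_wave_measurable norm_trig_wave_le])
    have "trig_wave (phase_coeff v k \<theta>) k \<theta> x = (\<Sum>i\<in>UNIV. (phase_coeff v k \<theta> \<bullet> mode_amp k i) *\<^sub>R trig_wave (mode_amp k i) k \<theta> x)" for x
      by (subst sum_mode_amp[OF L2_div_phase_coeff(1)[OF v'], symmetric])
        (simp add: trig_wave_def scaleR_sum_right mult.commute)
    then have "(LINT x|torus. (G x *v v x) \<bullet> trig_wave (phase_coeff v k \<theta>) k \<theta> x)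
      = (LINT x|torus. (\<Sum>i\<in>UNIV. (phase_coeff v k \<theta> \<bullet> mode_amp k i) * ((G x *v v x) \<bullet> trig_wave (mode_amp k i) k \<theta> x)))"
      by (simp only: inner_sum_right inner_scaleR_right)
    also have "\<dots> = (\<Sum>i\<in>UNIV. (phase_coeff v k \<theta> \<bullet> mode_amp k i) * mode_flux (mode_amp k i) k \<theta> v)"
      by (subst Bochner_Integration.integral_sum) (auto simp: advection_mode intro!: i)
    finally show ?thesis .
  qed
  then show ?thesis by (simp only: transfer_form_trig_proj[OF G v] sum_distrib_left)
qed

text \<open>Differentiation interchanges the two phases up to sign, so the coefficients of
  \<open>G\<close> and \<open>v\<close> match only after summation over
  \<open>phases\<close>.\<close>

lemma viscous_form_modes:
  assumes "ball_weight R \<kappa> K" and v': "v \<in> L2_div"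
  shows "ball_form R \<kappa> G (trig_proj n G) = (\<Sum>k\<in>modes n. \<Sum>\<theta>\<in>phases. \<Sum>i\<in>UNIV.
    ball_weight.weight_coeff R \<kappa> k / (2 * pi) ^ 3 * ((norm (frequency k))\<^sup>2 * (phase_coeff v k \<theta> \<bullet> mode_amp k i)\<^sup>2))"
proof -
  interpret ball_weight R \<kappa> K by fact
  have p: "phase_coeff v k (pi / 2 + pi / 2) = - phase_coeff v k 0" for k
    using phase_coeff_shift[OF v, of k pi] by simp
  have "(\<Sum>\<theta>\<in>phases. c * (phase_coeff G k \<theta> \<bullet> phase_coeff G k \<theta>)) = (\<Sum>\<theta>\<in>phases. c * ((norm (frequency k))\<^sup>2 * (phase_coeff v k \<theta> \<bullet> phase_coeff v k \<theta>)))" for c k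
    unfolding sum_phases phase_coeff_gradient inner_outer p power2_norm_eq_inner by (simp add: mult_ac)
  moreover have "phase_coeff v k \<theta> \<bullet> phase_coeff v k \<theta> = (\<Sum>i\<in>UNIV. (phase_coeff v k \<theta> \<bullet> mode_amp k i)\<^sup>2)" for k \<theta>
    unfolding power2_eq_square by (rule sum_mode_amp_inner[symmetric]) (rule L2_div_phase_coeff(1)[OF v'])+
  ultimately show ?thesis by (simp only: ball_form_trig_proj[OF G] sum_distrib_left)
qed

lemma transfer_form_tendsto_proj:
  assumes "ball_weight R \<kappa> K" and v': "v \<in> L2_div"
  shows "(\<lambda>n. transfer_form R \<kappa> G v (trig_proj n v)) \<longlonglongrightarrow> transfer_form R \<kappa> G v v"
proof -
  interpret ball_weight R \<kappa> K by fact
  let ?b = "\<lambda>n. C * (l2 torus (\<lambda>x. v x - trig_proj n v x) * (l2 torus G * l2 torus v))"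
  have "?b \<longlonglongrightarrow> C * (0 * (l2 torus G * l2 torus v))"
    by (intro tendsto_intros trig_proj_tendsto v')
  then have b: "?b \<longlonglongrightarrow> 0" by simp
  have "(\<lambda>n. transfer_form R \<kappa> G v v - transfer_form R \<kappa> G v (trig_proj n v)) \<longlonglongrightarrow> 0"
    by (rule tendsto_rabs_zero_cancel, rule tendsto_sandwich[OF _ _ tendsto_const b])
      (use transfer_form_diff_bound[OF G v v G v trig_proj_L2] in \<open>auto intro!: always_eventually\<close>)
  from tendsto_diff[OF tendsto_const[of "transfer_form R \<kappa> G v v"] this] show ?thesis by simp
qed

lemma transfer_form_proj_bound:
  assumes "ball_weight R \<kappa> K"
  shows "\<bar>transfer_form R \<kappa> G v (trig_proj n v)\<bar> \<le> ball_weight.C R K * ((l2 torus v)\<^sup>2 * l2 torus G)"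
proof -
  interpret ball_weight R \<kappa> K by fact
  have "\<bar>transfer_form R \<kappa> G v (trig_proj n v)\<bar> \<le> C * l2 torus (trig_proj n v) * (l2 torus G * l2 torus v)"
    by (rule transfer_form_bound[OF G v trig_proj_L2])
  also have "\<dots> \<le> C * l2 torus v * (l2 torus G * l2 torus v)"
    using C_nonneg l2_trig_proj_le[OF v] by (intro mult_right_mono mult_left_mono) auto
  finally show ?thesis by (simp add: power2_eq_square mult_ac)
qed

end

section \<open>Measurable functionals on \<open>L\<^sup>2_div\<close>\<close>

lemma space_L2_div_borel [simp]: "space L2_div_borel = L2_div"
  unfolding L2_div_borel_def by (rule space_measure_of) auto

text \<open>The hypothesis is a local Lipschitz bound, so preimages of open sets are among the
  generators of \<open>L2_div_borel\<close>. The growth factor admits linear and quadratic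
  functionals alike.\<close>

lemma L2_div_borel_measurableI:
  fixes F :: "(real^3 \<Rightarrow> real^3) \<Rightarrow> real"
  assumes "\<And>v w. v \<in> L2_div \<Longrightarrow> w \<in> L2_div \<Longrightarrow>
    \<bar>F w - F v\<bar> \<le> K * (l2 torus (\<lambda>x. w x - v x) * (1 + l2 torus w + l2 torus v))"
  shows "F \<in> borel_measurable L2_div_borel"
proof (rule borel_measurableI)
  fix S :: "real set" assume S: "open S"
  have "F -` S \<inter> L2_div \<in> {U. U \<subseteq> L2_div \<and>
     (\<forall>f\<in>U. \<exists>r>0. \<forall>g\<in>L2_div. L2_norm (\<lambda>x. g x - f x) < r \<longrightarrow> g \<in> U)}"
  proof (intro CollectI conjI ballI)
    fix v assume v: "v \<in> F -` S \<inter> L2_div"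
    then obtain e where e: "0 < e" "\<And>y. \<bar>y - F v\<bar> < e \<Longrightarrow> y \<in> S"
      using S by (auto simp: open_dist dist_real_def)
    \<comment> \<open>The minimum with one keeps \<open>l2 torus w\<close> below
      \<open>l2 torus v + 1\<close>, so the growth factor is bounded in terms of \<open>v\<close>
      alone.\<close>
    define r where "r = min 1 (e / (\<bar>K\<bar> * (2 + 2 * l2 torus v) + 1))"
    have pos: "0 < \<bar>K\<bar> * (2 + 2 * l2 torus v) + 1" by (simp add: add_nonneg_pos)
    have r: "0 < r" using e(1) pos by (simp add: r_def)
    have "w \<in> F -` S \<inter> L2_div" if w: "w \<in> L2_div" and lt: "L2_norm (\<lambda>x. w x - v x) < r" for w
    proof -
      note L = L2_div_L2_torus[OF w] L2_div_L2_torus[of v]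
      have v': "v \<in> L2_torus" using v L(2) by blast
      let ?d = "l2 torus (\<lambda>x. w x - v x)"
      have d: "?d < r" using lt L(1) v' by (subst (asm) L2_norm_eq) (auto simp: L2_torus_iff)
      have "l2 torus w \<le> ?d + l2 torus v"
        using l2_diff_abs[OF L2_torusD(3)[OF L(1)] L2_torusD(3)[OF v']] by linarith
      moreover have "?d < 1" using d by (simp add: r_def)
      ultimately have s: "1 + l2 torus w + l2 torus v \<le> 2 + 2 * l2 torus v" by linarith
      have "\<bar>F w - F v\<bar> \<le> K * (?d * (1 + l2 torus w + l2 torus v))" using assms v w by blast
      also have "\<dots> \<le> \<bar>K\<bar> * (?d * (1 + l2 torus w + l2 torus v))"
        by (intro mult_right_mono) auto
      also have "\<dots> \<le> \<bar>K\<bar> * (?d * (2 + 2 * l2 torus v))"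
        using s by (intro mult_left_mono) auto
      also have "\<dots> = ?d * (\<bar>K\<bar> * (2 + 2 * l2 torus v))" by simp
      also have "\<dots> \<le> ?d * (\<bar>K\<bar> * (2 + 2 * l2 torus v) + 1)" by (intro mult_left_mono) auto
      also have "\<dots> < (e / (\<bar>K\<bar> * (2 + 2 * l2 torus v) + 1)) * (\<bar>K\<bar> * (2 + 2 * l2 torus v) + 1)"
        using d pos by (intro mult_strict_right_mono) (simp_all add: r_def)
      also have "\<dots> = e" using pos by simp
      finally show ?thesis using e(2) w by blast
    qed
    with r show "\<exists>r>0. \<forall>g\<in>L2_div. L2_norm (\<lambda>x. g x - v x) < r \<longrightarrow> g \<in> F -` S \<inter> L2_div" by blast
  qed auto
  then show "F -` S \<inter> space L2_div_borel \<in> sets L2_div_borel"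
    unfolding space_L2_div_borel unfolding L2_div_borel_def by (intro in_measure_of) auto
qed

lemma phase_coeff_L2_div_measurable [measurable]: "(\<lambda>v. phase_coeff v k \<theta> \<bullet> a) \<in> borel_measurable L2_div_borel"
proof (rule L2_div_borel_measurableI)
  fix v w assume L: "v \<in> L2_div" "w \<in> L2_div"
  note L2 = L2_div_L2_torus[OF L(1)] L2_div_L2_torus[OF L(2)]
  let ?d = "l2 torus (\<lambda>x. w x - v x)"
  have "phase_coeff w k \<theta> \<bullet> a - phase_coeff v k \<theta> \<bullet> a = phase_coeff (\<lambda>x. w x - v x) k \<theta> \<bullet> a"
    by (simp add: phase_coeff_diff L2 inner_diff_left)
  also have "\<bar>\<dots>\<bar> \<le> norm (phase_coeff (\<lambda>x. w x - v x) k \<theta>) * norm a" by (rule Cauchy_Schwarz_ineq2)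
  also have "\<dots> \<le> (sqrt ((2 * pi) ^ 3) * ?d) * norm a"
    by (intro mult_right_mono phase_coeff_bound L2_torus_diff L2) auto
  also have "\<dots> \<le> (sqrt ((2 * pi) ^ 3) * (?d * (1 + l2 torus w + l2 torus v))) * norm a"
    by (intro mult_right_mono mult_left_mono) (simp_all add: distrib_left add_increasing2 algebra_simps)
  finally show "\<bar>phase_coeff w k \<theta> \<bullet> a - phase_coeff v k \<theta> \<bullet> a\<bar>
    \<le> (sqrt ((2 * pi) ^ 3) * norm a) * (?d * (1 + l2 torus w + l2 torus v))" by (simp only: mult_ac)
qed

lemma mode_flux_L2_div_measurable [measurable]: "mode_flux a k \<theta> \<in> borel_measurable L2_div_borel"
proof (rule L2_div_borel_measurableI)
  fix v w assume L: "v \<in> L2_div" "w \<in> L2_div"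
  let ?d = "l2 torus (\<lambda>x. w x - v x)"
  have "\<bar>mode_flux a k \<theta> w - mode_flux a k \<theta> v\<bar> \<le> norm a * norm (frequency k) * (?d * (l2 torus w + l2 torus v))"
    by (intro mode_flux_diff_bound L2_div_L2_torus L)
  also have "\<dots> \<le> norm a * norm (frequency k) * (?d * (1 + l2 torus w + l2 torus v))"
    by (intro mult_left_mono) auto
  finally show "\<bar>mode_flux a k \<theta> w - mode_flux a k \<theta> v\<bar> \<le> norm a * norm (frequency k) * (?d * (1 + l2 torus w + l2 torus v))" .
qed

lemma l2_L2_div_measurable [measurable]: "(\<lambda>v. l2 torus v) \<in> borel_measurable L2_div_borel"
proof (rule L2_div_borel_measurableI)
  fix v w assume L: "v \<in> L2_div" "w \<in> L2_div"
  let ?d = "l2 torus (\<lambda>x. w x - v x)"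
  have "\<bar>l2 torus w - l2 torus v\<bar> \<le> ?d"
    by (intro l2_diff_abs L2_torusD(3) L2_div_L2_torus L)
  also have "\<dots> = ?d * 1" by simp
  also have "\<dots> \<le> ?d * (1 + l2 torus w + l2 torus v)" by (rule mult_left_mono) (auto simp: add.assoc)
  finally show "\<bar>l2 torus w - l2 torus v\<bar> \<le> 1 * (?d * (1 + l2 torus w + l2 torus v))" by simp
qed

lemma norm_outer: "norm (outer a b) = norm a * norm b"
proof -
  have "(norm (outer a b))\<^sup>2 = (norm a * norm b)\<^sup>2"
    by (simp add: power2_norm_eq_inner inner_outer power_mult_distrib)
  then show ?thesis by (simp add: power2_eq_iff_nonneg)
qed

lemma grad_proj_L2_div_measurable [measurable]: "(\<lambda>v. l2 torus (grad_proj n v)) \<in> borel_measurable L2_div_borel"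
proof (rule L2_div_borel_measurableI)
  fix v w assume L: "v \<in> L2_div" "w \<in> L2_div"
  note L2 = L2_div_L2_torus[OF L(2)] L2_div_L2_torus[OF L(1)]
  let ?d = "l2 torus (\<lambda>x. w x - v x)" and ?c = "sqrt ((2 * pi) ^ 3)"
  let ?K = "(1 / (2 * pi) ^ 3) * (\<Sum>k\<in>modes n. 2 * ?c * norm (frequency k))"
  have o: "outer (a - b) c = outer a c - outer b c" for a b c by (simp add: outer_def vec_eq_iff left_diff_distrib)
  have lin: "grad_proj n w x - grad_proj n v x = grad_proj n (\<lambda>x. w x - v x) x" for x
    unfolding grad_proj_def phase_coeff_diff[OF L2] o trig_wave_def
    by (simp only: scaleR_diff_right[symmetric] sum_subtractf[symmetric]) (simp only: scaleR_diff_right add_diff_add)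
  have pt: "norm (grad_proj n (\<lambda>x. w x - v x) x) \<le> ?K * ?d" for x
  proof -
    have b: "norm (trig_wave (outer (phase_coeff (\<lambda>x. w x - v x) k \<theta>) (frequency k)) k \<psi> x) \<le> ?c * norm (frequency k) * ?d" for k \<theta> \<psi>
    proof -
      have "norm (trig_wave (outer (phase_coeff (\<lambda>x. w x - v x) k \<theta>) (frequency k)) k \<psi> x)
        \<le> norm (phase_coeff (\<lambda>x. w x - v x) k \<theta>) * norm (frequency k)"
        using norm_trig_wave_le by (simp add: norm_outer[symmetric])
      also have "\<dots> \<le> (?c * ?d) * norm (frequency k)"
        by (intro mult_right_mono phase_coeff_bound L2_torus_diff L2) auto
      finally show ?thesis by (simp add: mult_ac)
    qed
    have "norm (grad_proj n (\<lambda>x. w x - v x) x) \<le> (1 / (2 * pi) ^ 3) * (\<Sum>k\<in>modes n. 2 * ?c * norm (frequency k) * ?d)"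
      unfolding grad_proj_def norm_scaleR
    proof (rule mult_mono)
      show "norm (\<Sum>k\<in>modes n. trig_wave (outer (phase_coeff (\<lambda>x. w x - v x) k 0) (frequency k)) k (0 - pi / 2) x
         + trig_wave (outer (phase_coeff (\<lambda>x. w x - v x) k (pi / 2)) (frequency k)) k (pi / 2 - pi / 2) x)
        \<le> (\<Sum>k\<in>modes n. 2 * ?c * norm (frequency k) * ?d)"
      proof (rule sum_norm_le)
        fix k
        show "norm (trig_wave (outer (phase_coeff (\<lambda>x. w x - v x) k 0) (frequency k)) k (0 - pi / 2) x
         + trig_wave (outer (phase_coeff (\<lambda>x. w x - v x) k (pi / 2)) (frequency k)) k (pi / 2 - pi / 2) x) \<le> 2 * ?c * norm (frequency k) * ?d"
          using norm_triangle_mono[OF b[of k 0 "0 - pi / 2"] b[of k "pi / 2" "pi / 2 - pi / 2"]] by (simp add: mult_ac)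
      qed
    qed auto
    then show ?thesis by (simp only: sum_distrib_right mult.assoc)
  qed
  have sq: "sqint torus (grad_proj n z)" for z by (rule L2_torusD(3)[OF trig_poly_L2[OF trig_poly_grad_proj]])
  define K where "K = ?K"
  have K0: "0 \<le> K" unfolding K_def by (intro mult_nonneg_nonneg sum_nonneg) auto
  have "\<bar>l2 torus (grad_proj n w) - l2 torus (grad_proj n v)\<bar> \<le> l2 torus (grad_proj n (\<lambda>x. w x - v x))"
    using l2_diff_abs[OF sq sq, of w v] by (simp only: lin)
  also have "\<dots> \<le> l2 torus (\<lambda>x. K * ?d)"
    by (rule l2_mono[OF torus.sqint_const sqint_measurable[OF sq]])
      (use pt[folded K_def] in \<open>auto intro!: AE_I2 order_trans[OF _ abs_ge_self]\<close>)
  also have "\<dots> = ?c * K * (?d * 1)"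
    using K0 by (simp add: l2_def measure_torus real_sqrt_mult abs_mult mult_ac)
  also have "\<dots> \<le> ?c * K * (?d * (1 + l2 torus w + l2 torus v))"
    using K0 by (intro mult_left_mono) (auto simp: add.assoc)
  finally show "\<bar>l2 torus (grad_proj n w) - l2 torus (grad_proj n v)\<bar> \<le> ?c * K * (?d * (1 + l2 torus w + l2 torus v))" .
qed

lemma grad_norm_sq_measurable [measurable]: "grad_norm_sq \<in> borel_measurable L2_div_borel"
proof -
  have "(\<lambda>v. SUP n. ennreal ((l2 torus (grad_proj n v))\<^sup>2)) \<in> borel_measurable L2_div_borel" by measurable
  then show ?thesis by (rule measurable_cong[THEN iffD1, rotated]) (simp add: grad_norm_sq_eq)
qed

section \<open>The balance of a single mode\<close>

abbreviation time_upto :: "real \<Rightarrow> real measure" where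
  "time_upto t \<equiv> restrict_space lborel {0..t}"

lemma finite_measure_time: "finite_measure (time_upto t)"
  by (intro finite_measureI, cases "0 \<le> t") (simp_all add: emeasure_restrict_space space_restrict_space)

lemma measure_time: "0 \<le> t \<Longrightarrow> measure (time_upto t) (space (time_upto t)) = t"
  by (simp add: measure_restrict_space space_restrict_space)

lemma space_time: "space (time_upto t) = {0..t}"
  by (simp add: space_restrict_space)

text \<open>What the argument for one mode needs from the drift: joint measurability for Fubini, and
  a second moment that does not depend on time.\<close>

locale stationary_drift = prob_space M for M :: "'w measure" +
  fixes b :: "real \<Rightarrow> 'w \<Rightarrow> real" and B :: real
  assumes b_joint: "\<And>t. 0 \<le> t \<Longrightarrow> (\<lambda>(s, \<omega>). b s \<omega>) \<in> borel_measurable (time_upto t \<Otimes>\<^sub>M M)"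
    and b_sq: "\<And>s. 0 \<le> s \<Longrightarrow> sqint M (b s)"
    and l2_b: "\<And>s. 0 \<le> s \<Longrightarrow> l2 M (b s) = B"
begin

definition drift :: "real \<Rightarrow> 'w \<Rightarrow> real" where
  "drift t \<omega> = (LINT s|time_upto t. b s \<omega>)"

lemma pair: "pair_sigma_finite (time_upto t) M"
  using finite_measure.axioms(1)[OF finite_measure_time]
  by (simp add: pair_sigma_finite_def prob_space_axioms sigma_finite_measure_axioms finite_measure_def)

lemma B_nonneg: "0 \<le> B"
  using l2_b[of 0] by (metis l2_nonneg order_refl)

lemma drift_nn: "0 \<le> t \<Longrightarrow> (\<integral>\<^sup>+\<omega>. (\<integral>\<^sup>+s. (ennreal (norm (b s \<omega>)))\<^sup>2 \<partial>time_upto t) \<partial>M) = ennreal (t * B\<^sup>2)"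
proof -
  assume t: "0 \<le> t"
  interpret pair_sigma_finite "time_upto t" M by (rule pair)
  note [measurable] = b_joint[OF t]
  have "(\<integral>\<^sup>+\<omega>. (\<integral>\<^sup>+s. (ennreal (norm (b s \<omega>)))\<^sup>2 \<partial>time_upto t) \<partial>M)
    = (\<integral>\<^sup>+s. (\<integral>\<^sup>+\<omega>. (ennreal (norm (b s \<omega>)))\<^sup>2 \<partial>M) \<partial>time_upto t)"
    by (rule Fubini') measurable
  also have "\<dots> = (\<integral>\<^sup>+s. ennreal (B\<^sup>2) \<partial>time_upto t)"
    by (rule nn_integral_cong) (simp add: space_time nn_integral_eq_l2 b_sq l2_b del: real_norm_def)
  also have "\<dots> = ennreal (t * B\<^sup>2)"
    using t by (simp add: emeasure_restrict_space space_time ennreal_mult'' mult.commute)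
  finally show ?thesis .
qed

lemma drift_measurable: "0 \<le> t \<Longrightarrow> drift t \<in> borel_measurable M"
proof -
  assume t: "0 \<le> t"
  interpret finite_measure "time_upto t" by (rule finite_measure_time)
  have "(\<lambda>(\<omega>, s). b s \<omega>) \<in> borel_measurable (M \<Otimes>\<^sub>M time_upto t)"
    using measurable_pair_swap[OF b_joint[OF t]] by (simp add: case_prod_beta' comp_def)
  then show ?thesis unfolding drift_def[abs_def] by (rule borel_measurable_lebesgue_integral)
qed

text \<open>Cauchy-Schwarz in time along each path and exchange of the integrals. Almost every path
  is square integrable in time because the expectation of its time integral is finite.\<close>

lemma
  assumes t: "0 \<le> t"
  shows drift_sqint: "sqint M (drift t)" and l2_drift: "l2 M (drift t) \<le> t * B"
proof -
  interpret L: finite_measure "time_upto t" by (rule finite_measure_time)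
  interpret pair_sigma_finite "time_upto t" M by (rule pair)
  note [measurable] = b_joint[OF t]
  have m: "(\<lambda>\<omega>. \<integral>\<^sup>+s. (ennreal (norm (b s \<omega>)))\<^sup>2 \<partial>time_upto t) \<in> borel_measurable M"
    by measurable
  have "AE \<omega> in M. (\<integral>\<^sup>+s. (ennreal (norm (b s \<omega>)))\<^sup>2 \<partial>time_upto t) \<noteq> \<infinity>"
    by (rule nn_integral_PInf_AE[OF m]) (simp add: drift_nn[OF t] del: real_norm_def)
  then have "AE \<omega> in M. (ennreal (norm (drift t \<omega>)))\<^sup>2 \<le> ennreal t * (\<integral>\<^sup>+s. (ennreal (norm (b s \<omega>)))\<^sup>2 \<partial>time_upto t)"
  proof (rule AE_mp, intro AE_I2 impI)
    fix \<omega> assume \<omega>: "\<omega> \<in> space M" and fin: "(\<integral>\<^sup>+s. (ennreal (norm (b s \<omega>)))\<^sup>2 \<partial>time_upto t) \<noteq> \<infinity>"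
    obtain q where q: "0 \<le> q" "(\<integral>\<^sup>+s. (ennreal (norm (b s \<omega>)))\<^sup>2 \<partial>time_upto t) = ennreal q"
      using fin by (cases "\<integral>\<^sup>+s. (ennreal (norm (b s \<omega>)))\<^sup>2 \<partial>time_upto t") auto
    have "(\<lambda>s. b s \<omega>) \<in> borel_measurable (time_upto t)"
      using measurable_Pair1[OF b_joint[OF t] \<omega>] by simp
    note s = sqintI_nn[OF this, of "sqrt q"]
    have sq: "sqint (time_upto t) (\<lambda>s. b s \<omega>)" "l2 (time_upto t) (\<lambda>s. b s \<omega>) \<le> sqrt q" using s q by auto
    have "norm (drift t \<omega>) \<le> sqrt t * sqrt q"
      using order_trans[OF integral_norm_bound L.l1_le_l2[OF sq(1)]] mult_left_mono[OF sq(2), of "sqrt t"] t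
      unfolding drift_def measure_time[OF t] by force
    then have "(norm (drift t \<omega>))\<^sup>2 \<le> (sqrt t * sqrt q)\<^sup>2" by (rule power_mono) simp
    then show "(ennreal (norm (drift t \<omega>)))\<^sup>2 \<le> ennreal t * (\<integral>\<^sup>+s. (ennreal (norm (b s \<omega>)))\<^sup>2 \<partial>time_upto t)"
      using t q by (simp add: power_mult_distrib ennreal_power ennreal_mult'[symmetric] ennreal_leI)
  qed
  then have "(\<integral>\<^sup>+\<omega>. (ennreal (norm (drift t \<omega>)))\<^sup>2 \<partial>M) \<le> (\<integral>\<^sup>+\<omega>. ennreal t * (\<integral>\<^sup>+s. (ennreal (norm (b s \<omega>)))\<^sup>2 \<partial>time_upto t) \<partial>M)"
    by (rule nn_integral_mono_AE)
  also have "\<dots> = ennreal t * ennreal (t * B\<^sup>2)" by (subst nn_integral_cmult[OF m]) (simp only: drift_nn[OF t])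
  also have "\<dots> = ennreal ((t * B)\<^sup>2)"
    using t by (simp add: ennreal_mult'[symmetric] power2_eq_square mult_ac)
  finally show "sqint M (drift t)" "l2 M (drift t) \<le> t * B"
    using sqintI_nn[OF drift_measurable[OF t], of "t * B"] t B_nonneg by auto
qed

text \<open>Both factors are square integrable on the product of time and probability space, which
  justifies Fubini.\<close>

lemma drift_inner:
  assumes t: "0 \<le> t" and Y: "sqint M Y"
  shows "(LINT \<omega>|M. Y \<omega> * drift t \<omega>) = (LINT s|time_upto t. (LINT \<omega>|M. Y \<omega> * b s \<omega>))"
    and "integrable (time_upto t) (\<lambda>s. LINT \<omega>|M. Y \<omega> * b s \<omega>)"
proof -
  interpret L: finite_measure "time_upto t" by (rule finite_measure_time)
  interpret pair_sigma_finite "time_upto t" M by (rule pair)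
  note [measurable] = b_joint[OF t] sqint_measurable[OF Y]
  let ?P = "time_upto t \<Otimes>\<^sub>M M"
  have "(\<integral>\<^sup>+z. (ennreal (norm (case z of (s, \<omega>) \<Rightarrow> b s \<omega>)))\<^sup>2 \<partial>?P) = (\<integral>\<^sup>+\<omega>. (\<integral>\<^sup>+s. (ennreal (norm (b s \<omega>)))\<^sup>2 \<partial>time_upto t) \<partial>M)"
    by (subst nn_integral_snd[symmetric]) auto
  also have "\<dots> = ennreal ((sqrt t * B)\<^sup>2)" using t by (simp add: drift_nn power_mult_distrib del: real_norm_def)
  finally have 1: "sqint ?P (\<lambda>(s, \<omega>). b s \<omega>)"
    using sqintI_nn[OF b_joint[OF t], of "sqrt t * B"] t B_nonneg by auto
  have "(\<integral>\<^sup>+z. (ennreal (norm (case z of (s, \<omega>) \<Rightarrow> Y \<omega>)))\<^sup>2 \<partial>?P) = (\<integral>\<^sup>+\<omega>. (\<integral>\<^sup>+s. (ennreal (norm (Y \<omega>)))\<^sup>2 \<partial>time_upto t) \<partial>M)"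
    by (subst nn_integral_snd[symmetric]) auto
  also have "\<dots> = (\<integral>\<^sup>+\<omega>. ennreal t * (ennreal (norm (Y \<omega>)))\<^sup>2 \<partial>M)"
    using t by (simp add: emeasure_restrict_space space_time mult.commute)
  also have "\<dots> = ennreal ((sqrt t * l2 M Y)\<^sup>2)"
    using t by (simp add: nn_integral_cmult nn_integral_eq_l2[OF Y] power_mult_distrib ennreal_mult' del: real_norm_def)
  finally have 2: "sqint ?P (\<lambda>(s, \<omega>). Y \<omega>)"
    using sqintI_nn[of "\<lambda>(s, \<omega>). Y \<omega>" ?P "sqrt t * l2 M Y"] t by auto
  have i: "integrable ?P (\<lambda>(s, \<omega>). Y \<omega> * b s \<omega>)"
    using integrable_inner[OF 2 1] by (simp add: case_prod_beta')
  show "(LINT \<omega>|M. Y \<omega> * drift t \<omega>) = (LINT s|time_upto t. (LINT \<omega>|M. Y \<omega> * b s \<omega>))"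
    using Fubini_integral[OF i] by (simp add: drift_def)
  show "integrable (time_upto t) (\<lambda>s. LINT \<omega>|M. Y \<omega> * b s \<omega>)"
    by (rule integrable_fst[OF i])
qed

text \<open>No stochastic calculus is needed for the balance of the second moment: over a time step of
  length \<open>t\<close> all terms but the two below are of order \<open>t * sqrt t\<close>.\<close>

lemma stationary_balance:
  assumes X: "\<And>s. 0 \<le> s \<Longrightarrow> sqint M (X s)" "\<And>s. 0 \<le> s \<Longrightarrow> l2 M (X s) = l2 M (X 0)"
    and Xb: "\<And>s. 0 \<le> s \<Longrightarrow> (LINT \<omega>|M. X s \<omega> * b s \<omega>) = (LINT \<omega>|M. X 0 \<omega> * b 0 \<omega>)"
    and N: "\<And>s. 0 \<le> s \<Longrightarrow> sqint M (N s)" "\<And>s. 0 \<le> s \<Longrightarrow> l2 M (N s) = sqrt (s * Q)"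
      "\<And>s. 0 \<le> s \<Longrightarrow> (LINT \<omega>|M. X 0 \<omega> * N s \<omega>) = 0"
    and eq: "\<And>s. 0 \<le> s \<Longrightarrow> AE \<omega> in M. N s \<omega> = X s \<omega> + drift s \<omega> - X 0 \<omega>"
    and Q: "0 \<le> Q"
  shows "2 * (LINT \<omega>|M. X 0 \<omega> * b 0 \<omega>) = Q"
proof -
  let ?q = "LINT \<omega>|M. X 0 \<omega> * b 0 \<omega>"
  have meas [measurable]: "X s \<in> borel_measurable M" "N s \<in> borel_measurable M" "drift s \<in> borel_measurable M"
    if "0 \<le> s" for s using that X(1) N(1) drift_sqint sqint_measurable by blast+
  \<comment> \<open>The increment is noise minus drift, of orders \<open>sqrt t\<close> and
    \<open>t\<close>.\<close>
  have dX: "l2 M (\<lambda>\<omega>. X 0 \<omega> - X s \<omega>) \<le> sqrt (t * Q) + t * B" if s: "0 \<le> s" "s \<le> t" for s t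
  proof -
    have "l2 M (\<lambda>\<omega>. X 0 \<omega> - X s \<omega>) \<le> l2 M (\<lambda>\<omega>. N s \<omega> - drift s \<omega>)"
      by (rule l2_mono) (use s eq[OF s(1)] in \<open>auto intro!: sqint_diff N drift_sqint\<close>)
    also have "\<dots> \<le> l2 M (N s) + l2 M (drift s)" using s by (intro l2_diff N drift_sqint)
    also have "\<dots> \<le> sqrt (t * Q) + t * B"
      unfolding N(2)[OF s(1)] using real_sqrt_le_mono[OF mult_right_mono[OF s(2) Q]] mult_right_mono[OF s(2) B_nonneg]
        l2_drift[OF s(1)] by linarith
    finally show ?thesis .
  qed
  have bound: "\<bar>2 * ?q - Q\<bar> \<le> 2 * ((sqrt (t * Q) + t * B) * B) + 2 * sqrt (t * Q) * B + t * B\<^sup>2" if t: "0 < t" for t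
  proof -
    note t0 = less_imp_le[OF t]
    interpret L: finite_measure "time_upto t" by (rule finite_measure_time)
    let ?I = "drift t"
    have i: "integrable M (\<lambda>\<omega>. X 0 \<omega> * N t \<omega>)" "integrable M (\<lambda>\<omega>. X 0 \<omega> * ?I \<omega>)" "integrable M (\<lambda>\<omega>. N t \<omega> * ?I \<omega>)"
      "integrable M (\<lambda>\<omega>. (X 0 \<omega>)\<^sup>2)" "integrable M (\<lambda>\<omega>. (N t \<omega>)\<^sup>2)" "integrable M (\<lambda>\<omega>. (?I \<omega>)\<^sup>2)"
      using integrable_inner[OF X(1)[OF order_refl] N(1)[OF t0]] integrable_inner[OF X(1)[OF order_refl] drift_sqint[OF t0]]
        integrable_inner[OF N(1)[OF t0] drift_sqint[OF t0]] X(1)[OF order_refl] N(1)[OF t0] drift_sqint[OF t0]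
      by (simp_all add: sqint_def)
    \<comment> \<open>Square \<open>X t = X 0 + N t - drift t\<close>: the norms of
      \<open>X t\<close> and \<open>X 0\<close> cancel by stationarity, and the product of
      \<open>X 0\<close> with the noise has mean zero.\<close>
    have "(l2 M (X t))\<^sup>2 = (LINT \<omega>|M. ((X 0 \<omega>)\<^sup>2 + (N t \<omega>)\<^sup>2 + (?I \<omega>)\<^sup>2 + 2 * (X 0 \<omega> * N t \<omega>)) - (2 * (X 0 \<omega> * ?I \<omega>) + 2 * (N t \<omega> * ?I \<omega>)))"
      unfolding l2_squared
    proof (rule Bochner_Integration.integral_cong_AE)
      show "AE \<omega> in M. (norm (X t \<omega>))\<^sup>2 = ((X 0 \<omega>)\<^sup>2 + (N t \<omega>)\<^sup>2 + (?I \<omega>)\<^sup>2 + 2 * (X 0 \<omega> * N t \<omega>)) - (2 * (X 0 \<omega> * ?I \<omega>) + 2 * (N t \<omega> * ?I \<omega>))"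
        using eq[OF t0]
      proof eventually_elim
        case (elim \<omega>)
        then have *: "X t \<omega> = X 0 \<omega> + N t \<omega> - ?I \<omega>" by simp
        show ?case unfolding * by (simp add: power2_eq_square algebra_simps)
      qed
    qed (use t0 in measurable)
    also have "\<dots> = (l2 M (X 0))\<^sup>2 + (l2 M (N t))\<^sup>2 + (l2 M ?I)\<^sup>2
        - (2 * (LINT \<omega>|M. X 0 \<omega> * ?I \<omega>) + 2 * (LINT \<omega>|M. N t \<omega> * ?I \<omega>))"
      using i N(3)[OF t0] by (simp add: l2_squared)
    finally have 1: "2 * (LINT \<omega>|M. X 0 \<omega> * ?I \<omega>) - t * Q = (l2 M ?I)\<^sup>2 - 2 * (LINT \<omega>|M. N t \<omega> * ?I \<omega>)"
      using t Q by (simp add: X(2)[OF t0] N(2)[OF t0])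
    have "\<bar>LINT \<omega>|M. N t \<omega> * ?I \<omega>\<bar> \<le> sqrt (t * Q) * (t * B)"
      using integral_inner_le[OF N(1)[OF t0] drift_sqint[OF t0]] mult_left_mono[OF l2_drift[OF t0], of "sqrt (t * Q)"] t Q
      by (simp add: N(2)[OF t0])
    moreover have "(l2 M ?I)\<^sup>2 \<le> (t * B)\<^sup>2" by (intro power_mono l2_drift t0) simp
    ultimately have 2: "\<bar>2 * (LINT \<omega>|M. X 0 \<omega> * ?I \<omega>) - t * Q\<bar> \<le> (t * B)\<^sup>2 + 2 * (sqrt (t * Q) * (t * B))"
      unfolding 1 using zero_le_power2[of "l2 M ?I"] by linarith
    \<comment> \<open>At equal times the correlation of \<open>X\<close> and drift is
      \<open>?q\<close> by stationarity. Replacing \<open>X s\<close> by \<open>X 0\<close> costs at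
      most the norm of the increment times \<open>B\<close>, which is small compared with the length
      of the step after integration.\<close>
    have "\<bar>(LINT \<omega>|M. X 0 \<omega> * ?I \<omega>) - t * ?q\<bar> = \<bar>LINT s|time_upto t. ((LINT \<omega>|M. X 0 \<omega> * b s \<omega>) - ?q)\<bar>"
      using drift_inner(2)[OF t0 X(1)[OF order_refl]] measure_time[OF t0]
      by (simp add: drift_inner(1)[OF t0 X(1)])
    also have "\<dots> \<le> (LINT s|time_upto t. (sqrt (t * Q) + t * B) * B)"
    proof (rule integral_abs_le_AE)
      show "AE s in time_upto t. \<bar>(LINT \<omega>|M. X 0 \<omega> * b s \<omega>) - ?q\<bar> \<le> (sqrt (t * Q) + t * B) * B"
      proof (rule AE_I2)
        fix s assume "s \<in> space (time_upto t)"
        then have s: "0 \<le> s" "s \<le> t" by (auto simp: space_time)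
        have d: "sqint M (\<lambda>\<omega>. X 0 \<omega> - X s \<omega>)" using s by (intro sqint_diff X) auto
        have "(LINT \<omega>|M. X 0 \<omega> * b s \<omega>) - ?q = (LINT \<omega>|M. X 0 \<omega> * b s \<omega> - X s \<omega> * b s \<omega>)"
          using integrable_inner[OF X(1)[OF order_refl] b_sq[OF s(1)]] integrable_inner[OF X(1)[OF s(1)] b_sq[OF s(1)]]
          by (simp add: Xb[OF s(1)])
        also have "\<dots> = (LINT \<omega>|M. (X 0 \<omega> - X s \<omega>) \<bullet> b s \<omega>)" by (simp add: left_diff_distrib)
        also have "\<bar>\<dots>\<bar> \<le> l2 M (\<lambda>\<omega>. X 0 \<omega> - X s \<omega>) * B"
          using integral_inner_le[OF d b_sq[OF s(1)]] by (simp add: l2_b[OF s(1)])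
        also have "\<dots> \<le> (sqrt (t * Q) + t * B) * B" by (intro mult_right_mono dX s B_nonneg)
        finally show "\<bar>(LINT \<omega>|M. X 0 \<omega> * b s \<omega>) - ?q\<bar> \<le> (sqrt (t * Q) + t * B) * B" .
      qed
    qed (use drift_inner(2)[OF t0 X(1)[OF order_refl]] in auto)
    also have "\<dots> = t * ((sqrt (t * Q) + t * B) * B)" using measure_time[OF t0] by simp
    finally have 3: "\<bar>(LINT \<omega>|M. X 0 \<omega> * ?I \<omega>) - t * ?q\<bar> \<le> t * ((sqrt (t * Q) + t * B) * B)" .
    have "\<bar>t * (2 * ?q - Q)\<bar> \<le> t * (2 * ((sqrt (t * Q) + t * B) * B) + 2 * sqrt (t * Q) * B + t * B\<^sup>2)"
      using 2 3 by (simp add: power2_eq_square algebra_simps abs_le_iff)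
    then show ?thesis using t by (simp add: abs_mult)
  qed
  have "((\<lambda>t. 2 * ((sqrt (t * Q) + t * B) * B) + 2 * sqrt (t * Q) * B + t * B\<^sup>2) \<longlongrightarrow>
     2 * ((sqrt (0 * Q) + 0 * B) * B) + 2 * sqrt (0 * Q) * B + 0 * B\<^sup>2) (at_right 0)"
    by (intro tendsto_intros)
  then have "((\<lambda>t. 2 * ((sqrt (t * Q) + t * B) * B) + 2 * sqrt (t * Q) * B + t * B\<^sup>2) \<longlongrightarrow> 0) (at_right 0)" by simp
  then have "\<bar>2 * ?q - Q\<bar> \<le> 0"
    by (rule tendsto_lowerbound) (auto simp: eventually_at_right_less intro!: eventually_mono[OF eventually_at_right_less] bound)
  then show ?thesis by simp
qed

end

section \<open>Second moments of the noise\<close>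

context stochastic_basis
begin

definition incr :: "real \<Rightarrow> nat \<Rightarrow> 'w \<Rightarrow> real" where
  "incr t j \<omega> = \<beta> j t \<omega> - \<beta> j 0 \<omega>"

lemma incr_normal: "0 < t \<Longrightarrow> distributed M lborel (incr t j) (normal_density 0 (sqrt t))"
  using brownian_motion.gaussian_increments[OF brownian, of 0 t j] by (simp add: incr_def[abs_def])

lemma
  assumes t: "0 < t"
  shows incr_sqint: "sqint M (incr t j)" and l2_incr: "l2 M (incr t j) = sqrt t"
    and integral_incr: "(LINT \<omega>|M. incr t j \<omega>) = 0"
proof -
  note D = incr_normal[OF t, of j]
  have [measurable]: "incr t j \<in> borel_measurable M" using distributed_measurable[OF D] by simp
  have "integrable lborel (\<lambda>x. normal_density 0 (sqrt t) x * x\<^sup>2)"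
    using integrable_normal_moment[of "sqrt t" 0 2] t by simp
  then have "integrable M (\<lambda>\<omega>. (incr t j \<omega>)\<^sup>2)"
    using distributed_integrable[OF D, of "\<lambda>x. x\<^sup>2"] by simp
  then show "sqint M (incr t j)" by (simp add: sqint_def)
  show e: "(LINT \<omega>|M. incr t j \<omega>) = 0" using normal_distributed_expectation[OF _ D] t by simp
  show "l2 M (incr t j) = sqrt t"
    using normal_distributed_variance[OF _ D] t e by (simp add: l2_def)
qed

lemma incr_uncorrelated:
  assumes t: "0 < t" and ij: "i \<noteq> j"
  shows "(LINT \<omega>|M. incr t i \<omega> * incr t j \<omega>) = 0"
proof -
  have "indep_vars (\<lambda>_. borel) (\<lambda>k \<omega>. (\<lambda>w. w t - w 0) (\<lambda>s\<in>{0..}. \<beta> k s \<omega>)) UNIV"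
    using t by (intro indep_vars_compose2[OF independent]) measurable
  then have "indep_vars (\<lambda>_. borel) (\<lambda>k. incr t k) {i, j}"
    using t indep_vars_subset by (fastforce simp: incr_def[abs_def])
  from indep_vars_lebesgue_integral[OF _ this sqint_integrable[OF incr_sqint[OF t]]]
  show ?thesis using ij by (simp add: integral_incr[OF t])
qed

text \<open>The increment is independent of \<open>F 0\<close>, with respect to which
  \<open>X\<close> is measurable; passing from event families to generated sigma-algebras gives
  independent variables, and the expectation factors.\<close>

lemma incr_uncorrelated_initial:
  assumes t: "0 < t" and X: "X \<in> borel_measurable (F 0)" and sq: "sqint M X"
  shows "(LINT \<omega>|M. X \<omega> * incr t j \<omega>) = 0"
proof -
  have sp: "space (F 0) = space M" using subalgebras[of 0] by (simp add: subalgebra_def)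
  let ?D = "{incr t j -` A \<inter> space M | A. A \<in> sets borel}" and ?X = "{X -` A \<inter> space M | A. A \<in> sets borel}"
  have "?X \<subseteq> sets (F 0)" using measurable_sets[OF X] by (auto simp: sp)
  moreover have "indep_set (sets (F 0)) ?D"
    using brownian_motion.independent_increments[OF brownian, of 0 t j] t by (simp add: incr_def[abs_def])
  ultimately have "indep_set ?X ?D"
    unfolding indep_set_def by (elim indep_sets_mono_sets) (simp split: bool.split)
  then have "indep_set (sigma_sets (space M) ?X) (sigma_sets (space M) ?D)"
  proof (rule indep_set_sigma_sets)
    have "Int_stable {Y -` A \<inter> space M | A. A \<in> sets borel}" for Y :: "'w \<Rightarrow> real"
    proof (rule Int_stableI, clarify)
      fix A B :: "real set" assume "A \<in> sets borel" "B \<in> sets borel"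
      then show "\<exists>C. Y -` A \<inter> space M \<inter> (Y -` B \<inter> space M) = Y -` C \<inter> space M \<and> C \<in> sets borel"
        by (intro exI[of _ "A \<inter> B"]) auto
    qed
    then show "Int_stable ?X" "Int_stable ?D" by blast+
  qed
  then have "indep_var borel X borel (incr t j)"
    using sqint_measurable[OF sq] sqint_measurable[OF incr_sqint[OF t]] by (simp add: indep_var_eq)
  from indep_var_lebesgue_integral[OF this sqint_integrable[OF sq] sqint_integrable[OF incr_sqint[OF t]]]
  show ?thesis by (simp add: integral_incr[OF t])
qed

lemma l2_sum_incr:
  assumes t: "0 < t" and J: "finite J"
  shows "(l2 M (\<lambda>\<omega>. \<Sum>j\<in>J. c j * incr t j \<omega>))\<^sup>2 = t * (\<Sum>j\<in>J. (c j)\<^sup>2)"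
proof -
  have i: "integrable M (\<lambda>\<omega>. incr t i \<omega> * incr t j \<omega>)" for i j
    using integrable_inner[OF incr_sqint[OF t] incr_sqint[OF t]] by simp
  have v: "(LINT \<omega>|M. incr t i \<omega> * incr t j \<omega>) = (if i = j then t else 0)" for i j
    using l2_squared[of M "incr t j"] incr_uncorrelated[OF t, of i j] t by (simp add: l2_incr power2_eq_square)
  have "(l2 M (\<lambda>\<omega>. \<Sum>j\<in>J. c j * incr t j \<omega>))\<^sup>2 = (LINT \<omega>|M. (\<Sum>i\<in>J. \<Sum>j\<in>J. (c i * c j) * (incr t i \<omega> * incr t j \<omega>)))"
    unfolding l2_squared by (simp add: power2_eq_square sum_product mult_ac)
  also have "\<dots> = (\<Sum>i\<in>J. \<Sum>j\<in>J. (c i * c j) * (if i = j then t else 0))"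
    by (simp add: i v Bochner_Integration.integral_sum)
  also have "\<dots> = t * (\<Sum>j\<in>J. (c j)\<^sup>2)"
    by (simp add: sum.delta[OF J] if_distrib sum_distrib_left power2_eq_square mult_ac J cong: if_cong)
  finally show ?thesis .
qed

text \<open>The weak formulation delivers the noise as an almost sure sum. Uncorrelated increments
  make the partial sums Cauchy in \<open>L\<^sup>2\<close>, and completeness identifies their limit
  with the prescribed \<open>N\<close>; variance and correlation with \<open>X\<close> then pass to
  the limit.\<close>

lemma noise_moments:
  assumes t: "0 \<le> t" and c: "summable (\<lambda>j. (c j)\<^sup>2)"
    and X: "X \<in> borel_measurable (F 0)" "sqint M X"
    and N: "N \<in> borel_measurable M" "AE \<omega> in M. (\<lambda>j. ito_integral_const (c j) (\<beta> j) t \<omega>) sums N \<omega>"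
  shows "sqint M N" and "l2 M N = sqrt (t * (\<Sum>j. (c j)\<^sup>2))" and "(LINT \<omega>|M. X \<omega> * N \<omega>) = 0"
proof -
  have "sqint M N \<and> l2 M N = sqrt (t * (\<Sum>j. (c j)\<^sup>2)) \<and> (LINT \<omega>|M. X \<omega> * N \<omega>) = 0"
  \<comment> \<open>The Gaussian increments are available for positive times only. At time zero
    every term of the series vanishes.\<close>
  proof (cases "t = 0")
    case True
    have z: "AE \<omega> in M. N \<omega> = 0"
      using N(2) by eventually_elim (use True sums_unique2[OF sums_zero] in \<open>force simp: ito_integral_const_def\<close>)
    have l: "l2 M N = l2 M (\<lambda>\<omega>. 0 :: real)"
      unfolding l2_def by (intro arg_cong[of _ _ sqrt] Bochner_Integration.integral_cong_AE) (use z N(1) in auto)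
    have "(LINT \<omega>|M. X \<omega> * N \<omega>) = (LINT \<omega>|M. 0)"
      by (rule Bochner_Integration.integral_cong_AE) (use z N(1) sqint_measurable[OF X(2)] in auto)
    then show ?thesis using True z N(1) l sqint_bound[OF sqint_zero N(1)] by auto
  next
    case False
    then have t: "0 < t" using t by simp
    define S where "S n \<omega> = (\<Sum>j<n. c j * incr t j \<omega>)" for n \<omega>
    have lim: "AE \<omega> in M. (\<lambda>n. S n \<omega>) \<longlonglongrightarrow> N \<omega>"
      using N(2) by (simp add: sums_def S_def ito_integral_const_def incr_def)
    have sq: "sqint M (S n)" for n
      unfolding S_def[abs_def] using sqint_scaleR[OF incr_sqint[OF t]] by (intro sqint_sum) auto
    have lS: "(l2 M (S n))\<^sup>2 = t * (\<Sum>j<n. (c j)\<^sup>2)" for n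
      unfolding S_def[abs_def] by (rule l2_sum_incr[OF t]) simp
    have d: "(l2 M (\<lambda>\<omega>. S n \<omega> - S m \<omega>))\<^sup>2 = t * (\<Sum>j\<in>{m..<n}. (c j)\<^sup>2)" if "m \<le> n" for m n
    proof -
      have "S n \<omega> - S m \<omega> = (\<Sum>j\<in>{m..<n}. c j * incr t j \<omega>)" for \<omega>
        unfolding S_def using sum_diff_nat_ivl[of 0 m n "\<lambda>j. c j * incr t j \<omega>"] that by (simp add: lessThan_atLeast0)
      then show ?thesis using l2_sum_incr[OF t, of "{m..<n}" c] by simp
    qed
    have cauchy: "\<exists>K. \<forall>i\<ge>K. \<forall>j\<ge>K. l2 M (\<lambda>\<omega>. S i \<omega> - S j \<omega>) < \<epsilon>" if e: "0 < \<epsilon>" for \<epsilon>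
    proof -
      obtain K where K: "\<And>m n. K \<le> m \<Longrightarrow> norm (\<Sum>j\<in>{m..<n}. (c j)\<^sup>2) < \<epsilon>\<^sup>2 / t"
        using c e t unfolding summable_Cauchy by (meson divide_pos_pos zero_less_power)
      have lt: "l2 M (\<lambda>\<omega>. S n \<omega> - S m \<omega>) < \<epsilon>" if "K \<le> m" "m \<le> n" for m n
      proof (rule power_less_imp_less_base[of _ 2])
        have "(\<Sum>j\<in>{m..<n}. (c j)\<^sup>2) < \<epsilon>\<^sup>2 / t" using K[OF that(1), of n] by simp
        then show "(l2 M (\<lambda>\<omega>. S n \<omega> - S m \<omega>))\<^sup>2 < \<epsilon>\<^sup>2" using t that(2) by (simp add: d pos_less_divide_eq mult.commute)
      qed (use e in simp)
      have "l2 M (\<lambda>\<omega>. S i \<omega> - S j \<omega>) < \<epsilon>" if ij: "K \<le> i" "K \<le> j" for i j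
      proof (cases "j \<le> i")
        case False
        then show ?thesis using lt[of i j] ij by (simp add: l2_def power2_commute)
      qed (use lt ij in auto)
      then show ?thesis by blast
    qed
    obtain r where r: "strict_mono r" "\<And>f. f \<in> borel_measurable M \<Longrightarrow> (AE x in M. (\<lambda>n. S (r n) x) \<longlonglongrightarrow> f x) \<Longrightarrow>
      sqint M f \<and> (\<lambda>n. l2 M (\<lambda>x. f x - S n x)) \<longlonglongrightarrow> 0"
      by (rule l2_complete[OF finite_measure_axioms sq cauchy]) blast+
    have "AE \<omega> in M. (\<lambda>n. S (r n) \<omega>) \<longlonglongrightarrow> N \<omega>"
      using lim by eventually_elim (use LIMSEQ_subseq_LIMSEQ[OF _ r(1)] in \<open>simp add: comp_def\<close>)
    from r(2)[OF N(1) this] have N2: "sqint M N" and l: "(\<lambda>n. l2 M (\<lambda>x. N x - S n x)) \<longlonglongrightarrow> 0" by auto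
    have "(\<lambda>n. (l2 M (S n))\<^sup>2) \<longlonglongrightarrow> (l2 M N)\<^sup>2" by (intro tendsto_intros l2_tendsto_norm sq N2 l)
    moreover have "(\<lambda>n. (l2 M (S n))\<^sup>2) \<longlonglongrightarrow> t * (\<Sum>j. (c j)\<^sup>2)"
      unfolding lS by (intro tendsto_intros summable_LIMSEQ c)
    ultimately have "(l2 M N)\<^sup>2 = t * (\<Sum>j. (c j)\<^sup>2)" by (rule LIMSEQ_unique)
    then have 2: "l2 M N = sqrt (t * (\<Sum>j. (c j)\<^sup>2))" by (metis l2_nonneg real_sqrt_unique)
    have "(\<lambda>n. LINT \<omega>|M. X \<omega> \<bullet> S n \<omega>) \<longlonglongrightarrow> (LINT \<omega>|M. X \<omega> \<bullet> N \<omega>)"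
      by (rule inner_tendsto_l2) (use X sq N2 l in auto)
    moreover have "(LINT \<omega>|M. X \<omega> \<bullet> S n \<omega>) = 0" for n
    proof -
      have i: "integrable M (\<lambda>\<omega>. X \<omega> * incr t j \<omega>)" for j
        using integrable_inner[OF X(2) incr_sqint[OF t]] by simp
      have "(LINT \<omega>|M. X \<omega> \<bullet> S n \<omega>) = (LINT \<omega>|M. (\<Sum>j<n. c j * (X \<omega> * incr t j \<omega>)))"
        by (simp add: S_def sum_distrib_left mult_ac)
      also have "\<dots> = 0" by (simp add: Bochner_Integration.integral_sum i incr_uncorrelated_initial[OF t X])
      finally show ?thesis .
    qed
    ultimately have "(LINT \<omega>|M. X \<omega> * N \<omega>) = 0" using LIMSEQ_unique[OF tendsto_const] by fastforce
    with N2 2 show ?thesis by blast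
  qed
  then show "sqint M N" "l2 M N = sqrt (t * (\<Sum>j. (c j)\<^sup>2))" "(LINT \<omega>|M. X \<omega> * N \<omega>) = 0" by blast+
qed

end

section \<open>The chosen gradient and the stationary process\<close>

lemma has_gradient_grad: "v \<in> H1_div \<Longrightarrow> has_gradient v (grad v)"
  by (simp add: grad_def H1_div_def someI_ex)

lemma H1_div_approx:
  assumes "v \<in> H1_div"
  obtains \<phi> where "H1_approx v (grad v) \<phi> (\<lambda>n x. jacobian (\<phi> n) (at x))" "v \<in> L2_div"
proof -
  obtain \<phi> where \<phi>: "\<And>n. \<phi> n \<in> Cinf_div" "H1_approx v (grad v) \<phi> (\<lambda>n x. jacobian (\<phi> n) (at x))"
    using has_gradient_imp_H1_approx[OF has_gradient_grad[OF assms]] by blast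
  show ?thesis using \<phi> H1_approx.v_L2_div[OF \<phi>(2,1)] by (intro that) auto
qed

lemma grad_L2_torus: "grad v \<in> L2_torus"
  using has_gradient_grad[of v] by (cases "v \<in> H1_div") (auto simp: has_gradient_def grad_def L2_torus_iff periodic_def)

lemma grad_norm_sq_H1: "v \<in> H1_div \<Longrightarrow> grad_norm_sq v = ennreal ((l2 torus (grad v))\<^sup>2)"
  by (simp add: grad_norm_sq_def L2_norm_eq[OF L2_torusD(2)[OF grad_L2_torus]])

lemma H1_div_iff: "v \<in> H1_div \<longleftrightarrow> grad_norm_sq v < \<infinity>"
  by (cases "v \<in> H1_div") (auto simp: grad_norm_sq_H1 grad_norm_sq_def)

lemma l2_grad_eq: "l2 torus (grad v) = sqrt (enn2real (grad_norm_sq v))"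
proof (cases "v \<in> H1_div")
  case False
  then show ?thesis by (simp add: grad_norm_sq_def grad_def)
qed (simp add: grad_norm_sq_H1)

lemma H1_div_measurable [measurable]: "Measurable.pred L2_div_borel (\<lambda>v. v \<in> H1_div)"
  unfolding H1_div_iff by measurable

lemma l2_grad_measurable [measurable]: "(\<lambda>v. l2 torus (grad v)) \<in> borel_measurable L2_div_borel"
  unfolding l2_grad_eq by measurable

text \<open>Outside \<open>H1_div\<close> the function \<open>grad\<close> is zero by convention, so
  the case distinction is exact for every \<open>v\<close>.\<close>

lemma L2_inner_grad_mode:
  "L2_inner (grad v) (\<lambda>x. jacobian (trig_wave a k \<theta>) (at x))
    = (if v \<in> H1_div then (norm (frequency k))\<^sup>2 * (phase_coeff v k \<theta> \<bullet> a) else 0)"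
proof (cases "v \<in> H1_div")
  case True
  then obtain \<phi> where "H1_approx v (grad v) \<phi> (\<lambda>n x. jacobian (\<phi> n) (at x))" by (rule H1_div_approx)
  then interpret H1_approx v "grad v" \<phi> "\<lambda>n x. jacobian (\<phi> n) (at x)" .
  show ?thesis
    using True viscous_mode[of a k \<theta>] by (simp add: jacobian_trig_wave L2_inner_eq[OF L2_torusD(2)[OF G] trig_wave_measurable])
qed (simp add: grad_def L2_inner_def)

lemma L2_inner_advection_mode:
  assumes "v \<in> L2_div"
  shows "L2_inner (\<lambda>x. grad v x *v v x) (trig_wave a k \<theta>) = (if v \<in> H1_div then mode_flux a k \<theta> v else 0)"
proof (cases "v \<in> H1_div")
  case True
  then obtain \<phi> where "H1_approx v (grad v) \<phi> (\<lambda>n x. jacobian (\<phi> n) (at x))" by (rule H1_div_approx)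
  then interpret H1_approx v "grad v" \<phi> "\<lambda>n x. jacobian (\<phi> n) (at x)" .
  note [measurable] = L2_torusD(2)[OF v] L2_torusD(2)[OF G]
  show ?thesis using True advection_mode[of a k \<theta>] by (subst L2_inner_eq) simp_all
qed (simp add: grad_def L2_inner_def)

text \<open>The energy inequality and the moment bounds, standing properties of stationary
  solutions, are added in the form in which the theorem receives them.\<close>

locale stationary_energy_solution = stationary_martingale_solution M F \<beta> \<sigma> e \<nu> u
  for M :: "'w measure" and F \<beta> \<sigma> e \<nu> and u :: "real \<Rightarrow> 'w \<Rightarrow> real^3 \<Rightarrow> real^3" +
  assumes energy: "\<And>t. 0 \<le> t \<Longrightarrow> ennreal \<nu> * (\<integral>\<^sup>+\<omega>. grad_norm_sq (u t \<omega>) \<partial>M) \<le> ennreal (energy_input \<sigma>)"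
    and moments: "\<And>T r. 0 \<le> T \<Longrightarrow> 1 \<le> r \<Longrightarrow>
      (\<integral>\<^sup>+\<omega>. ennreal (enn2real (Linf_L2_norm T (\<lambda>t. u t \<omega>)) powr r) \<partial>M) < \<infinity>"
begin

lemma u_adapted: "0 \<le> t \<Longrightarrow> u t \<in> F t \<rightarrow>\<^sub>M L2_div_borel"
  using measurable_Pair2[OF progressive[of t], of t] by (simp add: space_restrict_space)

lemma u_measurable: "0 \<le> t \<Longrightarrow> u t \<in> M \<rightarrow>\<^sub>M L2_div_borel"
  using measurable_from_subalg[OF subalgebras u_adapted] .

text \<open>Progressive measurability refers to \<open>F T\<close>; enlarging it to \<open>M\<close>
  gives the form needed for Fubini.\<close>

lemma u_joint:
  assumes T: "0 \<le> T"
  shows "(\<lambda>(t, \<omega>). u t \<omega>) \<in> time_upto T \<Otimes>\<^sub>M M \<rightarrow>\<^sub>M L2_div_borel"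
proof -
  have "(\<lambda>\<omega>. \<omega>) \<in> M \<rightarrow>\<^sub>M F T" by (rule measurable_from_subalg[OF subalgebras[OF T]]) simp
  then have "(\<lambda>z. (fst z, snd z)) \<in> time_upto T \<Otimes>\<^sub>M M \<rightarrow>\<^sub>M restrict_space borel {0..T} \<Otimes>\<^sub>M F T"
    by (intro measurable_Pair measurable_compose[OF measurable_snd])
      (simp_all add: measurable_cong_sets[OF refl sets_restrict_space_cong[OF sets_lborel[symmetric]]])
  from measurable_compose[OF this progressive[OF T]] show ?thesis by (simp add: case_prod_beta')
qed

lemma u_path: "0 \<le> T \<Longrightarrow> \<omega> \<in> space M \<Longrightarrow> (\<lambda>t. u t \<omega>) \<in> time_upto T \<rightarrow>\<^sub>M L2_div_borel"
  using measurable_Pair1[OF u_joint] by auto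

lemma u_L2_div: "0 \<le> t \<Longrightarrow> \<omega> \<in> space M \<Longrightarrow> u t \<omega> \<in> L2_div"
  using measurable_space[OF u_measurable] by simp

lemmas u_L2_torus = L2_div_L2_torus[OF u_L2_div]

text \<open>Evaluation at time zero turns equality of path laws into equality of the laws at single
  times.\<close>

lemma distr_u:
  assumes t: "0 \<le> t"
  shows "distr M L2_div_borel (u t) = distr M L2_div_borel (u 0)"
proof -
  let ?P = "\<Pi>\<^sub>M t\<in>{0::real..}. L2_div_borel"
  have m: "(\<lambda>\<omega>. \<lambda>s\<in>{0..}. u (s + \<tau>) \<omega>) \<in> M \<rightarrow>\<^sub>M ?P" if "0 \<le> \<tau>" for \<tau>
    using that by (intro measurable_restrict u_measurable) simp
  have "distr M L2_div_borel (u \<tau>) = distr (distr M ?P (\<lambda>\<omega>. \<lambda>s\<in>{0..}. u (s + \<tau>) \<omega>)) L2_div_borel (\<lambda>w. w 0)" if "0 \<le> \<tau>" for \<tau>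
    by (subst distr_distr[OF measurable_component_singleton m[OF that]]) (simp_all add: comp_def)
  from this[OF t] this[OF order_refl] stationary[OF t] show ?thesis by simp
qed

lemma
  fixes g :: "(real^3 \<Rightarrow> real^3) \<Rightarrow> real"
  assumes t: "0 \<le> t" and g: "g \<in> borel_measurable L2_div_borel"
  shows integral_stationary: "(LINT \<omega>|M. g (u t \<omega>)) = (LINT \<omega>|M. g (u 0 \<omega>))"
    and integrable_stationary: "integrable M (\<lambda>\<omega>. g (u t \<omega>)) \<longleftrightarrow> integrable M (\<lambda>\<omega>. g (u 0 \<omega>))"
proof -
  show "(LINT \<omega>|M. g (u t \<omega>)) = (LINT \<omega>|M. g (u 0 \<omega>))"
    using integral_distr[OF u_measurable[OF t] g] integral_distr[OF u_measurable[OF order_refl] g] distr_u[OF t] by simp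
  show "integrable M (\<lambda>\<omega>. g (u t \<omega>)) \<longleftrightarrow> integrable M (\<lambda>\<omega>. g (u 0 \<omega>))"
    using integrable_distr_eq[OF u_measurable[OF t] g] integrable_distr_eq[OF u_measurable[OF order_refl] g] distr_u[OF t] by simp
qed

lemma nn_integral_stationary:
  assumes t: "0 \<le> t" and g: "g \<in> borel_measurable L2_div_borel"
  shows "(\<integral>\<^sup>+\<omega>. g (u t \<omega>) \<partial>M) = (\<integral>\<^sup>+\<omega>. g (u 0 \<omega>) \<partial>M)"
  using nn_integral_distr[OF u_measurable[OF t], of g] nn_integral_distr[OF u_measurable[OF order_refl], of g] distr_u[OF t] g
  by simp

lemma AE_paths:
  assumes T: "0 \<le> T"
  shows "AE \<omega> in M. AE s in time_upto T. u s \<omega> \<in> H1_div \<and> l2 torus (u s \<omega>) \<le> enn2real (Linf_L2_norm T (\<lambda>t. u t \<omega>))"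
proof -
  obtain \<alpha> where reg: "AE \<omega> in M. continuous_in_Hdot \<alpha> T (\<lambda>t. u t \<omega>) \<and>
      Linf_L2_norm T (\<lambda>t. u t \<omega>) < \<infinity> \<and> L2_H1_norm_sq T (\<lambda>t. u t \<omega>) < \<infinity>"
    using path_regularity[OF T] by blast
  show ?thesis
  proof (rule AE_mp[OF reg], rule AE_I2, rule impI, elim conjE)
    fix \<omega> assume \<omega>: "\<omega> \<in> space M" and Linf: "Linf_L2_norm T (\<lambda>t. u t \<omega>) < \<infinity>"
      and H1: "L2_H1_norm_sq T (\<lambda>t. u t \<omega>) < \<infinity>"
    note [measurable] = u_path[OF T \<omega>]
    have eq: "L2_norm (u s \<omega>) = l2 torus (u s \<omega>)" if "s \<in> {0..T}" for s
      using L2_norm_eq L2_torusD(2) u_L2_torus[OF _ \<omega>] that by auto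
    have "(\<integral>\<^sup>+s. grad_norm_sq (u s \<omega>) \<partial>time_upto T) \<le> (\<integral>\<^sup>+s. H1_norm_sq (u s \<omega>) \<partial>time_upto T)"
      by (rule nn_integral_mono) (simp add: H1_norm_sq_def)
    also have "\<dots> = L2_H1_norm_sq T (\<lambda>t. u t \<omega>)"
      by (simp add: L2_H1_norm_sq_def nn_integral_restrict_space)
    finally have "(\<integral>\<^sup>+s. grad_norm_sq (u s \<omega>) \<partial>time_upto T) \<noteq> \<infinity>" using H1 by (simp add: less_top top_unique)
    then have "AE s in time_upto T. grad_norm_sq (u s \<omega>) \<noteq> \<infinity>" by (intro nn_integral_PInf_AE) simp_all
    moreover have "AE s in time_upto T. ennreal (L2_norm (u s \<omega>)) \<le> Linf_L2_norm T (\<lambda>t. u t \<omega>)"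
      unfolding Linf_L2_norm_def by (rule esssup_AE)
    moreover note AE_space
    ultimately show "AE s in time_upto T. u s \<omega> \<in> H1_div \<and> l2 torus (u s \<omega>) \<le> enn2real (Linf_L2_norm T (\<lambda>t. u t \<omega>))"
    proof eventually_elim
      case (elim s)
      have "l2 torus (u s \<omega>) = enn2real (ennreal (L2_norm (u s \<omega>)))" using elim(3) by (simp add: eq space_time)
      also have "\<dots> \<le> enn2real (Linf_L2_norm T (\<lambda>t. u t \<omega>))" using elim(2) Linf by (intro enn2real_mono) auto
      finally show ?case using elim(1) by (simp add: H1_div_iff less_top)
    qed
  qed
qed

text \<open>The moment hypothesis concerns an essential supremum in time, which says nothing about
  one instant. By stationarity the moment at time zero equals its average over the unit time
  interval, and there the hypothesis applies. The power is four because the drift is quadratic in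
  \<open>u\<close> and has to be square integrable.\<close>

lemma integrable_fourth_moment:
  assumes t: "0 \<le> t"
  shows "integrable M (\<lambda>\<omega>. (l2 torus (u t \<omega>)) ^ 4)"
proof -
  let ?g = "\<lambda>v. ennreal ((l2 torus v) ^ 4)"
  have m [measurable]: "?g \<in> borel_measurable L2_div_borel" by measurable
  note [measurable] = u_joint[of 1, simplified] u_measurable[OF order_refl]
  interpret pair_sigma_finite "time_upto 1" M
    using finite_measure.axioms(1)[OF finite_measure_time]
    by (simp add: pair_sigma_finite_def prob_space_axioms sigma_finite_measure_axioms finite_measure_def)
  have "(\<integral>\<^sup>+\<omega>. ?g (u 0 \<omega>) \<partial>M) = (\<integral>\<^sup>+s. (\<integral>\<^sup>+\<omega>. ?g (u 0 \<omega>) \<partial>M) \<partial>time_upto 1)"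
    by (simp add: emeasure_restrict_space space_time)
  also have "\<dots> = (\<integral>\<^sup>+s. (\<integral>\<^sup>+\<omega>. ?g (u s \<omega>) \<partial>M) \<partial>time_upto 1)"
    by (rule nn_integral_cong, rule nn_integral_stationary[symmetric, OF _ m]) (simp add: space_time)
  also have "\<dots> = (\<integral>\<^sup>+\<omega>. (\<integral>\<^sup>+s. ?g (u s \<omega>) \<partial>time_upto 1) \<partial>M)"
    by (rule Fubini'[symmetric]) (use measurable_compose[OF u_joint m, of 1] in \<open>simp add: case_prod_beta'\<close>)
  also have "\<dots> \<le> (\<integral>\<^sup>+\<omega>. ennreal (enn2real (Linf_L2_norm 1 (\<lambda>t. u t \<omega>)) powr 4) \<partial>M)"
  proof (rule nn_integral_mono_AE)
    show "AE \<omega> in M. (\<integral>\<^sup>+s. ?g (u s \<omega>) \<partial>time_upto 1) \<le> ennreal (enn2real (Linf_L2_norm 1 (\<lambda>t. u t \<omega>)) powr 4)"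
      using AE_paths[OF zero_le_one]
    proof eventually_elim
      case (elim \<omega>)
      have "(\<integral>\<^sup>+s. ?g (u s \<omega>) \<partial>time_upto 1) \<le> (\<integral>\<^sup>+s. ennreal (enn2real (Linf_L2_norm 1 (\<lambda>t. u t \<omega>)) powr 4) \<partial>time_upto 1)"
        using elim by (intro nn_integral_mono_AE) (auto elim!: eventually_mono intro!: ennreal_leI power_mono simp: powr_numeral)
      then show ?case by (simp add: emeasure_restrict_space space_time)
    qed
  qed
  also have "\<dots> < \<infinity>" by (rule moments) simp_all
  finally have "integrable M (\<lambda>\<omega>. (l2 torus (u 0 \<omega>)) ^ 4)" by (intro integrableI_nonneg) auto
  then show ?thesis by (subst integrable_stationary[OF t, of "\<lambda>v. (l2 torus v) ^ 4"]) simp_all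
qed

lemma sqint_l2_squared: "0 \<le> t \<Longrightarrow> sqint M (\<lambda>\<omega>. (l2 torus (u t \<omega>))\<^sup>2)"
  using integrable_fourth_moment[of t] measurable_compose[OF u_measurable l2_L2_div_measurable]
  by (simp add: sqint_def power_mult[symmetric])

lemma sqint_l2: "0 \<le> t \<Longrightarrow> sqint M (\<lambda>\<omega>. l2 torus (u t \<omega>))"
  using sqint_integrable[OF sqint_l2_squared] measurable_compose[OF u_measurable l2_L2_div_measurable]
  by (simp add: sqint_def)

text \<open>\<open>grad_norm_sq\<close> is infinite outside \<open>H1_div\<close>. Since
  \<open>\<nu>\<close> is positive, the energy inequality makes its expectation finite, hence
  membership almost sure.\<close>

lemma
  assumes t: "0 \<le> t"
  shows AE_H1_div: "AE \<omega> in M. u t \<omega> \<in> H1_div"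
    and sqint_l2_grad: "sqint M (\<lambda>\<omega>. l2 torus (grad (u t \<omega>)))"
    and l2_grad_le: "\<nu> * (l2 M (\<lambda>\<omega>. l2 torus (grad (u t \<omega>))))\<^sup>2 \<le> energy_input \<sigma>"
proof -
  note [measurable] = u_measurable[OF t]
  have e0: "0 \<le> energy_input \<sigma>" by (simp add: energy_input_def suminf_nonneg summable_coeffs)
  have fin: "(\<integral>\<^sup>+\<omega>. grad_norm_sq (u t \<omega>) \<partial>M) \<noteq> \<infinity>"
  proof
    assume "(\<integral>\<^sup>+\<omega>. grad_norm_sq (u t \<omega>) \<partial>M) = \<infinity>"
    then show False using energy[OF t] viscosity_pos by (simp add: ennreal_mult_top top_unique)
  qed
  then have "AE \<omega> in M. grad_norm_sq (u t \<omega>) \<noteq> \<infinity>" by (intro nn_integral_PInf_AE) simp_all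
  then show ae: "AE \<omega> in M. u t \<omega> \<in> H1_div" by (simp add: H1_div_iff less_top)
  have "(\<integral>\<^sup>+\<omega>. (ennreal (norm (l2 torus (grad (u t \<omega>)))))\<^sup>2 \<partial>M) = (\<integral>\<^sup>+\<omega>. grad_norm_sq (u t \<omega>) \<partial>M)"
    by (rule nn_integral_cong_AE, use ae in eventually_elim) (simp add: grad_norm_sq_H1 ennreal_power)
  then obtain q where q: "0 \<le> q" "(\<integral>\<^sup>+\<omega>. (ennreal (norm (l2 torus (grad (u t \<omega>)))))\<^sup>2 \<partial>M) = ennreal q"
    "(\<integral>\<^sup>+\<omega>. grad_norm_sq (u t \<omega>) \<partial>M) = ennreal q"
    using fin by (cases "\<integral>\<^sup>+\<omega>. grad_norm_sq (u t \<omega>) \<partial>M") auto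
  have *: "sqint M (\<lambda>\<omega>. l2 torus (grad (u t \<omega>)))" "l2 M (\<lambda>\<omega>. l2 torus (grad (u t \<omega>))) \<le> sqrt q"
    using sqintI_nn[of "\<lambda>\<omega>. l2 torus (grad (u t \<omega>))" M "sqrt q"] q by auto
  then show "sqint M (\<lambda>\<omega>. l2 torus (grad (u t \<omega>)))" by blast
  have "(l2 M (\<lambda>\<omega>. l2 torus (grad (u t \<omega>))))\<^sup>2 \<le> q"
    using power_mono[OF *(2), of 2] q(1) by simp
  moreover have "\<nu> * q \<le> energy_input \<sigma>"
    using energy[OF t] viscosity_pos q e0 by (simp add: ennreal_mult'[symmetric])
  ultimately show "\<nu> * (l2 M (\<lambda>\<omega>. l2 torus (grad (u t \<omega>))))\<^sup>2 \<le> energy_input \<sigma>"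
    using mult_left_mono[of _ q \<nu>] viscosity_pos by (meson less_imp_le order_trans)
qed

end

text \<open>This is the use of completeness: the transfer and viscous forms of the random field
  arise as almost sure limits, and the structure functions agree with the transfer form only almost
  surely.\<close>

lemma (in complete_measure) borel_measurable_AE_eq:
  fixes f g :: "'a \<Rightarrow> real"
  assumes f: "f \<in> borel_measurable M" and eq: "AE x in M. f x = g x"
  shows "g \<in> borel_measurable M"
proof (rule measurableI)
  fix A :: "real set" assume "A \<in> sets borel"
  then have A: "f -` A \<inter> space M \<in> sets M" using f by (rule measurable_sets[rotated])
  have "AE x in M. x \<in> f -` A \<inter> space M \<longleftrightarrow> x \<in> g -` A \<inter> space M"
    using eq by eventually_elim auto
  then show "g -` A \<inter> space M \<in> sets M" using A by (rule in_sets_AE) auto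
qed simp

lemma (in complete_measure) borel_measurable_AE_limit:
  fixes f :: "'a \<Rightarrow> real"
  assumes s: "\<And>n. s n \<in> borel_measurable M" and lim: "AE x in M. (\<lambda>n. s n x) \<longlonglongrightarrow> f x"
  shows "f \<in> borel_measurable M"
proof (rule borel_measurable_AE_eq)
  show "(\<lambda>x. lim (\<lambda>n. s n x)) \<in> borel_measurable M" by (rule borel_measurable_lim_metric[OF s])
  show "AE x in M. lim (\<lambda>n. s n x) = f x" using lim by eventually_elim (rule limI)
qed

context forcing
begin

lemma e_L2_div: "e j \<in> L2_div"
proof -
  have "e j \<in> H1_div" using eigenfunctions[of j] by (auto simp: stokes_def)
  then show ?thesis using H1_div_approx by blast
qed

lemmas e_L2_torus = L2_div_L2_torus[OF e_L2_div]

lemma l2_e: "l2 torus (e j) = 1"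
  using orthonormal[of j j] L2_inner_eq[OF L2_torusD(2) L2_torusD(2), OF e_L2_torus e_L2_torus, of j j]
  by (simp add: l2_def power2_norm_eq_inner)

lemma summable_coeffs_bounded:
  assumes "\<And>j. \<bar>f j\<bar> \<le> C"
  shows "summable (\<lambda>j. (\<sigma> j)\<^sup>2 * f j)"
proof (rule summable_comparison_test')
  show "summable (\<lambda>j. (\<sigma> j)\<^sup>2 * C)" by (intro summable_mult2 summable_coeffs)
  show "norm ((\<sigma> j)\<^sup>2 * f j) \<le> (\<sigma> j)\<^sup>2 * C" if "0 \<le> j" for j using assms by (simp add: abs_mult mult_left_mono)
qed

lemma phase_coeff_e_bound: "\<bar>phase_coeff (e j) k \<theta> \<bullet> a\<bar> \<le> sqrt ((2 * pi) ^ 3) * norm a"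
  using phase_coeff_bound[OF e_L2_torus[of j], of k \<theta>] unfolding l2_e mult_1_right
  by (intro order_trans[OF Cauchy_Schwarz_ineq2 mult_right_mono]) auto

lemma summable_mode_input: "summable (\<lambda>j. (\<sigma> j)\<^sup>2 * (phase_coeff (e j) k \<theta> \<bullet> a)\<^sup>2)"
  by (rule summable_coeffs_bounded[of _ "(sqrt ((2 * pi) ^ 3) * norm a)\<^sup>2"])
    (use power_mono[OF phase_coeff_e_bound abs_ge_zero, of _ _ _ _ 2] in simp)

end

context stationary_energy_solution
begin

definition mode_drift :: "real^3 \<Rightarrow> int^3 \<Rightarrow> real \<Rightarrow> (real^3 \<Rightarrow> real^3) \<Rightarrow> real" where
  "mode_drift a k \<theta> v = \<nu> * ((norm (frequency k))\<^sup>2 * (phase_coeff v k \<theta> \<bullet> a)) + mode_flux a k \<theta> v"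

lemma mode_drift_measurable [measurable]: "mode_drift a k \<theta> \<in> borel_measurable L2_div_borel"
  unfolding mode_drift_def[abs_def] by measurable

lemma phase_coeff_inner_bound: "v \<in> L2_torus \<Longrightarrow> \<bar>phase_coeff v k \<theta> \<bullet> a\<bar> \<le> (sqrt ((2 * pi) ^ 3) * l2 torus v) * norm a"
  by (rule order_trans[OF Cauchy_Schwarz_ineq2 mult_right_mono[OF phase_coeff_bound]]) auto

lemma sqint_mode:
  assumes t: "0 \<le> t"
  shows "sqint M (\<lambda>\<omega>. phase_coeff (u t \<omega>) k \<theta> \<bullet> a)"
proof (rule sqint_bound[OF sqint_scaleR[OF sqint_l2[OF t]]])
  note [measurable] = u_measurable[OF t]
  show "(\<lambda>\<omega>. phase_coeff (u t \<omega>) k \<theta> \<bullet> a) \<in> borel_measurable M" by measurable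
  show "AE \<omega> in M. norm (phase_coeff (u t \<omega>) k \<theta> \<bullet> a) \<le> norm ((sqrt ((2 * pi) ^ 3) * norm a) *\<^sub>R l2 torus (u t \<omega>))"
    using phase_coeff_inner_bound[OF u_L2_torus[OF t]] by (intro AE_I2) (simp add: abs_mult mult_ac)
qed

lemma sqint_mode_drift:
  assumes t: "0 \<le> t"
  shows "sqint M (\<lambda>\<omega>. mode_drift a k \<theta> (u t \<omega>))"
  unfolding mode_drift_def
proof (intro sqint_add)
  note [measurable] = u_measurable[OF t]
  show "sqint M (\<lambda>\<omega>. \<nu> * ((norm (frequency k))\<^sup>2 * (phase_coeff (u t \<omega>) k \<theta> \<bullet> a)))"
    using sqint_scaleR[OF sqint_mode[OF t], of "\<nu> * (norm (frequency k))\<^sup>2"] by (simp add: mult.assoc)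
  show "sqint M (\<lambda>\<omega>. mode_flux a k \<theta> (u t \<omega>))"
  proof (rule sqint_bound[OF sqint_scaleR[OF sqint_l2_squared[OF t]]])
    show "(\<lambda>\<omega>. mode_flux a k \<theta> (u t \<omega>)) \<in> borel_measurable M" by measurable
    show "AE \<omega> in M. norm (mode_flux a k \<theta> (u t \<omega>)) \<le> norm ((norm a * norm (frequency k)) *\<^sub>R (l2 torus (u t \<omega>))\<^sup>2)"
      using mode_flux_bound[OF u_L2_torus[OF t]] by (intro AE_I2) (simp add: abs_mult)
  qed
qed

sublocale mode: stationary_drift M "\<lambda>s \<omega>. mode_drift a k \<theta> (u s \<omega>)" "l2 M (\<lambda>\<omega>. mode_drift a k \<theta> (u 0 \<omega>))"
  for a k \<theta>
proof
  fix t :: real assume t: "0 \<le> t"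
  show "(\<lambda>(s, \<omega>). mode_drift a k \<theta> (u s \<omega>)) \<in> borel_measurable (time_upto t \<Otimes>\<^sub>M M)"
    using measurable_compose[OF u_joint[OF t] mode_drift_measurable] by (simp add: case_prod_beta')
  show "sqint M (\<lambda>\<omega>. mode_drift a k \<theta> (u t \<omega>))" by (rule sqint_mode_drift[OF t])
  show "l2 M (\<lambda>\<omega>. mode_drift a k \<theta> (u t \<omega>)) = l2 M (\<lambda>\<omega>. mode_drift a k \<theta> (u 0 \<omega>))"
    unfolding l2_def using integral_stationary[OF t, of "\<lambda>v. (norm (mode_drift a k \<theta> v))\<^sup>2"] by simp
qed

text \<open>Tested with a wave, both gradient terms become functionals defined on all of
  \<open>L2_div\<close>, because almost every path is in \<open>H1_div\<close> at almost every time.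
  The essential bound on the path makes the two time integrals finite separately, so that they can
  be combined into the drift.\<close>

lemma weak_mode:
  assumes t: "0 \<le> t" and a: "a \<bullet> frequency k = 0" and k: "k \<noteq> 0"
  shows "AE \<omega> in M. (\<lambda>j. ito_integral_const (\<sigma> j * (phase_coeff (e j) k \<theta> \<bullet> a)) (\<beta> j) t \<omega>) sums
    (phase_coeff (u t \<omega>) k \<theta> \<bullet> a + mode.drift a k \<theta> t \<omega> - phase_coeff (u 0 \<omega>) k \<theta> \<bullet> a)"
  using weak_formulation[OF t trig_wave_Cinf_div[OF a k], of \<theta>] AE_paths[OF t] AE_space
proof eventually_elim
  case (elim \<omega>)
  note \<omega> = elim(3)
  let ?T = "time_upto t" and ?v = "\<lambda>s. u s \<omega>"
  interpret finite_measure ?T by (rule finite_measure_time)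
  note [measurable] = u_path[OF t \<omega>]
  let ?f = "\<lambda>s. (norm (frequency k))\<^sup>2 * (phase_coeff (u s \<omega>) k \<theta> \<bullet> a)" and ?g = "\<lambda>s. mode_flux a k \<theta> (u s \<omega>)"
  define K where "K = enn2real (Linf_L2_norm t (\<lambda>t. u t \<omega>))"
  have bd: "AE s in ?T. u s \<omega> \<in> H1_div \<and> l2 torus (u s \<omega>) \<le> K \<and> s \<in> {0..t}"
    using elim(2) AE_space by eventually_elim (simp add: K_def space_time)
  have i: "integrable ?T ?f" "integrable ?T ?g"
  proof -
    show "integrable ?T ?f"
    proof (rule integrable_const_bound)
      show "AE s in ?T. norm (?f s) \<le> (norm (frequency k))\<^sup>2 * ((sqrt ((2 * pi) ^ 3) * K) * norm a)"
        using bd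
      proof eventually_elim
        case (elim s)
        have "\<bar>phase_coeff (u s \<omega>) k \<theta> \<bullet> a\<bar> \<le> (sqrt ((2 * pi) ^ 3) * l2 torus (u s \<omega>)) * norm a"
          using elim by (intro phase_coeff_inner_bound u_L2_torus \<omega>) auto
        also have "\<dots> \<le> (sqrt ((2 * pi) ^ 3) * K) * norm a" using elim by (intro mult_right_mono mult_left_mono) auto
        finally show ?case by (simp only: real_norm_def abs_mult) (simp add: mult_left_mono)
      qed
    qed measurable
    show "integrable ?T ?g"
    proof (rule integrable_const_bound)
      show "AE s in ?T. norm (?g s) \<le> norm a * norm (frequency k) * K\<^sup>2"
        using bd
      proof eventually_elim
        case (elim s)
        have "\<bar>?g s\<bar> \<le> norm a * norm (frequency k) * (l2 torus (u s \<omega>))\<^sup>2"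
          using elim by (intro mode_flux_bound u_L2_torus \<omega>) auto
        also have "\<dots> \<le> norm a * norm (frequency k) * K\<^sup>2" using elim by (intro mult_left_mono power_mono) auto
        finally show ?case by simp
      qed
    qed measurable
  qed
  have 1: "(LINT s:{0..t}|lborel. L2_inner (grad (?v s)) (\<lambda>x. jacobian (trig_wave a k \<theta>) (at x))) = (LINT s|?T. ?f s)"
  proof -
    have "(LINT s:{0..t}|lborel. L2_inner (grad (?v s)) (\<lambda>x. jacobian (trig_wave a k \<theta>) (at x)))
      = (LINT s|?T. (if ?v s \<in> H1_div then ?f s else 0))"
      by (simp add: L2_inner_grad_mode set_lebesgue_integral_def integral_restrict_space)
    also have "\<dots> = (LINT s|?T. ?f s)"
      by (rule Bochner_Integration.integral_cong_AE) (use bd in \<open>auto elim!: eventually_mono\<close>)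
    finally show ?thesis .
  qed
  have 2: "(LINT s:{0..t}|lborel. L2_inner (\<lambda>x. grad (?v s) x *v ?v s x) (trig_wave a k \<theta>)) = (LINT s|?T. ?g s)"
  proof -
    have "(LINT s:{0..t}|lborel. L2_inner (\<lambda>x. grad (?v s) x *v ?v s x) (trig_wave a k \<theta>))
      = (LINT s|?T. L2_inner (\<lambda>x. grad (?v s) x *v ?v s x) (trig_wave a k \<theta>))"
      by (simp add: set_lebesgue_integral_def integral_restrict_space)
    also have "\<dots> = (LINT s|?T. (if ?v s \<in> H1_div then ?g s else 0))"
      by (rule Bochner_Integration.integral_cong[OF refl], rule L2_inner_advection_mode)
        (use u_L2_div[OF _ \<omega>] in \<open>simp add: space_time\<close>)
    also have "\<dots> = (LINT s|?T. ?g s)"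
      by (rule Bochner_Integration.integral_cong_AE) (use bd in \<open>auto elim!: eventually_mono\<close>)
    finally show ?thesis .
  qed
  have c: "L2_inner (\<lambda>x. \<sigma> j *\<^sub>R e j x) (trig_wave a k \<theta>) = \<sigma> j * (phase_coeff (e j) k \<theta> \<bullet> a)" for j
    using L2_torusD(2)[OF e_L2_torus, of j] by (subst L2_inner_eq) (simp_all add: phase_coeff_inner[OF e_L2_torus])
  have X: "L2_inner (u s \<omega>) (trig_wave a k \<theta>) = phase_coeff (u s \<omega>) k \<theta> \<bullet> a" if "0 \<le> s" for s
    using u_L2_torus[OF that \<omega>] by (simp add: phase_coeff_inner L2_inner_eq L2_torusD(2))
  have "mode.drift a k \<theta> t \<omega> = \<nu> * (LINT s|?T. ?f s) + (LINT s|?T. ?g s)"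
    using i unfolding mode.drift_def by (simp add: mode_drift_def)
  then show ?case using elim(1) unfolding 1 2 c by (simp add: X[OF t] X[OF order_refl] add.assoc)
qed

lemma mode_balance:
  assumes a: "a \<bullet> frequency k = 0" and k: "k \<noteq> 0" and t: "0 \<le> t"
  shows "2 * (LINT \<omega>|M. (phase_coeff (u t \<omega>) k \<theta> \<bullet> a) * mode_drift a k \<theta> (u t \<omega>))
    = (\<Sum>j. (\<sigma> j)\<^sup>2 * (phase_coeff (e j) k \<theta> \<bullet> a)\<^sup>2)"
proof -
  define X where "X s \<omega> = phase_coeff (u s \<omega>) k \<theta> \<bullet> a" for s \<omega>
  \<comment> \<open>By \<open>weak_mode\<close> this residual is the sum of the noise series, so
    \<open>noise_moments\<close> applies to it.\<close>
  define N where "N s \<omega> = X s \<omega> + mode.drift a k \<theta> s \<omega> - X 0 \<omega>" for s \<omega>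
  let ?Q = "\<Sum>j. (\<sigma> j * (phase_coeff (e j) k \<theta> \<bullet> a))\<^sup>2"
  have sX: "sqint M (X s)" if "0 \<le> s" for s unfolding X_def[abs_def] by (rule sqint_mode[OF that])
  have Xb: "(LINT \<omega>|M. X s \<omega> * mode_drift a k \<theta> (u s \<omega>)) = (LINT \<omega>|M. X 0 \<omega> * mode_drift a k \<theta> (u 0 \<omega>))" if "0 \<le> s" for s
    unfolding X_def using integral_stationary[OF that, of "\<lambda>v. (phase_coeff v k \<theta> \<bullet> a) * mode_drift a k \<theta> v"] by simp
  have Xl: "l2 M (X s) = l2 M (X 0)" if "0 \<le> s" for s
    unfolding l2_def X_def using integral_stationary[OF that, of "\<lambda>v. (norm (phase_coeff v k \<theta> \<bullet> a))\<^sup>2"] by simp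
  have X0: "X 0 \<in> borel_measurable (F 0)"
    unfolding X_def[abs_def] by (rule measurable_compose[OF u_adapted[OF order_refl] phase_coeff_L2_div_measurable])
  have sum: "summable (\<lambda>j. (\<sigma> j * (phase_coeff (e j) k \<theta> \<bullet> a))\<^sup>2)"
    using summable_mode_input by (simp add: power_mult_distrib)
  have Nm: "N s \<in> borel_measurable M" if "0 \<le> s" for s
    unfolding N_def[abs_def]
    using sqint_measurable[OF sX[OF that]] sqint_measurable[OF sX[OF order_refl]] mode.drift_measurable[OF that] by measurable
  note noise = noise_moments[OF _ sum X0 sX[OF order_refl] Nm weak_mode[OF _ a k, of _ \<theta>, folded X_def, folded N_def]]
  have "2 * (LINT \<omega>|M. X 0 \<omega> * mode_drift a k \<theta> (u 0 \<omega>)) = ?Q"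
  proof (rule mode.stationary_balance)
    fix s :: real assume s: "0 \<le> s"
    show "sqint M (X s)" "l2 M (X s) = l2 M (X 0)"
      "(LINT \<omega>|M. X s \<omega> * mode_drift a k \<theta> (u s \<omega>)) = (LINT \<omega>|M. X 0 \<omega> * mode_drift a k \<theta> (u 0 \<omega>))"
      "sqint M (N s)" "l2 M (N s) = sqrt (s * ?Q)" "(LINT \<omega>|M. X 0 \<omega> * N s \<omega>) = 0"
      by (fact sX[OF s] Xl[OF s] Xb[OF s] noise[OF s s s])+
    show "AE \<omega> in M. N s \<omega> = X s \<omega> + mode.drift a k \<theta> s \<omega> - X 0 \<omega>" by (simp add: N_def)
  qed (rule suminf_nonneg[OF sum], simp)
  then show ?thesis using Xb[OF t] by (simp add: X_def power_mult_distrib)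
qed

end

section \<open>The averaged energy balance\<close>

context forcing
begin

text \<open>Dominated convergence for series: the forms are bounded uniformly in mode and degree
  because the modes have norm one, and the squared coefficients are summable.\<close>

lemma suminf_ball_form_proj_tendsto:
  assumes "ball_weight R \<kappa> K"
  shows "(\<lambda>n. \<Sum>j. (\<sigma> j)\<^sup>2 * ball_form R \<kappa> (e j) (trig_proj n (e j))) \<longlonglongrightarrow> (\<Sum>j. (\<sigma> j)\<^sup>2 * ball_form R \<kappa> (e j) (e j))"
proof -
  interpret ball_weight R \<kappa> K by fact
  let ?B = "sqrt (measure torus UNIV) * C"
  have b: "\<bar>ball_form R \<kappa> (e j) (trig_proj n (e j))\<bar> \<le> ?B" for n j
    using ball_form_bound[OF e_L2_torus, of j n] by (simp add: l2_e)
  have s: "summable (\<lambda>j. (\<sigma> j)\<^sup>2 * ?B)" by (intro summable_mult2 summable_coeffs)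
  have lim: "(\<lambda>n. (\<sigma> j)\<^sup>2 * ball_form R \<kappa> (e j) (trig_proj n (e j))) \<longlonglongrightarrow> (\<sigma> j)\<^sup>2 * ball_form R \<kappa> (e j) (e j)" for j
    by (intro tendsto_intros ball_form_tendsto_proj e_L2_torus trig_proj_tendsto e_L2_div)
  have ev: "\<forall>\<^sub>F (j, n) in at_top \<times>\<^sub>F sequentially. norm ((\<sigma> j)\<^sup>2 * ball_form R \<kappa> (e j) (trig_proj n (e j))) \<le> (\<sigma> j)\<^sup>2 * ?B"
    using b by (intro always_eventually) (simp add: abs_mult mult_left_mono)
  show ?thesis
    using tannerys_theorem[of "\<lambda>j n. (\<sigma> j)\<^sup>2 * ball_form R \<kappa> (e j) (trig_proj n (e j))", OF lim ev s] by simp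
qed

end

context stationary_energy_solution
begin

text \<open>The balances of single modes are added with the multipliers of the ball average, and the
  truncation is removed. Domination under the expectation rests on the fourth moment and the energy
  inequality: the transfer is bounded by a multiple of \<open>|u|\<^sup>2 |grad u|\<close>, the
  viscous form by a multiple of \<open>|grad u|\<^sup>2\<close>, in \<open>L\<^sup>2\<close>
  norms.\<close>

lemma
  assumes w: "ball_weight R \<kappa> K" and t: "0 \<le> t"
  shows transfer_measurable: "(\<lambda>\<omega>. transfer_form R \<kappa> (grad (u t \<omega>)) (u t \<omega>) (u t \<omega>)) \<in> borel_measurable M"
    and viscous_measurable: "(\<lambda>\<omega>. ball_form R \<kappa> (grad (u t \<omega>)) (grad (u t \<omega>))) \<in> borel_measurable M"
    and energy_balance: "2 * ((LINT \<omega>|M. transfer_form R \<kappa> (grad (u t \<omega>)) (u t \<omega>) (u t \<omega>))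
      + \<nu> * (LINT \<omega>|M. ball_form R \<kappa> (grad (u t \<omega>)) (grad (u t \<omega>))))
      = (\<Sum>j. (\<sigma> j)\<^sup>2 * ball_form R \<kappa> (e j) (e j))"
proof -
  interpret ball_weight R \<kappa> K by fact
  note [measurable] = u_measurable[OF t]
  let ?w = "\<lambda>k. weight_coeff k / (2 * pi) ^ 3" and ?B = "sqrt (measure torus UNIV) * C"
  let ?a = "mode_amp"
  let ?tr = "\<lambda>\<omega>. transfer_form R \<kappa> (grad (u t \<omega>)) (u t \<omega>) (u t \<omega>)"
    and ?vi = "\<lambda>\<omega>. ball_form R \<kappa> (grad (u t \<omega>)) (grad (u t \<omega>))"
  define T where "T n v = (\<Sum>k\<in>modes n. \<Sum>\<theta>\<in>phases. \<Sum>i\<in>UNIV.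
    ?w k * ((phase_coeff v k \<theta> \<bullet> ?a k i) * mode_flux (?a k i) k \<theta> v))" for n v
  define V where "V n v = (\<Sum>k\<in>modes n. \<Sum>\<theta>\<in>phases. \<Sum>i\<in>UNIV.
    ?w k * ((norm (frequency k))\<^sup>2 * (phase_coeff v k \<theta> \<bullet> ?a k i)\<^sup>2))" for n v
  have [measurable]: "T n \<in> borel_measurable L2_div_borel" "V n \<in> borel_measurable L2_div_borel" for n
    unfolding T_def[abs_def] V_def[abs_def] by measurable
  have H: "\<bar>T n v\<bar> \<le> C * ((l2 torus v)\<^sup>2 * l2 torus (grad v)) \<and> \<bar>V n v\<bar> \<le> ?B * (l2 torus (grad v))\<^sup>2
     \<and> (\<lambda>n. T n v) \<longlonglongrightarrow> transfer_form R \<kappa> (grad v) v v \<and> (\<lambda>n. V n v) \<longlonglongrightarrow> ball_form R \<kappa> (grad v) (grad v)"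
    if v: "v \<in> H1_div" for v n
  proof -
    obtain \<phi> where "H1_approx v (grad v) \<phi> (\<lambda>n x. jacobian (\<phi> n) (at x))" and v': "v \<in> L2_div"
      using v by (rule H1_div_approx)
    then interpret a: H1_approx v "grad v" \<phi> "\<lambda>n x. jacobian (\<phi> n) (at x)" by simp
    have "T n v = transfer_form R \<kappa> (grad v) v (trig_proj n v)" "V n v = ball_form R \<kappa> (grad v) (trig_proj n (grad v))" for n
      unfolding T_def V_def by (simp_all only: a.transfer_form_modes[OF w v'] a.viscous_form_modes[OF w v'])
    then show ?thesis
      using a.transfer_form_proj_bound[OF w] ball_form_bound[OF a.G] a.transfer_form_tendsto_proj[OF w v']
        ball_form_tendsto_proj[OF a.G a.trig_proj_G_tendsto] by simp
  qed
  note ae = AE_H1_div[OF t]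
  have limT: "AE \<omega> in M. (\<lambda>n. T n (u t \<omega>)) \<longlonglongrightarrow> ?tr \<omega>" and limV: "AE \<omega> in M. (\<lambda>n. V n (u t \<omega>)) \<longlonglongrightarrow> ?vi \<omega>"
    using ae by (eventually_elim, use H in blast)+
  show mT: "?tr \<in> borel_measurable M"
    by (rule borel_measurable_AE_limit[OF _ limT]) measurable
  show mV: "?vi \<in> borel_measurable M"
    by (rule borel_measurable_AE_limit[OF _ limV]) measurable
  have iT: "integrable M (\<lambda>\<omega>. C * ((l2 torus (u t \<omega>))\<^sup>2 * l2 torus (grad (u t \<omega>))))"
    using integrable_inner[OF sqint_l2_squared[OF t] sqint_l2_grad[OF t]] by simp
  have iV: "integrable M (\<lambda>\<omega>. ?B * (l2 torus (grad (u t \<omega>)))\<^sup>2)"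
    using sqint_l2_grad[OF t] by (simp add: sqint_def)
  have bT: "AE \<omega> in M. norm (T n (u t \<omega>)) \<le> C * ((l2 torus (u t \<omega>))\<^sup>2 * l2 torus (grad (u t \<omega>)))"
    and bV: "AE \<omega> in M. norm (V n (u t \<omega>)) \<le> ?B * (l2 torus (grad (u t \<omega>)))\<^sup>2" for n
    using ae by (eventually_elim, use H in simp)+
  have mTn: "(\<lambda>\<omega>. T n (u t \<omega>)) \<in> borel_measurable M" "(\<lambda>\<omega>. V n (u t \<omega>)) \<in> borel_measurable M" for n by measurable
  note T_lim = integral_dominated_convergence[OF mT mTn(1) iT limT bT]
    and V_lim = integral_dominated_convergence[OF mV mTn(2) iV limV bV]
    and T_int = integrable_dominated_convergence2[OF mT mTn(1) iT limT bT]
    and V_int = integrable_dominated_convergence2[OF mV mTn(2) iV limV bV]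
  have balance: "2 * ((LINT \<omega>|M. T n (u t \<omega>)) + \<nu> * (LINT \<omega>|M. V n (u t \<omega>)))
    = (\<Sum>j. (\<sigma> j)\<^sup>2 * ball_form R \<kappa> (e j) (trig_proj n (e j)))" for n
  proof -
    let ?X = "\<lambda>k \<theta> i v. phase_coeff v k \<theta> \<bullet> ?a k i"
    let ?Y = "\<lambda>k \<theta> i \<omega>. ?X k \<theta> i (u t \<omega>) * mode_drift (?a k i) k \<theta> (u t \<omega>)"
    have i: "integrable M (?Y k \<theta> i)" for k \<theta> i
      using integrable_inner[OF sqint_mode[OF t] sqint_mode_drift[OF t]] by simp
    have s: "summable (\<lambda>j. (\<sigma> j)\<^sup>2 * (?X k \<theta> i (e j))\<^sup>2)" for k \<theta> i by (rule summable_mode_input)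
    have one: "2 * (LINT \<omega>|M. ?Y k \<theta> i \<omega>) = (\<Sum>j. (\<sigma> j)\<^sup>2 * (?X k \<theta> i (e j))\<^sup>2)" for k \<theta> i
    \<comment> \<open>The waves of frequency zero are not admissible test fields, but fields in
      \<open>L2_div\<close> have no such coefficient, so both sides vanish.\<close>
    proof (cases "k = 0")
      case True
      have "(LINT \<omega>|M. ?Y k \<theta> i \<omega>) = (LINT \<omega>|M. 0)"
        by (rule Bochner_Integration.integral_cong[OF refl]) (simp add: True L2_div_phase_coeff(2) u_L2_div[OF t])
      then show ?thesis by (simp add: True L2_div_phase_coeff(2)[OF e_L2_div])
    qed (rule mode_balance[OF mode_amp_orthogonal _ t])
    have "(LINT \<omega>|M. T n (u t \<omega>)) + \<nu> * (LINT \<omega>|M. V n (u t \<omega>)) = (LINT \<omega>|M. T n (u t \<omega>) + \<nu> * V n (u t \<omega>))"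
      using T_int V_int by simp
    also have "\<dots> = (LINT \<omega>|M. (\<Sum>k\<in>modes n. \<Sum>\<theta>\<in>phases. \<Sum>i\<in>UNIV. ?w k * ?Y k \<theta> i \<omega>))"
      unfolding T_def V_def mode_drift_def sum_distrib_left sum.distrib[symmetric]
      by (intro Bochner_Integration.integral_cong sum.cong refl) (simp only: power2_eq_square distrib_left mult_ac add_ac)
    also have "\<dots> = (\<Sum>k\<in>modes n. \<Sum>\<theta>\<in>phases. \<Sum>i\<in>UNIV. ?w k * (LINT \<omega>|M. ?Y k \<theta> i \<omega>))"
      by (simp only: Bochner_Integration.integral_sum Bochner_Integration.integrable_sum integrable_mult_right i integral_mult_right_zero)
    finally have "2 * ((LINT \<omega>|M. T n (u t \<omega>)) + \<nu> * (LINT \<omega>|M. V n (u t \<omega>)))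
      = (\<Sum>k\<in>modes n. \<Sum>\<theta>\<in>phases. \<Sum>i\<in>UNIV. ?w k * (2 * (LINT \<omega>|M. ?Y k \<theta> i \<omega>)))"
      by (simp only: sum_distrib_left mult.left_commute)
    also have "\<dots> = (\<Sum>k\<in>modes n. \<Sum>\<theta>\<in>phases. \<Sum>i\<in>UNIV. \<Sum>j. ?w k * ((\<sigma> j)\<^sup>2 * (?X k \<theta> i (e j))\<^sup>2))"
      by (simp only: one suminf_mult[OF s])
    also have "\<dots> = (\<Sum>j. \<Sum>k\<in>modes n. \<Sum>\<theta>\<in>phases. \<Sum>i\<in>UNIV. ?w k * ((\<sigma> j)\<^sup>2 * (?X k \<theta> i (e j))\<^sup>2))"
      by (simp only: suminf_sum summable_sum summable_mult s)
    also have "\<dots> = (\<Sum>j. (\<sigma> j)\<^sup>2 * ball_form R \<kappa> (e j) (trig_proj n (e j)))"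
      by (simp only: ball_form_trig_proj_self[OF e_L2_div] sum_distrib_left mult.left_commute)
    finally show ?thesis .
  qed
  have "(\<lambda>n. 2 * ((LINT \<omega>|M. T n (u t \<omega>)) + \<nu> * (LINT \<omega>|M. V n (u t \<omega>))))
    \<longlonglongrightarrow> 2 * ((LINT \<omega>|M. ?tr \<omega>) + \<nu> * (LINT \<omega>|M. ?vi \<omega>))"
    by (intro tendsto_intros T_lim V_lim)
  then show "2 * ((LINT \<omega>|M. ?tr \<omega>) + \<nu> * (LINT \<omega>|M. ?vi \<omega>)) = (\<Sum>j. (\<sigma> j)\<^sup>2 * ball_form R \<kappa> (e j) (e j))"
    unfolding balance using LIMSEQ_unique suminf_ball_form_proj_tendsto[OF w] by blast
qed

end

section \<open>Small separations\<close>

definition correlation :: "(real^3 \<Rightarrow> real^3) \<Rightarrow> real^3 \<Rightarrow> real" where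
  "correlation f h = (LINT x|torus. f x \<bullet> f (x + h))"

lemma correlation_0: "correlation f 0 = (l2 torus f)\<^sup>2"
  by (simp add: correlation_def l2_squared power2_norm_eq_inner)

lemma correlation_bound: "f \<in> L2_torus \<Longrightarrow> \<bar>correlation f h\<bar> \<le> (l2 torus f)\<^sup>2"
  using integral_inner_le[OF L2_torusD(3) sqint_torus_shift, of f f h] l2_torus_shift[of f h]
  by (simp add: correlation_def power2_eq_square)

text \<open>Correlating \<open>f\<close> with its truncation gives a finite trigonometric sum in
  \<open>h\<close>, hence a continuous function; the truncation error is uniform in \<open>h\<close>
  by translation invariance.\<close>

lemma correlation_continuous_at_0:
  assumes f': "f \<in> L2_div"
  shows "(correlation f \<longlongrightarrow> (l2 torus f)\<^sup>2) (at 0)"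
proof (rule tendstoI)
  fix \<epsilon> :: real assume \<epsilon>: "0 < \<epsilon>"
  note f = L2_div_L2_torus[OF f']
  define P where "P n h = (LINT x|torus. f x \<bullet> trig_proj n f (x + h))" for n h
  have shift: "trig_wave a k \<theta> (x + h) = trig_wave a k (\<theta> - frequency k \<bullet> h) x" for a :: "real^3" and k \<theta> x h
    by (simp add: trig_wave_def inner_add_right algebra_simps)
  have P_eq: "P n h = (1 / (2 * pi) ^ 3) * (\<Sum>k\<in>modes n. phase_coeff f k (0 - frequency k \<bullet> h) \<bullet> phase_coeff f k 0
      + phase_coeff f k (pi / 2 - frequency k \<bullet> h) \<bullet> phase_coeff f k (pi / 2))" for n h
  proof -
    have i: "integrable torus (\<lambda>x. f x \<bullet> trig_wave a k \<theta> x)" for a k \<theta>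
      by (intro integrable_inner L2_torusD(3) f trig_wave_L2)
    show ?thesis
      unfolding P_def trig_proj_def shift inner_scaleR_right inner_sum_right inner_add_right
      by (simp only: integral_mult_right_zero Bochner_Integration.integral_sum Bochner_Integration.integrable_add
          Bochner_Integration.integral_add i phase_coeff_inner[OF f, symmetric])
  qed
  have P_cont: "(P n \<longlongrightarrow> P n 0) (at 0)" for n
  proof -
    have "continuous_on UNIV (P n)"
      unfolding P_eq[abs_def] by (subst (1 3) phase_coeff_shift[OF f]) (intro continuous_intros)
    then show ?thesis by (simp add: continuous_on_eq_continuous_at isCont_def)
  qed
  have near: "\<bar>correlation f h - P n h\<bar> \<le> l2 torus f * l2 torus (\<lambda>x. f x - trig_proj n f x)" for n h
  proof -
    note d = L2_torus_diff[OF f trig_proj_L2[of n f]]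
    have "correlation f h - P n h = (LINT x|torus. f x \<bullet> (f (x + h) - trig_proj n f (x + h)))"
      unfolding correlation_def P_def inner_diff_right
      by (rule Bochner_Integration.integral_diff[symmetric])
        (intro integrable_inner sqint_torus_shift L2_torusD(3) f trig_proj_L2)+
    also have "\<bar>\<dots>\<bar> \<le> l2 torus f * l2 torus (\<lambda>x. f (x + h) - trig_proj n f (x + h))"
      using integral_inner_le[OF L2_torusD(3)[OF f] sqint_torus_shift[OF d]] by simp
    finally show ?thesis using l2_torus_shift[OF d, of h] by simp
  qed
  have "(\<lambda>n. l2 torus f * l2 torus (\<lambda>x. f x - trig_proj n f x)) \<longlonglongrightarrow> l2 torus f * 0"
    by (intro tendsto_intros trig_proj_tendsto f')
  then have "\<forall>\<^sub>F n in sequentially. l2 torus f * l2 torus (\<lambda>x. f x - trig_proj n f x) < \<epsilon> / 3"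
    using \<epsilon> by (intro order_tendstoD) auto
  then obtain n where n: "l2 torus f * l2 torus (\<lambda>x. f x - trig_proj n f x) < \<epsilon> / 3"
    by (auto simp: eventually_sequentially)
  have "\<forall>\<^sub>F h in at 0. dist (P n h) (P n 0) < \<epsilon> / 3" using \<epsilon> by (intro tendstoD[OF P_cont]) simp
  then show "\<forall>\<^sub>F h in at 0. dist (correlation f h) ((l2 torus f)\<^sup>2) < \<epsilon>"
  proof eventually_elim
    case (elim h)
    then show ?case
      using near[of h n] near[of 0 n] n unfolding dist_real_def correlation_0[symmetric] by linarith
  qed
qed

context ball_weight
begin

definition total :: real where
  "total = (LINT h|leb_on (cball 0 R). \<kappa> h)"

text \<open>Fubini. It reduces the behaviour of the form for small radii to the continuity of the
  correlation at zero.\<close>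

lemma ball_form_correlation:
  assumes f: "f \<in> L2_torus"
  shows "ball_form R \<kappa> f f = (LINT h|leb_on (cball 0 R). \<kappa> h * correlation f h)"
    and "integrable (leb_on (cball 0 R)) (\<lambda>h. \<kappa> h * correlation f h)"
proof -
  let ?B = "leb_on (cball 0 R) :: (real^3) measure"
  interpret pair_sigma_finite torus ?B ..
  note [measurable] = L2_torusD(2)[OF f]
  note s = L2_torusD(3)[OF f]
  let ?m = "measure ?B UNIV"
  have "(\<integral>\<^sup>+p. (ennreal (norm (f (fst p))))\<^sup>2 \<partial>(torus \<Otimes>\<^sub>M ?B)) = (\<integral>\<^sup>+h. \<integral>\<^sup>+x. (ennreal (norm (f x)))\<^sup>2 \<partial>torus \<partial>?B)"
    by (subst nn_integral_snd[symmetric]) auto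
  also have "\<dots> = ennreal ((sqrt ?m * l2 torus f)\<^sup>2)"
    by (simp add: nn_integral_eq_l2[OF s] ball.emeasure_eq_measure ennreal_mult' power_mult_distrib mult.commute)
  finally have 1: "sqint (torus \<Otimes>\<^sub>M ?B) (\<lambda>p. f (fst p))"
    by (intro sqintI_nn(1)[of _ _ "sqrt ?m * l2 torus f"]) auto
  have "(\<integral>\<^sup>+p. (ennreal (norm (\<kappa> (snd p) *\<^sub>R f (fst p + snd p))))\<^sup>2 \<partial>(torus \<Otimes>\<^sub>M ?B))
    = (\<integral>\<^sup>+h. \<integral>\<^sup>+x. (ennreal \<bar>\<kappa> h\<bar>)\<^sup>2 * (ennreal (norm (f (x + h))))\<^sup>2 \<partial>torus \<partial>?B)"
    by (subst nn_integral_snd[symmetric]) (auto simp: ennreal_mult power_mult_distrib)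
  also have "\<dots> = (\<integral>\<^sup>+h. (ennreal \<bar>\<kappa> h\<bar>)\<^sup>2 * ennreal ((l2 torus f)\<^sup>2) \<partial>?B)"
    by (intro nn_integral_cong, subst nn_integral_cmult)
      (simp_all add: nn_integral_eq_l2[OF sqint_torus_shift[OF f]] l2_torus_shift[OF f])
  also have "\<dots> \<le> (\<integral>\<^sup>+h. ennreal (K\<^sup>2) * ennreal ((l2 torus f)\<^sup>2) \<partial>?B)"
  proof (rule nn_integral_mono_AE)
    have "(ennreal \<bar>\<kappa> h\<bar>)\<^sup>2 \<le> ennreal (K\<^sup>2)" if "norm h \<le> R" for h
      using power_mono[OF bound[OF that] abs_ge_zero, of 2] by (simp add: ennreal_power ennreal_leI)
    then show "AE h in ?B. (ennreal \<bar>\<kappa> h\<bar>)\<^sup>2 * ennreal ((l2 torus f)\<^sup>2) \<le> ennreal (K\<^sup>2) * ennreal ((l2 torus f)\<^sup>2)"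
      by (auto simp: AE_leb_on intro!: AE_I2 mult_right_mono)
  qed
  also have "\<dots> = ennreal ((sqrt ?m * (K * l2 torus f))\<^sup>2)"
    by (simp add: ball.emeasure_eq_measure ennreal_mult'[symmetric] power_mult_distrib mult_ac)
  finally have 2: "sqint (torus \<Otimes>\<^sub>M ?B) (\<lambda>p. \<kappa> (snd p) *\<^sub>R f (fst p + snd p))"
    using K_nonneg by (intro sqintI_nn(1)[of _ _ "sqrt ?m * (K * l2 torus f)"]) auto
  have i: "integrable (torus \<Otimes>\<^sub>M ?B) (\<lambda>(x, h). \<kappa> h * (f x \<bullet> f (x + h)))"
    using integrable_inner[OF 1 2] by (simp add: case_prod_beta')
  show "ball_form R \<kappa> f f = (LINT h|?B. \<kappa> h * correlation f h)"
    unfolding ball_form_def integral_inner_ball_conv[OF f] Fubini_integral[OF i, symmetric] correlation_def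
    by simp
  show "integrable ?B (\<lambda>h. \<kappa> h * correlation f h)"
    using integrable_snd[OF i] by (simp add: correlation_def)
qed

lemma ball_form_near:
  assumes f: "f \<in> L2_torus" and pos: "\<And>h. norm h \<le> R \<Longrightarrow> 0 \<le> \<kappa> h"
    and near: "\<And>h. norm h \<le> R \<Longrightarrow> \<bar>correlation f h - c\<bar> \<le> \<delta>"
  shows "\<bar>ball_form R \<kappa> f f - c * total\<bar> \<le> \<delta> * total"
proof -
  let ?B = "leb_on (cball 0 R) :: (real^3) measure"
  have i: "integrable ?B \<kappa>" by (rule integrable_leb_on_continuous[OF compact_cball \<kappa>])
  note c = ball_form_correlation[OF f]
  have "ball_form R \<kappa> f f - c * total = (LINT h|?B. \<kappa> h * correlation f h - c * \<kappa> h)"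
    using i c(2) by (simp add: c(1) total_def)
  also have "\<bar>\<dots>\<bar> \<le> (LINT h|?B. \<delta> * \<kappa> h)"
  proof (rule integral_abs_le_AE)
    have "\<bar>\<kappa> h * correlation f h - c * \<kappa> h\<bar> \<le> \<delta> * \<kappa> h" if "norm h \<le> R" for h
    proof -
      have "\<bar>\<kappa> h * correlation f h - c * \<kappa> h\<bar> = \<kappa> h * \<bar>correlation f h - c\<bar>"
        using pos[OF that] by (simp add: abs_mult right_diff_distrib[symmetric] mult.commute[of c])
      then show ?thesis using mult_left_mono[OF near[OF that] pos[OF that]] by (simp add: mult.commute)
    qed
    then show "AE h in ?B. \<bar>\<kappa> h * correlation f h - c * \<kappa> h\<bar> \<le> \<delta> * \<kappa> h"
      by (auto simp: AE_leb_on intro!: AE_I2)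
  qed (use i c(2) in auto)
  finally show ?thesis by (simp add: total_def)
qed

end

section \<open>Total weights and the limit of the energy input\<close>

lemma sphere_area: "measure sphere_measure UNIV = 4 * pi"
proof -
  have "emeasure sphere_measure UNIV = (\<integral>\<^sup>+n. 1 \<partial>sphere_measure)" by simp
  also have "\<dots> = 3 * emeasure lborel (cball 0 1 - {0} :: (real^3) set)"
    by (subst nn_integral_sphere) simp_all
  also have "emeasure lborel (cball 0 1 - {0} :: (real^3) set) = emeasure lborel (cball 0 1 :: (real^3) set)"
    by (rule emeasure_Diff_null_set) auto
  also have "\<dots> = ennreal (4 / 3 * pi)"
    using emeasure_cball[of 1 "0 :: real^3"] by (simp add: unit_ball_vol_3)
  also have "3 * ennreal (4 / 3 * pi) = ennreal (4 * pi)"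
    using ennreal_mult'[of "4 / 3 * pi" 3] by (simp add: mult.commute)
  finally show ?thesis by (simp add: measure_def)
qed

lemma total_one:
  assumes R: "0 < R" "R \<le> 1"
  shows "ball_weight.total R (\<lambda>h. 1) = 4 / 3 * pi * R ^ 3"
proof -
  have "((\<lambda>r. r\<^sup>2) has_integral (R ^ 3 / 3 - 0 ^ 3 / 3)) {0..R}"
    using R by (intro fundamental_theorem_of_calculus)
      (auto intro!: derivative_eq_intros simp flip: has_real_derivative_iff_has_vector_derivative)
  then show ?thesis
    unfolding ball_weight.total_def[OF ball_weight_one[OF R]]
    using R by (subst ball_integral_eq) (simp_all add: sphere_area integral_unique)
qed

text \<open>In polar coordinates \<open>4 * pi\<close> times the difference of
  \<open>R ^ 5 / 3\<close> and \<open>R ^ 5 / 5\<close>.\<close>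

lemma total_moment:
  assumes R: "0 < R" "R \<le> 1"
  shows "ball_weight.total R (\<lambda>h. R\<^sup>2 - (norm h)\<^sup>2) = 8 / 15 * pi * R ^ 5"
proof -
  let ?g = "\<lambda>r. r\<^sup>2 * ((R\<^sup>2 - r\<^sup>2) * (4 * pi))" and ?G = "\<lambda>r. (R\<^sup>2 * r ^ 3 / 3 - r ^ 5 / 5) * (4 * pi)"
  have "(?g has_integral (?G R - ?G 0)) {0..R}"
    using R by (intro fundamental_theorem_of_calculus)
      (auto intro!: derivative_eq_intros simp: algebra_simps power2_eq_square power4_eq_xxxx simp flip: has_real_derivative_iff_has_vector_derivative)
  then have 1: "integral {0..R} ?g = 8 / 15 * pi * R ^ 5"
    by (simp add: integral_unique algebra_simps eval_nat_numeral)
  have 2: "(LINT n|sphere_measure. R\<^sup>2 - (norm (r *\<^sub>R n))\<^sup>2) = (R\<^sup>2 - r\<^sup>2) * (4 * pi)" for r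
  proof -
    have "(LINT n|sphere_measure. R\<^sup>2 - (norm (r *\<^sub>R n))\<^sup>2) = (LINT n|sphere_measure. R\<^sup>2 - r\<^sup>2)"
    proof (rule Bochner_Integration.integral_cong_AE)
      show "AE n in sphere_measure. R\<^sup>2 - (norm (r *\<^sub>R n))\<^sup>2 = R\<^sup>2 - r\<^sup>2"
        using AE_sphere_norm by eventually_elim (simp add: power_mult_distrib)
    qed simp_all
    then show ?thesis by (simp add: sphere_area)
  qed
  show ?thesis
    unfolding ball_weight.total_def[OF ball_weight_moment[OF R]]
    using R by (subst ball_integral_eq, intro continuous_intros, simp, simp only: 2 1)
qed

text \<open>The correlation of each mode tends to its value one at zero, and so does its average
  against a nonnegative weight. These averages are bounded by one, so Tannery's theorem takes the
  limit inside the sum.\<close>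

lemma (in forcing) energy_input_limit:
  fixes \<kappa> :: "real \<Rightarrow> real^3 \<Rightarrow> real"
  assumes w: "\<And>l. 0 < l \<Longrightarrow> l \<le> 1 \<Longrightarrow> ball_weight l (\<kappa> l) (K l)"
    and pos: "\<And>l h. 0 < l \<Longrightarrow> l \<le> 1 \<Longrightarrow> norm h \<le> l \<Longrightarrow> 0 \<le> \<kappa> l h"
    and total: "\<And>l. 0 < l \<Longrightarrow> l \<le> 1 \<Longrightarrow> 0 < ball_weight.total l (\<kappa> l)"
  shows "((\<lambda>l. (\<Sum>j. (\<sigma> j)\<^sup>2 * ball_form l (\<kappa> l) (e j) (e j)) / ball_weight.total l (\<kappa> l)) \<longlongrightarrow> (\<Sum>j. (\<sigma> j)\<^sup>2)) (at_right 0)"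
proof -
  let ?Z = "\<lambda>l. ball_weight.total l (\<kappa> l)"
  have small: "\<forall>\<^sub>F l in at_right (0::real). 0 < l \<and> l < \<eta>" if "0 < \<eta>" for \<eta>
    using eventually_at_right_real[OF that] by simp
  have b: "\<bar>ball_form l (\<kappa> l) (e j) (e j) / ?Z l\<bar> \<le> 1" if l: "0 < l" "l \<le> 1" for l j
  proof -
    interpret ball_weight l "\<kappa> l" "K l" by (rule w[OF l])
    show ?thesis
      using ball_form_near[OF e_L2_torus[of j] pos[OF l], of 0 1] correlation_bound[OF e_L2_torus[of j]] total[OF l]
      by (simp add: l2_e)
  qed
  have lim: "((\<lambda>l. (\<sigma> j)\<^sup>2 * (ball_form l (\<kappa> l) (e j) (e j) / ?Z l)) \<longlongrightarrow> (\<sigma> j)\<^sup>2 * 1) (at_right 0)" for j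
  proof (intro tendsto_intros tendstoI)
    fix \<epsilon> :: real assume \<epsilon>: "0 < \<epsilon>"
    have "\<forall>\<^sub>F h in at 0. dist (correlation (e j) h) ((l2 torus (e j))\<^sup>2) < \<epsilon> / 2"
      using \<epsilon> by (intro tendstoD[OF correlation_continuous_at_0[OF e_L2_div]]) simp
    then obtain \<eta> where \<eta>: "0 < \<eta>" "\<And>h. h \<noteq> 0 \<Longrightarrow> norm h < \<eta> \<Longrightarrow> \<bar>correlation (e j) h - 1\<bar> < \<epsilon> / 2"
      unfolding eventually_at by (auto simp: l2_e dist_real_def)
    have near: "\<bar>correlation (e j) h - 1\<bar> \<le> \<epsilon> / 2" if "norm h < \<eta>" for h
      using \<eta>(2)[of h] that \<epsilon> by (cases "h = 0") (auto simp: correlation_0 l2_e intro: less_imp_le)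
    have "\<forall>\<^sub>F l in at_right (0::real). 0 < l \<and> l < min 1 \<eta>" using \<eta>(1) by (intro small) simp
    then show "\<forall>\<^sub>F l in at_right 0. dist (ball_form l (\<kappa> l) (e j) (e j) / ?Z l) 1 < \<epsilon>"
    proof eventually_elim
      case (elim l)
      then have l: "0 < l" "l \<le> 1" by auto
      interpret ball_weight l "\<kappa> l" "K l" by (rule w[OF l])
      have "\<bar>ball_form l (\<kappa> l) (e j) (e j) - 1 * ?Z l\<bar> \<le> \<epsilon> / 2 * ?Z l"
        using elim near by (intro ball_form_near e_L2_torus pos[OF l]) auto
      then have "\<bar>(ball_form l (\<kappa> l) (e j) (e j) - ?Z l) / ?Z l\<bar> \<le> \<epsilon> / 2" using total[OF l] by (simp add: field_simps)
      then show ?case using total[OF l] \<epsilon> by (simp add: dist_real_def diff_divide_distrib)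
    qed
  qed
  have "\<forall>\<^sub>F (j, l) in at_top \<times>\<^sub>F at_right 0. norm ((\<sigma> j)\<^sup>2 * (ball_form l (\<kappa> l) (e j) (e j) / ?Z l)) \<le> (\<sigma> j)\<^sup>2"
    unfolding eventually_prod_filter
  proof (rule exI[of _ "\<lambda>_. True"], intro exI conjI allI impI)
    show "\<forall>\<^sub>F l in at_right (0::real). 0 < l \<and> l < 1" by (rule small) simp
    fix j :: nat and l :: real assume "0 < l \<and> l < 1"
    then show "case (j, l) of (j, l) \<Rightarrow> norm ((\<sigma> j)\<^sup>2 * (ball_form l (\<kappa> l) (e j) (e j) / ?Z l)) \<le> (\<sigma> j)\<^sup>2"
      using b[of l j] by (simp add: abs_mult mult_left_le del: abs_divide times_divide_eq_right)
  qed simp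
  from tannerys_theorem[OF lim this summable_coeffs]
  have "((\<lambda>l. \<Sum>j. (\<sigma> j)\<^sup>2 * (ball_form l (\<kappa> l) (e j) (e j) / ?Z l)) \<longlongrightarrow> (\<Sum>j. (\<sigma> j)\<^sup>2)) (at_right 0)" by simp
  then show ?thesis
  proof (rule Lim_transform_eventually)
    show "\<forall>\<^sub>F l in at_right 0. (\<Sum>j. (\<sigma> j)\<^sup>2 * (ball_form l (\<kappa> l) (e j) (e j) / ?Z l))
      = (\<Sum>j. (\<sigma> j)\<^sup>2 * ball_form l (\<kappa> l) (e j) (e j)) / ?Z l"
      using small[OF zero_less_one]
    proof eventually_elim
      case (elim l)
      then have l: "0 < l" "l \<le> 1" by auto
      have "\<bar>ball_form l (\<kappa> l) (e j) (e j)\<bar> \<le> ?Z l" for j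
        using b[OF l, of j] total[OF l] by (simp add: divide_le_eq)
      from suminf_divide[OF summable_coeffs_bounded[of _ "?Z l", OF this], where c = "?Z l"] show ?case by simp
    qed
  qed
qed

text \<open>The analysis common to both laws: \<open>\<omega>\<close> controls separations below
  \<open>l\<^sub>I\<close> uniformly in the viscosity, while the second error is harmless above a
  dissipation length that tends to zero more slowly than it.\<close>

lemma structure_function_law:
  fixes S :: "real \<Rightarrow> real \<Rightarrow> real"
  assumes bound: "\<And>\<nu> l. 0 < \<nu> \<Longrightarrow> 0 < l \<Longrightarrow> l \<le> 1 \<Longrightarrow> \<bar>S \<nu> l / l + c\<bar> \<le> \<omega> l + D * sqrt (m \<nu>) / l"
    and \<omega>: "(\<omega> \<longlongrightarrow> 0) (at_right 0)" and m: "(m \<longlongrightarrow> 0) (at_right 0)" "\<And>\<nu>. 0 < \<nu> \<Longrightarrow> 0 \<le> m \<nu>"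
    and D: "0 \<le> D"
  shows "\<exists>l\<^sub>D. (\<forall>\<nu>>0. 0 < l\<^sub>D \<nu>) \<and> (l\<^sub>D \<longlongrightarrow> 0) (at_right 0) \<and>
      ((\<lambda>l\<^sub>I. Limsup (at_right 0) (\<lambda>\<nu>. SUP l\<in>{l\<^sub>D \<nu>..l\<^sub>I}. ereal \<bar>S \<nu> l / l + c\<bar>)) \<longlongrightarrow> 0) (at_right 0)"
proof (intro exI conjI allI impI)
  \<comment> \<open>With this choice \<open>sqrt (m \<nu>) \<le> (d \<nu>)\<^sup>2\<close>, so for
    \<open>l \<ge> d \<nu>\<close> the viscous error is at most \<open>D * d \<nu>\<close>. Adding
    \<open>\<nu>\<close> keeps the length positive even if \<open>m \<nu>\<close> vanishes.\<close>
  define d where "d \<nu> = sqrt (sqrt (m \<nu> + \<nu>))" for \<nu>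
  show pos: "0 < d \<nu>" if "0 < \<nu>" for \<nu> using m(2)[OF that] that by (simp add: d_def)
  have "(d \<longlongrightarrow> sqrt (sqrt (0 + 0))) (at_right 0)"
    unfolding d_def[abs_def] by (intro tendsto_intros m(1))
  then show d0: "(d \<longlongrightarrow> 0) (at_right 0)" by simp
  let ?X = "\<lambda>l\<^sub>I \<nu>. SUP l\<in>{d \<nu>..l\<^sub>I}. ereal \<bar>S \<nu> l / l + c\<bar>"
  have ev_pos: "\<forall>\<^sub>F x in at_right (0::real). 0 < x" by (rule eventually_at_right_less)
  \<comment> \<open>A supremum over an empty interval is minus infinity in \<open>ereal\<close>, so
    nonnegativity is not automatic; it holds once \<open>d \<nu>\<close> lies below
    \<open>l\<^sub>I\<close>.\<close>
  have lower: "0 \<le> Limsup (at_right 0) (?X l\<^sub>I)" if "0 < l\<^sub>I" for l\<^sub>I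
  proof (rule le_Limsup)
    show "\<forall>\<^sub>F \<nu> in at_right 0. 0 \<le> ?X l\<^sub>I \<nu>"
      using order_tendstoD(2)[OF d0 that]
    proof eventually_elim
      case (elim \<nu>)
      have "0 \<le> ereal \<bar>S \<nu> l\<^sub>I / l\<^sub>I + c\<bar>" by simp
      also have "\<dots> \<le> ?X l\<^sub>I \<nu>" using elim by (intro SUP_upper) auto
      finally show ?case .
    qed
  qed simp
  have upper: "\<forall>\<^sub>F l\<^sub>I in at_right 0. Limsup (at_right 0) (?X l\<^sub>I) \<le> ereal (2 * \<delta>)" if \<delta>: "0 < \<delta>" for \<delta>
  proof -
    have "\<forall>\<^sub>F l in at_right 0. l < 1 \<and> \<omega> l < \<delta>"
      using eventually_at_right_real[of 0 1] order_tendstoD(2)[OF \<omega> \<delta>] by (auto elim: eventually_elim2)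
    then obtain \<eta> where \<eta>: "0 < \<eta>" "\<And>l. 0 < l \<Longrightarrow> l < \<eta> \<Longrightarrow> l < 1 \<and> \<omega> l < \<delta>"
      by (auto simp: eventually_at_right_field)
    have "Limsup (at_right 0) (?X l\<^sub>I) \<le> ereal (2 * \<delta>)" if lI: "0 < l\<^sub>I \<and> l\<^sub>I < \<eta>" for l\<^sub>I
    proof (rule Limsup_bounded)
      have "((\<lambda>\<nu>. D * d \<nu>) \<longlongrightarrow> D * 0) (at_right 0)" by (intro tendsto_intros d0)
      then have "\<forall>\<^sub>F \<nu> in at_right 0. D * d \<nu> < \<delta>" using \<delta> by (intro order_tendstoD(2)) auto
      then show "\<forall>\<^sub>F \<nu> in at_right 0. ?X l\<^sub>I \<nu> \<le> ereal (2 * \<delta>)"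
        using ev_pos
      proof eventually_elim
        case (elim \<nu>)
        note d = pos[OF elim(2)]
        show ?case
        proof (rule SUP_least)
          fix l assume "l \<in> {d \<nu>..l\<^sub>I}"
          then have l: "d \<nu> \<le> l" "0 < l" "l < \<eta>" using d lI by auto
          have "D * sqrt (m \<nu>) / l \<le> D * (d \<nu>)\<^sup>2 / d \<nu>"
          proof (rule frac_le)
            have "sqrt (m \<nu>) \<le> (d \<nu>)\<^sup>2" using m(2)[OF elim(2)] elim(2) by (simp add: d_def)
            then show "D * sqrt (m \<nu>) \<le> D * (d \<nu>)\<^sup>2" using D by (rule mult_left_mono)
          qed (use d l D in auto)
          also have "\<dots> = D * d \<nu>" using d by (simp add: power2_eq_square)
          finally have "\<bar>S \<nu> l / l + c\<bar> \<le> 2 * \<delta>"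
            using bound[OF elim(2) l(2)] \<eta>(2)[OF l(2,3)] elim(1) by linarith
          then show "ereal \<bar>S \<nu> l / l + c\<bar> \<le> ereal (2 * \<delta>)" by simp
        qed
      qed
    qed
    then show ?thesis using eventually_at_right_real[OF \<eta>(1)] by (auto elim: eventually_mono)
  qed
  show "((\<lambda>l\<^sub>I. Limsup (at_right 0) (?X l\<^sub>I)) \<longlongrightarrow> 0) (at_right 0)"
  proof (rule order_tendstoI)
    fix a :: ereal assume a: "a < 0"
    show "\<forall>\<^sub>F l\<^sub>I in at_right 0. a < Limsup (at_right 0) (?X l\<^sub>I)"
      using ev_pos by eventually_elim (use a lower in \<open>auto intro: less_le_trans\<close>)
  next
    fix a :: ereal assume "0 < a"
    then obtain r where r: "0 < ereal r" "ereal r < a" using ereal_dense2 by blast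
    have "\<forall>\<^sub>F l\<^sub>I in at_right 0. Limsup (at_right 0) (?X l\<^sub>I) \<le> ereal (2 * (r / 2))"
      using r by (intro upper) simp
    then show "\<forall>\<^sub>F l\<^sub>I in at_right 0. Limsup (at_right 0) (?X l\<^sub>I) < a"
      by eventually_elim (use r in \<open>auto intro: le_less_trans\<close>)
  qed
qed

section \<open>Error estimates for the two structure functions\<close>

context stationary_energy_solution
begin

lemma energy_input_nonneg: "0 \<le> energy_input \<sigma>"
  by (simp add: energy_input_def suminf_nonneg summable_coeffs)

lemma expectation_energy:
  assumes t: "0 \<le> t"
  shows "(LINT \<omega>|M. (L2_norm (u t \<omega>))\<^sup>2) = (l2 M (\<lambda>\<omega>. l2 torus (u t \<omega>)))\<^sup>2"
  unfolding l2_squared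
  by (rule Bochner_Integration.integral_cong[OF refl]) (simp add: L2_norm_eq[OF L2_torusD(2)[OF u_L2_torus[OF t]]])

text \<open>The dissipation is bounded by \<open>sqrt (\<nu> E |grad u|\<^sup>2) * sqrt (\<nu> E |u|\<^sup>2)\<close>, whose first factor stays
  bounded and whose second one vanishes by assumption.\<close>

lemma viscous_term_bound:
  assumes w: "ball_weight l \<kappa> K" and t: "0 \<le> t"
    and le: "\<And>\<omega>. u t \<omega> \<in> H1_div \<Longrightarrow>
      \<bar>ball_form l \<kappa> (grad (u t \<omega>)) (grad (u t \<omega>))\<bar> \<le> B * (l2 torus (grad (u t \<omega>)) * l2 torus (u t \<omega>))"
    and B: "0 \<le> B"
  shows "\<nu> * \<bar>LINT \<omega>|M. ball_form l \<kappa> (grad (u t \<omega>)) (grad (u t \<omega>))\<bar>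
    \<le> B * sqrt (energy_input \<sigma> * (\<nu> * (LINT \<omega>|M. (L2_norm (u t \<omega>))\<^sup>2)))"
proof -
  let ?G = "l2 M (\<lambda>\<omega>. l2 torus (grad (u t \<omega>)))" and ?U = "l2 M (\<lambda>\<omega>. l2 torus (u t \<omega>))"
  have i: "integrable M (\<lambda>\<omega>. l2 torus (grad (u t \<omega>)) * l2 torus (u t \<omega>))"
    and le2: "\<bar>LINT \<omega>|M. l2 torus (grad (u t \<omega>)) * l2 torus (u t \<omega>)\<bar> \<le> ?G * ?U"
    using integrable_inner[OF sqint_l2_grad[OF t] sqint_l2[OF t]] integral_inner_le[OF sqint_l2_grad[OF t] sqint_l2[OF t]]
    by simp_all
  have "\<bar>LINT \<omega>|M. ball_form l \<kappa> (grad (u t \<omega>)) (grad (u t \<omega>))\<bar> \<le> (LINT \<omega>|M. B * (l2 torus (grad (u t \<omega>)) * l2 torus (u t \<omega>)))"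
    by (rule integral_abs_le_AE)
      (use i viscous_measurable[OF w t] AE_H1_div[OF t] le in \<open>auto elim!: eventually_mono\<close>)
  also have "\<dots> \<le> B * (?G * ?U)" using le2 B by (simp add: mult_left_mono)
  finally have "\<nu> * \<bar>LINT \<omega>|M. ball_form l \<kappa> (grad (u t \<omega>)) (grad (u t \<omega>))\<bar> \<le> \<nu> * (B * (?G * ?U))"
    using viscosity_pos by (intro mult_left_mono) auto
  also have "\<dots> = B * (sqrt (\<nu> * ?G\<^sup>2) * sqrt (\<nu> * ?U\<^sup>2))"
    using viscosity_pos by (simp add: real_sqrt_mult mult_ac)
  also have "\<dots> \<le> B * (sqrt (energy_input \<sigma>) * sqrt (\<nu> * ?U\<^sup>2))"
    using l2_grad_le[OF t] B viscosity_pos by (intro mult_left_mono mult_right_mono) auto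
  finally show ?thesis by (simp add: expectation_energy[OF t] real_sqrt_mult)
qed

text \<open>The quantity \<open>s\<close> is tied to the transfer form on \<open>H1_div\<close>
  only, hence almost surely; completeness of the probability space makes it measurable and the two
  expectations equal.\<close>

lemma third_order_average:
  assumes t: "0 \<le> t" and w: "ball_weight l \<kappa> K" and "0 < p"
    and id: "\<And>\<omega>. u t \<omega> \<in> H1_div \<Longrightarrow> l ^ p * s \<omega> = - c * transfer_form l \<kappa> (grad (u t \<omega>)) (u t \<omega>) (u t \<omega>)"
  shows "(LINT \<omega>|M. s \<omega>) = - (c / l ^ p) * (LINT \<omega>|M. transfer_form l \<kappa> (grad (u t \<omega>)) (u t \<omega>) (u t \<omega>))"
proof -
  interpret ball_weight l \<kappa> K by fact
  let ?r = "\<lambda>\<omega>. - (c / l ^ p) * transfer_form l \<kappa> (grad (u t \<omega>)) (u t \<omega>) (u t \<omega>)"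
  have eq: "AE \<omega> in M. ?r \<omega> = s \<omega>"
    using AE_H1_div[OF t] by eventually_elim (use R id in \<open>simp add: field_simps\<close>)
  have m: "?r \<in> borel_measurable M" using transfer_measurable[OF w t] by measurable
  have "(LINT \<omega>|M. s \<omega>) = (LINT \<omega>|M. ?r \<omega>)"
    by (rule Bochner_Integration.integral_cong_AE) (use borel_measurable_AE_eq[OF m eq] m eq in auto)
  then show ?thesis by simp
qed

text \<open>The energy balance eliminates the transfer. What remains is the deviation of the
  averaged input from its limit and the viscous form, both relative to the total weight.\<close>

lemma scaling_bound:
  assumes w: "ball_weight l \<kappa> K" and t: "0 \<le> t" and c: "0 \<le> c" and Z: "0 < ball_weight.total l \<kappa>" and l: "0 < l"
    and S: "S / l = - (c / ball_weight.total l \<kappa>) * (LINT \<omega>|M. transfer_form l \<kappa> (grad (u t \<omega>)) (u t \<omega>) (u t \<omega>))"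
    and le: "\<And>\<omega>. u t \<omega> \<in> H1_div \<Longrightarrow>
      \<bar>ball_form l \<kappa> (grad (u t \<omega>)) (grad (u t \<omega>))\<bar>
        \<le> D * ball_weight.total l \<kappa> / l * (l2 torus (grad (u t \<omega>)) * l2 torus (u t \<omega>))"
    and D: "0 \<le> D"
  shows "\<bar>S / l + c * energy_input \<sigma>\<bar>
    \<le> c / 2 * \<bar>(\<Sum>j. (\<sigma> j)\<^sup>2 * ball_form l \<kappa> (e j) (e j)) / ball_weight.total l \<kappa> - (\<Sum>j. (\<sigma> j)\<^sup>2)\<bar>
      + c * D * sqrt (energy_input \<sigma> * (\<nu> * (LINT \<omega>|M. (L2_norm (u t \<omega>))\<^sup>2))) / l"
proof -
  define Z' where "Z' = ball_weight.total l \<kappa>"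
  let ?A = "\<Sum>j. (\<sigma> j)\<^sup>2 * ball_form l \<kappa> (e j) (e j)"
    and ?T = "LINT \<omega>|M. transfer_form l \<kappa> (grad (u t \<omega>)) (u t \<omega>) (u t \<omega>)"
    and ?V = "LINT \<omega>|M. ball_form l \<kappa> (grad (u t \<omega>)) (grad (u t \<omega>))"
    and ?q = "sqrt (energy_input \<sigma> * (\<nu> * (LINT \<omega>|M. (L2_norm (u t \<omega>))\<^sup>2)))"
  have Z: "0 < Z'" using Z by (simp add: Z'_def)
  have T: "?T = ?A / 2 - \<nu> * ?V" using energy_balance[OF w t] by simp
  have "S / l + c * energy_input \<sigma> = - (c / 2) * (?A / Z' - (\<Sum>j. (\<sigma> j)\<^sup>2)) + c * (\<nu> * ?V) / Z'"
    unfolding S T Z'_def[symmetric] energy_input_def using Z by (simp add: field_simps)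
  then have "\<bar>S / l + c * energy_input \<sigma>\<bar> \<le> \<bar>- (c / 2) * (?A / Z' - (\<Sum>j. (\<sigma> j)\<^sup>2))\<bar> + \<bar>c * (\<nu> * ?V) / Z'\<bar>"
    by (simp only: abs_triangle_ineq)
  also have "\<dots> = c / 2 * \<bar>?A / Z' - (\<Sum>j. (\<sigma> j)\<^sup>2)\<bar> + c * (\<nu> * \<bar>?V\<bar>) / Z'"
    using c Z viscosity_pos by (simp add: abs_mult)
  also have "\<dots> \<le> c / 2 * \<bar>?A / Z' - (\<Sum>j. (\<sigma> j)\<^sup>2)\<bar> + c * (D * Z' / l * ?q) / Z'"
    using viscous_term_bound[OF w t le, folded Z'_def] c Z l D
    by (intro add_left_mono divide_right_mono mult_left_mono) auto
  also have "c * (D * Z' / l * ?q) / Z' = c * D * ?q / l" using Z by simp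
  finally show ?thesis by (simp add: Z'_def)
qed

end

lemma content_cball_3: "0 \<le> l \<Longrightarrow> measure lborel (cball 0 l :: (real^3) set) = 4 / 3 * pi * l ^ 3"
  using content_cball[of l "0 :: real^3"] by (simp add: unit_ball_vol_3)

lemma increment_measurable:
  assumes [measurable]: "v \<in> borel_measurable borel"
  shows "increment h v \<in> borel_measurable borel"
  unfolding increment_def[abs_def] by measurable

context stationary_energy_solution
begin

text \<open>The viscous constant three is the area \<open>4 * pi * l\<^sup>2\<close> divided by the
  total weight over \<open>l\<close>.\<close>

lemma S_0_bound:
  assumes t: "0 \<le> t" and l: "0 < l" "l \<le> 1"
  shows "\<bar>S_0 M (u t) l / l + 4 / 3 * energy_input \<sigma>\<bar>
    \<le> 4 / 3 / 2 * \<bar>(\<Sum>j. (\<sigma> j)\<^sup>2 * ball_form l (\<lambda>h. 1) (e j) (e j)) / ball_weight.total l (\<lambda>h. 1) - (\<Sum>j. (\<sigma> j)\<^sup>2)\<bar>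
      + 4 / 3 * 3 * sqrt (energy_input \<sigma> * (\<nu> * (LINT \<omega>|M. (L2_norm (u t \<omega>))\<^sup>2))) / l"
proof (rule scaling_bound[OF ball_weight_one[OF l] t])
  let ?s = "\<lambda>\<omega>. LINT n|sphere_measure. (LINT x:torus_box|lborel.
    (norm (increment (l *\<^sub>R n) (u t \<omega>) x))\<^sup>2 * (increment (l *\<^sub>R n) (u t \<omega>) x \<bullet> n))"
  have "(LINT \<omega>|M. ?s \<omega>) = - (4 / l ^ 2) * (LINT \<omega>|M. transfer_form l (\<lambda>h. 1) (grad (u t \<omega>)) (u t \<omega>) (u t \<omega>))"
  proof (rule third_order_average[OF t ball_weight_one[OF l]])
    fix \<omega> assume "u t \<omega> \<in> H1_div"
    then obtain \<phi> where "H1_approx (u t \<omega>) (grad (u t \<omega>)) \<phi> (\<lambda>n x. jacobian (\<phi> n) (at x))" by (rule H1_div_approx)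
    then interpret H1_approx "u t \<omega>" "grad (u t \<omega>)" \<phi> "\<lambda>n x. jacobian (\<phi> n) (at x)" .
    note [measurable] = increment_measurable[OF L2_torusD(2)[OF v]]
    have "?s \<omega> = (LINT n|sphere_measure. LINT x|torus. (norm (increment (l *\<^sub>R n) (u t \<omega>) x))\<^sup>2 * (increment (l *\<^sub>R n) (u t \<omega>) x \<bullet> n))"
      by (intro Bochner_Integration.integral_cong refl integral_leb_on(1)[symmetric]) measurable
    then show "l ^ 2 * ?s \<omega> = - 4 * transfer_form l (\<lambda>h. 1) (grad (u t \<omega>)) (u t \<omega>) (u t \<omega>)"
      using H1_third_order_identities(1)[OF l] by simp
  qed simp
  then show "S_0 M (u t) l / l = - (4 / 3 / ball_weight.total l (\<lambda>h. 1))
      * (LINT \<omega>|M. transfer_form l (\<lambda>h. 1) (grad (u t \<omega>)) (u t \<omega>) (u t \<omega>))"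
    using l by (simp add: S_0_def total_one[OF l] eval_nat_numeral)
  fix \<omega> assume "u t \<omega> \<in> H1_div"
  then obtain \<phi> where "H1_approx (u t \<omega>) (grad (u t \<omega>)) \<phi> (\<lambda>n x. jacobian (\<phi> n) (at x))" by (rule H1_div_approx)
  from H1_approx.H1_viscous_bounds(1)[OF this l]
  show "\<bar>ball_form l (\<lambda>h. 1) (grad (u t \<omega>)) (grad (u t \<omega>))\<bar>
      \<le> 3 * ball_weight.total l (\<lambda>h. 1) / l * (l2 torus (grad (u t \<omega>)) * l2 torus (u t \<omega>))"
    using l by (simp add: sphere_area total_one[OF l] eval_nat_numeral mult_ac)
qed (use l in \<open>simp_all add: total_one\<close>)

text \<open>The viscous constant five is twice the volume of the ball times \<open>l\<close>,
  divided by the total weight over \<open>l\<close>.\<close>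

lemma S_par_bound:
  assumes t: "0 \<le> t" and l: "0 < l" "l \<le> 1"
  shows "\<bar>S_par M (u t) l / l + 4 / 5 * energy_input \<sigma>\<bar>
    \<le> 4 / 5 / 2 * \<bar>(\<Sum>j. (\<sigma> j)\<^sup>2 * ball_form l (\<lambda>h. l\<^sup>2 - (norm h)\<^sup>2) (e j) (e j)) / ball_weight.total l (\<lambda>h. l\<^sup>2 - (norm h)\<^sup>2)
        - (\<Sum>j. (\<sigma> j)\<^sup>2)\<bar>
      + 4 / 5 * 5 * sqrt (energy_input \<sigma> * (\<nu> * (LINT \<omega>|M. (L2_norm (u t \<omega>))\<^sup>2))) / l"
proof (rule scaling_bound[OF ball_weight_moment[OF l] t])
  let ?k = "\<lambda>h :: real^3. l\<^sup>2 - (norm h)\<^sup>2"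
  have p: "l ^ 5 = l ^ 4 * l" "l ^ 4 = l ^ 3 * l" by (simp_all add: eval_nat_numeral)
  let ?s = "\<lambda>\<omega>. LINT n|sphere_measure. (LINT x:torus_box|lborel. (increment (l *\<^sub>R n) (u t \<omega>) x \<bullet> n) ^ 3)"
  have "(LINT \<omega>|M. ?s \<omega>) = - (6 / l ^ 4) * (LINT \<omega>|M. transfer_form l ?k (grad (u t \<omega>)) (u t \<omega>) (u t \<omega>))"
  proof (rule third_order_average[OF t ball_weight_moment[OF l]])
    fix \<omega> assume "u t \<omega> \<in> H1_div"
    then obtain \<phi> where "H1_approx (u t \<omega>) (grad (u t \<omega>)) \<phi> (\<lambda>n x. jacobian (\<phi> n) (at x))" by (rule H1_div_approx)
    then interpret H1_approx "u t \<omega>" "grad (u t \<omega>)" \<phi> "\<lambda>n x. jacobian (\<phi> n) (at x)" .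
    note [measurable] = increment_measurable[OF L2_torusD(2)[OF v]]
    have "?s \<omega> = (LINT n|sphere_measure. LINT x|torus. (increment (l *\<^sub>R n) (u t \<omega>) x \<bullet> n) ^ 3)"
      by (intro Bochner_Integration.integral_cong refl integral_leb_on(1)[symmetric]) measurable
    then show "l ^ 4 * ?s \<omega> = - 6 * transfer_form l ?k (grad (u t \<omega>)) (u t \<omega>) (u t \<omega>)"
      using H1_third_order_identities(2)[OF l] by simp
  qed simp
  then show "S_par M (u t) l / l = - (4 / 5 / ball_weight.total l ?k)
      * (LINT \<omega>|M. transfer_form l ?k (grad (u t \<omega>)) (u t \<omega>) (u t \<omega>))"
    using l by (simp add: S_par_def total_moment[OF l] p)
  fix \<omega> assume "u t \<omega> \<in> H1_div"
  then obtain \<phi> where "H1_approx (u t \<omega>) (grad (u t \<omega>)) \<phi> (\<lambda>n x. jacobian (\<phi> n) (at x))" by (rule H1_div_approx)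
  from H1_approx.H1_viscous_bounds(2)[OF this l]
  show "\<bar>ball_form l ?k (grad (u t \<omega>)) (grad (u t \<omega>))\<bar>
      \<le> 5 * ball_weight.total l ?k / l * (l2 torus (grad (u t \<omega>)) * l2 torus (u t \<omega>))"
    using l by (simp add: content_cball_3 total_moment[OF l] p mult_ac)
qed (use l in \<open>simp_all add: total_moment\<close>)

end

theorem theorem1p3:
  fixes M :: "real \<Rightarrow> 'w measure"
    and F :: "real \<Rightarrow> real \<Rightarrow> 'w measure"
    and \<beta> :: "real \<Rightarrow> nat \<Rightarrow> real \<Rightarrow> 'w \<Rightarrow> real"
    and \<sigma> :: "nat \<Rightarrow> real"
    and e :: "nat \<Rightarrow> real^3 \<Rightarrow> real^3"
    and u :: "real \<Rightarrow> real \<Rightarrow> 'w \<Rightarrow> real^3 \<Rightarrow> real^3"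
    and t\<^sub>0 :: real
  assumes solutions: "\<And>\<nu>. 0 < \<nu> \<Longrightarrow>
      stationary_martingale_solution (M \<nu>) (F \<nu>) (\<beta> \<nu>) \<sigma> e \<nu> (u \<nu>)"
    and energy_inequality: "\<And>\<nu> t. 0 < \<nu> \<Longrightarrow> 0 \<le> t \<Longrightarrow>
      ennreal \<nu> * (\<integral>\<^sup>+\<omega>. grad_norm_sq (u \<nu> t \<omega>) \<partial>M \<nu>) \<le> ennreal (energy_input \<sigma>)"
    and moment_bounds: "\<And>\<nu> T r. 0 < \<nu> \<Longrightarrow> 0 \<le> T \<Longrightarrow> 1 \<le> r \<Longrightarrow>
      (\<integral>\<^sup>+\<omega>. ennreal (enn2real (Linf_L2_norm T (\<lambda>t. u \<nu> t \<omega>)) powr r) \<partial>M \<nu>) < \<infinity>"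
    and time: "0 \<le> t\<^sub>0"
    and weak_anomalous_dissipation:
      "((\<lambda>\<nu>. \<nu> * (LINT \<omega>|M \<nu>. (L2_norm (u \<nu> t\<^sub>0 \<omega>))\<^sup>2)) \<longlongrightarrow> 0) (at_right 0)"
  shows "(\<exists>l\<^sub>D. (\<forall>\<nu>>0. 0 < l\<^sub>D \<nu>) \<and> (l\<^sub>D \<longlongrightarrow> 0) (at_right 0) \<and>
      ((\<lambda>l\<^sub>I. Limsup (at_right 0) (\<lambda>\<nu>. SUP l\<in>{l\<^sub>D \<nu>..l\<^sub>I}.
          ereal \<bar>S_0 (M \<nu>) (u \<nu> t\<^sub>0) l / l + 4 / 3 * energy_input \<sigma>\<bar>)) \<longlongrightarrow> 0) (at_right 0))
    \<and> (\<exists>l\<^sub>D. (\<forall>\<nu>>0. 0 < l\<^sub>D \<nu>) \<and> (l\<^sub>D \<longlongrightarrow> 0) (at_right 0) \<and>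
      ((\<lambda>l\<^sub>I. Limsup (at_right 0) (\<lambda>\<nu>. SUP l\<in>{l\<^sub>D \<nu>..l\<^sub>I}.
          ereal \<bar>S_par (M \<nu>) (u \<nu> t\<^sub>0) l / l + 4 / 5 * energy_input \<sigma>\<bar>)) \<longlongrightarrow> 0) (at_right 0))"
proof -
  have sol: "stationary_energy_solution (M \<nu>) (F \<nu>) (\<beta> \<nu>) \<sigma> e \<nu> (u \<nu>)" if "0 < \<nu>" for \<nu>
    using solutions[OF that] energy_inequality[OF that] moment_bounds[OF that]
    by (intro stationary_energy_solution.intro stationary_energy_solution_axioms.intro)
  \<comment> \<open>Coefficients and modes do not depend on the viscosity, so the solution for
    viscosity one supplies the facts about the forcing.\<close>
  interpret forcing \<sigma> e
    using sol[of 1] by (simp add: stationary_energy_solution_def stationary_martingale_solution_def)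
  \<comment> \<open>The energy input is absorbed into \<open>?m\<close>, since it stands under the
    square root of the viscous bound together with \<open>\<nu>\<close> times the mean
    energy.\<close>
  let ?m = "\<lambda>\<nu>. energy_input \<sigma> * (\<nu> * (LINT \<omega>|M \<nu>. (L2_norm (u \<nu> t\<^sub>0 \<omega>))\<^sup>2))"
  let ?\<omega> = "\<lambda>\<kappa> l. \<bar>(\<Sum>j. (\<sigma> j)\<^sup>2 * ball_form l (\<kappa> l) (e j) (e j)) / ball_weight.total l (\<kappa> l) - (\<Sum>j. (\<sigma> j)\<^sup>2)\<bar>"
  have m: "(?m \<longlongrightarrow> 0) (at_right 0)" using weak_anomalous_dissipation by (rule tendsto_mult_right_zero)
  have m0: "0 \<le> ?m \<nu>" if "0 < \<nu>" for \<nu>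
    using that stationary_energy_solution.energy_input_nonneg[OF sol[OF that]] by simp
  have \<omega>: "((\<lambda>l. c * ?\<omega> \<kappa> l) \<longlongrightarrow> 0) (at_right 0)"
    if "((\<lambda>l. (\<Sum>j. (\<sigma> j)\<^sup>2 * ball_form l (\<kappa> l) (e j) (e j)) / ball_weight.total l (\<kappa> l)) \<longlongrightarrow> (\<Sum>j. (\<sigma> j)\<^sup>2)) (at_right 0)" for c \<kappa>
    using that by (intro tendsto_mult_right_zero tendsto_rabs_zero) (rule LIM_zero)
  have \<omega>0: "((\<lambda>l. 4 / 3 / 2 * ?\<omega> (\<lambda>l h. 1) l) \<longlongrightarrow> 0) (at_right 0)"
    by (rule \<omega>, rule energy_input_limit[OF ball_weight_one]) (simp_all add: total_one)
  have \<omega>1: "((\<lambda>l. 4 / 5 / 2 * ?\<omega> (\<lambda>l h. l\<^sup>2 - (norm h)\<^sup>2) l) \<longlongrightarrow> 0) (at_right 0)"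
    by (rule \<omega>, rule energy_input_limit[OF ball_weight_moment]) (simp_all add: total_moment power_mono)
  show ?thesis
    by (intro conjI structure_function_law[OF _ \<omega>0 m m0, where D = "4 / 3 * 3"] structure_function_law[OF _ \<omega>1 m m0, where D = "4 / 5 * 5"]
        stationary_energy_solution.S_0_bound[OF sol time] stationary_energy_solution.S_par_bound[OF sol time]) simp_all
qed

end
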